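(* Let $(\mathcal{M},\tau)$ be a tracial $W^*$-probability space and let $R,S>0$. For $1\le i\le n$ let $\mathbf{X}_i=(X_{ij})_{j=1}^{r(i)}$ and $\mathbf{Y}_i=(Y_{ij})_{j=1}^{s(i)}$ be finite tuples of self-adjoint elements of $\mathcal{M}$ such that $\|X_{ij}\|_\infty\le R$ and $\|Y_{ij}\|_\infty\le S$ for all $i,j$. Let $\tau_{\mathbf{X}}^{(R)}\in TS(\mathcal{C}_R(\mathbf{x}))$ be the tracial state induced from $\tau$ via the $*$-homomorphism $\mathcal{C}_R(\mathbf{x})\to\mathcal{M}$ determined by $x_{ij}\mapsto X_{ij}$, and let $\tau_{\mathbf{Y}}^{(S)}\in TS(\mathcal{C}_S(\mathbf{y}))$ be similarly induced via $y_{ij}\mapsto Y_{ij}$. If $\mathbf{Y}_i\subset W^*(\mathbf{X}_i)$ in $\mathcal{M}$ for every $1\le i\le n$, then $$\eta_{\mathrm{orb},R}(\tau_{\mathbf{X}}^{(R)})\le\eta_{\mathrm{orb},S}(\tau_{\mathbf{Y}}^{(S)}).$$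
   Context: A tracial $W^*$-probability space $(\mathcal{M},\tau)$ is a finite von Neumann algebra with a faithful normal tracial state; $\|\cdot\|_\infty$ is the operator norm; $W^*(\mathbf{X}_i)$ is the von Neumann subalgebra generated by $\mathbf{X}_i$. Universal algebras. Let $\mathbf{x}_i=(x_{ij})_{j=1}^{r(i)}$, $1\le i\le n$, be tuples of indeterminates, $\mathbf{x}=\mathbf{x}_1\sqcup\cdots\sqcup\mathbf{x}_n$, and $R>0$. $\mathcal{C}_R(\mathbf{x}_i)$ is the universal (unital, full) $C^*$-free product of $r(i)$ copies of $C[-R,R]$, where $x_{ij}$ is the coordinate function $t$ in the $j$th copy; $\mathcal{C}_R(\mathbf{x})=\bigstar_{i=1}^n\mathcal{C}_R(\mathbf{x}_i)$ is the universal $C^*$-free product. $\mathcal{C}_S(\mathbf{y})$ is defined in the same way for $S>0$ and $\mathbf{y}=\mathbf{y}_1\sqcup\cdots\sqcup\mathbf{y}_n$, $\mathbf{y}_i=(y_{ij})_{j=1}^{s(i)}$. For self-adjoint elements $\mathbf{a}=(a_{ij})$ of norm $\le R$ in a unital $C^*$-algebra, $f\mapsto f(\mathbf{a})$ is the unital $*$-homomorphism on $\mathcal{C}_R(\mathbf{x})$ determined by $x_{ij}\mapsto a_{ij}$ (similarly on $\mathcal{C}_R(\mathbf{x}_i)$). $\mathcal{A}^{sa}$ is the set of self-adjoint elements and $TS(\mathcal{A})$ the set of tracial states of a unital $C^*$-algebra $\mathcal{A}$. Matrices. $\mathrm{tr}_N$ is the normalized trace on $M_N(\mathbb{C})$,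 $M_N(\mathbb{C})_R^{sa}$ the set of self-adjoint $N\times N$ matrices of operator norm $\le R$, $\gamma_{\mathrm{U}(N)}$ the Haar probability measure on the unitary group $\mathrm{U}(N)$. For $\tau_i\in TS(\mathcal{C}_R(\mathbf{x}_i))$, $N,m\in\mathbb{N}$, $\delta>0$, $\Gamma_R(\tau_i;N,m,\delta)$ is the set of $(A_j)_{j=1}^{r(i)}\in(M_N(\mathbb{C})_R^{sa})^{r(i)}$ with $|\mathrm{tr}_N(A_{j_1}\cdots A_{j_l})-\tau_i(x_{ij_1}\cdots x_{ij_l})|<\delta$ for all $1\le l\le m$ and $1\le j_k\le r(i)$. Orbital free pressure. For $h\in\mathcal{C}_R(\mathbf{x})^{sa}$ and $\tau_i\in TS(\mathcal{C}_R(\mathbf{x}_i))$, $1\le i\le n$, put $$\pi_{\mathrm{orb},R}(h:(\tau_i)_{i=1}^n;N,m,\delta)=\sup_{(\mathbf{A}_i)\in\prod_{i=1}^n\Gamma_R(\tau_i;N,m,\delta)}\log\int_{\mathrm{U}(N)^n}\exp\bigl(-N^2\mathrm{tr}_N(h((V_i\mathbf{A}_iV_i^* )_{i=1}^n))\bigr)\,d\gamma_{\mathrm{U}(N)}^{\otimes n}(V_i)$$ (equal to $-\infty$ if some $\Gamma_R(\tau_i;N,m,\delta)$ is empty), where $V_i\mathbf{A}_iV_i^*$ means entrywise conjugation, and $$\pi_{\mathrm{orb},R}(h:(\tau_i)_{i=1}^n)=\inf_{m\in\mathbb{N},\delta>0}\ \limsup_{N\to\infty}\frac1{N^2}\pi_{\mathrm{orb},R}(h:(\tau_i)_{i=1}^n;N,m,\delta).$$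 Orbital $\eta$-entropy. For $\sigma\in TS(\mathcal{C}_R(\mathbf{x}))$ with restrictions $\sigma_i=\sigma\!\upharpoonright_{\mathcal{C}_R(\mathbf{x}_i)}$, $$\eta_{\mathrm{orb},R}(\sigma)=\inf\{\sigma(h)+\pi_{\mathrm{orb},R}(h:(\sigma_i)_{i=1}^n)\mid h\in\mathcal{C}_R(\mathbf{x})^{sa}\}\in[-\infty,\infty).$$ $\eta_{\mathrm{orb},S}$ on $TS(\mathcal{C}_S(\mathbf{y}))$ is defined in the same way, relative to the decomposition $\mathbf{y}=\mathbf{y}_1\sqcup\cdots\sqcup\mathbf{y}_n$. *)

theory Defs
  imports
    "HOL-Algebra.Ring"
    "HOL-Probability.Probability"
    "Jordan_Normal_Form.Schur_Decomposition"
begin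

section \<open>Unital *-algebras over the complex numbers\<close>

text \<open>
  C*-algebras are given by their *-algebra structure only: the C*-norm of a C*-algebra is
  determined by it, and no definition below depends on a choice of norm.
\<close>

record 'a star_algebra = "'a ring" +
  smul :: "complex \<Rightarrow> 'a \<Rightarrow> 'a"
  star :: "'a \<Rightarrow> 'a"

definition self_adjoint_elems :: "('a, 'z) star_algebra_scheme \<Rightarrow> 'a set" where
  "self_adjoint_elems A = {a \<in> carrier A. star A a = a}"

definition unital_star_hom ::
  "('a, 'y) star_algebra_scheme \<Rightarrow> ('b, 'z) star_algebra_scheme \<Rightarrow> ('a \<Rightarrow> 'b) set" where
  "unital_star_hom A B =
     {\<phi> \<in> Ring.ring_hom A B.
        (\<forall>c. \<forall>a\<in>carrier A. \<phi> (smul A c a) = smul B c (\<phi> a)) \<and>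
        (\<forall>a\<in>carrier A. \<phi> (star A a) = star B (\<phi> a))}"

definition tracial_state :: "('a, 'z) star_algebra_scheme \<Rightarrow> ('a \<Rightarrow> complex) \<Rightarrow> bool" where
  "tracial_state A \<sigma> \<longleftrightarrow>
     (\<forall>a\<in>carrier A. \<forall>b\<in>carrier A. \<sigma> (a \<oplus>\<^bsub>A\<^esub> b) = \<sigma> a + \<sigma> b) \<and>
     (\<forall>c. \<forall>a\<in>carrier A. \<sigma> (smul A c a) = c * \<sigma> a) \<and>
     (\<forall>a\<in>carrier A. \<sigma> (star A a \<otimes>\<^bsub>A\<^esub> a) \<in> \<real>\<^sub>\<ge>\<^sub>0) \<and>
     \<sigma> \<one>\<^bsub>A\<^esub> = 1 \<and>
     (\<forall>a\<in>carrier A. \<forall>b\<in>carrier A. \<sigma> (a \<otimes>\<^bsub>A\<^esub> b) = \<sigma> (b \<otimes>\<^bsub>A\<^esub> a))"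

definition list_product :: "('a, 'z) ring_scheme \<Rightarrow> 'a list \<Rightarrow> 'a" where
  "list_product A xs = foldr (monoid.mult A) xs \<one>\<^bsub>A\<^esub>"


section \<open>C*-completions\<close>

definition seminorm_dist ::
  "('a, 'z) star_algebra_scheme \<Rightarrow> ('a \<Rightarrow> real) \<Rightarrow> 'a \<Rightarrow> 'a \<Rightarrow> real" where
  "seminorm_dist P \<rho> p q = \<rho> (p \<oplus>\<^bsub>P\<^esub> smul P (-1) q)"

definition cstar_seminorm :: "('a, 'z) star_algebra_scheme \<Rightarrow> ('a \<Rightarrow> real) \<Rightarrow> bool" where
  "cstar_seminorm P \<rho> \<longleftrightarrow>
     (\<forall>p\<in>carrier P. 0 \<le> \<rho> p) \<and>
     (\<forall>p\<in>carrier P. \<forall>q\<in>carrier P. \<rho> (p \<oplus>\<^bsub>P\<^esub> q) \<le> \<rho> p + \<rho> q) \<and>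
     (\<forall>c. \<forall>p\<in>carrier P. \<rho> (smul P c p) = cmod c * \<rho> p) \<and>
     (\<forall>p\<in>carrier P. \<forall>q\<in>carrier P. \<rho> (p \<otimes>\<^bsub>P\<^esub> q) \<le> \<rho> p * \<rho> q) \<and>
     (\<forall>p\<in>carrier P. \<rho> (star P p \<otimes>\<^bsub>P\<^esub> p) = (\<rho> p)\<^sup>2)"

definition cauchy_seqs :: "('a, 'z) star_algebra_scheme \<Rightarrow> ('a \<Rightarrow> real) \<Rightarrow> (nat \<Rightarrow> 'a) set" where
  "cauchy_seqs P \<nu> =
     {f. (\<forall>k. f k \<in> carrier P) \<and>
         (\<forall>e>0. \<exists>K. \<forall>k\<ge>K. \<forall>l\<ge>K. seminorm_dist P \<nu> (f k) (f l) < e)}"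

definition completion_class ::
  "('a, 'z) star_algebra_scheme \<Rightarrow> ('a \<Rightarrow> real) \<Rightarrow> (nat \<Rightarrow> 'a) \<Rightarrow> (nat \<Rightarrow> 'a) set" where
  "completion_class P \<nu> f =
     {g \<in> cauchy_seqs P \<nu>. (\<lambda>k. seminorm_dist P \<nu> (f k) (g k)) \<longlonglongrightarrow> 0}"

text \<open>
  The separation and completion of \<open>P\<close> with respect to \<open>\<nu>\<close>, as classes of Cauchy sequences. The
  unions are over sets of representatives, all of which yield the same class.
\<close>

definition star_completion ::
  "('a, 'z) star_algebra_scheme \<Rightarrow> ('a \<Rightarrow> real) \<Rightarrow> (nat \<Rightarrow> 'a) set star_algebra" where
  "star_completion P \<nu> = \<lparr>
     carrier = completion_class P \<nu> ` cauchy_seqs P \<nu>,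
     monoid.mult = (\<lambda>F G. \<Union>f\<in>F. \<Union>g\<in>G. completion_class P \<nu> (\<lambda>k. f k \<otimes>\<^bsub>P\<^esub> g k)),
     one = completion_class P \<nu> (\<lambda>k. \<one>\<^bsub>P\<^esub>),
     ring.zero = completion_class P \<nu> (\<lambda>k. \<zero>\<^bsub>P\<^esub>),
     add = (\<lambda>F G. \<Union>f\<in>F. \<Union>g\<in>G. completion_class P \<nu> (\<lambda>k. f k \<oplus>\<^bsub>P\<^esub> g k)),
     smul = (\<lambda>c F. \<Union>f\<in>F. completion_class P \<nu> (\<lambda>k. smul P c (f k))),
     star = (\<lambda>F. \<Union>f\<in>F. completion_class P \<nu> (\<lambda>k. star P (f k)))\<rparr>"


section \<open>Universal free products of unital C*-algebras\<close>

text \<open>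
  The free unital *-algebra on the disjoint union of the carriers of a family \<open>A\<close>: noncommutative
  polynomials, given by their coefficients on words whose letters are pairs \<open>(j, a)\<close> with
  \<open>a \<in> carrier (A j)\<close>. The adjoint of the letter \<open>(j, a)\<close> is \<open>(j, star (A j) a)\<close>.
\<close>

type_synonym ('i, 'a) free_poly = "('i \<times> 'a) list \<Rightarrow> complex"

definition letters :: "'i set \<Rightarrow> ('i \<Rightarrow> ('a, 'z) star_algebra_scheme) \<Rightarrow> ('i \<times> 'a) set" where
  "letters J A = (SIGMA j:J. carrier (A j))"

definition free_star_algebra ::
  "'i set \<Rightarrow> ('i \<Rightarrow> ('a, 'z) star_algebra_scheme) \<Rightarrow> ('i, 'a) free_poly star_algebra" where
  "free_star_algebra J A = \<lparr>
     carrier = {p. finite {w. p w \<noteq> 0} \<and> {w. p w \<noteq> 0} \<subseteq> lists (letters J A)},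
     monoid.mult = (\<lambda>p q w. \<Sum>k\<le>length w. p (take k w) * q (drop k w)),
     one = (\<lambda>w. if w = [] then 1 else 0),
     ring.zero = (\<lambda>w. 0),
     add = (\<lambda>p q w. p w + q w),
     smul = (\<lambda>c p w. c * p w),
     star = (\<lambda>p w. if w \<in> lists (letters J A)
                    then cnj (p (rev (map (\<lambda>(j, a). (j, star (A j) a)) w))) else 0)\<rparr>"

definition letter :: "'i \<Rightarrow> 'a \<Rightarrow> ('i, 'a) free_poly" where
  "letter j a = (\<lambda>w. if w = [(j, a)] then 1 else 0)"

text \<open>
  C*-seminorms for which every \<open>letter j\<close> becomes a unital *-homomorphism on \<open>A j\<close>; it preserves
  adjoints already in the free *-algebra.
\<close>

definition free_product_seminorms ::
  "'i set \<Rightarrow> ('i \<Rightarrow> ('a, 'z) star_algebra_scheme) \<Rightarrow> (('i, 'a) free_poly \<Rightarrow> real) set" where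
  "free_product_seminorms J A =
     (let P = free_star_algebra J A in
      {\<rho>. cstar_seminorm P \<rho> \<and>
          (\<forall>j\<in>J.
             (\<forall>a\<in>carrier (A j). \<forall>b\<in>carrier (A j).
                seminorm_dist P \<rho> (letter j (a \<oplus>\<^bsub>A j\<^esub> b)) (letter j a \<oplus>\<^bsub>P\<^esub> letter j b) = 0 \<and>
                seminorm_dist P \<rho> (letter j (a \<otimes>\<^bsub>A j\<^esub> b)) (letter j a \<otimes>\<^bsub>P\<^esub> letter j b) = 0) \<and>
             (\<forall>c. \<forall>a\<in>carrier (A j).
                seminorm_dist P \<rho> (letter j (smul (A j) c a)) (smul P c (letter j a)) = 0) \<and>
             seminorm_dist P \<rho> (letter j \<one>\<^bsub>A j\<^esub>) \<one>\<^bsub>P\<^esub> = 0)})"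

text \<open>
  The supremum is over a nonempty set bounded above: if the \<open>A j\<close> are C*-algebras, then
  \<open>\<rho> (letter j a)\<close> is at most the norm of \<open>a\<close>.
\<close>

definition free_product_norm ::
  "'i set \<Rightarrow> ('i \<Rightarrow> ('a, 'z) star_algebra_scheme) \<Rightarrow> ('i, 'a) free_poly \<Rightarrow> real" where
  "free_product_norm J A p = (SUP \<rho>\<in>free_product_seminorms J A. \<rho> p)"

type_synonym ('i, 'a) free_product = "(nat \<Rightarrow> ('i, 'a) free_poly) set"

definition cstar_free_product ::
  "'i set \<Rightarrow> ('i \<Rightarrow> ('a, 'z) star_algebra_scheme) \<Rightarrow> ('i, 'a) free_product star_algebra" where
  "cstar_free_product J A = star_completion (free_star_algebra J A) (free_product_norm J A)"

definition free_product_incl ::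
  "'i set \<Rightarrow> ('i \<Rightarrow> ('a, 'z) star_algebra_scheme) \<Rightarrow> 'i \<Rightarrow> 'a \<Rightarrow> ('i, 'a) free_product" where
  "free_product_incl J A j a =
     completion_class (free_star_algebra J A) (free_product_norm J A) (\<lambda>k. letter j a)"


section \<open>The universal algebras\<close>

text \<open>Functions on \<open>{-R..R}\<close> are extended by 0.\<close>

definition C_interval :: "real \<Rightarrow> (real \<Rightarrow> complex) star_algebra" where
  "C_interval R = \<lparr>
     carrier = {f. continuous_on {-R..R} f \<and> (\<forall>t. t \<notin> {-R..R} \<longrightarrow> f t = 0)},
     monoid.mult = (\<lambda>f g t. f t * g t),
     one = (\<lambda>t. if t \<in> {-R..R} then 1 else 0),
     ring.zero = (\<lambda>t. 0),
     add = (\<lambda>f g t. f t + g t),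
     smul = (\<lambda>c f t. c * f t),
     star = (\<lambda>f t. cnj (f t))\<rparr>"

definition interval_coord :: "real \<Rightarrow> real \<Rightarrow> complex" where
  "interval_coord R t = (if t \<in> {-R..R} then of_real t else 0)"

text \<open>
  Tuples are indexed from 0. \<open>CR_part R l\<close> is the algebra of a single tuple of length \<open>l\<close>, and
  \<open>CR R n r\<close> that of the concatenation of \<open>n\<close> tuples, the \<open>i\<close>-th of length \<open>r i\<close>.
\<close>

type_synonym CR_part_elem = "(nat, real \<Rightarrow> complex) free_product"
type_synonym CR_elem = "(nat, CR_part_elem) free_product"

definition CR_part :: "real \<Rightarrow> nat \<Rightarrow> CR_part_elem star_algebra" where
  "CR_part R l = cstar_free_product {..<l} (\<lambda>j. C_interval R)"

definition part_gen :: "real \<Rightarrow> nat \<Rightarrow> nat \<Rightarrow> CR_part_elem" where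
  "part_gen R l j = free_product_incl {..<l} (\<lambda>j. C_interval R) j (interval_coord R)"

definition CR :: "real \<Rightarrow> nat \<Rightarrow> (nat \<Rightarrow> nat) \<Rightarrow> CR_elem star_algebra" where
  "CR R n r = cstar_free_product {..<n} (\<lambda>i. CR_part R (r i))"

definition CR_incl :: "real \<Rightarrow> nat \<Rightarrow> (nat \<Rightarrow> nat) \<Rightarrow> nat \<Rightarrow> CR_part_elem \<Rightarrow> CR_elem" where
  "CR_incl R n r = free_product_incl {..<n} (\<lambda>i. CR_part R (r i))"

definition CR_gen :: "real \<Rightarrow> nat \<Rightarrow> (nat \<Rightarrow> nat) \<Rightarrow> nat \<Rightarrow> nat \<Rightarrow> CR_elem" where
  "CR_gen R n r i j = CR_incl R n r i (part_gen R (r i) j)"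

definition CR_eval ::
  "real \<Rightarrow> nat \<Rightarrow> (nat \<Rightarrow> nat) \<Rightarrow> ('b, 'z) star_algebra_scheme \<Rightarrow> (nat \<Rightarrow> nat \<Rightarrow> 'b) \<Rightarrow> CR_elem \<Rightarrow> 'b"
where
  "CR_eval R n r B a =
     (THE \<phi>. \<phi> \<in> unital_star_hom (CR R n r) B \<and> \<phi> \<in> extensional (carrier (CR R n r)) \<and>
             (\<forall>i<n. \<forall>j<r i. \<phi> (CR_gen R n r i j) = a i j))"


section \<open>Matrices\<close>

definition mat_algebra :: "nat \<Rightarrow> complex mat star_algebra" where
  "mat_algebra N = \<lparr>
     carrier = carrier_mat N N,
     monoid.mult = (*),
     one = 1\<^sub>m N,
     ring.zero = 0\<^sub>m N N,
     add = (+),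
     smul = (\<lambda>c A. c \<cdot>\<^sub>m A),
     star = mat_adjoint\<rparr>"

definition ntr :: "nat \<Rightarrow> complex mat \<Rightarrow> complex" where
  "ntr N A = (\<Sum>i<N. A $$ (i, i)) / of_nat N"

definition cvec_norm :: "complex Matrix.vec \<Rightarrow> real" where
  "cvec_norm v = sqrt (\<Sum>i<dim_vec v. (cmod (vec_index v i))\<^sup>2)"

definition mat_opnorm :: "nat \<Rightarrow> complex mat \<Rightarrow> real" where
  "mat_opnorm N A = (SUP v\<in>{v \<in> carrier_vec N. cvec_norm v \<le> 1}. cvec_norm (A *\<^sub>v v))"

definition bounded_sa_mats :: "real \<Rightarrow> nat \<Rightarrow> complex mat set" where
  "bounded_sa_mats R N = {A \<in> self_adjoint_elems (mat_algebra N). mat_opnorm N A \<le> R}"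

definition unitary_mats :: "nat \<Rightarrow> complex mat set" where
  "unitary_mats N =
     {V \<in> carrier_mat N N. V * mat_adjoint V = 1\<^sub>m N \<and> mat_adjoint V * V = 1\<^sub>m N}"

text \<open>The matrix entries embed the unitary group into a finite power of \<open>complex\<close>, so they generate
  its Borel \<open>\<sigma>\<close>-algebra.\<close>

definition unitary_borel :: "nat \<Rightarrow> complex mat measure" where
  "unitary_borel N =
     sigma (unitary_mats N)
       {{V \<in> unitary_mats N. V $$ (i, j) \<in> B} | i j B. i < N \<and> j < N \<and> B \<in> sets borel}"

definition haar_unitary :: "nat \<Rightarrow> complex mat measure" where
  "haar_unitary N =
     (THE \<mu>. sets \<mu> = sets (unitary_borel N) \<and> prob_space \<mu> \<and>
             (\<forall>U\<in>unitary_mats N. distr \<mu> \<mu> (\<lambda>V. U * V) = \<mu>))"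


section \<open>Orbital free pressure and orbital \<open>\<eta>\<close>-entropy\<close>

definition microstates ::
  "real \<Rightarrow> nat \<Rightarrow> (CR_part_elem \<Rightarrow> complex) \<Rightarrow> nat \<Rightarrow> nat \<Rightarrow> real \<Rightarrow> (nat \<Rightarrow> complex mat) set" where
  "microstates R l \<sigma> N m \<delta> =
     {A \<in> {..<l} \<rightarrow>\<^sub>E bounded_sa_mats R N.
        \<forall>js. 1 \<le> length js \<and> length js \<le> m \<and> set js \<subseteq> {..<l} \<longrightarrow>
          cmod (ntr N (list_product (mat_algebra N) (map A js))
                - \<sigma> (list_product (CR_part R l) (map (part_gen R l) js))) < \<delta>}"

definition orb_integral ::
  "real \<Rightarrow> nat \<Rightarrow> (nat \<Rightarrow> nat) \<Rightarrow> CR_elem \<Rightarrow> nat \<Rightarrow> (nat \<Rightarrow> nat \<Rightarrow> complex mat) \<Rightarrow> real" where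
  "orb_integral R n r h N A =
     (LINT V|Pi\<^sub>M {..<n} (\<lambda>i. haar_unitary N).
        exp (- (real N)\<^sup>2 *
             Re (ntr N (CR_eval R n r (mat_algebra N)
                          (\<lambda>i j. V i * A i j * mat_adjoint (V i)) h))))"

definition orb_pressure_micro ::
  "real \<Rightarrow> nat \<Rightarrow> (nat \<Rightarrow> nat) \<Rightarrow> CR_elem \<Rightarrow> (nat \<Rightarrow> CR_part_elem \<Rightarrow> complex) \<Rightarrow>
   nat \<Rightarrow> nat \<Rightarrow> real \<Rightarrow> ereal" where
  "orb_pressure_micro R n r h \<sigma> N m \<delta> =
     (SUP A\<in>(\<Pi>\<^sub>E i\<in>{..<n}. microstates R (r i) (\<sigma> i) N m \<delta>). ereal (ln (orb_integral R n r h N A)))"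

definition orb_pressure ::
  "real \<Rightarrow> nat \<Rightarrow> (nat \<Rightarrow> nat) \<Rightarrow> CR_elem \<Rightarrow> (nat \<Rightarrow> CR_part_elem \<Rightarrow> complex) \<Rightarrow> ereal" where
  "orb_pressure R n r h \<sigma> =
     (INF (m, \<delta>)\<in>{1..} \<times> {0<..}.
        limsup (\<lambda>N. ereal (1 / (real N)\<^sup>2) * orb_pressure_micro R n r h \<sigma> N m \<delta>))"

definition eta_orb :: "real \<Rightarrow> nat \<Rightarrow> (nat \<Rightarrow> nat) \<Rightarrow> (CR_elem \<Rightarrow> complex) \<Rightarrow> ereal" where
  "eta_orb R n r \<sigma> =
     (INF h\<in>self_adjoint_elems (CR R n r).
        ereal (Re (\<sigma> h)) + orb_pressure R n r h (\<lambda>i f. \<sigma> (CR_incl R n r i f)))"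


section \<open>Von Neumann algebras\<close>

class complex_hilbert_space = real_normed_vector + complete_space +
  fixes scaleC :: "complex \<Rightarrow> 'a \<Rightarrow> 'a"
    and cinner :: "'a \<Rightarrow> 'a \<Rightarrow> complex"
  assumes scaleC_add_right: "scaleC c (x + y) = scaleC c x + scaleC c y"
    and scaleC_add_left: "scaleC (c + d) x = scaleC c x + scaleC d x"
    and scaleC_scaleC: "scaleC c (scaleC d x) = scaleC (c * d) x"
    and scaleC_of_real: "scaleC (of_real t) x = t *\<^sub>R x"
    and cinner_add_right: "cinner x (y + z) = cinner x y + cinner x z"
    and cinner_scaleC_right: "cinner x (scaleC c y) = c * cinner x y"
    and cinner_commute: "cinner y x = cnj (cinner x y)"
    and cinner_self: "cinner x x = of_real ((norm x)\<^sup>2)"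

text \<open>Elements of \<open>'h \<Rightarrow>\<^sub>L 'h\<close> are only real linear.\<close>

definition bounded_ops :: "('h::complex_hilbert_space \<Rightarrow>\<^sub>L 'h) set" where
  "bounded_ops = {T. \<forall>c x. blinfun_apply T (scaleC c x) = scaleC c (blinfun_apply T x)}"

definition op_adjoint :: "('h::complex_hilbert_space \<Rightarrow>\<^sub>L 'h) \<Rightarrow> ('h \<Rightarrow>\<^sub>L 'h)" where
  "op_adjoint T =
     (THE S. S \<in> bounded_ops \<and>
        (\<forall>x y. cinner (blinfun_apply S x) y = cinner x (blinfun_apply T y)))"

definition op_algebra ::
  "('h::complex_hilbert_space \<Rightarrow>\<^sub>L 'h) set \<Rightarrow> ('h \<Rightarrow>\<^sub>L 'h) star_algebra" where
  "op_algebra M = \<lparr>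
     carrier = M,
     monoid.mult = (o\<^sub>L),
     one = id_blinfun,
     ring.zero = 0,
     add = (+),
     smul = (\<lambda>c T. Blinfun (\<lambda>x. scaleC c (blinfun_apply T x))),
     star = op_adjoint\<rparr>"

definition weak_operator_topology :: "('h::complex_hilbert_space \<Rightarrow>\<^sub>L 'h) topology" where
  "weak_operator_topology =
     topology_generated_by
       {{T \<in> bounded_ops. cinner x (blinfun_apply T y) \<in> U} | x y U. open U}"

definition ultraweak_topology :: "('h::complex_hilbert_space \<Rightarrow>\<^sub>L 'h) topology" where
  "ultraweak_topology =
     topology_generated_by
       {{T \<in> bounded_ops. (\<Sum>k. cinner (\<xi> k) (blinfun_apply T (\<eta> k))) \<in> U} | (\<xi> :: nat \<Rightarrow> 'h) \<eta> U.
          summable (\<lambda>k. (norm (\<xi> k))\<^sup>2) \<and> summable (\<lambda>k. (norm (\<eta> k))\<^sup>2) \<and> open U}"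

definition von_neumann_algebra :: "('h::complex_hilbert_space \<Rightarrow>\<^sub>L 'h) set \<Rightarrow> bool" where
  "von_neumann_algebra M \<longleftrightarrow>
     M \<subseteq> bounded_ops \<and>
     \<one>\<^bsub>op_algebra M\<^esub> \<in> M \<and>
     (\<forall>S\<in>M. \<forall>T\<in>M. S \<oplus>\<^bsub>op_algebra M\<^esub> T \<in> M \<and> S \<otimes>\<^bsub>op_algebra M\<^esub> T \<in> M) \<and>
     (\<forall>c. \<forall>T\<in>M. smul (op_algebra M) c T \<in> M) \<and>
     (\<forall>T\<in>M. star (op_algebra M) T \<in> M) \<and>
     closedin weak_operator_topology M"

definition generated_vN ::
  "('h::complex_hilbert_space \<Rightarrow>\<^sub>L 'h) set \<Rightarrow> ('h \<Rightarrow>\<^sub>L 'h) set \<Rightarrow> ('h \<Rightarrow>\<^sub>L 'h) set" where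
  "generated_vN M X = \<Inter>{L. von_neumann_algebra L \<and> X \<subseteq> L \<and> L \<subseteq> M}"

definition tracial_Wstar_prob_space ::
  "('h::complex_hilbert_space \<Rightarrow>\<^sub>L 'h) set \<Rightarrow> (('h \<Rightarrow>\<^sub>L 'h) \<Rightarrow> complex) \<Rightarrow> bool" where
  "tracial_Wstar_prob_space M \<tau> \<longleftrightarrow>
     von_neumann_algebra M \<and>
     \<comment> \<open>finite: every isometry is unitary\<close>
     (\<forall>v\<in>M. op_adjoint v o\<^sub>L v = id_blinfun \<longrightarrow> v o\<^sub>L op_adjoint v = id_blinfun) \<and>
     tracial_state (op_algebra M) \<tau> \<and>
     \<comment> \<open>normal, i.e. continuous in the ultraweak topology\<close>
     continuous_map (subtopology ultraweak_topology M) euclidean \<tau> \<and>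
     \<comment> \<open>faithful\<close>
     (\<forall>a\<in>M. \<tau> (op_adjoint a o\<^sub>L a) = 0 \<longrightarrow> a = 0)"

definition induced_trace ::
  "real \<Rightarrow> nat \<Rightarrow> (nat \<Rightarrow> nat) \<Rightarrow> ('h::complex_hilbert_space \<Rightarrow>\<^sub>L 'h) set \<Rightarrow>
   (('h \<Rightarrow>\<^sub>L 'h) \<Rightarrow> complex) \<Rightarrow> (nat \<Rightarrow> nat \<Rightarrow> ('h \<Rightarrow>\<^sub>L 'h)) \<Rightarrow> CR_elem \<Rightarrow> complex" where
  "induced_trace R n r M \<tau> X f = \<tau> (CR_eval R n r (op_algebra M) X f)"

end

theory Submission
  imports Defs
begin

text \<open>
  The entropy of \<open>X\<close> is an infimum over self-adjoint \<open>h\<close> in the universal algebra of \<open>x\<close>, so it suffices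
  to bring every competitor for \<open>Y\<close>, together with its pressure, over to that algebra. If every
  \<open>Y i j\<close> were of the form \<open>f i j\<close> evaluated at \<open>X i\<close>, with \<open>f i j\<close> self-adjoint of norm at most \<open>S\<close> in
  the algebra of the single tuple \<open>x i\<close>, one would use the homomorphism \<open>\<Theta>\<close> that sends
  \<open>y i j\<close> to \<open>f i j\<close>. Evaluating \<open>\<Theta> h\<close> at \<open>V A V*\<close> is evaluating \<open>h\<close> at \<open>V f(A) V*\<close>, because unitary
  conjugation is an automorphism of the matrix algebra and \<open>f i j\<close> involves one tuple only. So the
  orbital integrals of \<open>\<Theta> h\<close> at \<open>A\<close> and of \<open>h\<close> at \<open>f(A)\<close> have the same integrand
  (\<open>orb_integral_transfer\<close>), and if \<open>A\<close> is a good microstate of \<open>X i\<close>, then \<open>f(A)\<close> is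
  one of \<open>Y i\<close> (\<open>microstate_approximation\<close>, \<open>pressure_transfer\<close>).

  In general \<open>Y i j\<close> is only a strong limit of such elements. Kaplansky's density theorem
  (\<open>kaplansky\<close>) keeps the approximants self-adjoint and of norm at most \<open>S\<close>, and normality of the trace
  makes them converge to \<open>Y i j\<close> in the 2-norm (\<open>normal_approximation\<close>). On bounded sets multiplication is
  continuous for the 2-norm, so the traces of \<open>\<Theta> k h\<close> converge to that of \<open>h\<close> for every \<open>h\<close>
  (\<open>approximating_homomorphisms\<close>). For fixed \<open>h\<close>, \<open>m\<close>, \<open>\<delta>\<close>, only finitely many words matter,
  so one \<open>k\<close> serves them all up to an error that is sent to zero at the end. The bound on the
  pressures holds for each \<open>N\<close> separately.

  The rest provides the objects with their universal properties. Every
  C*-seminorm on a C*-algebra is dominated by the norm, since self-adjoint elements of norm less than 1 are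
  averages of two unitaries (\<open>seminorm_contractive\<close>); von Neumann's inequality gives the continuous
  functional calculus; together they give the universal property of the free products
  (\<open>FA_hom\<close>) and hence the meaning of \<open>CR_eval\<close>. The Haar measure enters only through
  its being carried by the unitary group, but as it is given by a definite description this requires its existence
  and uniqueness (\<open>haar_unitary_is_haar\<close>).
\<close>

section \<open>Star-algebras and C*-seminorms\<close>

locale star_alg = ring A for A :: "('a, 'z) star_algebra_scheme" (structure) +
  assumes smul_closed [simp, intro]: "x \<in> carrier A ==> smul A c x \<in> carrier A"
    and smul_add_r: "x \<in> carrier A ==> y \<in> carrier A ==> smul A c (x \<oplus> y) = smul A c x \<oplus> smul A c y"
    and smul_add_l: "x \<in> carrier A ==> smul A (c + d) x = smul A c x \<oplus> smul A d x"
    and smul_smul [simp]: "x \<in> carrier A ==> smul A c (smul A d x) = smul A (c * d) x"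
    and smul_one [simp]: "x \<in> carrier A ==> smul A 1 x = x"
    and smul_mult_l: "x \<in> carrier A ==> y \<in> carrier A ==> smul A c x \<otimes> y = smul A c (x \<otimes> y)"
    and smul_mult_r: "x \<in> carrier A ==> y \<in> carrier A ==> x \<otimes> smul A c y = smul A c (x \<otimes> y)"
    and star_closed [simp, intro]: "x \<in> carrier A ==> star A x \<in> carrier A"
    and star_star [simp]: "x \<in> carrier A ==> star A (star A x) = x"
    and star_add: "x \<in> carrier A ==> y \<in> carrier A ==> star A (x \<oplus> y) = star A x \<oplus> star A y"
    and star_mult: "x \<in> carrier A ==> y \<in> carrier A ==> star A (x \<otimes> y) = star A y \<otimes> star A x"
    and star_smul: "x \<in> carrier A ==> star A (smul A c x) = smul A (cnj c) (star A x)"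

lemma star_algI:
  fixes A (structure)
  assumes "\<And>x y. x \<in> carrier A ==> y \<in> carrier A ==> x \<oplus> y \<in> carrier A"
    and "\<And>x y. x \<in> carrier A ==> y \<in> carrier A ==> x \<otimes> y \<in> carrier A"
    and "\<zero> \<in> carrier A" and "\<one> \<in> carrier A"
    and "\<And>x y z. x \<in> carrier A ==> y \<in> carrier A ==> z \<in> carrier A ==> (x \<oplus> y) \<oplus> z = x \<oplus> (y \<oplus> z)"
    and "\<And>x y. x \<in> carrier A ==> y \<in> carrier A ==> x \<oplus> y = y \<oplus> x"
    and "\<And>x. x \<in> carrier A ==> \<zero> \<oplus> x = x"
    and "\<And>x. x \<in> carrier A ==> smul A 0 x = \<zero>"
    and "\<And>x y z. x \<in> carrier A ==> y \<in> carrier A ==> z \<in> carrier A ==> (x \<otimes> y) \<otimes> z = x \<otimes> (y \<otimes> z)"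
    and "\<And>x. x \<in> carrier A ==> \<one> \<otimes> x = x" and "\<And>x. x \<in> carrier A ==> x \<otimes> \<one> = x"
    and "\<And>x y z. x \<in> carrier A ==> y \<in> carrier A ==> z \<in> carrier A ==> (x \<oplus> y) \<otimes> z = x \<otimes> z \<oplus> y \<otimes> z"
    and "\<And>x y z. x \<in> carrier A ==> y \<in> carrier A ==> z \<in> carrier A ==> z \<otimes> (x \<oplus> y) = z \<otimes> x \<oplus> z \<otimes> y"
    and smul_closed: "\<And>x c. x \<in> carrier A ==> smul A c x \<in> carrier A"
    and "\<And>x y c. x \<in> carrier A ==> y \<in> carrier A ==> smul A c (x \<oplus> y) = smul A c x \<oplus> smul A c y"
    and smul_add_l: "\<And>x c d. x \<in> carrier A ==> smul A (c + d) x = smul A c x \<oplus> smul A d x"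
    and "\<And>x c d. x \<in> carrier A ==> smul A c (smul A d x) = smul A (c * d) x"
    and smul_one: "\<And>x. x \<in> carrier A ==> smul A 1 x = x"
    and "\<And>x y c. x \<in> carrier A ==> y \<in> carrier A ==> smul A c x \<otimes> y = smul A c (x \<otimes> y)"
    and "\<And>x y c. x \<in> carrier A ==> y \<in> carrier A ==> x \<otimes> smul A c y = smul A c (x \<otimes> y)"
    and "\<And>x. x \<in> carrier A ==> star A x \<in> carrier A"
    and "\<And>x. x \<in> carrier A ==> star A (star A x) = x"
    and "\<And>x y. x \<in> carrier A ==> y \<in> carrier A ==> star A (x \<oplus> y) = star A x \<oplus> star A y"
    and "\<And>x y. x \<in> carrier A ==> y \<in> carrier A ==> star A (x \<otimes> y) = star A y \<otimes> star A x"
    and "\<And>x c. x \<in> carrier A ==> star A (smul A c x) = smul A (cnj c) (star A x)"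
  shows "star_alg A"
proof -
  have inv: "\<exists>y\<in>carrier A. y \<oplus> x = \<zero>" if x: "x \<in> carrier A" for x
    using smul_add_l[OF x, of "-1" 1] assms(8)[OF x] smul_one[OF x] smul_closed[OF x]
    by (intro bexI[of _ "smul A (-1) x"]) auto
  have "ring A"
    by (intro ringI abelian_groupI monoidI) (use assms inv in auto)
  then show ?thesis
    unfolding star_alg_def star_alg_axioms_def using assms by auto
qed

context star_alg
begin

abbreviation sb where "sb x y \<equiv> x \<oplus> smul A (-1) y"

lemma smul_zero_l [simp]: assumes "x \<in> carrier A" shows "smul A 0 x = \<zero>"
  using smul_add_l[OF assms, of 0 0] assms by (simp add: add.l_cancel_one)

lemma smul_zero_r [simp]: "smul A c \<zero> = \<zero>"
  using smul_smul[of \<zero> c 0] smul_zero_l[of \<zero>] by simp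

lemma smul_m1: assumes "x \<in> carrier A" shows "smul A (-1) x = \<ominus> x"
  using smul_add_l[OF assms, of "-1" 1] assms by (simp add: add.inv_equality)

lemma star_one [simp]: "star A \<one> = \<one>"
  using star_mult[of "star A \<one>" \<one>] by simp

lemma star_zero [simp]: "star A \<zero> = \<zero>"
  using star_smul[of \<zero> 0] by simp

lemma sb_self [simp]: "x \<in> carrier A ==> sb x x = \<zero>"
  by (simp add: smul_m1 r_neg)

lemma sb_eq_zero: "x \<in> carrier A ==> y \<in> carrier A ==> sb x y = \<zero> \<longleftrightarrow> x = y"
  by (metis local.minus_minus minus_equality smul_closed smul_m1 sb_self)

lemma sb_add: "x \<in> carrier A ==> y \<in> carrier A ==> z \<in> carrier A ==> w \<in> carrier A ==>
   sb (x \<oplus> y) (z \<oplus> w) = sb x z \<oplus> sb y w"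
  by (simp add: smul_add_r a_assoc a_comm add.m_lcomm)

lemma sb_tri: "x \<in> carrier A ==> y \<in> carrier A ==> z \<in> carrier A ==> sb x z = sb x y \<oplus> sb y z"
  by (simp add: smul_m1 a_assoc r_neg1 r_neg2)

lemma sb_mult: "x \<in> carrier A ==> y \<in> carrier A ==> z \<in> carrier A ==> w \<in> carrier A ==>
   sb (x \<otimes> y) (z \<otimes> w) = (x \<otimes> sb y w) \<oplus> (sb x z \<otimes> w)"
  by (simp add: smul_m1 l_distr r_distr a_assoc l_minus r_minus r_neg1 r_neg2)

lemma sb_smul: "x \<in> carrier A ==> y \<in> carrier A ==> sb (smul A c x) (smul A c y) = smul A c (sb x y)"
  by (simp add: smul_add_r)

lemma sb_star: "x \<in> carrier A ==> y \<in> carrier A ==> sb (star A x) (star A y) = star A (sb x y)"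
  by (simp add: star_add star_smul)

lemma sb_swap: "x \<in> carrier A ==> y \<in> carrier A ==> sb y x = smul A (-1) (sb x y)"
  by (simp add: smul_add_r a_comm)

lemma sb_add_cancel: "x \<in> carrier A ==> y \<in> carrier A ==> sb x y \<oplus> y = x"
  by (simp add: smul_m1 a_assoc l_neg)

lemma commuting_product:
  assumes "x \<in> carrier A" "y \<in> carrier A" "x \<otimes> y = y \<otimes> x"
  shows "(x \<oplus> smul A c y) \<otimes> (x \<oplus> smul A d y) =
         x \<otimes> x \<oplus> (smul A (c + d) (x \<otimes> y) \<oplus> smul A (c * d) (y \<otimes> y))"
proof -
  have "(x \<oplus> smul A c y) \<otimes> (x \<oplus> smul A d y) =
        (x \<otimes> x \<oplus> smul A c (y \<otimes> x)) \<oplus> (smul A d (x \<otimes> y) \<oplus> smul A (c * d) (y \<otimes> y))"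
    using assms(1,2) by (simp add: l_distr r_distr smul_mult_l smul_mult_r smul_add_r mult.commute)
  then show ?thesis
    using assms(1,2) by (simp add: a_assoc smul_add_l assms(3))
qed

lemma list_product_closed: "set xs \<subseteq> carrier A ==> list_product A xs \<in> carrier A"
  by (induction xs) (auto simp: list_product_def)

lemma list_product_append: "set xs \<subseteq> carrier A ==> set ys \<subseteq> carrier A ==>
   list_product A (xs @ ys) = list_product A xs \<otimes> list_product A ys"
  by (induction xs) (auto simp: list_product_def m_assoc list_product_closed[unfolded list_product_def])

end

text \<open>Both the seminorms in the definition of a free product and the norms of C*-algebras are instances; only the latter are definite
  and complete.\<close>

locale cstar_semi = star_alg A for A :: "('a, 'z) star_algebra_scheme" (structure) +
  fixes \<nu> :: "'a => real"
  assumes semi: "cstar_seminorm A \<nu>"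
begin

abbreviation dst where "dst x y \<equiv> seminorm_dist A \<nu> x y"

lemma nu_ge0 [simp]: "x \<in> carrier A ==> 0 \<le> \<nu> x"
  and nu_add: "x \<in> carrier A ==> y \<in> carrier A ==> \<nu> (x \<oplus> y) \<le> \<nu> x + \<nu> y"
  and nu_smul: "x \<in> carrier A ==> \<nu> (smul A c x) = cmod c * \<nu> x"
  and nu_mult: "x \<in> carrier A ==> y \<in> carrier A ==> \<nu> (x \<otimes> y) \<le> \<nu> x * \<nu> y"
  and nu_cstar: "x \<in> carrier A ==> \<nu> (star A x \<otimes> x) = (\<nu> x)\<^sup>2"
  using semi unfolding cstar_seminorm_def by auto

lemma nu_zero [simp]: "\<nu> \<zero> = 0"
  using nu_smul[of \<zero> 0] by simp

lemma nu_star [simp]: assumes x: "x \<in> carrier A" shows "\<nu> (star A x) = \<nu> x"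
proof -
  have *: "\<nu> y \<le> \<nu> (star A y)" if y: "y \<in> carrier A" for y
  proof (cases "\<nu> y = 0")
    case False
    then have "\<nu> y > 0" using nu_ge0[OF y] by linarith
    moreover have "\<nu> y * \<nu> y \<le> \<nu> (star A y) * \<nu> y"
      using nu_mult[of "star A y" y] nu_cstar[OF y] y by (simp add: power2_eq_square)
    ultimately show ?thesis by simp
  qed (use y in auto)
  show ?thesis using *[OF x] *[of "star A x"] x by auto
qed

lemma nu_one_le: "\<nu> \<one> \<le> 1"
proof -
  have "\<nu> \<one> = (\<nu> \<one>)\<^sup>2" using nu_cstar[of \<one>] by simp
  then have "\<nu> \<one> * (1 - \<nu> \<one>) = 0" by (simp add: power2_eq_square algebra_simps)
  then show ?thesis by auto
qed

lemma dst_ge0 [simp]: "x \<in> carrier A ==> y \<in> carrier A ==> 0 \<le> dst x y"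
  by (simp add: seminorm_dist_def)
lemma dst_self [simp]: "x \<in> carrier A ==> dst x x = 0"
  by (simp add: seminorm_dist_def)
lemma dst_sym: "x \<in> carrier A ==> y \<in> carrier A ==> dst x y = dst y x"
  using sb_swap[of y x] by (simp add: seminorm_dist_def nu_smul del: smul_smul smul_one)
lemma dst_tri: "x \<in> carrier A ==> y \<in> carrier A ==> z \<in> carrier A ==> dst x z \<le> dst x y + dst y z"
  by (simp add: seminorm_dist_def sb_tri[of x y z] nu_add)
lemma dst_add: "x \<in> carrier A ==> y \<in> carrier A ==> z \<in> carrier A ==> w \<in> carrier A ==>
   dst (x \<oplus> y) (z \<oplus> w) \<le> dst x z + dst y w"
  by (simp add: seminorm_dist_def sb_add nu_add)
lemma dst_smul: "x \<in> carrier A ==> y \<in> carrier A ==> dst (smul A c x) (smul A c y) = cmod c * dst x y"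
  by (simp add: seminorm_dist_def sb_smul nu_smul del: smul_smul)
lemma dst_star: "x \<in> carrier A ==> y \<in> carrier A ==> dst (star A x) (star A y) = dst x y"
  by (simp add: seminorm_dist_def sb_star)
lemma dst_mult: "x \<in> carrier A ==> y \<in> carrier A ==> z \<in> carrier A ==> w \<in> carrier A ==>
   dst (x \<otimes> y) (z \<otimes> w) \<le> \<nu> x * dst y w + dst x z * \<nu> w"
  unfolding seminorm_dist_def sb_mult
  by (rule order_trans[OF nu_add add_mono]) (auto intro: nu_mult)
lemma dst_zero: "x \<in> carrier A ==> dst x \<zero> = \<nu> x"
  by (simp add: seminorm_dist_def)
lemma nu_le_dst: "x \<in> carrier A ==> y \<in> carrier A ==> \<nu> x \<le> dst x y + \<nu> y"
  using nu_add[of "sb x y" y] by (simp add: seminorm_dist_def sb_add_cancel)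
lemma nu_dst: "x \<in> carrier A ==> y \<in> carrier A ==> \<bar>\<nu> x - \<nu> y\<bar> \<le> dst x y"
  using nu_le_dst[of x y] nu_le_dst[of y x] dst_sym[of x y] by auto

definition conv :: "(nat => 'a) => 'a => bool" where
  "conv f l \<longleftrightarrow> (\<forall>k. f k \<in> carrier A) \<and> l \<in> carrier A \<and> (\<lambda>k. dst (f k) l) \<longlonglongrightarrow> 0"

lemma convD: "conv f l ==> f k \<in> carrier A" "conv f l ==> l \<in> carrier A"
  by (auto simp: conv_def)

lemma conv_const: "x \<in> carrier A ==> conv (\<lambda>k. x) x"
  by (simp add: conv_def)

lemma conv_bound:
  assumes "\<And>k. f k \<in> carrier A" "l \<in> carrier A" "\<And>k. dst (f k) l \<le> u k" "u \<longlonglongrightarrow> 0"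
  shows "conv f l"
  unfolding conv_def using assms
  by (auto intro: tendsto_sandwich[of "\<lambda>_. 0" _ _ u])

lemma conv_nu: assumes "conv f l" shows "(\<lambda>k. \<nu> (f k)) \<longlonglongrightarrow> \<nu> l"
proof -
  have "(\<lambda>k. \<nu> (f k) - \<nu> l) \<longlonglongrightarrow> 0"
    by (rule Lim_null_comparison[of _ "\<lambda>k. dst (f k) l"]) (use assms nu_dst in \<open>auto simp: conv_def\<close>)
  then show ?thesis by (simp add: LIM_zero_iff)
qed

lemma conv_add: assumes "conv f l" "conv g m" shows "conv (\<lambda>k. f k \<oplus> g k) (l \<oplus> m)"
  by (rule conv_bound[where u="\<lambda>k. dst (f k) l + dst (g k) m"])
     (use assms in \<open>auto simp: conv_def intro!: dst_add tendsto_eq_intros\<close>)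

lemma conv_smul: assumes "conv f l" shows "conv (\<lambda>k. smul A c (f k)) (smul A c l)"
  by (rule conv_bound[where u="\<lambda>k. cmod c * dst (f k) l"])
     (use assms in \<open>auto simp: conv_def dst_smul intro!: tendsto_eq_intros\<close>)

lemma conv_star: assumes "conv f l" shows "conv (\<lambda>k. star A (f k)) (star A l)"
  using assms by (auto simp: conv_def dst_star)

lemma conv_mult: assumes "conv f l" "conv g m" shows "conv (\<lambda>k. f k \<otimes> g k) (l \<otimes> m)"
proof (rule conv_bound[where u="\<lambda>k. \<nu> (f k) * dst (g k) m + dst (f k) l * \<nu> m"])
  show "(\<lambda>k. \<nu> (f k) * dst (g k) m + dst (f k) l * \<nu> m) \<longlonglongrightarrow> 0"
    using conv_nu[OF assms(1)] assms by (auto simp: conv_def intro!: tendsto_eq_intros)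
qed (use assms in \<open>auto simp: conv_def intro!: dst_mult\<close>)

lemma conv_dst0: assumes "conv f l" "conv f m" shows "dst l m = 0"
proof -
  have "(\<lambda>k. dst (f k) l + dst (f k) m) \<longlonglongrightarrow> 0" using assms by (auto simp: conv_def intro!: tendsto_eq_intros)
  moreover have "dst l m \<le> dst (f k) l + dst (f k) m" for k
    using assms dst_tri[of l "f k" m] dst_sym[of l "f k"] by (auto simp: conv_def)
  ultimately have "dst l m \<le> 0" by (meson LIMSEQ_le_const)
  then show ?thesis using assms by (intro antisym) (auto simp: conv_def)
qed

lemma conv_imp_cauchy: assumes "conv f l" shows "f \<in> cauchy_seqs A \<nu>"
proof -
  have "\<exists>K. \<forall>k\<ge>K. \<forall>j\<ge>K. dst (f k) (f j) < e" if "e > 0" for e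
  proof -
    have "\<forall>\<^sub>F k in sequentially. dst (f k) l < e/2"
      using assms that by (intro order_tendstoD(2)[of _ 0]) (auto simp: conv_def)
    then obtain K where K: "\<forall>k\<ge>K. dst (f k) l < e/2" by (auto simp: eventually_sequentially)
    have "dst (f k) (f j) < e" if "k \<ge> K" "j \<ge> K" for k j
      using K[rule_format, OF that(1)] K[rule_format, OF that(2)]
        dst_tri[OF convD(1)[OF assms, of k] convD(2)[OF assms] convD(1)[OF assms, of j]]
        dst_sym[OF convD(2)[OF assms] convD(1)[OF assms, of j]] by linarith
    then show ?thesis by blast
  qed
  then show ?thesis using convD(1)[OF assms] unfolding cauchy_seqs_def by blast
qed

end

locale cstar = cstar_semi +
  assumes nu_eq0D: "x \<in> carrier A ==> \<nu> x = 0 ==> x = \<zero>"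
    and complete: "f \<in> cauchy_seqs A \<nu> ==> \<exists>l. conv f l"
begin

lemma dst_eq0: "x \<in> carrier A ==> y \<in> carrier A ==> dst x y = 0 \<longleftrightarrow> x = y"
  using nu_eq0D[of "sb x y"] sb_eq_zero[of x y] unfolding seminorm_dist_def
  by (metis a_closed nu_zero smul_closed)

lemma conv_unique: "conv f l ==> conv f m ==> l = m"
  using conv_dst0[of f l m] dst_eq0[OF convD(2) convD(2), of f l f m] by simp

text \<open>The two iterations below, for square roots and for polar parts, converge geometrically.\<close>

lemma complete_geometric:
  assumes f: "\<And>k. f k \<in> carrier A" and q: "0 \<le> q" "q < 1"
    and step: "\<And>k. dst (f (Suc k)) (f k) \<le> C * q ^ k"
  shows "\<exists>l. conv f l"
proof (rule complete)
  have le: "dst (f (k + m)) (f k) \<le> (\<Sum>i<m. C * q ^ (k + i))" for k m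
  proof (induction m)
    case (Suc m)
    then show ?case using dst_tri[of "f (k + Suc m)" "f (k + m)" "f k"] step[of "k + m"] f by simp
  qed (use f in simp)
  have C: "C \<ge> 0" using order_trans[OF dst_ge0 step[of 0]] f by simp
  have bnd: "dst (f (k + m)) (f k) \<le> C * q ^ k / (1 - q)" for k m
  proof -
    have "(\<Sum>i<m. C * q ^ (k + i)) = C * q ^ k * (\<Sum>i<m. q ^ i)"
      by (simp add: power_add sum_distrib_left mult_ac)
    also have "\<dots> \<le> C * q ^ k * (1 / (1 - q))"
    proof (rule mult_left_mono)
      show "(\<Sum>i<m. q ^ i) \<le> 1 / (1 - q)"
        using q by (subst suminf_geometric[symmetric]) (auto intro!: sum_le_suminf)
    qed (use C q in auto)
    finally show ?thesis using le[of k m] by simp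
  qed
  have lim: "(\<lambda>k. 2 * (C * q ^ k / (1 - q))) \<longlonglongrightarrow> 0"
    using tendsto_mult_left[OF LIMSEQ_power_zero[of q], of "2 * C / (1 - q)"] q by (simp add: mult_ac)
  show "f \<in> cauchy_seqs A \<nu>"
    unfolding cauchy_seqs_def
  proof (clarsimp simp: f)
    fix e :: real assume "e > 0"
    then obtain K where K: "2 * (C * q ^ K / (1 - q)) < e"
      using order_tendstoD(2)[OF lim] by (auto simp: eventually_sequentially)
    have "dst (f k) (f l) < e" if kl: "k \<ge> K" "l \<ge> K" for k l
      using bnd[of K "k - K"] bnd[of K "l - K"] dst_tri[OF f[of k] f[of K] f[of l]]
        dst_sym[OF f[of K] f[of l]] K kl by simp
    then show "\<exists>K. \<forall>k\<ge>K. \<forall>l\<ge>K. dst (f k) (f l) < e" by blast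
  qed
qed

text \<open>The iterates of \<open>s \<mapsto> (e + s\<^sup>2) / 2\<close> starting at 0 have norm at most
  \<open>q = 1 - sqrt (1 - \<nu> e) < 1\<close>, so consecutive differences shrink by the factor \<open>q\<close>; the limit
  satisfies \<open>(1 - s)\<^sup>2 = 1 - e\<close>. All iterates are polynomials in \<open>e\<close>, which gives the
  commutation.\<close>

lemma sqrt_exists:
  assumes e: "e \<in> carrier A" "star A e = e" and lt: "\<nu> e < 1"
  shows "\<exists>c\<in>carrier A. star A c = c \<and> c \<otimes> c = sb \<one> e \<and>
           (\<forall>z\<in>carrier A. z \<otimes> e = e \<otimes> z \<longrightarrow> z \<otimes> c = c \<otimes> z)"
proof -
  define q where "q = 1 - sqrt (1 - \<nu> e)"
  have q: "0 \<le> q" "q < 1" "(\<nu> e + q * q) / 2 = q"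
    using lt e by (auto simp: q_def field_simps)
  define s where "s = rec_nat \<zero> (\<lambda>_ x. smul A (1/2) (e \<oplus> x \<otimes> x))"
  have s0: "s 0 = \<zero>" and sS: "s (Suc k) = smul A (1/2) (e \<oplus> s k \<otimes> s k)" for k by (auto simp: s_def)
  have sc [simp]: "s k \<in> carrier A" for k by (induction k) (auto simp: s0 sS e)
  have com: "z \<otimes> s k = s k \<otimes> z" if z: "z \<in> carrier A" "z \<otimes> e = e \<otimes> z" for z k
  proof (induction k)
    case (Suc k)
    have "z \<otimes> (s k \<otimes> s k) = (s k \<otimes> s k) \<otimes> z"
      using Suc z(1) by (metis m_assoc sc)
    then show ?case using z e by (simp add: sS smul_mult_l smul_mult_r l_distr r_distr)
  qed (use z in \<open>simp add: s0\<close>)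
  have sstar: "star A (s k) = s k" for k
    by (induction k) (auto simp: s0 sS star_smul star_add star_mult e)
  have sb: "\<nu> (s k) \<le> q" for k
  proof (induction k)
    case (Suc k)
    have "\<nu> (s (Suc k)) \<le> (\<nu> e + \<nu> (s k) * \<nu> (s k)) / 2"
      using nu_add[of e "s k \<otimes> s k"] nu_mult[of "s k" "s k"] e by (simp add: sS nu_smul)
    also have "\<dots> \<le> (\<nu> e + q * q) / 2" using Suc q(1) by (intro divide_right_mono add_left_mono mult_mono) auto
    finally show ?case using q by simp
  qed (use q in \<open>simp add: s0\<close>)
  have step: "dst (s (Suc (Suc k))) (s (Suc k)) \<le> q * dst (s (Suc k)) (s k)" for k
  proof -
    have "dst (s (Suc (Suc k))) (s (Suc k)) = 1/2 * dst (e \<oplus> s (Suc k) \<otimes> s (Suc k)) (e \<oplus> s k \<otimes> s k)"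
      using e by (subst (1 2) sS) (simp add: dst_smul)
    also have "\<dots> \<le> 1/2 * (dst e e + dst (s (Suc k) \<otimes> s (Suc k)) (s k \<otimes> s k))"
      using e by (intro mult_left_mono dst_add) auto
    also have "\<dots> \<le> 1/2 * (\<nu> (s (Suc k)) * dst (s (Suc k)) (s k) + dst (s (Suc k)) (s k) * \<nu> (s k))"
      using e dst_mult[of "s (Suc k)" "s (Suc k)" "s k" "s k"] by simp
    also have "\<dots> \<le> 1/2 * (q * dst (s (Suc k)) (s k) + dst (s (Suc k)) (s k) * q)"
      using sb by (intro mult_left_mono add_mono mult_right_mono) auto
    finally show ?thesis by simp
  qed
  have "dst (s (Suc k)) (s k) \<le> dst (s 1) (s 0) * q ^ k" for k
  proof (induction k)
    case (Suc k)
    show ?case using step[of k] mult_left_mono[OF Suc q(1)] by (simp add: mult_ac)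
  qed simp
  from complete_geometric[OF sc q(1,2) this] obtain t where t: "conv s t" by blast
  have tc [simp]: "t \<in> carrier A" using convD(2)[OF t] .
  have "conv (\<lambda>k. s (Suc k)) t" using t unfolding conv_def by (auto intro: LIMSEQ_Suc)
  moreover have "conv (\<lambda>k. s (Suc k)) (smul A (1/2) (e \<oplus> t \<otimes> t))"
    unfolding sS by (intro conv_smul conv_add conv_const conv_mult t e)
  ultimately have t_eq: "t = smul A (1/2) (e \<oplus> t \<otimes> t)" by (rule conv_unique)
  have tt: "t \<otimes> t = smul A 2 t \<oplus> smul A (-1) e"
  proof -
    have "smul A 2 t = e \<oplus> t \<otimes> t" using arg_cong[OF t_eq, of "smul A 2"] e by simp
    then show ?thesis using sb_add_cancel[of "t \<otimes> t" e] e by (simp add: a_ac)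
  qed
  have tstar: "star A t = t" using conv_star[OF t] t by (simp add: sstar conv_unique)
  have tcom: "z \<otimes> t = t \<otimes> z" if z: "z \<in> carrier A" "z \<otimes> e = e \<otimes> z" for z
  proof (rule conv_unique)
    show "conv (\<lambda>k. z \<otimes> s k) (z \<otimes> t)" by (intro conv_mult conv_const t z)
    show "conv (\<lambda>k. z \<otimes> s k) (t \<otimes> z)" unfolding com[OF z] by (intro conv_mult conv_const t z)
  qed
  let ?c = "sb \<one> t"
  have cc: "?c \<otimes> ?c = sb \<one> e"
  proof -
    have "?c \<otimes> ?c = \<one> \<oplus> (smul A (-2) t \<oplus> (smul A 2 t \<oplus> smul A (-1) e))"
      using e by (simp add: commuting_product tt)
    also have "\<dots> = \<one> \<oplus> ((smul A (-2) t \<oplus> smul A 2 t) \<oplus> smul A (-1) e)"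
      using e by (simp add: a_assoc)
    also have "smul A (-2) t \<oplus> smul A 2 t = \<zero>"
      using smul_add_l[of t "-2" "2", symmetric] by simp
    also have "\<one> \<oplus> (\<zero> \<oplus> smul A (-1) e) = sb \<one> e"
      using e by simp
    finally show ?thesis .
  qed
  show ?thesis
  proof (intro bexI[of _ ?c] conjI ballI impI)
    show "star A ?c = ?c" by (simp add: star_add star_smul tstar)
    show "?c \<otimes> ?c = sb \<one> e" by (rule cc)
    fix z assume "z \<in> carrier A" "z \<otimes> e = e \<otimes> z"
    then show "z \<otimes> ?c = ?c \<otimes> z" using tcom[of z] by (simp add: l_distr r_distr smul_mult_l smul_mult_r)
  qed simp
qed

text \<open>The unitary is \<open>v = b + \<i> sqrt (1 - b\<^sup>2)\<close>.\<close>

lemma unitary_exists: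
  assumes b: "b \<in> carrier A" "star A b = b" and lt: "\<nu> b < 1"
  shows "\<exists>v\<in>carrier A. star A v \<otimes> v = \<one> \<and> v \<otimes> star A v = \<one> \<and> b = smul A (1/2) (v \<oplus> star A v)"
proof -
  have lt2: "\<nu> (b \<otimes> b) < 1"
    using nu_mult[of b b] b lt nu_ge0[of b] by (smt (verit, best) mult_less_cancel_right1 mult_left_le_one_le)
  obtain c where c: "c \<in> carrier A" "star A c = c" "c \<otimes> c = sb \<one> (b \<otimes> b)"
      and com: "\<And>z. z \<in> carrier A ==> z \<otimes> (b \<otimes> b) = (b \<otimes> b) \<otimes> z ==> z \<otimes> c = c \<otimes> z"
    using sqrt_exists[OF m_closed[OF b(1) b(1)] _ lt2] b(1)
    by (metis b(2) star_mult)
  have bc: "b \<otimes> c = c \<otimes> b" using com[of b] b by (simp add: m_assoc)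
  let ?v = "b \<oplus> smul A \<i> c"
  have vs: "star A ?v = b \<oplus> smul A (-\<i>) c" using b c by (simp add: star_add star_smul)
  have sum1: "b \<otimes> b \<oplus> c \<otimes> c = \<one>"
    using sb_add_cancel[of \<one> "b \<otimes> b"] b c by (simp add: a_comm)
  have e1: "star A ?v \<otimes> ?v = \<one>" and e2: "?v \<otimes> star A ?v = \<one>"
    unfolding vs using b(1) c(1) sum1 by (simp_all add: commuting_product bc)
  have e3: "b = smul A (1/2) (?v \<oplus> star A ?v)"
  proof -
    have "?v \<oplus> star A ?v = (b \<oplus> b) \<oplus> (smul A \<i> c \<oplus> smul A (-\<i>) c)"
      unfolding vs using b c(1) by (simp add: a_assoc add.m_lcomm)
    also have "\<dots> = smul A 2 b" using b c(1) smul_add_l[of c "\<i>" "-\<i>"] smul_add_l[of b 1 1] by simp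
    finally show ?thesis using b by simp
  qed
  show ?thesis using b c e1 e2 e3 by (intro bexI[of _ ?v] conjI) auto
qed

text \<open>By the C*-identity it suffices to treat self-adjoint elements of norm less than 1; these are averages of two unitaries, and a
  C*-seminorm is at most 1 on unitaries.\<close>

lemma seminorm_contractive:
  assumes rho: "cstar_seminorm A \<rho>" and x: "x \<in> carrier A"
  shows "\<rho> x \<le> \<nu> x"
proof -
  interpret R: cstar_semi A \<rho> by unfold_locales (rule rho)
  have sa1: "\<rho> b \<le> 1" if b: "b \<in> carrier A" "star A b = b" "\<nu> b < 1" for b
  proof -
    obtain v where v: "v \<in> carrier A" "star A v \<otimes> v = \<one>" "v \<otimes> star A v = \<one>" "b = smul A (1/2) (v \<oplus> star A v)"
      using unitary_exists[OF b] by blast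
    have "(\<rho> v)\<^sup>2 \<le> 1" using R.nu_cstar[OF v(1)] v(2) R.nu_one_le by simp
    then have "\<rho> v \<le> 1" using abs_square_le_1[of "\<rho> v"] by simp
    then show ?thesis unfolding v(4) using v(1) R.nu_add[of v "star A v"] by (simp add: R.nu_smul)
  qed
  have sa: "\<rho> b \<le> \<nu> b" if b: "b \<in> carrier A" "star A b = b" for b
  proof (rule field_le_epsilon)
    fix e :: real assume e: "e > 0"
    let ?t = "\<nu> b + e"
    have t: "?t > 0" using e nu_ge0[OF b(1)] by linarith
    let ?a = "smul A (of_real (1 / ?t)) b"
    have n: "cmod (of_real (1 / ?t)) = 1 / ?t" using t by (simp only: norm_of_real) simp
    have "\<nu> ?a < 1" using b t e by (simp only: nu_smul n) simp
    then have "\<rho> ?a \<le> 1" using sa1[of ?a] b by (simp only: star_smul complex_cnj_complex_of_real smul_closed)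
    then have "1 / ?t * \<rho> b \<le> 1" using b by (simp only: R.nu_smul n)
    then show "\<rho> b \<le> ?t" using t by (simp add: divide_le_eq)
  qed
  have "(\<rho> x)\<^sup>2 \<le> (\<nu> x)\<^sup>2"
  proof -
    have "star A (star A x \<otimes> x) = star A x \<otimes> x" using x by (simp only: star_mult star_closed star_star)
    from sa[OF _ this] show ?thesis using x by (simp only: nu_cstar R.nu_cstar m_closed star_closed)
  qed
  then show ?thesis using nu_ge0[OF x] by (rule power2_le_imp_le)
qed

end

section \<open>Continuous functional calculus\<close>

text \<open>Fourier coefficients as averages over roots of unity; this avoids integration over the circle.\<close>

lemma coeff_le_sup_circle:
  fixes p :: "complex poly"
  assumes K: "\<And>z. cmod z = 1 ==> cmod (poly p z) \<le> K"
  shows "cmod (coeff p k) \<le> K"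
proof -
  define M where "M = degree p + k + 1"
  define w where "w = (\<lambda>j. cis (2 * pi * real j / real M))"
  have M: "M > 0" by (simp add: M_def)
  have orth: "(\<Sum>j<M. w j ^ i * cnj (w j) ^ k) = (if i = k then of_nat M else 0)" if i: "i \<le> degree p" for i
  proof -
    define x where "x = 2 * pi * (real i - real k) / real M"
    have t: "w j ^ i * cnj (w j) ^ k = cis x ^ j" for j
    proof -
      have "w j ^ i * cnj (w j) ^ k =
          cis (real i * (2 * pi * real j / real M) + real k * (- (2 * pi * real j / real M)))"
        by (simp only: w_def cis_cnj Complex.DeMoivre cis_mult)
      also have "real i * (2 * pi * real j / real M) + real k * (- (2 * pi * real j / real M)) = real j * x"
        by (simp add: x_def diff_divide_distrib algebra_simps)
      finally show ?thesis by (simp only: Complex.DeMoivre)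
    qed
    have "cis x ^ M = 1"
    proof -
      have "real M * x = 2 * pi * of_int (int i - int k)" using M by (simp add: x_def)
      then show ?thesis unfolding Complex.DeMoivre
        by (simp only:) (simp add: complex_eq_iff cos_int_2pin sin_int_2pin del: of_int_diff)
    qed
    moreover have "cis x \<noteq> 1" if "i \<noteq> k"
    proof
      assume "cis x = 1"
      then have "cos x = 1" by (metis cis.simps(1) one_complex.simps(1))
      then obtain n :: int where n: "x = of_int n * 2 * pi" unfolding cos_one_2pi_int by auto
      then have "2 * pi * (real i - real k) = 2 * pi * (of_int n * real M)"
        using M by (simp add: x_def divide_eq_eq mult_ac)
      then have "real_of_int (int i - int k) = real_of_int (n * int M)"
        by (subst (asm) mult_cancel_left) simp
      then have eq: "int i - int k = n * int M" by linarith
      have "\<bar>int i - int k\<bar> < int M" using i by (simp add: M_def)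
      then have "\<bar>n\<bar> * int M < 1 * int M" by (simp add: eq abs_mult)
      then have "n = 0" using M by (subst (asm) mult_less_cancel_right_pos) auto
      then show False using eq that by simp
    qed
    moreover have "w j ^ k * cnj (w j) ^ k = 1" for j
      by (simp add: w_def power_mult_distrib[symmetric] cis_cnj cis_mult)
    ultimately show ?thesis
      by (cases "i = k") (simp_all add: t sum_gp_strict)
  qed
  have "(\<Sum>j<M. poly p (w j) * cnj (w j) ^ k) = (\<Sum>j<M. \<Sum>i\<le>degree p. coeff p i * (w j ^ i * cnj (w j) ^ k))"
    by (simp add: poly_altdef sum_distrib_right mult.assoc)
  also have "\<dots> = (\<Sum>i\<le>degree p. coeff p i * (\<Sum>j<M. w j ^ i * cnj (w j) ^ k))"
    by (subst sum.swap) (simp add: sum_distrib_left)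
  also have "\<dots> = (\<Sum>i\<le>degree p. if i = k then coeff p k * of_nat M else 0)"
    by (rule sum.cong) (use orth in auto)
  also have "\<dots> = coeff p k * of_nat M"
    by (auto simp: coeff_eq_0)
  finally have eq: "coeff p k * of_nat M = (\<Sum>j<M. poly p (w j) * cnj (w j) ^ k)" ..
  have "cmod (coeff p k) * M = cmod (coeff p k * of_nat M)" by (simp add: norm_mult)
  also have "\<dots> \<le> (\<Sum>j<M. cmod (poly p (w j) * cnj (w j) ^ k))" unfolding eq by (rule norm_sum)
  also have "\<dots> \<le> (\<Sum>j<M. K)"
    by (rule sum_mono) (auto simp: norm_mult norm_power w_def intro!: K)
  finally show ?thesis using M by simp
qed

context star_alg
begin

definition ev :: "complex poly => 'a => 'a" where
  "ev p x = fold_coeffs (\<lambda>a y. smul A a \<one> \<oplus> x \<otimes> y) p \<zero>"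

lemma ev_0 [simp]: "ev 0 x = \<zero>"
  by (simp add: ev_def)

lemma ev_pCons [simp]: "x \<in> carrier A ==> ev (pCons a p) x = smul A a \<one> \<oplus> x \<otimes> ev p x"
  by (cases "p = 0"; cases "a = 0") (simp_all add: ev_def)

lemma ev_closed [simp, intro]: "x \<in> carrier A ==> ev p x \<in> carrier A"
  by (induction p) simp_all

lemma ev_1: "x \<in> carrier A ==> ev 1 x = \<one>"
  by (simp add: one_pCons)

lemma ev_add: "x \<in> carrier A ==> ev (p + q) x = ev p x \<oplus> ev q x"
proof (induction p q rule: poly_induct2)
  case (pCons a p b q)
  then show ?case by (simp add: smul_add_l r_distr a_assoc add.m_lcomm)
qed simp

lemma ev_smult: "x \<in> carrier A ==> ev (Polynomial.smult c p) x = smul A c (ev p x)"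
  by (induction p) (simp_all add: smul_add_r smul_mult_r)

lemma ev_mult: "x \<in> carrier A ==> ev (p * q) x = ev p x \<otimes> ev q x"
  by (induction p) (simp_all add: ev_add ev_smult l_distr smul_mult_l m_assoc)

lemma ev_commute: "x \<in> carrier A ==> z \<in> carrier A ==> z \<otimes> x = x \<otimes> z ==> z \<otimes> ev p x = ev p x \<otimes> z"
proof (induction p)
  case (pCons a p)
  have "z \<otimes> (x \<otimes> ev p x) = (x \<otimes> ev p x) \<otimes> z"
    using pCons by (metis ev_closed m_assoc)
  then show ?case using pCons(3,4) by (simp add: r_distr l_distr smul_mult_l smul_mult_r)
qed simp

lemma ev_star: "x \<in> carrier A ==> star A (ev p x) = ev (map_poly cnj p) (star A x)"
proof (induction p)
  case (pCons a p)
  then show ?case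
    using ev_commute[of "star A x" "star A x" "map_poly cnj p"]
    by (simp add: map_poly_pCons star_add star_smul star_mult)
qed simp

end

text \<open>The power trick: an estimate for all \<open>2 ^ k\<close>-th powers absorbs a factor that grows linearly in the
  exponent.\<close>

lemma geometric_beats_linear:
  fixes a K :: real
  assumes "0 \<le> K" "0 \<le> a" and le: "\<And>k::nat. a ^ (2 ^ k) \<le> (2 ^ k * d + 1) * K ^ (2 ^ k)"
  shows "a \<le> K"
proof (rule ccontr)
  assume "\<not> a \<le> K"
  then have aK: "a > K" by simp
  have K: "K > 0"
  proof (rule ccontr)
    assume "\<not> K > 0"
    then have "K = 0" using assms by simp
    then show False using le[of 0] aK by simp
  qed
  define q where "q = K / a"
  have q: "0 < q" "q < 1" using aK K by (auto simp: q_def)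
  have a: "a > 0" using aK K by simp
  have "(\<lambda>n. (real n * d + 1) * q ^ n) \<longlonglongrightarrow> 0"
  proof -
    have "(\<lambda>n. d * (real n * q ^ n) + q ^ n) \<longlonglongrightarrow> d * 0 + 0"
      using q by (intro tendsto_add tendsto_mult_left powser_times_n_limit_0 LIMSEQ_power_zero) auto
    then show ?thesis by (simp add: algebra_simps)
  qed
  then have "\<forall>\<^sub>F n in sequentially. (real n * d + 1) * q ^ n < 1"
    by (rule order_tendstoD) simp
  then obtain N where N: "\<And>n. n \<ge> N ==> (real n * d + 1) * q ^ n < 1"
    by (auto simp: eventually_sequentially)
  have "2 ^ N \<ge> N" by simp
  from N[OF this] have *: "(2 ^ N * d + 1) * q ^ (2 ^ N) < 1" by simp
  have "a ^ (2 ^ N) \<le> (2 ^ N * d + 1) * K ^ (2 ^ N)" by (rule le)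
  also have "K ^ (2 ^ N) = q ^ (2 ^ N) * a ^ (2 ^ N)"
    using a by (simp add: q_def power_divide)
  finally have "a ^ (2 ^ N) * 1 \<le> a ^ (2 ^ N) * ((2 ^ N * d + 1) * q ^ (2 ^ N))"
    by (simp add: mult_ac)
  then have "1 \<le> (2 ^ N * d + 1) * q ^ (2 ^ N)" using a by (subst (asm) mult_le_cancel_left_pos) auto
  then show False using * by simp
qed

context cstar_semi
begin

lemma nu_ev_le_coeffs:
  assumes v: "v \<in> carrier A" "\<nu> v \<le> 1"
  shows "degree p \<le> n ==> \<nu> (ev p v) \<le> (\<Sum>k\<le>n. cmod (coeff p k))"
proof (induction n arbitrary: p)
  case 0
  then obtain a where "p = [:a:]" using degree_eq_zeroE by blast
  then show ?case using nu_one_le v by (simp add: nu_smul mult_left_le)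
next
  case (Suc n)
  obtain a q where p: "p = pCons a q" by (cases p)
  have q: "degree q \<le> n" using Suc.prems by (auto simp: p split: if_splits)
  have "\<nu> (ev p v) \<le> cmod a * \<nu> \<one> + \<nu> v * \<nu> (ev q v)"
    unfolding p using v nu_add[of "smul A a \<one>" "v \<otimes> ev q v"] nu_mult[of v "ev q v"] by (simp add: nu_smul)
  also have "\<dots> \<le> cmod a * 1 + 1 * \<nu> (ev q v)"
    using v nu_one_le by (intro add_mono mult_mono) auto
  also have "\<dots> \<le> cmod a + (\<Sum>k\<le>n. cmod (coeff q k))" using Suc.IH[OF q] by simp
  also have "\<dots> = (\<Sum>k\<le>Suc n. cmod (coeff p k))"
    by (simp add: p sum.atMost_Suc_shift del: sum.atMost_Suc)
  finally show ?case .
qed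

text \<open>Von Neumann's inequality for a unitary. The coefficients of \<open>p ^ 2 ^ k\<close> are at most
  \<open>K ^ 2 ^ k\<close> and their number grows linearly in \<open>2 ^ k\<close>, while
  \<open>\<nu> (x ^ 2 ^ k) = (\<nu> x) ^ 2 ^ k\<close> for the normal element \<open>x = p(v)\<close>.\<close>

lemma unitary_ev_bound:
  assumes v: "v \<in> carrier A" "star A v \<otimes> v = \<one>" "v \<otimes> star A v = \<one>"
    and K: "\<And>z. cmod z = 1 ==> cmod (poly p z) \<le> K"
  shows "\<nu> (ev p v) \<le> K"
proof -
  have v1: "\<nu> v \<le> 1"
    using nu_cstar[OF v(1)] nu_one_le abs_square_le_1[of "\<nu> v"] v by simp
  have normal: "\<nu> (ev (q * q) v) = (\<nu> (ev q v))\<^sup>2" for q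
  proof -
    let ?y = "ev q v" and ?w = "ev (map_poly cnj q) (star A v)"
    have y: "?y \<in> carrier A" "?w \<in> carrier A" using v by auto
    have sy: "star A ?y = ?w" using v by (simp add: ev_star)
    have "star A v \<otimes> ?y = ?y \<otimes> star A v" using ev_commute[of v "star A v" q] v by simp
    then have com: "?y \<otimes> ?w = ?w \<otimes> ?y" using ev_commute[of "star A v" ?y "map_poly cnj q"] v by simp
    have swy: "star A (?w \<otimes> ?y) = ?w \<otimes> ?y"
      using y sy by (metis star_mult star_star)
    have "(\<nu> (?y \<otimes> ?y))\<^sup>2 = \<nu> (star A (?y \<otimes> ?y) \<otimes> (?y \<otimes> ?y))" using y by (simp only: nu_cstar m_closed)
    also have "star A (?y \<otimes> ?y) \<otimes> (?y \<otimes> ?y) = (?w \<otimes> ?y) \<otimes> (?w \<otimes> ?y)"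
      using y com by (simp only: star_mult sy) (metis m_assoc m_closed)
    also have "\<dots> = star A (?w \<otimes> ?y) \<otimes> (?w \<otimes> ?y)" by (simp only: swy)
    also have "\<nu> \<dots> = (\<nu> (?w \<otimes> ?y))\<^sup>2" using y by (simp only: nu_cstar m_closed)
    also have "\<nu> (?w \<otimes> ?y) = (\<nu> ?y)\<^sup>2" using nu_cstar[OF y(1)] by (simp only: sy)
    finally have "\<nu> (?y \<otimes> ?y) = (\<nu> ?y)\<^sup>2"
      using y by (simp only: power2_eq_iff_nonneg nu_ge0 m_closed zero_le_power2)
    then show ?thesis using v by (simp only: ev_mult)
  qed
  have pow: "\<nu> (ev (p ^ (2 ^ k)) v) = (\<nu> (ev p v)) ^ (2 ^ k)" for k
  proof (induction k)
    case (Suc k)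
    have "p ^ (2 ^ Suc k) = p ^ (2 ^ k) * p ^ (2 ^ k)" by (simp add: power_add[symmetric] mult_2)
    then show ?case using Suc normal[of "p ^ (2 ^ k)"] by (simp add: power_mult[symmetric] mult.commute)
  qed simp
  have K0: "K \<ge> 0" using K[of 1] norm_ge_zero order_trans by (metis norm_one)
  show ?thesis
  proof (rule geometric_beats_linear[of K "\<nu> (ev p v)" "real (degree p)"])
    fix k :: nat
    let ?q = "p ^ (2 ^ k)"
    have Kq: "cmod (poly ?q z) \<le> K ^ (2 ^ k)" if "cmod z = 1" for z
      using K[OF that] by (simp add: norm_power power_mono)
    have "\<nu> (ev ?q v) \<le> (\<Sum>j\<le>2 ^ k * degree p. cmod (coeff ?q j))"
      using nu_ev_le_coeffs[OF v(1) v1, of ?q] degree_power_le[of p "2 ^ k"] by (simp add: mult.commute)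
    also have "\<dots> \<le> (\<Sum>j\<le>2 ^ k * degree p. K ^ (2 ^ k))"
      by (intro sum_mono coeff_le_sup_circle Kq)
    also have "\<dots> = (2 ^ k * real (degree p) + 1) * K ^ (2 ^ k)" by (simp add: algebra_simps)
    finally show "\<nu> (ev p v) ^ (2 ^ k) \<le> (2 ^ k * real (degree p) + 1) * K ^ (2 ^ k)"
      unfolding pow .
  qed (use K0 v in auto)
qed

text \<open>With \<open>b = R (v + v*) / 2\<close>, multiplying \<open>q(b)\<close> by \<open>v ^ d\<close> turns it into a
  polynomial in \<open>v\<close> alone, whose values on the circle have the size of \<open>q\<close> on \<open>[-R, R]\<close>.\<close>

lemma trig_substitution:
  assumes v: "v \<in> carrier A" "star A v \<otimes> v = \<one>" "v \<otimes> star A v = \<one>"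
    and b: "b = smul A (of_real R / 2) (v \<oplus> star A v)"
  shows "degree q \<le> d ==> \<exists>c. ev c v = ev q b \<otimes> v [^] d \<and>
      (\<forall>z. cmod z = 1 \<longrightarrow> poly c z = z ^ d * poly q (of_real (R * Re z)))"
proof (induction d arbitrary: q)
  case 0
  then obtain a where a: "q = [:a:]" using degree_eq_zeroE by blast
  have bc: "b \<in> carrier A" using v by (simp add: b)
  show ?case by (intro exI[of _ q]) (use v bc in \<open>simp add: a\<close>)
next
  case (Suc d)
  have bc [simp]: "b \<in> carrier A" using v by (simp add: b)
  obtain a q' where q: "q = pCons a q'" by (cases q)
  have q': "degree q' \<le> d" using Suc.prems by (auto simp: q split: if_splits)
  obtain c where c: "ev c v = ev q' b \<otimes> v [^] d"
     and cz: "\<And>z. cmod z = 1 ==> poly c z = z ^ d * poly q' (of_real (R * Re z))"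
    using Suc.IH[OF q'] by blast
  let ?r = "[:of_real R / 2, 0, of_real R / 2:]"
  have bv: "b \<otimes> v = ev ?r v"
    using v unfolding b by (simp add: smul_mult_l l_distr smul_mult_r smul_add_r a_comm)
  let ?c = "monom a (Suc d) + ?r * c"
  have evm: "ev (monom a k) v = smul A a (v [^] k)" for k
  proof (induction k)
    case (Suc k)
    then show ?case using v nat_pow_Suc2[of v k] by (simp add: monom_Suc smul_mult_r)
  qed (use v in \<open>simp add: monom_0\<close>)
  have "ev ?c v = smul A a (v [^] Suc d) \<oplus> b \<otimes> (v \<otimes> (ev q' b \<otimes> v [^] d))"
    unfolding ev_add[OF v(1)] ev_mult[OF v(1)] c evm bv[symmetric] using v by (simp add: m_assoc)
  also have "v \<otimes> (ev q' b \<otimes> v [^] d) = ev q' b \<otimes> v [^] Suc d"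
    using v ev_commute[of v v c, unfolded c] by (simp add: m_assoc)
  also have "smul A a (v [^] Suc d) \<oplus> b \<otimes> (ev q' b \<otimes> v [^] Suc d) = ev q b \<otimes> v [^] Suc d"
    unfolding q using v by (simp add: l_distr smul_mult_l m_assoc del: nat_pow_Suc)
  finally have 1: "ev ?c v = ev q b \<otimes> v [^] Suc d" .
  have 2: "poly ?c z = z ^ Suc d * poly q (of_real (R * Re z))" if z: "cmod z = 1" for z
  proof -
    have "z * cnj z = 1" using z by (simp add: complex_norm_square[symmetric])
    moreover have "2 * complex_of_real (Re z) = z + cnj z" by (simp add: complex_add_cnj)
    ultimately have "1 + z * z = z * (2 * complex_of_real (Re z))" by (simp add: algebra_simps)
    then have h: "of_real R / 2 * (1 + z * z) = of_real R / 2 * (z * (2 * complex_of_real (Re z)))" by (rule arg_cong)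
    have "poly ?r z = of_real R / 2 * (1 + z * z)" by (simp add: algebra_simps)
    then have r: "poly ?r z = z * of_real (R * Re z)" unfolding h by simp
    show ?thesis unfolding poly_add poly_mult r cz[OF z] by (simp add: q poly_monom algebra_simps)
  qed
  show ?case using 1 2 by blast
qed

end

context cstar
begin

text \<open>Write \<open>b = R (v + v*) / 2\<close> with \<open>v\<close> unitary; multiplication by powers of \<open>v\<close>
  preserves the norm, so the bound for unitaries applies.\<close>

lemma sa_ev_bound_strict:
  assumes b: "b \<in> carrier A" "star A b = b" "\<nu> b < R"
    and K: "\<And>t. \<bar>t\<bar> \<le> R ==> cmod (poly q (of_real t)) \<le> K"
  shows "\<nu> (ev q b) \<le> K"
proof -
  have R: "R > 0" using b nu_ge0[OF b(1)] by linarith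
  let ?a = "smul A (of_real (1 / R)) b"
  have "\<nu> ?a < 1" using b R by (simp only: nu_smul norm_of_real) simp
  moreover have "star A ?a = ?a" using b by (simp only: star_smul complex_cnj_complex_of_real)
  ultimately obtain v where v: "v \<in> carrier A" "star A v \<otimes> v = \<one>" "v \<otimes> star A v = \<one>"
      "?a = smul A (1/2) (v \<oplus> star A v)"
    using unitary_exists[of ?a] b by blast
  have "b = smul A (of_real R) ?a" using b R by simp
  also have "\<dots> = smul A (of_real R / 2) (v \<oplus> star A v)" unfolding v(4) using v(1) by simp
  finally have bv: "b = smul A (of_real R / 2) (v \<oplus> star A v)" .
  obtain c where c: "ev c v = ev q b \<otimes> v [^] degree q"
     and cz: "\<And>z. cmod z = 1 ==> poly c z = z ^ degree q * poly q (of_real (R * Re z))"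
    using trig_substitution[OF v(1-3) bv order_refl] by blast
  have "\<nu> (ev c v) \<le> K"
  proof (rule unitary_ev_bound[OF v(1-3)])
    fix z assume z: "cmod z = 1"
    have "\<bar>R * Re z\<bar> \<le> R" using abs_Re_le_cmod[of z] z R by (simp add: abs_mult mult_left_le)
    then show "cmod (poly c z) \<le> K" using K[of "R * Re z"] z by (simp only: cz norm_mult norm_power) simp
  qed
  moreover have "v [^] k \<otimes> star A v [^] k = \<one>" for k :: nat
  proof (induction k)
    case (Suc k)
    have "v [^] Suc k \<otimes> star A v [^] Suc k = v [^] k \<otimes> ((v \<otimes> star A v) \<otimes> star A v [^] k)"
      using v(1) nat_pow_Suc2[of "star A v" k] by (simp add: m_assoc)
    then show ?case using Suc v by simp
  qed simp
  then have "ev q b = ev c v \<otimes> star A v [^] degree q"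
    unfolding c using v(1) b by (simp add: m_assoc)
  moreover have "\<nu> (star A v [^] k) \<le> 1" for k :: nat
  proof (induction k)
    case (Suc k)
    have "\<nu> v \<le> 1" using nu_cstar[OF v(1)] nu_one_le abs_square_le_1[of "\<nu> v"] v by simp
    then show ?case using Suc nu_mult[of "star A v [^] k" "star A v"] v(1)
      by (simp add: mult_le_one order_trans)
  qed (simp add: nu_one_le)
  ultimately show ?thesis
    using nu_mult[of "ev c v" "star A v [^] degree q"] v(1)
    by (smt (verit) ev_closed mult_left_le nat_pow_closed nu_ge0 star_closed)
qed

text \<open>The strict case is applied to slightly larger intervals, on which the polynomial is at most \<open>K + e\<close> by uniform
  continuity.\<close>

lemma sa_ev_bound:
  assumes b: "b \<in> carrier A" "star A b = b" "\<nu> b \<le> R"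
    and K: "\<And>t. \<bar>t\<bar> \<le> R ==> cmod (poly q (of_real t)) \<le> K"
  shows "\<nu> (ev q b) \<le> K"
proof (rule field_le_epsilon)
  fix e :: real assume e: "e > 0"
  have R: "R \<ge> 0" using b nu_ge0[OF b(1)] by linarith
  have "uniformly_continuous_on {-R-1..R+1} (\<lambda>t. poly q (complex_of_real t))"
    by (intro compact_uniformly_continuous continuous_intros) simp
  then obtain d where d: "d > 0"
     "\<And>s t. s \<in> {-R-1..R+1} ==> t \<in> {-R-1..R+1} ==> dist t s < d ==>
        dist (poly q (complex_of_real t)) (poly q (of_real s)) < e"
    unfolding uniformly_continuous_on_def using e by metis
  define R' where "R' = R + min 1 (d / 2)"
  show "\<nu> (ev q b) \<le> K + e"
  proof (rule sa_ev_bound_strict[OF b(1,2), of R'])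
    show "\<nu> b < R'" using b d by (auto simp: R'_def)
    fix t assume t: "\<bar>t\<bar> \<le> R'"
    define s where "s = max (-R) (min R t)"
    have "\<bar>s\<bar> \<le> R" "dist t s < d" "s \<in> {-R-1..R+1}" "t \<in> {-R-1..R+1}"
      using t R d(1) by (auto simp: s_def R'_def dist_real_def)
    then have "dist (poly q (complex_of_real t)) (poly q (of_real s)) < e" "cmod (poly q (of_real s)) \<le> K"
      using d(2) K by auto
    then show "cmod (poly q (of_real t)) \<le> K + e"
      by (smt (verit) dist_norm norm_triangle_sub)
  qed
qed

end

section \<open>Extension of homomorphisms\<close>

lemma unital_star_homD:
  assumes "\<phi> \<in> unital_star_hom A B"
  shows "x \<in> carrier A ==> \<phi> x \<in> carrier B"
    and "x \<in> carrier A ==> y \<in> carrier A ==> \<phi> (x \<otimes>\<^bsub>A\<^esub> y) = \<phi> x \<otimes>\<^bsub>B\<^esub> \<phi> y"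
    and "x \<in> carrier A ==> y \<in> carrier A ==> \<phi> (x \<oplus>\<^bsub>A\<^esub> y) = \<phi> x \<oplus>\<^bsub>B\<^esub> \<phi> y"
    and "\<phi> \<one>\<^bsub>A\<^esub> = \<one>\<^bsub>B\<^esub>"
    and "x \<in> carrier A ==> \<phi> (smul A c x) = smul B c (\<phi> x)"
    and "x \<in> carrier A ==> \<phi> (star A x) = star B (\<phi> x)"
  using assms by (auto simp: unital_star_hom_def Ring.ring_hom_def)

lemma unital_star_homI:
  assumes "\<And>x. x \<in> carrier A ==> \<phi> x \<in> carrier B"
    and "\<And>x y. x \<in> carrier A ==> y \<in> carrier A ==> \<phi> (x \<otimes>\<^bsub>A\<^esub> y) = \<phi> x \<otimes>\<^bsub>B\<^esub> \<phi> y"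
    and "\<And>x y. x \<in> carrier A ==> y \<in> carrier A ==> \<phi> (x \<oplus>\<^bsub>A\<^esub> y) = \<phi> x \<oplus>\<^bsub>B\<^esub> \<phi> y"
    and "\<phi> \<one>\<^bsub>A\<^esub> = \<one>\<^bsub>B\<^esub>"
    and "\<And>x c. x \<in> carrier A ==> \<phi> (smul A c x) = smul B c (\<phi> x)"
    and "\<And>x. x \<in> carrier A ==> \<phi> (star A x) = star B (\<phi> x)"
  shows "\<phi> \<in> unital_star_hom A B"
  using assms by (auto simp: unital_star_hom_def Ring.ring_hom_def)

text \<open>A contractive homomorphism is extended from a dense subalgebra. The subalgebra and the map are given together as a graph
  \<open>G\<close> that is closed under the operations: single-valuedness is a consequence of \<open>le\<close>, so it need not be checked
  for presentations such as polynomials in an element.\<close>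

lemma hom_extension:
  fixes A :: "('a, 'y) star_algebra_scheme" (structure) and B :: "('b, 'z) star_algebra_scheme"
  assumes A: "cstar_semi A \<nu>" and B: "cstar B \<mu>"
    and G: "\<And>x y. (x, y) \<in> G ==> x \<in> carrier A" "\<And>x y. (x, y) \<in> G ==> y \<in> carrier B"
    and le: "\<And>x y. (x, y) \<in> G ==> \<mu> y \<le> \<nu> x"
    and Gone: "(\<one>, \<one>\<^bsub>B\<^esub>) \<in> G"
    and Gadd: "\<And>x y x' y'. (x, y) \<in> G ==> (x', y') \<in> G ==> (x \<oplus> x', y \<oplus>\<^bsub>B\<^esub> y') \<in> G"
    and Gmult: "\<And>x y x' y'. (x, y) \<in> G ==> (x', y') \<in> G ==> (x \<otimes> x', y \<otimes>\<^bsub>B\<^esub> y') \<in> G"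
    and Gsmul: "\<And>x y c. (x, y) \<in> G ==> (smul A c x, smul B c y) \<in> G"
    and Gstar: "\<And>x y. (x, y) \<in> G ==> (star A x, star B y) \<in> G"
    and dense: "\<And>x. x \<in> carrier A ==> \<exists>f g. (\<forall>k. (f k, g k) \<in> G) \<and> cstar_semi.conv A \<nu> f x"
  shows "\<exists>\<phi>\<in>unital_star_hom A B. \<forall>x y. (x, y) \<in> G \<longrightarrow> \<phi> x = y"
proof -
  interpret A: cstar_semi A \<nu> by (rule A)
  interpret B: cstar B \<mu> by (rule B)
  have dle: "seminorm_dist B \<mu> y y' \<le> seminorm_dist A \<nu> x x'" if "(x, y) \<in> G" "(x', y') \<in> G" for x y x' y'
    unfolding seminorm_dist_def by (intro le Gadd Gsmul that)
  define H where "H x y \<longleftrightarrow> (\<exists>f g. (\<forall>k. (f k, g k) \<in> G) \<and> A.conv f x \<and> B.conv g y)" for x y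
  have HI2: "H x y" if "\<And>k. (f k, g k) \<in> G" "A.conv f x" "B.conv g y" for f g x y
    using that unfolding H_def by blast
  have HI: "H x y" if "(x, y) \<in> G" for x y
    unfolding H_def by (rule exI[of _ "\<lambda>_. x"], rule exI[of _ "\<lambda>_. y"]) (use that G in \<open>auto intro: A.conv_const B.conv_const\<close>)
  have tot: "\<exists>y. H x y" if xA: "x \<in> carrier A" for x
  proof -
    obtain f g where fg: "\<And>k. (f k, g k) \<in> G" and f: "A.conv f x" using dense[OF xA] by blast
    have "g \<in> cauchy_seqs B \<mu>"
      unfolding cauchy_seqs_def
    proof (intro CollectI conjI allI impI)
      show "g k \<in> carrier B" for k using G(2)[OF fg] .
      fix e :: real assume "e > 0"
      then obtain K where K: "\<forall>k\<ge>K. \<forall>l\<ge>K. seminorm_dist A \<nu> (f k) (f l) < e"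
        using A.conv_imp_cauchy[OF f] unfolding cauchy_seqs_def by blast
      have "seminorm_dist B \<mu> (g k) (g l) < e" if "k \<ge> K" "l \<ge> K" for k l
        using K[rule_format, OF that] dle[OF fg[of k] fg[of l]] by linarith
      then show "\<exists>K. \<forall>k\<ge>K. \<forall>l\<ge>K. seminorm_dist B \<mu> (g k) (g l) < e" by blast
    qed
    then obtain y where "B.conv g y" using B.complete by blast
    then show ?thesis unfolding H_def using fg f by blast
  qed
  have uniq: "y = y'" if H: "H x y" "H x y'" for x y y'
  proof -
    obtain f g f' g' where *: "\<And>k. (f k, g k) \<in> G" "A.conv f x" "B.conv g y"
       "\<And>k. (f' k, g' k) \<in> G" "A.conv f' x" "B.conv g' y'"
      using H unfolding H_def by blast
    have "B.conv g' y"
    proof (rule B.conv_bound)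
      show "g' k \<in> carrier B" for k using B.convD(1)[OF *(6)] .
      show "y \<in> carrier B" using B.convD(2)[OF *(3)] .
      show "seminorm_dist B \<mu> (g' k) y \<le> (seminorm_dist A \<nu> (f' k) x + seminorm_dist A \<nu> (f k) x) + seminorm_dist B \<mu> (g k) y" for k
        using B.dst_tri[OF B.convD(1)[OF *(6)] B.convD(1)[OF *(3)] B.convD(2)[OF *(3)], of k k]
          dle[OF *(4) *(1), of k k] A.dst_tri[OF A.convD(1)[OF *(5)] A.convD(2)[OF *(2)] A.convD(1)[OF *(2)], of k k]
          A.dst_sym[OF A.convD(2)[OF *(2)] A.convD(1)[OF *(2)], of k] by linarith
      show "(\<lambda>k. (seminorm_dist A \<nu> (f' k) x + seminorm_dist A \<nu> (f k) x) + seminorm_dist B \<mu> (g k) y) \<longlonglongrightarrow> 0"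
        using *(2,3,5) unfolding A.conv_def B.conv_def by (auto intro!: tendsto_add_zero)
    qed
    then show ?thesis using B.conv_unique[OF _ *(6)] by blast
  qed
  define \<phi> where "\<phi> x = (THE y. H x y)" for x
  have phi: "\<phi> x = y" if "H x y" for x y
    unfolding \<phi>_def using that uniq by blast
  have HC: "y \<in> carrier B" if "H x y" for x y using that B.convD(2) unfolding H_def by blast
  have phiH: "H x (\<phi> x)" if "x \<in> carrier A" for x using tot[OF that] phi by blast
  have Hadd: "H (x \<oplus> x') (y \<oplus>\<^bsub>B\<^esub> y')" if H: "H x y" "H x' y'" for x y x' y'
  proof -
    obtain f g f' g' where *: "\<And>k. (f k, g k) \<in> G" "A.conv f x" "B.conv g y"
       "\<And>k. (f' k, g' k) \<in> G" "A.conv f' x'" "B.conv g' y'"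
      using H unfolding H_def by blast
    show ?thesis by (rule HI2[OF _ A.conv_add[OF *(2,5)] B.conv_add[OF *(3,6)]]) (rule Gadd[OF *(1,4)])
  qed
  have Hmult: "H (x \<otimes> x') (y \<otimes>\<^bsub>B\<^esub> y')" if H: "H x y" "H x' y'" for x y x' y'
  proof -
    obtain f g f' g' where *: "\<And>k. (f k, g k) \<in> G" "A.conv f x" "B.conv g y"
       "\<And>k. (f' k, g' k) \<in> G" "A.conv f' x'" "B.conv g' y'"
      using H unfolding H_def by blast
    show ?thesis by (rule HI2[OF _ A.conv_mult[OF *(2,5)] B.conv_mult[OF *(3,6)]]) (rule Gmult[OF *(1,4)])
  qed
  have Hsmul: "H (smul A c x) (smul B c y)" if H: "H x y" for x y c
  proof -
    obtain f g where *: "\<And>k. (f k, g k) \<in> G" "A.conv f x" "B.conv g y"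
      using H unfolding H_def by blast
    show ?thesis by (rule HI2[OF _ A.conv_smul[OF *(2)] B.conv_smul[OF *(3)]]) (rule Gsmul[OF *(1)])
  qed
  have Hstar: "H (star A x) (star B y)" if H: "H x y" for x y
  proof -
    obtain f g where *: "\<And>k. (f k, g k) \<in> G" "A.conv f x" "B.conv g y"
      using H unfolding H_def by blast
    show ?thesis by (rule HI2[OF _ A.conv_star[OF *(2)] B.conv_star[OF *(3)]]) (rule Gstar[OF *(1)])
  qed
  have "\<phi> \<in> unital_star_hom A B"
    by (intro unital_star_homI HC[OF phiH] phi[OF Hadd] phi[OF Hmult] phi[OF Hsmul] phi[OF Hstar] phi[OF HI[OF Gone]] phiH)
  moreover have "\<forall>x y. (x, y) \<in> G \<longrightarrow> \<phi> x = y" using phi HI by blast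
  ultimately show ?thesis by blast
qed

lemma unital_star_hom_comp:
  assumes "\<phi> \<in> unital_star_hom A B" "\<psi> \<in> unital_star_hom B C"
  shows "(\<lambda>x. \<psi> (\<phi> x)) \<in> unital_star_hom A C"
  by (intro unital_star_homI) (simp_all add: unital_star_homD[OF assms(1)] unital_star_homD[OF assms(2)])

lemma cstar_seminorm_comp:
  assumes "star_alg A" "cstar_seminorm B \<mu>" "\<phi> \<in> unital_star_hom A B"
  shows "cstar_seminorm A (\<lambda>x. \<mu> (\<phi> x))"
proof -
  interpret star_alg A by fact
  show ?thesis
    using assms(2) unfolding cstar_seminorm_def by (simp add: unital_star_homD[OF assms(3)])
qed

text \<open>The pull-back of \<open>\<mu>\<close> along \<open>\<phi>\<close> is a C*-seminorm.\<close>

lemma hom_contractive: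
  assumes "cstar A \<nu>" "cstar_seminorm B \<mu>" "\<phi> \<in> unital_star_hom A B" "x \<in> carrier A"
  shows "\<mu> (\<phi> x) \<le> \<nu> x"
  using cstar.seminorm_contractive[OF assms(1) cstar_seminorm_comp[OF _ assms(2,3)] assms(4)]
    assms(1) by (simp add: cstar_def cstar_semi_def)

lemma hom_list_product:
  assumes "star_alg A" "\<phi> \<in> unital_star_hom A B" "set xs \<subseteq> carrier A"
  shows "\<phi> (list_product A xs) = list_product B (map \<phi> xs)"
proof -
  interpret star_alg A by fact
  show ?thesis using assms(3)
    by (induction xs)
       (auto simp: list_product_def unital_star_homD[OF assms(2)] list_product_closed[unfolded list_product_def])
qed

lemma hom_conv:
  assumes "cstar A \<nu>" "cstar B \<mu>" "\<phi> \<in> unital_star_hom A B" "cstar_semi.conv A \<nu> f l"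
  shows "cstar_semi.conv B \<mu> (\<lambda>k. \<phi> (f k)) (\<phi> l)"
proof -
  interpret A: cstar A \<nu> by fact
  interpret B: cstar B \<mu> by fact
  note h = unital_star_homD[OF assms(3)]
  show ?thesis
  proof (rule B.conv_bound)
    show "\<phi> (f k) \<in> carrier B" for k using h(1) A.convD(1)[OF assms(4)] by blast
    show "\<phi> l \<in> carrier B" using h(1) A.convD(2)[OF assms(4)] by blast
    show "seminorm_dist B \<mu> (\<phi> (f k)) (\<phi> l) \<le> seminorm_dist A \<nu> (f k) l" for k
      using hom_contractive[OF assms(1) B.semi assms(3), of "f k \<oplus>\<^bsub>A\<^esub> smul A (-1) l"]
        A.convD[OF assms(4)] by (simp add: seminorm_dist_def h)
    show "(\<lambda>k. seminorm_dist A \<nu> (f k) l) \<longlonglongrightarrow> 0" using assms(4) by (simp add: A.conv_def)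
  qed
qed

section \<open>Continuous functions on an interval\<close>

definition sup_norm :: "real => (real => complex) => real" where
  "sup_norm R f = (SUP t\<in>{-R..R}. cmod (f t))"

lemma C_interval_star_alg: "star_alg (C_interval R)"
proof (rule star_algI)
  show "\<one>\<^bsub>C_interval R\<^esub> \<in> carrier (C_interval R)"
    by (auto simp: C_interval_def intro!: continuous_on_eq[OF continuous_on_const])
qed (auto simp: C_interval_def fun_eq_iff algebra_simps intro!: continuous_intros)

lemma sup_norm_upper:
  assumes "f \<in> carrier (C_interval R)" shows "t \<in> {-R..R} ==> cmod (f t) \<le> sup_norm R f"
proof -
  have "continuous_on {-R..R} (\<lambda>t. cmod (f t))"
    using assms by (auto simp: C_interval_def intro!: continuous_intros)
  then have "bdd_above ((\<lambda>t. cmod (f t)) ` {-R..R})"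
    by (intro bounded_imp_bdd_above compact_imp_bounded compact_continuous_image) auto
  then show "t \<in> {-R..R} ==> cmod (f t) \<le> sup_norm R f"
    unfolding sup_norm_def using cSUP_upper[of t "{-R..R}" "\<lambda>t. cmod (f t)"] by blast
qed

lemma sup_norm_least:
  assumes "R > 0" "\<And>t. t \<in> {-R..R} ==> cmod (f t) \<le> K" shows "sup_norm R f \<le> K"
  unfolding sup_norm_def using assms by (intro cSUP_least) auto

lemma C_interval_seminorm:
  assumes R: "R > 0" shows "cstar_seminorm (C_interval R) (sup_norm R)"
proof -
  interpret star_alg "C_interval R" by (rule C_interval_star_alg)
  let ?C = "carrier (C_interval R)"
  have ge0: "0 \<le> sup_norm R f" if "f \<in> ?C" for f
    using order_trans[OF norm_ge_zero sup_norm_upper[OF that, of 0]] R by simp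
  have [simp]: "f \<oplus>\<^bsub>C_interval R\<^esub> g = (\<lambda>t. f t + g t)" "f \<otimes>\<^bsub>C_interval R\<^esub> g = (\<lambda>t. f t * g t)"
     "smul (C_interval R) c f = (\<lambda>t. c * f t)" "star (C_interval R) f = (\<lambda>t. cnj (f t))" for f g c
    by (auto simp: C_interval_def)
  have smul_le: "sup_norm R (\<lambda>t. c * f t) \<le> cmod c * sup_norm R f" if "f \<in> ?C" for f c
    using R sup_norm_upper[OF that] by (intro sup_norm_least) (auto simp: norm_mult intro!: mult_left_mono)
  have smul_C: "(\<lambda>t. c * f t) \<in> ?C" if "f \<in> ?C" for f c
    using smul_closed[OF that] by simp
  show ?thesis
    unfolding cstar_seminorm_def
  proof (intro conjI ballI allI)
    fix f g assume fg: "f \<in> ?C" "g \<in> ?C"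
    show "sup_norm R (f \<oplus>\<^bsub>C_interval R\<^esub> g) \<le> sup_norm R f + sup_norm R g"
      using R sup_norm_upper[OF fg(1)] sup_norm_upper[OF fg(2)]
      by (auto intro!: sup_norm_least norm_triangle_le add_mono)
    show "sup_norm R (f \<otimes>\<^bsub>C_interval R\<^esub> g) \<le> sup_norm R f * sup_norm R g"
      using R sup_norm_upper[OF fg(1)] sup_norm_upper[OF fg(2)] ge0[OF fg(1)]
      by (auto intro!: sup_norm_least mult_mono simp: norm_mult)
  next
    fix f c assume f: "f \<in> ?C"
    show "0 \<le> sup_norm R f" by (rule ge0[OF f])
    show "sup_norm R (smul (C_interval R) c f) = cmod c * sup_norm R f"
    proof (cases "c = 0")
      case True
      have "sup_norm R (\<lambda>t. 0) = 0" using R by (simp add: sup_norm_def)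
      then show ?thesis using True by simp
    next
      case False
      have "sup_norm R f \<le> cmod (1/c) * sup_norm R (\<lambda>t. c * f t)"
        using smul_le[OF smul_C[OF f, of c], of "1/c"] False by simp
      then have "cmod c * sup_norm R f \<le> sup_norm R (\<lambda>t. c * f t)"
        using False by (simp add: norm_divide field_simps)
      then show ?thesis using smul_le[OF f, of c] by simp
    qed
    have "sup_norm R (\<lambda>t. cnj (f t) * f t) = (sup_norm R f)\<^sup>2"
    proof (rule antisym)
      show "sup_norm R (\<lambda>t. cnj (f t) * f t) \<le> (sup_norm R f)\<^sup>2"
        using R sup_norm_upper[OF f] ge0[OF f]
        by (intro sup_norm_least) (auto simp: norm_mult power2_eq_square intro!: mult_mono)
      have C: "(\<lambda>t. cnj (f t) * f t) \<in> ?C" using m_closed[OF star_closed[OF f] f] by simp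
      have "sup_norm R f \<le> sqrt (sup_norm R (\<lambda>t. cnj (f t) * f t))"
        using R sup_norm_upper[OF C]
        by (intro sup_norm_least real_le_rsqrt) (auto simp: norm_mult power2_eq_square)
      then show "(sup_norm R f)\<^sup>2 \<le> sup_norm R (\<lambda>t. cnj (f t) * f t)"
        using ge0[OF f] ge0[OF C] by (metis real_sqrt_ge_0_iff real_sqrt_le_iff real_sqrt_pow2 power_mono)
    qed
    then show "sup_norm R (star (C_interval R) f \<otimes>\<^bsub>C_interval R\<^esub> f) = (sup_norm R f)\<^sup>2" by simp
  qed
qed

lemma C_interval_dist:
  "seminorm_dist (C_interval R) (sup_norm R) f g = sup_norm R (\<lambda>t. f t - g t)"
  by (simp add: seminorm_dist_def C_interval_def)

lemma C_interval_cstar: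
  assumes R: "R > 0" shows "cstar (C_interval R) (sup_norm R)"
proof -
  interpret star_alg "C_interval R" by (rule C_interval_star_alg)
  interpret cstar_semi "C_interval R" "sup_norm R"
    by unfold_locales (rule C_interval_seminorm[OF R])
  have diffC: "(\<lambda>t. f t - g t) \<in> carrier (C_interval R)"
    if "f \<in> carrier (C_interval R)" "g \<in> carrier (C_interval R)" for f g
    using that by (auto simp: C_interval_def intro!: continuous_intros)
  show ?thesis
  proof unfold_locales
    fix f assume f: "f \<in> carrier (C_interval R)" "sup_norm R f = 0"
    have "f t = 0" for t
      using sup_norm_upper[OF f(1), of t] f by (cases "t \<in> {-R..R}") (auto simp: C_interval_def)
    then show "f = \<zero>\<^bsub>C_interval R\<^esub>" by (auto simp: C_interval_def)
  next
    fix f assume f: "f \<in> cauchy_seqs (C_interval R) (sup_norm R)"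
    then have fC: "f k \<in> carrier (C_interval R)" for k by (auto simp: cauchy_seqs_def)
    have "uniformly_Cauchy_on {-R..R} f"
    proof (rule uniformly_Cauchy_onI)
      fix e :: real assume "e > 0"
      then obtain K where K: "\<forall>k\<ge>K. \<forall>l\<ge>K. sup_norm R (\<lambda>t. f k t - f l t) < e"
        using f unfolding cauchy_seqs_def C_interval_dist by blast
      have "dist (f m x) (f n x) < e" if "x \<in> {-R..R}" "m \<ge> K" "n \<ge> K" for x m n
        using K[rule_format, OF that(2,3)] sup_norm_upper[OF diffC[OF fC[of m] fC[of n]] that(1)]
        by (simp add: dist_norm)
      then show "\<exists>M. \<forall>x\<in>{-R..R}. \<forall>m\<ge>M. \<forall>n\<ge>M. dist (f m x) (f n x) < e" by blast
    qed
    then obtain l where l: "uniform_limit {-R..R} f l sequentially"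
      using Cauchy_uniformly_convergent unfolding uniformly_convergent_on_def by blast
    have cont: "continuous_on {-R..R} l"
      by (rule uniform_limit_theorem[OF _ l]) (use fC in \<open>auto simp: C_interval_def\<close>)
    define g where "g = (\<lambda>t. if t \<in> {-R..R} then l t else 0)"
    have "continuous_on {-R..R} g" by (rule continuous_on_eq[OF cont]) (simp add: g_def)
    then have gC: "g \<in> carrier (C_interval R)" by (auto simp: C_interval_def g_def)
    have "(\<lambda>k. sup_norm R (\<lambda>t. f k t - g t)) \<longlonglongrightarrow> 0"
    proof (rule LIMSEQ_I)
      fix e :: real assume e: "e > 0"
      then have "\<exists>K. \<forall>k\<ge>K. \<forall>t\<in>{-R..R}. dist (f k t) (l t) < e/2"
        using uniform_limitD[OF l, of "e/2"] unfolding eventually_sequentially by simp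
      then obtain K where K: "\<And>k t. k \<ge> K ==> t \<in> {-R..R} ==> dist (f k t) (l t) < e/2"
        by blast
      have "norm (sup_norm R (\<lambda>t. f k t - g t) - 0) < e" if "k \<ge> K" for k
      proof -
        have "sup_norm R (\<lambda>t. f k t - g t) \<le> e/2"
          by (rule sup_norm_least[OF R]) (use K[OF that] in \<open>auto simp: g_def dist_norm intro: less_imp_le\<close>)
        moreover have "0 \<le> sup_norm R (\<lambda>t. f k t - g t)" by (rule nu_ge0[OF diffC[OF fC gC]])
        ultimately show ?thesis using e by simp
      qed
      then show "\<exists>K. \<forall>k\<ge>K. norm (sup_norm R (\<lambda>t. f k t - g t) - 0) < e" by blast
    qed
    then show "\<exists>l. conv f l" unfolding conv_def C_interval_dist using fC gC by blast
  qed
qed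

definition poly_fun :: "real => complex poly => real => complex" where
  "poly_fun R q t = (if t \<in> {-R..R} then poly q (of_real t) else 0)"

lemma poly_fun_carrier: "poly_fun R q \<in> carrier (C_interval R)"
  unfolding C_interval_def poly_fun_def
  by (auto intro!: continuous_on_eq[of "{-R..R}" "\<lambda>t. poly q (complex_of_real t)"] continuous_intros)

lemma weierstrass_complex:
  assumes f: "f \<in> carrier (C_interval R)" and e: "e > 0" and R: "R > 0"
  shows "\<exists>q. sup_norm R (\<lambda>t. poly_fun R q t - f t) \<le> e"
proof -
  have c: "continuous_on {-R..R} (\<lambda>t. Re (f t))" "continuous_on {-R..R} (\<lambda>t. Im (f t))"
    using f by (auto simp: C_interval_def intro!: continuous_intros)
  have one: "\<exists>p :: complex poly. \<forall>t\<in>{-R..R}. cmod (poly p (of_real t) - of_real (h t)) < e/2"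
    if h: "continuous_on {-R..R} h" for h
  proof -
    obtain g where g: "real_polynomial_function g" "\<And>x. x \<in> {-R..R} ==> \<bar>h x - g x\<bar> < e/2"
      using Stone_Weierstrass_real_polynomial_function[OF compact_Icc h, of "e/2"] e by auto
    obtain a n where a: "g = (\<lambda>x. \<Sum>i\<le>n. a i * x ^ i)"
      using real_polynomial_function_imp_sum[OF g(1)] by blast
    have "poly (\<Sum>i\<le>n. monom (complex_of_real (a i)) i) (of_real t) = of_real (g t)" for t
      by (simp add: a poly_sum poly_monom)
    then show ?thesis
      using g(2) by (intro exI[of _ "\<Sum>i\<le>n. monom (complex_of_real (a i)) i"])
        (simp add: of_real_diff[symmetric] abs_minus_commute del: of_real_diff)
  qed
  obtain p where p: "\<And>t. t \<in> {-R..R} ==> cmod (poly p (of_real t) - of_real (Re (f t))) < e/2"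
    using one[OF c(1)] by blast
  obtain q where q: "\<And>t. t \<in> {-R..R} ==> cmod (poly q (of_real t) - of_real (Im (f t))) < e/2"
    using one[OF c(2)] by blast
  let ?q = "p + Polynomial.smult \<i> q"
  have "sup_norm R (\<lambda>t. poly_fun R ?q t - f t) \<le> e"
  proof (rule sup_norm_least[OF R])
    fix t assume t: "t \<in> {-R..R}"
    have "poly_fun R ?q t - f t = (poly p (of_real t) - of_real (Re (f t))) + \<i> * (poly q (of_real t) - of_real (Im (f t)))"
      using t by (subst complex_eq[of "f t"]) (simp add: poly_fun_def algebra_simps)
    also have "cmod \<dots> \<le> e/2 + e/2"
      using p[OF t] q[OF t] by (intro norm_triangle_le add_mono) (auto simp: norm_mult)
    finally show "cmod (poly_fun R ?q t - f t) \<le> e" by simp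
  qed
  then show ?thesis by blast
qed

lemma poly_fun_dense:
  assumes f: "f \<in> carrier (C_interval R)" and R: "R > 0"
  shows "\<exists>q. cstar_semi.conv (C_interval R) (sup_norm R) (\<lambda>k. poly_fun R (q k)) f"
proof -
  interpret cstar "C_interval R" "sup_norm R" by (rule C_interval_cstar[OF R])
  have "\<exists>q. \<forall>k. sup_norm R (\<lambda>t. poly_fun R (q k) t - f t) \<le> 1 / real (Suc k)"
    by (intro choice allI weierstrass_complex f R) simp
  then obtain q where q: "\<And>k. sup_norm R (\<lambda>t. poly_fun R (q k) t - f t) \<le> 1 / real (Suc k)" by blast
  have "conv (\<lambda>k. poly_fun R (q k)) f"
    by (rule conv_bound[where u="\<lambda>k. 1 / real (Suc k)"])
       (use q f poly_fun_carrier LIMSEQ_inverse_real_of_nat in \<open>auto simp: C_interval_dist inverse_eq_divide\<close>)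
  then show ?thesis by blast
qed

lemma poly_fun_ops:
  "\<one>\<^bsub>C_interval R\<^esub> = poly_fun R 1"
  "poly_fun R p \<oplus>\<^bsub>C_interval R\<^esub> poly_fun R q = poly_fun R (p + q)"
  "poly_fun R p \<otimes>\<^bsub>C_interval R\<^esub> poly_fun R q = poly_fun R (p * q)"
  "smul (C_interval R) c (poly_fun R p) = poly_fun R (Polynomial.smult c p)"
  "star (C_interval R) (poly_fun R p) = poly_fun R (map_poly cnj p)"
  "interval_coord R = poly_fun R [:0, 1:]"
proof -
  have "cnj (poly p (of_real t)) = poly (map_poly cnj p) (of_real t)" for t
    by (induction p) (auto simp: map_poly_pCons)
  then show "star (C_interval R) (poly_fun R p) = poly_fun R (map_poly cnj p)"
    by (auto simp: C_interval_def poly_fun_def)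
qed (auto simp: C_interval_def poly_fun_def interval_coord_def)

text \<open>Polynomial functions form a dense subalgebra on which evaluation is contractive.\<close>

lemma functional_calculus:
  assumes B: "cstar B \<mu>" and b: "b \<in> carrier B" "star B b = b" "\<mu> b \<le> R" and R: "R > 0"
  shows "\<exists>\<phi>\<in>unital_star_hom (C_interval R) B. \<phi> (interval_coord R) = b"
proof -
  interpret B: cstar B \<mu> by fact
  interpret C: cstar "C_interval R" "sup_norm R" by (rule C_interval_cstar[OF R])
  define G where "G = range (\<lambda>q. (poly_fun R q, B.ev q b))"
  have "\<exists>\<phi>\<in>unital_star_hom (C_interval R) B. \<forall>x y. (x, y) \<in> G \<longrightarrow> \<phi> x = y"
  proof (rule hom_extension[OF C.cstar_semi_axioms B])
    fix x y assume "(x, y) \<in> G"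
    then obtain q where q: "x = poly_fun R q" "y = B.ev q b" by (auto simp: G_def)
    show "x \<in> carrier (C_interval R)" "y \<in> carrier B" using q poly_fun_carrier b by auto
    show "\<mu> y \<le> sup_norm R x"
      unfolding q
    proof (rule B.sa_ev_bound[OF b])
      fix t assume "\<bar>t\<bar> \<le> R"
      then show "cmod (poly q (complex_of_real t)) \<le> sup_norm R (poly_fun R q)"
        using sup_norm_upper[OF poly_fun_carrier[of R q], of t] by (auto simp: poly_fun_def abs_le_iff)
    qed
    show "(star (C_interval R) x, star B y) \<in> G"
      unfolding q poly_fun_ops using b B.ev_star[of b q] by (auto simp: G_def)
    fix c show "(smul (C_interval R) c x, smul B c y) \<in> G"
      unfolding q poly_fun_ops using b B.ev_smult[of b c q, symmetric] by (auto simp: G_def)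
    fix x' y' assume "(x', y') \<in> G"
    then obtain q' where q': "x' = poly_fun R q'" "y' = B.ev q' b" by (auto simp: G_def)
    show "(x \<oplus>\<^bsub>C_interval R\<^esub> x', y \<oplus>\<^bsub>B\<^esub> y') \<in> G" "(x \<otimes>\<^bsub>C_interval R\<^esub> x', y \<otimes>\<^bsub>B\<^esub> y') \<in> G"
      unfolding q q' poly_fun_ops B.ev_add[OF b(1), symmetric] B.ev_mult[OF b(1), symmetric] by (auto simp: G_def)
  next
    show "(\<one>\<^bsub>C_interval R\<^esub>, \<one>\<^bsub>B\<^esub>) \<in> G"
      unfolding poly_fun_ops using B.ev_1[OF b(1), symmetric] by (auto simp: G_def)
  next
    fix x assume "x \<in> carrier (C_interval R)"
    from poly_fun_dense[OF this R] obtain q where "C.conv (\<lambda>k. poly_fun R (q k)) x" by blast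
    then show "\<exists>f g. (\<forall>k. (f k, g k) \<in> G) \<and> C.conv f x"
      by (intro exI[of _ "\<lambda>k. poly_fun R (q k)"] exI[of _ "\<lambda>k. B.ev (q k) b"]) (auto simp: G_def)
  qed
  then obtain \<phi> where "\<phi> \<in> unital_star_hom (C_interval R) B" "\<And>q. \<phi> (poly_fun R q) = B.ev q b"
    by (auto simp: G_def)
  then show ?thesis using b by (intro bexI[of _ \<phi>]) (auto simp: poly_fun_ops(6))
qed

section \<open>The C*-completion\<close>

text \<open>Limits along representatives agree, so the choice of the representative does not matter.\<close>

definition completion_norm :: "('a, 'z) star_algebra_scheme => ('a => real) => (nat => 'a) set => real" where
  "completion_norm P \<nu> F = lim (\<lambda>k. \<nu> ((SOME f. f \<in> F) k))"

context cstar_semi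
begin

abbreviation CS where "CS \<equiv> cauchy_seqs A \<nu>"
abbreviation cls where "cls \<equiv> completion_class A \<nu>"
abbreviation Cm where "Cm \<equiv> star_completion A \<nu>"
abbreviation cn where "cn \<equiv> completion_norm A \<nu>"

lemma CSD: "f \<in> CS ==> f k \<in> carrier A"
  by (simp add: cauchy_seqs_def)

lemma CSE: assumes "f \<in> CS" "e > 0"
  obtains K where "\<And>k l. k \<ge> K ==> l \<ge> K ==> dst (f k) (f l) < e"
  using assms unfolding cauchy_seqs_def by blast

lemma CS_I: "(\<And>k. f k \<in> carrier A) ==> (\<And>e. e > 0 ==> \<exists>K. \<forall>k\<ge>K. \<forall>l\<ge>K. dst (f k) (f l) < e) ==> f \<in> CS"
  by (simp add: cauchy_seqs_def)

lemma CS_const: "x \<in> carrier A ==> (\<lambda>k. x) \<in> CS"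
  by (rule conv_imp_cauchy[OF conv_const])

lemma CS_bounded: assumes f: "f \<in> CS" obtains C where "C > 0" "\<And>k. \<nu> (f k) \<le> C"
proof -
  obtain K where K: "\<And>k l. k \<ge> K ==> l \<ge> K ==> dst (f k) (f l) < 1" using CSE[OF f, of 1] by auto
  define C where "C = Max ((\<lambda>k. \<nu> (f k)) ` {..K}) + 1"
  have le: "\<nu> (f k) \<le> C - 1" if "k \<le> K" for k unfolding C_def using that by (auto intro!: Max_ge)
  have "\<nu> (f k) \<le> C" for k
  proof (cases "k \<le> K")
    case False
    then show ?thesis using le[of K] K[of k K] nu_le_dst[OF CSD[OF f] CSD[OF f], of k K] by linarith
  qed (use le[of k] in linarith)
  moreover have "C > 0" using le[of 0] nu_ge0[OF CSD[OF f], of 0] by linarith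
  ultimately show ?thesis using that by blast
qed

text \<open>Sums, products, multiples and adjoints of Cauchy sequences are all Cauchy by this estimate.\<close>

lemma CS_modulus:
  assumes f: "\<And>k. h k \<in> carrier A" and fg: "f \<in> CS" "g \<in> CS"
    and le: "\<And>k l. dst (h k) (h l) \<le> C * (dst (f k) (f l) + dst (g k) (g l))" and C: "C > 0"
  shows "h \<in> CS"
proof (rule CS_I)
  fix e :: real assume e: "e > 0"
  obtain K where K: "\<And>k l. k \<ge> K ==> l \<ge> K ==> dst (f k) (f l) < e / (2 * C)" using CSE[OF fg(1), of "e / (2 * C)"] e C by auto
  obtain L where L: "\<And>k l. k \<ge> L ==> l \<ge> L ==> dst (g k) (g l) < e / (2 * C)" using CSE[OF fg(2), of "e / (2 * C)"] e C by auto
  have "dst (h k) (h l) < e" if "k \<ge> max K L" "l \<ge> max K L" for k l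
  proof -
    have "C * (dst (f k) (f l) + dst (g k) (g l)) < C * (e / (2 * C) + e / (2 * C))"
      using K[of k l] L[of k l] that C by (intro mult_strict_left_mono add_strict_mono) auto
    also have "\<dots> = e" using C by (simp add: field_simps)
    finally show ?thesis using le[of k l] by linarith
  qed
  then show "\<exists>K. \<forall>k\<ge>K. \<forall>l\<ge>K. dst (h k) (h l) < e" by blast
qed (rule f)

lemma CS_add: assumes "f \<in> CS" "g \<in> CS" shows "(\<lambda>k. f k \<oplus> g k) \<in> CS"
  by (rule CS_modulus[OF _ assms, where C=1]) (use CSD assms dst_add in auto)

lemma CS_smul: assumes "f \<in> CS" shows "(\<lambda>k. smul A c (f k)) \<in> CS"
proof (rule CS_modulus[OF _ assms assms, where C="cmod c + 1"])
  show "dst (smul A c (f k)) (smul A c (f l)) \<le> (cmod c + 1) * (dst (f k) (f l) + dst (f k) (f l))" for k l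
    using CSD[OF assms] by (auto simp: dst_smul intro!: mult_mono)
qed (use CSD assms in \<open>auto intro: add_nonneg_pos\<close>)

lemma CS_star: assumes "f \<in> CS" shows "(\<lambda>k. star A (f k)) \<in> CS"
  by (rule CS_modulus[OF _ assms assms, where C=1]) (use CSD assms in \<open>auto simp: dst_star\<close>)

lemma CS_mult: assumes f: "f \<in> CS" and g: "g \<in> CS" shows "(\<lambda>k. f k \<otimes> g k) \<in> CS"
proof -
  obtain C where C: "C > 0" "\<And>k. \<nu> (f k) \<le> C" using CS_bounded[OF f] by blast
  obtain D where D: "D > 0" "\<And>k. \<nu> (g k) \<le> D" using CS_bounded[OF g] by blast
  show ?thesis
  proof (rule CS_modulus[OF _ f g, where C="C + D"])
    fix k l
    have "dst (f k \<otimes> g k) (f l \<otimes> g l) \<le> \<nu> (f k) * dst (g k) (g l) + dst (f k) (f l) * \<nu> (g l)"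
      using CSD[OF f] CSD[OF g] by (intro dst_mult) auto
    also have "\<dots> \<le> C * dst (g k) (g l) + dst (f k) (f l) * D"
      using CSD[OF f] CSD[OF g] C D by (intro add_mono mult_right_mono mult_left_mono) auto
    also have "\<dots> \<le> (C + D) * (dst (f k) (f l) + dst (g k) (g l))"
      using CSD[OF f] CSD[OF g] C D by (simp add: algebra_simps)
    finally show "dst (f k \<otimes> g k) (f l \<otimes> g l) \<le> (C + D) * (dst (f k) (f l) + dst (g k) (g l))" .
  qed (use CSD f g C D in auto)
qed

lemma cls_self: "f \<in> CS ==> f \<in> cls f"
  by (simp add: completion_class_def CSD)

lemma cls_CS: "g \<in> cls f ==> g \<in> CS"
  by (simp add: completion_class_def)

lemma cls_eqI:
  assumes f: "f \<in> CS" "g \<in> CS" and lim: "(\<lambda>k. dst (f k) (g k)) \<longlonglongrightarrow> 0"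
  shows "cls f = cls g"
proof -
  have *: "cls f \<subseteq> cls g" if fg: "f \<in> CS" "g \<in> CS" and lim: "(\<lambda>k. dst (f k) (g k)) \<longlonglongrightarrow> 0" for f g
  proof
    fix h assume h: "h \<in> cls f"
    have "(\<lambda>k. dst (g k) (h k)) \<longlonglongrightarrow> 0"
    proof (rule tendsto_sandwich[of "\<lambda>_. 0" _ _ "\<lambda>k. dst (f k) (g k) + dst (f k) (h k)"])
      show "\<forall>\<^sub>F k in sequentially. dst (g k) (h k) \<le> dst (f k) (g k) + dst (f k) (h k)"
        using CSD[OF fg(1)] CSD[OF fg(2)] CSD[OF cls_CS[OF h]] dst_tri dst_sym
        by (intro always_eventually) metis
      show "(\<lambda>k. dst (f k) (g k) + dst (f k) (h k)) \<longlonglongrightarrow> 0"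
        using lim h by (intro tendsto_add_zero) (auto simp: completion_class_def)
    qed (use CSD fg cls_CS[OF h] in auto)
    then show "h \<in> cls g" using cls_CS[OF h] by (simp add: completion_class_def)
  qed
  have "(\<lambda>k. dst (g k) (f k)) \<longlonglongrightarrow> 0" using lim by (simp add: dst_sym[OF CSD[OF f(2)] CSD[OF f(1)]])
  then show ?thesis using *[OF f lim] *[OF f(2,1)] by blast
qed

lemma cls_dist: "g \<in> cls f ==> (\<lambda>k. dst (f k) (g k)) \<longlonglongrightarrow> 0"
  by (simp add: completion_class_def)

lemma Cm_carrier: "carrier Cm = cls ` CS"
  by (simp add: star_completion_def)

lemma cls_carrier [intro]: "f \<in> CS ==> cls f \<in> carrier Cm"
  by (simp add: Cm_carrier)

lemma Cm_add: assumes f: "f \<in> CS" and g: "g \<in> CS"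
  shows "cls f \<oplus>\<^bsub>Cm\<^esub> cls g = cls (\<lambda>k. f k \<oplus> g k)"
proof -
  have "cls (\<lambda>k. f' k \<oplus> g' k) = cls (\<lambda>k. f k \<oplus> g k)" if *: "f' \<in> cls f" "g' \<in> cls g" for f' g'
  proof (rule cls_eqI[symmetric])
    show "(\<lambda>k. dst (f k \<oplus> g k) (f' k \<oplus> g' k)) \<longlonglongrightarrow> 0"
    proof (rule tendsto_sandwich[of "\<lambda>_. 0" _ _ "\<lambda>k. dst (f k) (f' k) + dst (g k) (g' k)"])
      show "(\<lambda>k. dst (f k) (f' k) + dst (g k) (g' k)) \<longlonglongrightarrow> 0"
        using * by (intro tendsto_add_zero cls_dist)
    qed (use dst_add CSD f g cls_CS * in auto)
  qed (use CS_add f g cls_CS * in auto)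
  then have "(\<Union>f'\<in>cls f. \<Union>g'\<in>cls g. cls (\<lambda>k. f' k \<oplus> g' k)) = cls (\<lambda>k. f k \<oplus> g k)"
    using cls_self[OF f] cls_self[OF g] by blast
  then show ?thesis by (simp add: star_completion_def)
qed

lemma Cm_mult: assumes f: "f \<in> CS" and g: "g \<in> CS"
  shows "cls f \<otimes>\<^bsub>Cm\<^esub> cls g = cls (\<lambda>k. f k \<otimes> g k)"
proof -
  obtain C where C: "C > 0" "\<And>k. \<nu> (f k) \<le> C" using CS_bounded[OF f] by blast
  have "cls (\<lambda>k. f' k \<otimes> g' k) = cls (\<lambda>k. f k \<otimes> g k)" if *: "f' \<in> cls f" "g' \<in> cls g" for f' g'
  proof (rule cls_eqI[symmetric])
    obtain D where D: "D > 0" "\<And>k. \<nu> (g' k) \<le> D" using CS_bounded[OF cls_CS[OF *(2)]] by blast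
    note cc = CSD[OF f] CSD[OF g] CSD[OF cls_CS[OF *(1)]] CSD[OF cls_CS[OF *(2)]]
    show "(\<lambda>k. dst (f k \<otimes> g k) (f' k \<otimes> g' k)) \<longlonglongrightarrow> 0"
    proof (rule tendsto_sandwich[of "\<lambda>_. 0" _ _ "\<lambda>k. C * dst (g k) (g' k) + dst (f k) (f' k) * D"])
      show "(\<lambda>k. C * dst (g k) (g' k) + dst (f k) (f' k) * D) \<longlonglongrightarrow> 0"
        using * by (intro tendsto_add_zero tendsto_mult_right_zero tendsto_mult_left_zero cls_dist)
      have "dst (f k \<otimes> g k) (f' k \<otimes> g' k) \<le> C * dst (g k) (g' k) + dst (f k) (f' k) * D" for k
        using C(2)[of k] D(2)[of k] cc
        by (intro order_trans[OF dst_mult] add_mono mult_right_mono mult_left_mono) auto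
      then show "\<forall>\<^sub>F k in sequentially. dst (f k \<otimes> g k) (f' k \<otimes> g' k) \<le> C * dst (g k) (g' k) + dst (f k) (f' k) * D"
        by simp
    qed (use cc in auto)
  qed (use CS_mult f g cls_CS * in auto)
  then have "(\<Union>f'\<in>cls f. \<Union>g'\<in>cls g. cls (\<lambda>k. f' k \<otimes> g' k)) = cls (\<lambda>k. f k \<otimes> g k)"
    using cls_self[OF f] cls_self[OF g] by blast
  then show ?thesis by (simp add: star_completion_def)
qed

lemma Cm_smul: assumes f: "f \<in> CS" shows "smul Cm c (cls f) = cls (\<lambda>k. smul A c (f k))"
proof -
  have "cls (\<lambda>k. smul A c (f' k)) = cls (\<lambda>k. smul A c (f k))" if *: "f' \<in> cls f" for f'
  proof (rule cls_eqI[symmetric])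
    show "(\<lambda>k. dst (smul A c (f k)) (smul A c (f' k))) \<longlonglongrightarrow> 0"
      using CSD[OF f] CSD[OF cls_CS[OF *]] cls_dist[OF *] by (auto simp: dst_smul intro: tendsto_mult_right_zero)
  qed (use CS_smul f cls_CS * in auto)
  then have "(\<Union>f'\<in>cls f. cls (\<lambda>k. smul A c (f' k))) = cls (\<lambda>k. smul A c (f k))"
    using cls_self[OF f] by blast
  then show ?thesis by (simp add: star_completion_def)
qed

lemma Cm_star: assumes f: "f \<in> CS" shows "star Cm (cls f) = cls (\<lambda>k. star A (f k))"
proof -
  have "cls (\<lambda>k. star A (f' k)) = cls (\<lambda>k. star A (f k))" if *: "f' \<in> cls f" for f'
  proof (rule cls_eqI[symmetric])
    show "(\<lambda>k. dst (star A (f k)) (star A (f' k))) \<longlonglongrightarrow> 0"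
      using CSD[OF f] CSD[OF cls_CS[OF *]] cls_dist[OF *] by (auto simp: dst_star)
  qed (use CS_star f cls_CS * in auto)
  then have "(\<Union>f'\<in>cls f. cls (\<lambda>k. star A (f' k))) = cls (\<lambda>k. star A (f k))"
    using cls_self[OF f] by blast
  then show ?thesis by (simp add: star_completion_def)
qed

lemma Cm_one: "\<one>\<^bsub>Cm\<^esub> = cls (\<lambda>_. \<one>)" and Cm_zero: "\<zero>\<^bsub>Cm\<^esub> = cls (\<lambda>_. \<zero>)"
  by (simp_all add: star_completion_def)

lemma star_alg_Cm: "star_alg Cm"
proof -
  have E: "\<exists>f. f \<in> CS \<and> F = cls f" if "F \<in> carrier Cm" for F using that by (auto simp: Cm_carrier)
  note ops = Cm_add Cm_mult Cm_smul Cm_star Cm_one Cm_zero CS_add CS_mult CS_smul CS_star CS_const cls_carrier CSD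
  show ?thesis
    apply (rule star_algI; ((drule E)+)?; (elim exE conjE)?)
    apply (simp_all add: ops a_assoc m_assoc l_distr r_distr smul_add_r smul_add_l smul_mult_l
      smul_mult_r star_add star_mult star_smul)
    by (simp add: a_comm CSD)
qed

lemma cn_lim: assumes f: "f \<in> CS" shows "(\<lambda>k. \<nu> (f k)) \<longlonglongrightarrow> cn (cls f)"
proof -
  define g where "g = (SOME g. g \<in> cls f)"
  have g: "g \<in> cls f" unfolding g_def using cls_self[OF f] by (metis someI)
  note gc = CSD[OF cls_CS[OF g]] CSD[OF f]
  have "Cauchy (\<lambda>k. \<nu> (g k))"
  proof (rule metric_CauchyI)
    fix e :: real assume "e > 0"
    then obtain K where K: "\<And>k l. k \<ge> K ==> l \<ge> K ==> dst (g k) (g l) < e" using CSE[OF cls_CS[OF g]] by metis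
    have "dist (\<nu> (g m)) (\<nu> (g n)) < e" if "m \<ge> K" "n \<ge> K" for m n
      using nu_dst[of "g m" "g n"] K[OF that] gc by (simp add: dist_real_def)
    then show "\<exists>M. \<forall>m\<ge>M. \<forall>n\<ge>M. dist (\<nu> (g m)) (\<nu> (g n)) < e" by blast
  qed
  then have l: "(\<lambda>k. \<nu> (g k)) \<longlonglongrightarrow> cn (cls f)"
    unfolding completion_norm_def g_def[symmetric] by (simp add: Cauchy_convergent_iff convergent_LIMSEQ_iff)
  have "(\<lambda>k. \<nu> (f k) - \<nu> (g k)) \<longlonglongrightarrow> 0"
    by (rule Lim_null_comparison[of _ "\<lambda>k. dst (f k) (g k)"])
       (use gc nu_dst cls_dist[OF g] in auto)
  from tendsto_add[OF this l] show ?thesis by simp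
qed

lemma cn_unique: "f \<in> CS ==> (\<lambda>k. \<nu> (f k)) \<longlonglongrightarrow> x ==> cn (cls f) = x"
  using cn_lim LIMSEQ_unique by blast

lemma cn_const: "x \<in> carrier A ==> cn (cls (\<lambda>_. x)) = \<nu> x"
  by (rule cn_unique[OF CS_const]) auto

lemma cstar_seminorm_Cm: "cstar_seminorm Cm cn"
proof -
  have E: "\<exists>f. f \<in> CS \<and> F = cls f" if "F \<in> carrier Cm" for F using that by (auto simp: Cm_carrier)
  show ?thesis
    unfolding cstar_seminorm_def
  proof (intro conjI ballI allI)
    fix F assume "F \<in> carrier Cm"
    then obtain f where f: "f \<in> CS" "F = cls f" using E by blast
    show "0 \<le> cn F"
      unfolding f by (rule LIMSEQ_le_const[OF cn_lim[OF f(1)]]) (use CSD[OF f(1)] in auto)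
    show "cn (star Cm F \<otimes>\<^bsub>Cm\<^esub> F) = (cn F)\<^sup>2"
    proof -
      have "(\<lambda>k. \<nu> (star A (f k) \<otimes> f k)) \<longlonglongrightarrow> (cn F)\<^sup>2"
        unfolding f using tendsto_power[OF cn_lim[OF f(1)], of 2] by (simp add: nu_cstar[OF CSD[OF f(1)]])
      from cn_unique[OF _ this] show ?thesis
        using f by (simp add: Cm_star Cm_mult CS_star CS_mult)
    qed
    fix c show "cn (smul Cm c F) = cmod c * cn F"
    proof -
      have "(\<lambda>k. \<nu> (smul A c (f k))) \<longlonglongrightarrow> cmod c * cn F"
        unfolding f using tendsto_mult_left[OF cn_lim[OF f(1)], of "cmod c"] by (simp add: nu_smul[OF CSD[OF f(1)]])
      from cn_unique[OF _ this] show ?thesis using f by (simp add: Cm_smul CS_smul)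
    qed
  next
    fix F G assume "F \<in> carrier Cm" "G \<in> carrier Cm"
    then obtain f g where f: "f \<in> CS" "F = cls f" and g: "g \<in> CS" "G = cls g" using E by blast
    show "cn (F \<oplus>\<^bsub>Cm\<^esub> G) \<le> cn F + cn G"
      unfolding f g Cm_add[OF f(1) g(1)]
      by (rule LIMSEQ_le[OF cn_lim[OF CS_add[OF f(1) g(1)]] tendsto_add[OF cn_lim[OF f(1)] cn_lim[OF g(1)]]])
         (use nu_add CSD[OF f(1)] CSD[OF g(1)] in auto)
    show "cn (F \<otimes>\<^bsub>Cm\<^esub> G) \<le> cn F * cn G"
      unfolding f g Cm_mult[OF f(1) g(1)]
      by (rule LIMSEQ_le[OF cn_lim[OF CS_mult[OF f(1) g(1)]] tendsto_mult[OF cn_lim[OF f(1)] cn_lim[OF g(1)]]])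
         (use nu_mult CSD[OF f(1)] CSD[OF g(1)] in auto)
  qed
qed

lemma Cm_dist_lim: assumes f: "f \<in> CS" and g: "g \<in> CS"
  shows "(\<lambda>k. dst (f k) (g k)) \<longlonglongrightarrow> seminorm_dist Cm cn (cls f) (cls g)"
  using cn_lim[OF CS_add[OF f CS_smul[OF g]], of "-1"] f g
  by (simp add: seminorm_dist_def Cm_smul Cm_add CS_smul)

lemma Cm_dist_const: "x \<in> carrier A ==> y \<in> carrier A ==>
   seminorm_dist Cm cn (cls (\<lambda>_. x)) (cls (\<lambda>_. y)) = dst x y"
  using Cm_dist_lim[OF CS_const CS_const, of x y] by (simp add: LIMSEQ_const_iff)

lemma cstar_semi_Cm: "cstar_semi Cm cn"
  by (simp add: cstar_semi_def cstar_semi_axioms_def star_alg_Cm cstar_seminorm_Cm)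

lemma Cm_dense: assumes f: "f \<in> CS" shows "cstar_semi.conv Cm cn (\<lambda>n. cls (\<lambda>_. f n)) (cls f)"
proof -
  interpret Cm: cstar_semi Cm cn by (rule cstar_semi_Cm)
  have "(\<lambda>n. seminorm_dist Cm cn (cls (\<lambda>_. f n)) (cls f)) \<longlonglongrightarrow> 0"
  proof (rule LIMSEQ_I)
    fix e :: real assume e: "e > 0"
    then obtain K where K: "\<And>k l. k \<ge> K ==> l \<ge> K ==> dst (f k) (f l) < e / 2" using CSE[OF f, of "e/2"] by auto
    have "norm (seminorm_dist Cm cn (cls (\<lambda>_. f n)) (cls f) - 0) < e" if "n \<ge> K" for n
    proof -
      have "seminorm_dist Cm cn (cls (\<lambda>_. f n)) (cls f) \<le> e / 2"
        using K[OF that] by (intro LIMSEQ_le_const2[OF Cm_dist_lim[OF CS_const[OF CSD[OF f]] f]]) (auto intro: less_imp_le)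
      moreover have "0 \<le> seminorm_dist Cm cn (cls (\<lambda>_. f n)) (cls f)"
        using f by (intro Cm.dst_ge0 cls_carrier CS_const CSD)
      ultimately show ?thesis using e by simp
    qed
    then show "\<exists>K. \<forall>n\<ge>K. norm (seminorm_dist Cm cn (cls (\<lambda>_. f n)) (cls f) - 0) < e" by blast
  qed
  then show ?thesis using f unfolding Cm.conv_def by (auto intro!: cls_carrier CS_const CSD)
qed

text \<open>The members of a Cauchy sequence are approximated by constant sequences, whose values form a Cauchy sequence that represents the
  limit.\<close>

lemma cstar_Cm: "cstar Cm cn"
proof -
  interpret Cm: cstar_semi Cm cn by (rule cstar_semi_Cm)
  have E: "\<exists>f. f \<in> CS \<and> F = cls f" if "F \<in> carrier Cm" for F using that by (auto simp: Cm_carrier)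
  show ?thesis
  proof unfold_locales
    fix F assume F: "F \<in> carrier Cm" "cn F = 0"
    then obtain f where f: "f \<in> CS" "F = cls f" using E by blast
    show "F = \<zero>\<^bsub>Cm\<^esub>"
      unfolding f Cm_zero
      by (rule cls_eqI[OF f(1) CS_const]) (use cn_lim[OF f(1)] F f CSD[OF f(1)] in \<open>auto simp: dst_zero\<close>)
  next
    fix F assume F: "F \<in> cauchy_seqs Cm cn"
    then have FC: "F n \<in> carrier Cm" for n by (simp add: cauchy_seqs_def)
    have "\<exists>p\<in>carrier A. seminorm_dist Cm cn (cls (\<lambda>_. p)) (F n) < 1 / real (Suc n)" for n
    proof -
      obtain f where f: "f \<in> CS" "F n = cls f" using E[OF FC] by blast
      have "\<forall>\<^sub>F k in sequentially. seminorm_dist Cm cn (cls (\<lambda>_. f k)) (F n) < 1 / real (Suc n)"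
        using Cm_dense[OF f(1)] unfolding f(2) Cm.conv_def by (intro order_tendstoD(2)[of _ 0]) auto
      then obtain k where "seminorm_dist Cm cn (cls (\<lambda>_. f k)) (F n) < 1 / real (Suc n)"
        by (auto simp: eventually_sequentially)
      then show ?thesis using CSD[OF f(1)] by blast
    qed
    then obtain p where p: "\<And>n. p n \<in> carrier A" "\<And>n. seminorm_dist Cm cn (cls (\<lambda>_. p n)) (F n) < 1 / real (Suc n)"
      by metis
    have pc: "cls (\<lambda>_. p n) \<in> carrier Cm" for n using p by (intro cls_carrier CS_const)
    have lim1: "(\<lambda>n. 1 / real (Suc n)) \<longlonglongrightarrow> 0" using LIMSEQ_inverse_real_of_nat by (simp add: inverse_eq_divide)
    have pCS: "p \<in> CS"
    proof (rule CS_I[OF p(1)])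
      fix e :: real assume e: "e > 0"
      then obtain K where K: "\<And>n. n \<ge> K ==> 1 / real (Suc n) < e / 3"
        using order_tendstoD(2)[OF lim1, of "e/3"] by (auto simp: eventually_sequentially)
      obtain L where L: "\<And>k l. k \<ge> L ==> l \<ge> L ==> seminorm_dist Cm cn (F k) (F l) < e / 3"
        using Cm.CSE[OF F, of "e/3"] e by auto
      have "dst (p k) (p l) < e" if "k \<ge> max K L" "l \<ge> max K L" for k l
        using Cm.dst_tri[OF pc[of k] FC[of k] pc[of l]] Cm.dst_tri[OF FC[of k] FC[of l] pc[of l]]
          Cm.dst_sym[OF FC[of l] pc[of l]] p(2)[of k] p(2)[of l] K[of k] K[of l] L[of k l] that
          Cm_dist_const[OF p(1)[of k] p(1)[of l]] by simp
      then show "\<exists>K. \<forall>k\<ge>K. \<forall>l\<ge>K. dst (p k) (p l) < e" by blast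
    qed
    have "Cm.conv F (cls p)"
    proof (rule Cm.conv_bound[OF FC cls_carrier[OF pCS]])
      show "seminorm_dist Cm cn (F n) (cls p) \<le> 1 / real (Suc n) + seminorm_dist Cm cn (cls (\<lambda>_. p n)) (cls p)" for n
        using Cm.dst_tri[OF FC[of n] pc[of n] cls_carrier[OF pCS]] Cm.dst_sym[OF FC[of n] pc[of n]] p(2)[of n] by linarith
      show "(\<lambda>n. 1 / real (Suc n) + seminorm_dist Cm cn (cls (\<lambda>_. p n)) (cls p)) \<longlonglongrightarrow> 0"
        using Cm_dense[OF pCS] unfolding Cm.conv_def by (intro tendsto_add_zero lim1) blast
    qed
    then show "\<exists>l. Cm.conv F l" by blast
  qed
qed

end

section \<open>The free star-algebra\<close>

definition wmono :: "('i \<times> 'a) list => ('i, 'a) free_poly" where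
  "wmono w = (\<lambda>u. if u = w then 1 else 0)"

locale alg_family =
  fixes J :: "'i set" and A :: "'i => ('a, 'z) star_algebra_scheme"
  assumes star_alg_A: "j \<in> J ==> star_alg (A j)"
begin

abbreviation P where "P \<equiv> free_star_algebra J A"
abbreviation W where "W \<equiv> lists (letters J A)"
abbreviation ls where "ls \<equiv> (\<lambda>(j, a). (j, star (A j) a))"
abbreviation ws where "ws w \<equiv> rev (map ls w)"

lemma P_simps:
  "p \<otimes>\<^bsub>P\<^esub> q = (\<lambda>w. \<Sum>k\<le>length w. p (take k w) * q (drop k w))"
  "p \<oplus>\<^bsub>P\<^esub> q = (\<lambda>w. p w + q w)"
  "\<one>\<^bsub>P\<^esub> = (\<lambda>w. if w = [] then 1 else 0)"
  "\<zero>\<^bsub>P\<^esub> = (\<lambda>w. 0)"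
  "smul P c p = (\<lambda>w. c * p w)"
  "star P p = (\<lambda>w. if w \<in> W then cnj (p (ws w)) else 0)"
  by (simp_all add: free_star_algebra_def)

lemma P_carrier: "p \<in> carrier P \<longleftrightarrow> finite {w. p w \<noteq> 0} \<and> (\<forall>w. p w \<noteq> 0 \<longrightarrow> w \<in> W)"
  by (auto simp: free_star_algebra_def)

lemma ls_letters: "x \<in> letters J A ==> ls x \<in> letters J A" "x \<in> letters J A ==> ls (ls x) = x"
  using star_alg.star_closed[OF star_alg_A] star_alg.star_star[OF star_alg_A] by (auto simp: letters_def)

lemma ws_W [simp]: "w \<in> W ==> ws w \<in> W"
  using ls_letters(1) by (auto simp: in_lists_conv_set)

lemma ws_ws [simp]: "w \<in> W ==> ws (ws w) = w"
proof -
  assume "w \<in> W"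
  then have "map (ls \<circ> ls) w = map id w"
    using ls_letters(2) by (intro map_cong) (auto simp: in_lists_conv_set simp del: split_paired_All)
  then show ?thesis by (simp add: rev_map)
qed

text \<open>Both sides sum over the ways to cut a word into three consecutive parts.\<close>

lemma conv_assoc:
  fixes p q r :: "'b list => complex"
  shows "(\<Sum>k\<le>length w. (\<Sum>j\<le>length (take k w). p (take j (take k w)) * q (drop j (take k w))) * r (drop k w))
   = (\<Sum>j\<le>length w. p (take j w) * (\<Sum>i\<le>length (drop j w). q (take i (drop j w)) * r (drop i (drop j w))))"
    (is "?L = ?R")
proof -
  let ?n = "length w"
  have "?L = (\<Sum>k\<le>?n. \<Sum>j\<le>k. p (take j w) * q (drop j (take k w)) * r (drop k w))"
    by (intro sum.cong refl) (simp add: sum_distrib_right min_def)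
  also have "\<dots> = (\<Sum>(k, j)\<in>Sigma {..?n} (\<lambda>k. {..k}). p (take j w) * q (drop j (take k w)) * r (drop k w))"
    by (subst sum.Sigma) auto
  also have "\<dots> = (\<Sum>(j, i)\<in>Sigma {..?n} (\<lambda>j. {..?n - j}). p (take j w) * (q (take i (drop j w)) * r (drop i (drop j w))))"
    by (rule sum.reindex_bij_witness[where i="\<lambda>x. (fst x + snd x, fst x)" and j="\<lambda>x. (snd x, fst x - snd x)"])
       (clarsimp simp: drop_take mult.assoc; arith?)+
  also have "\<dots> = ?R"
    by (subst sum.Sigma[symmetric]) (auto simp: sum_distrib_left)
  finally show ?thesis .
qed

lemma mult_supp:
  assumes p: "p \<in> carrier P" and q: "q \<in> carrier P" shows "p \<otimes>\<^bsub>P\<^esub> q \<in> carrier P"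
proof -
  have *: "\<exists>u v. w = u @ v \<and> p u \<noteq> 0 \<and> q v \<noteq> 0" if nz: "(p \<otimes>\<^bsub>P\<^esub> q) w \<noteq> 0" for w
  proof -
    obtain k where "p (take k w) * q (drop k w) \<noteq> 0"
      by (rule sum.not_neutral_contains_not_neutral[OF nz[unfolded P_simps]])
    then show ?thesis by (intro exI[of _ "take k w"] exI[of _ "drop k w"]) auto
  qed
  have "{w. (p \<otimes>\<^bsub>P\<^esub> q) w \<noteq> 0} \<subseteq> (\<lambda>(u, v). u @ v) ` ({w. p w \<noteq> 0} \<times> {w. q w \<noteq> 0})"
    using * by fastforce
  moreover have "finite ((\<lambda>(u, v). u @ v) ` ({w. p w \<noteq> 0} \<times> {w. q w \<noteq> 0}))"
    using p q unfolding P_carrier by blast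
  ultimately have fin: "finite {w. (p \<otimes>\<^bsub>P\<^esub> q) w \<noteq> 0}" by (rule finite_subset)
  have "w \<in> W" if nz: "(p \<otimes>\<^bsub>P\<^esub> q) w \<noteq> 0" for w
  proof -
    obtain u v where uv: "w = u @ v" "p u \<noteq> 0" "q v \<noteq> 0" using *[OF nz] by blast
    then have "u \<in> W" "v \<in> W" using p q unfolding P_carrier by blast+
    then show ?thesis unfolding uv(1) append_in_lists_conv by (rule conjI)
  qed
  with fin show ?thesis unfolding P_carrier by (intro conjI allI impI)
qed

lemma star_supp: assumes p: "p \<in> carrier P" shows "star P p \<in> carrier P"
proof -
  have "{w. star P p w \<noteq> 0} \<subseteq> ws ` {w. p w \<noteq> 0}"
  proof
    fix w assume "w \<in> {w. star P p w \<noteq> 0}"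
    then have "w \<in> W" "p (ws w) \<noteq> 0" by (auto simp: P_simps split: if_splits)
    then show "w \<in> ws ` {w. p w \<noteq> 0}" using ws_ws[of w] by (intro image_eqI[of _ _ "ws w"]) auto
  qed
  then have "finite {w. star P p w \<noteq> 0}" using p unfolding P_carrier by (meson finite_imageI finite_subset)
  then show ?thesis unfolding P_carrier by (auto simp: P_simps split: if_splits)
qed

lemma star_mult_P: assumes p: "p \<in> carrier P" and q: "q \<in> carrier P"
  shows "star P (p \<otimes>\<^bsub>P\<^esub> q) = star P q \<otimes>\<^bsub>P\<^esub> star P p"
proof
  fix w
  show "star P (p \<otimes>\<^bsub>P\<^esub> q) w = (star P q \<otimes>\<^bsub>P\<^esub> star P p) w"
  proof (cases "w \<in> W")
    case False
    have "star P q (take k w) * star P p (drop k w) = 0" for k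
    proof -
      have "\<not> (take k w \<in> W \<and> drop k w \<in> W)" using False append_in_lists_conv[of "take k w" "drop k w"] by simp
      then show ?thesis by (auto simp: P_simps)
    qed
    then show ?thesis using False by (simp add: P_simps(1,6))
  next
    case True
    then have tw: "take k w \<in> W" "drop k w \<in> W" for k
      using append_in_lists_conv[of "take k w" "drop k w"] by simp_all
    have "star P (p \<otimes>\<^bsub>P\<^esub> q) w = (\<Sum>k\<le>length w. cnj (p (take k (ws w))) * cnj (q (drop k (ws w))))"
      using True by (simp add: P_simps)
    also have "\<dots> = (\<Sum>k\<le>length w. cnj (p (take (length w - k) (ws w))) * cnj (q (drop (length w - k) (ws w))))"
      by (rule sum.reindex_bij_witness[where i="\<lambda>k. length w - k" and j="\<lambda>k. length w - k"]) auto
    also have "\<dots> = (\<Sum>k\<le>length w. cnj (q (ws (take k w))) * cnj (p (ws (drop k w))))"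
      by (intro sum.cong refl) (simp add: take_rev drop_rev take_map drop_map mult.commute)
    also have "\<dots> = (star P q \<otimes>\<^bsub>P\<^esub> star P p) w"
      using tw by (simp add: P_simps)
    finally show ?thesis .
  qed
qed

lemma star_alg_P: "star_alg P"
proof (rule star_algI)
  fix p q r assume p: "p \<in> carrier P" and q: "q \<in> carrier P" and r: "r \<in> carrier P"
  show "p \<otimes>\<^bsub>P\<^esub> q \<otimes>\<^bsub>P\<^esub> r = p \<otimes>\<^bsub>P\<^esub> (q \<otimes>\<^bsub>P\<^esub> r)"
    unfolding P_simps by (rule ext) (rule conv_assoc)
  show "p \<otimes>\<^bsub>P\<^esub> q \<in> carrier P" by (rule mult_supp[OF p q])
  have "{w. p w + q w \<noteq> 0} \<subseteq> {w. p w \<noteq> 0} \<union> {w. q w \<noteq> 0}" by auto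
  moreover have "finite ({w. p w \<noteq> 0} \<union> {w. q w \<noteq> 0})" using p q by (simp add: P_carrier)
  ultimately have fin: "finite {w. p w + q w \<noteq> 0}" by (rule finite_subset)
  have "w \<in> W" if "p w + q w \<noteq> 0" for w
  proof -
    have "p w \<noteq> 0 \<or> q w \<noteq> 0" using that by fastforce
    then show ?thesis using p q unfolding P_carrier by blast
  qed
  with fin show "p \<oplus>\<^bsub>P\<^esub> q \<in> carrier P"
    unfolding P_carrier P_simps by (intro conjI allI impI)
  show "star P (p \<otimes>\<^bsub>P\<^esub> q) = star P q \<otimes>\<^bsub>P\<^esub> star P p" by (rule star_mult_P[OF p q])
next
  fix p assume p: "p \<in> carrier P"
  show "star P p \<in> carrier P" by (rule star_supp[OF p])
  show "star P (star P p) = p"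
    using p by (auto simp: P_simps P_carrier fun_eq_iff)
  have "(\<Sum>k\<le>length w. (if take k w = [] then 1 else 0) * p (drop k w)) = p w" for w
  proof -
    have "(\<Sum>k\<le>length w. (if take k w = [] then 1 else 0) * p (drop k w)) = (\<Sum>k\<le>length w. if k = 0 then p w else 0)"
      by (intro sum.cong) auto
    then show ?thesis by simp
  qed
  then show "\<one>\<^bsub>P\<^esub> \<otimes>\<^bsub>P\<^esub> p = p" by (simp add: P_simps)
  have "(\<Sum>k\<le>length w. p (take k w) * (if drop k w = [] then 1 else 0)) = p w" for w
  proof -
    have "(\<Sum>k\<le>length w. p (take k w) * (if drop k w = [] then 1 else 0)) = (\<Sum>k\<le>length w. if k = length w then p w else 0)"
      by (intro sum.cong) auto
    then show ?thesis by simp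
  qed
  then show "p \<otimes>\<^bsub>P\<^esub> \<one>\<^bsub>P\<^esub> = p" by (simp add: P_simps)
  fix c
  have "{w. c * p w \<noteq> 0} \<subseteq> {w. p w \<noteq> 0}" by auto
  then show "smul P c p \<in> carrier P"
    using p finite_subset unfolding P_carrier P_simps by auto
qed (auto simp: P_simps P_carrier fun_eq_iff algebra_simps sum.distrib sum_distrib_left)

sublocale P: star_alg P by (rule star_alg_P)

lemma mono_carrier: "w \<in> W ==> wmono w \<in> carrier P"
  by (auto simp: P_carrier wmono_def)

lemma mono_Nil: "wmono [] = \<one>\<^bsub>P\<^esub>"
  by (simp add: wmono_def P_simps)

lemma letter_mono: "letter j a = wmono [(j, a)]"
  by (simp add: letter_def wmono_def)

lemma mono_mult: "wmono u \<otimes>\<^bsub>P\<^esub> wmono v = wmono (u @ v)"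
proof
  fix w
  have "(wmono u \<otimes>\<^bsub>P\<^esub> wmono v) w = (\<Sum>k\<le>length w. if k = length u then (if w = u @ v then 1 else 0) else 0)"
    unfolding P_simps wmono_def
  proof (intro sum.cong refl)
    fix k assume k: "k \<in> {..length w}"
    show "(if take k w = u then 1 else 0) * (if drop k w = v then 1 else 0)
        = (if k = length u then (if w = u @ v then 1 else 0) else (0::complex))"
    proof -
      have iff: "take k w = u \<and> drop k w = v \<longleftrightarrow> k = length u \<and> w = u @ v"
      proof
        assume *: "take k w = u \<and> drop k w = v"
        then have "u = take k w" "v = drop k w" by simp_all
        then show "k = length u \<and> w = u @ v" using k by simp
      qed simp
      have "(if take k w = u then 1 else 0) * (if drop k w = v then 1 else 0)
          = (if take k w = u \<and> drop k w = v then 1 else (0::complex))" by simp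
      also have "\<dots> = (if k = length u \<and> w = u @ v then 1 else 0)" by (simp only: iff)
      finally show ?thesis by simp
    qed
  qed
  also have "\<dots> = wmono (u @ v) w" by (auto simp: wmono_def)
  finally show "(wmono u \<otimes>\<^bsub>P\<^esub> wmono v) w = wmono (u @ v) w" .
qed

lemma mono_star: assumes w: "w \<in> W" shows "star P (wmono w) = wmono (ws w)"
proof
  fix u
  have "u \<in> W \<and> ws u = w \<longleftrightarrow> u = ws w"
  proof
    assume *: "u \<in> W \<and> ws u = w"
    show "u = ws w" using ws_ws[OF conjunct1[OF *]] conjunct2[OF *] by (simp only:)
  next
    assume *: "u = ws w"
    show "u \<in> W \<and> ws u = w" unfolding * using ws_W[OF w] ws_ws[OF w] by (rule conjI)
  qed
  then show "star P (wmono w) u = wmono (ws w) u"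
    unfolding P_simps wmono_def by (cases "u \<in> W") simp_all
qed

text \<open>A noncommutative polynomial is a finite sum of multiples of words.\<close>

lemma P_induct [consumes 1, case_names zero mono add]:
  assumes p: "p \<in> carrier P" and z: "Q \<zero>\<^bsub>P\<^esub>"
    and m: "\<And>c w. w \<in> W ==> Q (smul P c (wmono w))"
    and a: "\<And>p q. p \<in> carrier P ==> q \<in> carrier P ==> Q p ==> Q q ==> Q (p \<oplus>\<^bsub>P\<^esub> q)"
  shows "Q p"
proof -
  have "finite S ==> p \<in> carrier P ==> {w. p w \<noteq> 0} \<subseteq> S ==> Q p" for S p
  proof (induction S arbitrary: p rule: finite_induct)
    case empty
    then have "p = \<zero>\<^bsub>P\<^esub>" by (auto simp: P_simps)
    then show ?case using z by simp
  next
    case (insert w S)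
    show ?case
    proof (cases "p w = 0")
      case True
      then show ?thesis using insert by blast
    next
      case False
      then have w: "w \<in> W" using insert.prems(1) by (simp add: P_carrier)
      let ?q = "p(w := 0)"
      have sub: "{v. ?q v \<noteq> 0} \<subseteq> {v. p v \<noteq> 0}" by auto
      have pf: "finite {v. p v \<noteq> 0}" and pW: "\<And>v. p v \<noteq> 0 ==> v \<in> W"
        using insert.prems(1) unfolding P_carrier by blast+
      have qc: "?q \<in> carrier P"
        unfolding P_carrier using finite_subset[OF sub pf] sub pW by blast
      have "{v. ?q v \<noteq> 0} \<subseteq> S" using insert.prems(2) by auto
      then have "Q ?q" by (rule insert.IH[OF qc])
      moreover have "p = smul P (p w) (wmono w) \<oplus>\<^bsub>P\<^esub> ?q" by (auto simp: P_simps wmono_def)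
      ultimately show ?thesis using a[OF _ qc m[OF w]] mono_carrier[OF w] by (metis P.smul_closed)
    qed
  qed
  then show ?thesis using p by (auto simp: P_carrier)
qed

lemma letter_carrier: "j \<in> J ==> a \<in> carrier (A j) ==> letter j a \<in> carrier P"
  unfolding letter_mono by (rule mono_carrier) (auto simp: letters_def)

lemma letter_star: "j \<in> J ==> a \<in> carrier (A j) ==> letter j (star (A j) a) = star P (letter j a)"
  unfolding letter_mono by (subst mono_star) (auto simp: letters_def)

text \<open>The universal property of the free *-algebra: a word is sent to the product of the images of its letters.\<close>

lemma free_eval:
  assumes B: "star_alg B"
    and phi: "\<And>j a. j \<in> J ==> a \<in> carrier (A j) ==> \<phi> j a \<in> carrier B"
    and phis: "\<And>j a. j \<in> J ==> a \<in> carrier (A j) ==> \<phi> j (star (A j) a) = star B (\<phi> j a)"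
  shows "\<exists>E\<in>unital_star_hom P B. \<forall>j\<in>J. \<forall>a\<in>carrier (A j). E (letter j a) = \<phi> j a"
proof -
  interpret B: star_alg B by fact
  define M where "M w = list_product B (map (\<lambda>(j, a). \<phi> j a) w)" for w
  have Mset: "set (map (\<lambda>(j, a). \<phi> j a) w) \<subseteq> carrier B" if "w \<in> W" for w
    using that phi by (auto simp: in_lists_conv_set letters_def)
  have MC: "M w \<in> carrier B" if "w \<in> W" for w
    unfolding M_def by (rule B.list_product_closed[OF Mset[OF that]])
  have Mapp: "M (u @ v) = M u \<otimes>\<^bsub>B\<^esub> M v" if "u \<in> W" "v \<in> W" for u v
    unfolding M_def map_append by (rule B.list_product_append[OF Mset Mset]) (use that in auto)
  have Mone: "M [x] = (\<lambda>(j, a). \<phi> j a) x" if "x \<in> letters J A" for x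
    using that phi by (auto simp: M_def list_product_def letters_def)
  have Mstar: "M (ws w) = star B (M w)" if "w \<in> W" for w
    using that
  proof (induction w)
    case Nil
    then show ?case by (simp add: M_def list_product_def)
  next
    case (Cons x w)
    then have x: "x \<in> letters J A" and w: "w \<in> W" by auto
    have "M (ws (x # w)) = M (ws w) \<otimes>\<^bsub>B\<^esub> M [ls x]"
      using Mapp[of "ws w" "[ls x]"] ls_letters(1)[OF x] ws_W[OF w] by simp
    also have "\<dots> = star B (M w) \<otimes>\<^bsub>B\<^esub> star B (M [x])"
      using Cons.IH x Mone[OF x] Mone[OF ls_letters(1)[OF x]] phis by (auto simp: letters_def)
    also have "\<dots> = star B (M ([x] @ w))"
    proof -
      have xW: "[x] \<in> W" using x by simp
      show ?thesis by (simp only: Mapp[OF xW w] B.star_mult[OF MC[OF xW] MC[OF w]])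
    qed
    finally show ?case by simp
  qed
  define E where "E p = finsum B (\<lambda>w. smul B (p w) (M w)) {w. p w \<noteq> 0}" for p
  have Esup: "E p = finsum B (\<lambda>w. smul B (p w) (M w)) S"
    if S: "finite S" "{w. p w \<noteq> 0} \<subseteq> S" "S \<subseteq> W" for p S
  proof -
    have SM: "M w \<in> carrier B" if "w \<in> S" for w using MC S(3) that by blast
    show ?thesis unfolding E_def
      by (rule B.add.finprod_mono_neutral_cong_left) (use S SM in auto)
  qed
  have EC: "E p \<in> carrier B" if "p \<in> carrier P" for p
    unfolding E_def by (rule B.finsum_closed) (use that MC in \<open>auto simp: P_carrier\<close>)
  have Eadd: "E (p \<oplus>\<^bsub>P\<^esub> q) = E p \<oplus>\<^bsub>B\<^esub> E q" if "p \<in> carrier P" "q \<in> carrier P" for p q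
  proof -
    define S where "S = {w. p w \<noteq> 0} \<union> {w. q w \<noteq> 0}"
    have S: "finite S" "S \<subseteq> W" using that unfolding S_def P_carrier by blast+
    have sub: "{w. (p \<oplus>\<^bsub>P\<^esub> q) w \<noteq> 0} \<subseteq> S" "{w. p w \<noteq> 0} \<subseteq> S" "{w. q w \<noteq> 0} \<subseteq> S"
      by (auto simp: P_simps S_def)
    have SM: "M w \<in> carrier B" if "w \<in> S" for w using MC S(2) that by blast
    have "E (p \<oplus>\<^bsub>P\<^esub> q) = finsum B (\<lambda>w. smul B (p w + q w) (M w)) S"
      using Esup[OF S(1) sub(1) S(2)] by (simp add: P_simps)
    also have "\<dots> = finsum B (\<lambda>w. smul B (p w) (M w) \<oplus>\<^bsub>B\<^esub> smul B (q w) (M w)) S"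
      by (intro B.finsum_cong') (use SM in \<open>auto simp: B.smul_add_l\<close>)
    also have "\<dots> = finsum B (\<lambda>w. smul B (p w) (M w)) S \<oplus>\<^bsub>B\<^esub> finsum B (\<lambda>w. smul B (q w) (M w)) S"
      by (intro B.finsum_addf) (use SM in auto)
    also have "\<dots> = E p \<oplus>\<^bsub>B\<^esub> E q" by (simp only: Esup[OF S(1) sub(2) S(2)] Esup[OF S(1) sub(3) S(2)])
    finally show ?thesis .
  qed
  have Emono: "E (smul P c (wmono w)) = smul B c (M w)" if w: "w \<in> W" for c w
  proof -
    have "E (smul P c (wmono w)) = finsum B (\<lambda>u. smul B (smul P c (wmono w) u) (M u)) {w}"
      by (rule Esup) (use w in \<open>auto simp: P_simps wmono_def\<close>)
    then show ?thesis using MC[OF w] by (simp add: P_simps wmono_def)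
  qed
  have Emono1: "E (wmono w) = M w" if w: "w \<in> W" for w
    using Emono[OF w, of 1] mono_carrier[OF w] MC[OF w] by simp
  have Ezero: "E \<zero>\<^bsub>P\<^esub> = \<zero>\<^bsub>B\<^esub>" by (simp add: E_def P_simps)
  have Esmul: "E (smul P c p) = smul B c (E p)" if "p \<in> carrier P" for c p
    using that
  proof (induction p rule: P_induct)
    case (mono d w)
    then show ?case using mono_carrier MC Emono by simp
  next
    case (add p q)
    then show ?case using EC by (simp add: P.smul_add_r Eadd B.smul_add_r)
  qed (simp add: Ezero)
  have Emult1: "E (smul P c (wmono w) \<otimes>\<^bsub>P\<^esub> q) = smul B c (M w) \<otimes>\<^bsub>B\<^esub> E q" if w: "w \<in> W" and "q \<in> carrier P" for c w q
    using that(2)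
  proof (induction q rule: P_induct)
    case (mono d v)
    have "smul P c (wmono w) \<otimes>\<^bsub>P\<^esub> smul P d (wmono v) = smul P (c * d) (wmono (w @ v))"
      using w mono mono_carrier by (simp add: P.smul_mult_l P.smul_mult_r mono_mult mult.commute)
    then show ?case using w mono MC
      by (simp add: Emono Mapp B.smul_mult_l B.smul_mult_r mult.commute)
  next
    case (add p q)
    then show ?case using EC MC[OF w] mono_carrier[OF w] by (simp add: P.r_distr Eadd B.r_distr)
  qed (use w mono_carrier MC in \<open>simp add: Ezero\<close>)
  have Emult: "E (p \<otimes>\<^bsub>P\<^esub> q) = E p \<otimes>\<^bsub>B\<^esub> E q" if "p \<in> carrier P" and q: "q \<in> carrier P" for p q
    using that(1)
  proof (induction p rule: P_induct)
    case (mono d v)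
    then show ?case using q by (simp add: Emult1 Emono)
  next
    case (add p p')
    then show ?case using q EC by (simp add: P.l_distr Eadd B.l_distr)
  qed (use q EC in \<open>simp add: Ezero\<close>)
  have Estar: "E (star P p) = star B (E p)" if "p \<in> carrier P" for p
    using that
  proof (induction p rule: P_induct)
    case (mono d v)
    have "star P (smul P d (wmono v)) = smul P (cnj d) (wmono (ws v))"
      using mono mono_carrier by (simp only: P.star_smul mono_star)
    then show ?case using mono MC[OF mono] ws_W[OF mono] by (simp only: Emono B.star_smul Mstar)
  next
    case (add p q)
    then show ?case using EC by (simp add: P.star_add Eadd B.star_add)
  qed (simp add: Ezero)
  have "E \<one>\<^bsub>P\<^esub> = \<one>\<^bsub>B\<^esub>" unfolding mono_Nil[symmetric] by (subst Emono1) (auto simp: M_def list_product_def)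
  then have "E \<in> unital_star_hom P B"
    by (intro unital_star_homI EC Emult Eadd Esmul Estar)
  moreover have "E (letter j a) = \<phi> j a" if "j \<in> J" "a \<in> carrier (A j)" for j a
    unfolding letter_mono using that Mone[of "(j, a)"] by (subst Emono1) (auto simp: letters_def)
  ultimately show ?thesis by blast
qed

end

section \<open>Free products of C*-algebras\<close>

text \<open>Closure under adjoints is left out, since the generators below are self-adjoint.\<close>

definition closed_subalgebra :: "('a, 'z) star_algebra_scheme => ('a => real) => 'a set => bool" where
  "closed_subalgebra A \<nu> D \<longleftrightarrow> D \<subseteq> carrier A \<and> \<one>\<^bsub>A\<^esub> \<in> D \<and>
     (\<forall>x\<in>D. \<forall>y\<in>D. x \<oplus>\<^bsub>A\<^esub> y \<in> D \<and> x \<otimes>\<^bsub>A\<^esub> y \<in> D) \<and> (\<forall>c. \<forall>x\<in>D. smul A c x \<in> D) \<and>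
     (\<forall>f l. (\<forall>k. f k \<in> D) \<and> cstar_semi.conv A \<nu> f l \<longrightarrow> l \<in> D)"

lemma closed_subalgebraI:
  assumes "D \<subseteq> carrier A" "\<one>\<^bsub>A\<^esub> \<in> D"
    and "\<And>x y. x \<in> D ==> y \<in> D ==> x \<oplus>\<^bsub>A\<^esub> y \<in> D" "\<And>x y. x \<in> D ==> y \<in> D ==> x \<otimes>\<^bsub>A\<^esub> y \<in> D"
    and "\<And>c x. x \<in> D ==> smul A c x \<in> D"
    and "\<And>f l. (\<And>k. f k \<in> D) ==> cstar_semi.conv A \<nu> f l ==> l \<in> D"
  shows "closed_subalgebra A \<nu> D"
  unfolding closed_subalgebra_def
proof (intro conjI ballI allI impI)
  fix f l assume *: "(\<forall>k. f k \<in> D) \<and> cstar_semi.conv A \<nu> f l"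
  show "l \<in> D" by (rule assms(6)[OF spec[OF conjunct1[OF *]] conjunct2[OF *]])
qed (simp_all add: assms(1-5))

lemma closed_subalgebraD:
  assumes "closed_subalgebra A \<nu> D"
  shows "x \<in> D ==> x \<in> carrier A" and "\<one>\<^bsub>A\<^esub> \<in> D"
    and "x \<in> D ==> y \<in> D ==> x \<oplus>\<^bsub>A\<^esub> y \<in> D" and "x \<in> D ==> y \<in> D ==> x \<otimes>\<^bsub>A\<^esub> y \<in> D"
    and "x \<in> D ==> smul A c x \<in> D"
    and "(\<And>k. f k \<in> D) ==> cstar_semi.conv A \<nu> f l ==> l \<in> D"
  using assms unfolding closed_subalgebra_def by blast+

lemma closed_subalgebra_preimage:
  assumes A: "cstar A \<nu>" and B: "cstar B \<mu>" and h: "\<phi> \<in> unital_star_hom A B" and D: "closed_subalgebra B \<mu> D"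
  shows "closed_subalgebra A \<nu> {x \<in> carrier A. \<phi> x \<in> D}"
proof -
  interpret A: cstar A \<nu> by fact
  note hD = unital_star_homD[OF h]
  note DD = closed_subalgebraD[OF D]
  show ?thesis
  proof (rule closed_subalgebraI)
    fix f l assume f: "\<And>k. f k \<in> {x \<in> carrier A. \<phi> x \<in> D}" and l: "A.conv f l"
    have "\<phi> l \<in> D" by (rule DD(6)[OF _ hom_conv[OF A B h l]]) (use f in blast)
    then show "l \<in> {x \<in> carrier A. \<phi> x \<in> D}" using A.convD(2)[OF l] by blast
  qed (use hD DD in auto)
qed

text \<open>Two homomorphisms that agree on generators agree.\<close>

lemma closed_subalgebra_equalizer:
  assumes A: "cstar A \<nu>" and B: "cstar B \<mu>" and h: "\<phi> \<in> unital_star_hom A B" "\<psi> \<in> unital_star_hom A B"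
  shows "closed_subalgebra A \<nu> {x \<in> carrier A. \<phi> x = \<psi> x}"
proof -
  interpret A: cstar A \<nu> by fact
  interpret B: cstar B \<mu> by fact
  note hD = unital_star_homD[OF h(1)] unital_star_homD[OF h(2)]
  show ?thesis
  proof (rule closed_subalgebraI)
    fix f l assume f: "\<And>k. f k \<in> {x \<in> carrier A. \<phi> x = \<psi> x}" and l: "A.conv f l"
    have "(\<lambda>k. \<phi> (f k)) = (\<lambda>k. \<psi> (f k))" using f by auto
    then have "\<phi> l = \<psi> l"
      using B.conv_unique[OF hom_conv[OF A B h(1) l]] hom_conv[OF A B h(2) l] by simp
    then show "l \<in> {x \<in> carrier A. \<phi> x = \<psi> x}" using A.convD(2)[OF l] by blast
  qed (auto simp: hD)
qed

lemma C_interval_generated: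
  assumes R: "R > 0" and D: "closed_subalgebra (C_interval R) (sup_norm R) D" and c: "interval_coord R \<in> D"
  shows "carrier (C_interval R) \<subseteq> D"
proof
  interpret C: cstar "C_interval R" "sup_norm R" by (rule C_interval_cstar[OF R])
  note DD = closed_subalgebraD[OF D]
  have p: "poly_fun R q \<in> D" for q
  proof (induction q)
    case 0
    have eq: "poly_fun R 0 = smul (C_interval R) 0 \<one>\<^bsub>C_interval R\<^esub>" unfolding poly_fun_ops by simp
    show ?case unfolding eq by (rule DD(5)[OF DD(2)])
  next
    case (pCons a q)
    have "poly_fun R (pCons a q) = smul (C_interval R) a \<one>\<^bsub>C_interval R\<^esub> \<oplus>\<^bsub>C_interval R\<^esub> interval_coord R \<otimes>\<^bsub>C_interval R\<^esub> poly_fun R q"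
      unfolding poly_fun_ops by (simp add: one_pCons)
    then show ?case using DD pCons.IH c by simp
  qed
  fix f assume "f \<in> carrier (C_interval R)"
  from poly_fun_dense[OF this R] obtain q where "C.conv (\<lambda>k. poly_fun R (q k)) f" by blast
  then show "f \<in> D" by (rule DD(6)[OF p])
qed

locale cstar_family = alg_family +
  fixes N :: "'a => 'b => real"
  assumes cstar_A: "j \<in> J ==> cstar (A j) (N j)"
begin

abbreviation FP where "FP \<equiv> free_product_seminorms J A"
abbreviation fpn where "fpn \<equiv> free_product_norm J A"
abbreviation FA where "FA \<equiv> cstar_free_product J A"
abbreviation fan where "fan \<equiv> completion_norm P (free_product_norm J A)"
abbreviation incl where "incl \<equiv> free_product_incl J A"

lemma FP_iff: "\<rho> \<in> FP \<longleftrightarrow> cstar_seminorm P \<rho> \<and>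
   (\<forall>j\<in>J. (\<forall>a\<in>carrier (A j). \<forall>b\<in>carrier (A j).
        seminorm_dist P \<rho> (letter j (a \<oplus>\<^bsub>A j\<^esub> b)) (letter j a \<oplus>\<^bsub>P\<^esub> letter j b) = 0 \<and>
        seminorm_dist P \<rho> (letter j (a \<otimes>\<^bsub>A j\<^esub> b)) (letter j a \<otimes>\<^bsub>P\<^esub> letter j b) = 0) \<and>
     (\<forall>c. \<forall>a\<in>carrier (A j). seminorm_dist P \<rho> (letter j (smul (A j) c a)) (smul P c (letter j a)) = 0) \<and>
     seminorm_dist P \<rho> (letter j \<one>\<^bsub>A j\<^esub>) \<one>\<^bsub>P\<^esub> = 0)"
  by (simp add: free_product_seminorms_def Let_def)

lemma zero_FP: "(\<lambda>p. 0) \<in> FP"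
  by (simp add: FP_iff cstar_seminorm_def seminorm_dist_def)

lemma semi_FP: "\<rho> \<in> FP ==> cstar_semi P \<rho>"
  unfolding FP_iff cstar_semi_def cstar_semi_axioms_def using star_alg_P by blast

text \<open>Composed with \<open>letter j\<close>, such a seminorm becomes a C*-seminorm on \<open>A j\<close>.\<close>

lemma FP_letter_le: assumes rho: "\<rho> \<in> FP" and j: "j \<in> J" and a: "a \<in> carrier (A j)"
  shows "\<rho> (letter j a) \<le> N j a"
proof -
  interpret R: cstar_semi P \<rho> by (rule semi_FP[OF rho])
  interpret Aj: cstar "A j" "N j" by (rule cstar_A[OF j])
  have eq: "\<rho> x = \<rho> y" if "seminorm_dist P \<rho> x y = 0" "x \<in> carrier P" "y \<in> carrier P" for x y
    using R.nu_dst[OF that(2,3)] that(1) by simp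
  note lc = letter_carrier[OF j]
  have 1: "\<rho> (letter j (x \<oplus>\<^bsub>A j\<^esub> y)) = \<rho> (letter j x \<oplus>\<^bsub>P\<^esub> letter j y)"
   "\<rho> (letter j (x \<otimes>\<^bsub>A j\<^esub> y)) = \<rho> (letter j x \<otimes>\<^bsub>P\<^esub> letter j y)"
     if "x \<in> carrier (A j)" "y \<in> carrier (A j)" for x y
    using rho j that by (auto simp: FP_iff intro!: eq lc P.a_closed P.m_closed)
  have 2: "\<rho> (letter j (smul (A j) c x)) = \<rho> (smul P c (letter j x))" if "x \<in> carrier (A j)" for x c
    using rho j that by (auto simp: FP_iff intro!: eq lc)
  have "cstar_seminorm (A j) (\<lambda>x. \<rho> (letter j x))"
    unfolding cstar_seminorm_def
    using lc by (auto simp: 1 2 R.nu_add R.nu_mult R.nu_smul letter_star[OF j] R.nu_cstar)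
  from Aj.seminorm_contractive[OF this a] show ?thesis .
qed

lemma FP_bounded: assumes "p \<in> carrier P" shows "\<exists>C. \<forall>\<rho>\<in>FP. \<rho> p \<le> C"
  using assms
proof (induction p rule: P_induct)
  case zero
  show ?case by (rule exI[of _ 0]) (auto simp: cstar_semi.nu_zero[OF semi_FP])
next
  case (mono c w)
  have "\<exists>C\<ge>0. \<forall>\<rho>\<in>FP. \<rho> (wmono w) \<le> C"
    using mono
  proof (induction w)
    case Nil
    show ?case unfolding mono_Nil
      by (rule exI[of _ 1]) (use cstar_semi.nu_one_le[OF semi_FP] in auto)
  next
    case (Cons x w)
    then obtain C where C: "C \<ge> 0" "\<And>\<rho>. \<rho> \<in> FP ==> \<rho> (wmono w) \<le> C" by blast
    obtain j a where x: "x = (j, a)" "j \<in> J" "a \<in> carrier (A j)"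
      using Cons by (auto simp: letters_def)
    have w: "w \<in> W" using Cons by auto
    have N0: "N j a \<ge> 0" proof -
      interpret Aj: cstar "A j" "N j" by (rule cstar_A[OF x(2)])
      show ?thesis using x(3) by simp
    qed
    have "\<rho> (wmono (x # w)) \<le> N j a * C" if r: "\<rho> \<in> FP" for \<rho>
    proof -
      interpret R: cstar_semi P \<rho> by (rule semi_FP[OF r])
      have "wmono (x # w) = letter j a \<otimes>\<^bsub>P\<^esub> wmono w" by (simp add: letter_mono mono_mult x)
      then have "\<rho> (wmono (x # w)) \<le> \<rho> (letter j a) * \<rho> (wmono w)"
        using R.nu_mult letter_carrier[OF x(2,3)] mono_carrier[OF w] by simp
      also have "\<dots> \<le> N j a * C"
        using FP_letter_le[OF r x(2,3)] C(2)[OF r] N0 R.nu_ge0[OF mono_carrier[OF w]] by (intro mult_mono)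
      finally show ?thesis .
    qed
    then show ?case using N0 C(1) by (intro exI[of _ "N j a * C"]) auto
  qed
  then obtain C where C: "C \<ge> 0" "\<And>\<rho>. \<rho> \<in> FP ==> \<rho> (wmono w) \<le> C" by blast
  have "\<rho> (smul P c (wmono w)) \<le> cmod c * C" if r: "\<rho> \<in> FP" for \<rho>
    using cstar_semi.nu_smul[OF semi_FP[OF r] mono_carrier[OF mono]] C(2)[OF r] by (simp add: mult_left_mono)
  then show ?case by blast
next
  case (add p q)
  then obtain C D where "\<And>\<rho>. \<rho> \<in> FP ==> \<rho> p \<le> C" "\<And>\<rho>. \<rho> \<in> FP ==> \<rho> q \<le> D" by blast
  then have "\<rho> (p \<oplus>\<^bsub>P\<^esub> q) \<le> C + D" if r: "\<rho> \<in> FP" for \<rho>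
    using cstar_semi.nu_add[OF semi_FP[OF r] add(1,2)] r by (meson add_mono order_trans)
  then show ?case by blast
qed

lemma fpn_upper: assumes "\<rho> \<in> FP" "p \<in> carrier P" shows "\<rho> p \<le> fpn p"
proof -
  have "bdd_above ((\<lambda>\<rho>. \<rho> p) ` FP)" using FP_bounded[OF assms(2)] by (auto simp: bdd_above_def)
  then show ?thesis unfolding free_product_norm_def by (rule cSUP_upper[OF assms(1)])
qed

lemma fpn_least: assumes "\<And>\<rho>. \<rho> \<in> FP ==> \<rho> p \<le> C" shows "fpn p \<le> C"
  unfolding free_product_norm_def by (rule cSUP_least) (use zero_FP assms in auto)

lemma fpn_ge0: "p \<in> carrier P ==> 0 \<le> fpn p"
  using fpn_upper[OF zero_FP] by simp

lemma fpn_smul_le: assumes p: "p \<in> carrier P" shows "fpn (smul P c p) \<le> cmod c * fpn p"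
proof (rule fpn_least)
  fix \<rho> assume r: "\<rho> \<in> FP"
  show "\<rho> (smul P c p) \<le> cmod c * fpn p"
    using cstar_semi.nu_smul[OF semi_FP[OF r] p, of c] fpn_upper[OF r p] by (simp add: mult_left_mono)
qed

text \<open>A pointwise supremum of C*-seminorms is one; boundedness comes from \<open>FP_bounded\<close>.\<close>

lemma fpn_seminorm: "cstar_seminorm P fpn"
  unfolding cstar_seminorm_def
proof (intro conjI ballI allI)
  fix p q assume p: "p \<in> carrier P" and q: "q \<in> carrier P"
  show "fpn (p \<oplus>\<^bsub>P\<^esub> q) \<le> fpn p + fpn q"
  proof (rule fpn_least)
    fix \<rho> assume r: "\<rho> \<in> FP"
    show "\<rho> (p \<oplus>\<^bsub>P\<^esub> q) \<le> fpn p + fpn q"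
      using cstar_semi.nu_add[OF semi_FP[OF r] p q] fpn_upper[OF r p] fpn_upper[OF r q] by linarith
  qed
  show "fpn (p \<otimes>\<^bsub>P\<^esub> q) \<le> fpn p * fpn q"
  proof (rule fpn_least)
    fix \<rho> assume r: "\<rho> \<in> FP"
    have "\<rho> p * \<rho> q \<le> fpn p * fpn q"
      using fpn_upper[OF r p] fpn_upper[OF r q] fpn_ge0[OF p] cstar_semi.nu_ge0[OF semi_FP[OF r] q] by (rule mult_mono)
    then show "\<rho> (p \<otimes>\<^bsub>P\<^esub> q) \<le> fpn p * fpn q"
      using cstar_semi.nu_mult[OF semi_FP[OF r] p q] by linarith
  qed
next
  fix p c assume p: "p \<in> carrier P"
  show "0 \<le> fpn p" by (rule fpn_ge0[OF p])
  show "fpn (smul P c p) = cmod c * fpn p"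
  proof (cases "c = 0")
    case True
    then show ?thesis using fpn_smul_le[OF p, of 0] fpn_ge0[of "smul P 0 p"] p by auto
  next
    case False
    have "fpn p \<le> cmod (1/c) * fpn (smul P c p)"
      using fpn_smul_le[of "smul P c p" "1/c"] False p by simp
    then have "cmod c * fpn p \<le> fpn (smul P c p)" using False by (simp add: norm_divide field_simps)
    then show ?thesis using fpn_smul_le[OF p, of c] by simp
  qed
  show "fpn (star P p \<otimes>\<^bsub>P\<^esub> p) = (fpn p)\<^sup>2"
  proof (rule antisym)
    have c: "star P p \<otimes>\<^bsub>P\<^esub> p \<in> carrier P" using p by simp
    show "fpn (star P p \<otimes>\<^bsub>P\<^esub> p) \<le> (fpn p)\<^sup>2"
    proof (rule fpn_least)
      fix \<rho> assume r: "\<rho> \<in> FP"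
      show "\<rho> (star P p \<otimes>\<^bsub>P\<^esub> p) \<le> (fpn p)\<^sup>2"
        using cstar_semi.nu_cstar[OF semi_FP[OF r] p] fpn_upper[OF r p] cstar_semi.nu_ge0[OF semi_FP[OF r] p]
        by (simp add: power_mono)
    qed
    have "fpn p \<le> sqrt (fpn (star P p \<otimes>\<^bsub>P\<^esub> p))"
    proof (rule fpn_least)
      fix \<rho> assume r: "\<rho> \<in> FP"
      show "\<rho> p \<le> sqrt (fpn (star P p \<otimes>\<^bsub>P\<^esub> p))"
        using cstar_semi.nu_cstar[OF semi_FP[OF r] p] fpn_upper[OF r c] by (intro real_le_rsqrt) simp
    qed
    then have "(fpn p)\<^sup>2 \<le> (sqrt (fpn (star P p \<otimes>\<^bsub>P\<^esub> p)))\<^sup>2" using fpn_ge0[OF p] by (rule power_mono)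
    then show "(fpn p)\<^sup>2 \<le> fpn (star P p \<otimes>\<^bsub>P\<^esub> p)" using fpn_ge0[OF c] by simp
  qed
qed

sublocale F: cstar_semi P fpn
  by unfold_locales (rule fpn_seminorm)

lemma cstar_FA: "cstar FA fan"
  unfolding cstar_free_product_def by (rule F.cstar_Cm)

sublocale FA: cstar FA fan by (rule cstar_FA)

lemma fpn_zero: assumes p: "p \<in> carrier P" and z: "\<And>\<rho>. \<rho> \<in> FP ==> \<rho> p = 0" shows "fpn p = 0"
  using fpn_least[of p 0] z fpn_ge0[OF p] by fastforce

lemma incl_eq: "incl j a = F.cls (\<lambda>_. letter j a)"
  by (simp add: free_product_incl_def)

lemma cls_const_eq:
  assumes "p \<in> carrier P" "q \<in> carrier P" "\<And>\<rho>. \<rho> \<in> FP ==> seminorm_dist P \<rho> p q = 0"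
  shows "F.cls (\<lambda>_. p) = F.cls (\<lambda>_. q)"
proof (rule F.cls_eqI[OF F.CS_const[OF assms(1)] F.CS_const[OF assms(2)]])
  have "F.dst p q = 0"
    unfolding seminorm_dist_def by (rule fpn_zero) (use assms in \<open>auto simp: seminorm_dist_def\<close>)
  then show "(\<lambda>k. F.dst p q) \<longlonglongrightarrow> 0" by simp
qed

lemma incl_hom: assumes j: "j \<in> J" shows "incl j \<in> unital_star_hom (A j) FA"
proof -
  interpret Aj: cstar "A j" "N j" by (rule cstar_A[OF j])
  note lc = letter_carrier[OF j]
  note ops = F.Cm_add F.Cm_mult F.Cm_smul F.Cm_star F.Cm_one F.CS_const lc
  show ?thesis
    unfolding cstar_free_product_def
  proof (rule unital_star_homI)
    fix x y assume x: "x \<in> carrier (A j)" and y: "y \<in> carrier (A j)"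
    show "incl j (x \<otimes>\<^bsub>A j\<^esub> y) = incl j x \<otimes>\<^bsub>F.Cm\<^esub> incl j y"
      unfolding incl_eq using x y by (simp add: ops) (rule cls_const_eq, use x y lc j in \<open>auto simp: FP_iff\<close>)
    show "incl j (x \<oplus>\<^bsub>A j\<^esub> y) = incl j x \<oplus>\<^bsub>F.Cm\<^esub> incl j y"
      unfolding incl_eq using x y by (simp add: ops) (rule cls_const_eq, use x y lc j in \<open>auto simp: FP_iff\<close>)
  next
    fix x c assume x: "x \<in> carrier (A j)"
    show "incl j x \<in> carrier F.Cm" unfolding incl_eq using x by (intro F.cls_carrier F.CS_const lc)
    show "incl j (smul (A j) c x) = smul F.Cm c (incl j x)"
      unfolding incl_eq using x by (simp add: ops) (rule cls_const_eq, use x lc j in \<open>auto simp: FP_iff\<close>)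
    show "incl j (star (A j) x) = star F.Cm (incl j x)"
      unfolding incl_eq using x by (simp add: ops letter_star[OF j])
  next
    show "incl j \<one>\<^bsub>A j\<^esub> = \<one>\<^bsub>F.Cm\<^esub>"
      unfolding incl_eq F.Cm_one by (rule cls_const_eq) (use lc j in \<open>auto simp: FP_iff\<close>)
  qed
qed

lemma FA_E: assumes "x \<in> carrier FA" obtains f where "f \<in> F.CS" "x = F.cls f"
  using assms unfolding cstar_free_product_def F.Cm_carrier by blast

lemma FA_dense: assumes "f \<in> F.CS" shows "FA.conv (\<lambda>n. F.cls (\<lambda>_. f n)) (F.cls f)"
  using F.Cm_dense[OF assms] unfolding cstar_free_product_def .

text \<open>Evaluation on the free *-algebra followed by the norm of \<open>B\<close> is one of the seminorms in the supremum, hence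
  evaluation is contractive for the free product norm and extends to the completion.\<close>

lemma FA_hom:
  assumes B: "cstar B \<mu>" and phi: "\<And>j. j \<in> J ==> \<phi> j \<in> unital_star_hom (A j) B"
  shows "\<exists>\<Phi>\<in>unital_star_hom FA B. \<forall>j\<in>J. \<forall>a\<in>carrier (A j). \<Phi> (incl j a) = \<phi> j a"
proof -
  interpret B: cstar B \<mu> by fact
  note pD = unital_star_homD[OF phi]
  obtain E where E: "E \<in> unital_star_hom P B" and El: "\<And>j a. j \<in> J ==> a \<in> carrier (A j) ==> E (letter j a) = \<phi> j a"
  proof -
    have "\<exists>E\<in>unital_star_hom P B. \<forall>j\<in>J. \<forall>a\<in>carrier (A j). E (letter j a) = \<phi> j a"
      by (rule free_eval[OF B.star_alg_axioms]) (simp_all add: pD)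
    then show ?thesis using that by blast
  qed
  note ED = unital_star_homD[OF E]
  have rho: "(\<lambda>p. \<mu> (E p)) \<in> FP"
  proof -
    have sem: "cstar_seminorm P (\<lambda>p. \<mu> (E p))" by (rule cstar_seminorm_comp[OF star_alg_P B.semi E])
    have z: "seminorm_dist P (\<lambda>p. \<mu> (E p)) p q = 0" if "E p = E q" "p \<in> carrier P" "q \<in> carrier P" for p q
      using that ED by (simp add: seminorm_dist_def)
    show ?thesis
      unfolding FP_iff
    proof (intro conjI ballI allI sem)
      fix j a b c assume j: "j \<in> J"
      interpret Aj: cstar "A j" "N j" by (rule cstar_A[OF j])
      note lc = letter_carrier[OF j]
      show "seminorm_dist P (\<lambda>p. \<mu> (E p)) (letter j \<one>\<^bsub>A j\<^esub>) \<one>\<^bsub>P\<^esub> = 0"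
        by (rule z) (simp_all add: lc El[OF j] ED pD[OF j])
      assume a: "a \<in> carrier (A j)"
      show "seminorm_dist P (\<lambda>p. \<mu> (E p)) (letter j (smul (A j) c a)) (smul P c (letter j a)) = 0"
        by (rule z) (use a in \<open>simp_all add: lc El[OF j] ED pD[OF j]\<close>)
      assume b: "b \<in> carrier (A j)"
      show "seminorm_dist P (\<lambda>p. \<mu> (E p)) (letter j (a \<oplus>\<^bsub>A j\<^esub> b)) (letter j a \<oplus>\<^bsub>P\<^esub> letter j b) = 0"
        by (rule z) (use a b in \<open>simp_all add: lc El[OF j] ED pD[OF j]\<close>)
      show "seminorm_dist P (\<lambda>p. \<mu> (E p)) (letter j (a \<otimes>\<^bsub>A j\<^esub> b)) (letter j a \<otimes>\<^bsub>P\<^esub> letter j b) = 0"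
        by (rule z) (use a b in \<open>simp_all add: lc El[OF j] ED pD[OF j]\<close>)
    qed
  qed
  define G where "G = (\<lambda>p. (F.cls (\<lambda>_. p), E p)) ` carrier P"
  note ops = F.Cm_add F.Cm_mult F.Cm_smul F.Cm_star F.Cm_one F.CS_const
  have "\<exists>\<Phi>\<in>unital_star_hom F.Cm B. \<forall>x y. (x, y) \<in> G \<longrightarrow> \<Phi> x = y"
  proof (rule hom_extension[OF F.cstar_semi_Cm B])
    fix x y assume "(x, y) \<in> G"
    then obtain p where p: "p \<in> carrier P" "x = F.cls (\<lambda>_. p)" "y = E p" by (auto simp: G_def)
    show "x \<in> carrier F.Cm" unfolding p by (intro F.cls_carrier F.CS_const p)
    show "y \<in> carrier B" unfolding p by (rule ED(1)[OF p(1)])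
    show "\<mu> y \<le> F.cn x" unfolding p F.cn_const[OF p(1)] by (rule fpn_upper[OF rho p(1)])
    show "(star F.Cm x, star B y) \<in> G"
      unfolding p using p(1) by (auto simp: ops G_def ED(6)[symmetric] intro!: image_eqI[of _ _ "star P p"])
    fix c show "(smul F.Cm c x, smul B c y) \<in> G"
      unfolding p using p(1) by (auto simp: ops G_def ED(5)[symmetric] intro!: image_eqI[of _ _ "smul P c p"])
    fix x' y' assume "(x', y') \<in> G"
    then obtain p' where p': "p' \<in> carrier P" "x' = F.cls (\<lambda>_. p')" "y' = E p'" by (auto simp: G_def)
    show "(x \<oplus>\<^bsub>F.Cm\<^esub> x', y \<oplus>\<^bsub>B\<^esub> y') \<in> G"
      unfolding p p' using p(1) p'(1) by (auto simp: ops G_def ED(3)[symmetric] intro!: image_eqI[of _ _ "p \<oplus>\<^bsub>P\<^esub> p'"])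
    show "(x \<otimes>\<^bsub>F.Cm\<^esub> x', y \<otimes>\<^bsub>B\<^esub> y') \<in> G"
      unfolding p p' using p(1) p'(1) by (auto simp: ops G_def ED(2)[symmetric] intro!: image_eqI[of _ _ "p \<otimes>\<^bsub>P\<^esub> p'"])
  next
    show "(\<one>\<^bsub>F.Cm\<^esub>, \<one>\<^bsub>B\<^esub>) \<in> G"
      unfolding G_def F.Cm_one by (rule image_eqI[of _ _ "\<one>\<^bsub>P\<^esub>"]) (auto simp: ED)
  next
    fix x assume "x \<in> carrier F.Cm"
    then obtain f where f: "f \<in> F.CS" "x = F.cls f" unfolding F.Cm_carrier by blast
    show "\<exists>f g. (\<forall>k. (f k, g k) \<in> G) \<and> cstar_semi.conv F.Cm F.cn f x"
      unfolding f(2)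
      by (rule exI[of _ "\<lambda>n. F.cls (\<lambda>_. f n)"], rule exI[of _ "\<lambda>n. E (f n)"])
         (use F.Cm_dense[OF f(1)] F.CSD[OF f(1)] in \<open>auto simp: G_def\<close>)
  qed
  then obtain \<Phi> where Ph: "\<Phi> \<in> unital_star_hom F.Cm B" "\<And>p. p \<in> carrier P ==> \<Phi> (F.cls (\<lambda>_. p)) = E p"
    by (auto simp: G_def)
  show ?thesis
    unfolding cstar_free_product_def
    by (rule bexI[OF _ Ph(1)]) (use Ph(2) El letter_carrier in \<open>auto simp: incl_eq\<close>)
qed

lemma FA_generated:
  assumes D: "closed_subalgebra FA fan D" and i: "\<And>j a. j \<in> J ==> a \<in> carrier (A j) ==> incl j a \<in> D"
  shows "carrier FA \<subseteq> D"
proof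
  note DD = closed_subalgebraD[OF D]
  note ops = F.Cm_add F.Cm_mult F.Cm_smul F.Cm_star F.Cm_one F.CS_const
  have w: "F.cls (\<lambda>_. wmono w) \<in> D" if "w \<in> W" for w
    using that
  proof (induction w)
    case Nil
    show ?case using DD(2) by (simp add: mono_Nil F.Cm_one[symmetric] cstar_free_product_def)
  next
    case (Cons x w)
    obtain j a where x: "x = (j, a)" "j \<in> J" "a \<in> carrier (A j)"
      using Cons by (auto simp: letters_def)
    have w: "w \<in> W" using Cons by auto
    have "wmono (x # w) = letter j a \<otimes>\<^bsub>P\<^esub> wmono w" by (simp add: letter_mono mono_mult x)
    then have "F.cls (\<lambda>_. wmono (x # w)) = incl j a \<otimes>\<^bsub>FA\<^esub> F.cls (\<lambda>_. wmono w)"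
      unfolding incl_eq cstar_free_product_def
      using letter_carrier[OF x(2,3)] mono_carrier[OF w] by (simp add: ops)
    then show ?case using DD(4)[OF i[OF x(2,3)]] Cons by simp
  qed
  have p: "F.cls (\<lambda>_. p) \<in> D" if "p \<in> carrier P" for p
    using that
  proof (induction p rule: P_induct)
    case zero
    have "F.cls (\<lambda>_. \<zero>\<^bsub>P\<^esub>) = smul FA 0 \<one>\<^bsub>FA\<^esub>"
      unfolding cstar_free_product_def by (simp add: ops)
    then show ?case using DD(5)[OF DD(2), of 0] by simp
  next
    case (mono c w)
    have "F.cls (\<lambda>_. smul P c (wmono w)) = smul FA c (F.cls (\<lambda>_. wmono w))"
      unfolding cstar_free_product_def using mono_carrier[OF mono] by (simp add: ops)
    then show ?case using DD(5)[OF w[OF mono], of c] by simp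
  next
    case (add p q)
    have "F.cls (\<lambda>_. p \<oplus>\<^bsub>P\<^esub> q) = F.cls (\<lambda>_. p) \<oplus>\<^bsub>FA\<^esub> F.cls (\<lambda>_. q)"
      unfolding cstar_free_product_def using add by (simp add: ops)
    then show ?case using DD(3)[OF add(3,4)] by simp
  qed
  fix x assume "x \<in> carrier FA"
  then obtain f where f: "f \<in> F.CS" "x = F.cls f" by (rule FA_E)
  show "x \<in> D" unfolding f(2) by (rule DD(6)[OF p[OF F.CSD[OF f(1)]] FA_dense[OF f(1)]])
qed

end

section \<open>The universal algebras\<close>

definition part_norm :: "real => nat => CR_part_elem => real" where
  "part_norm R l = completion_norm (free_star_algebra {..<l} (\<lambda>j. C_interval R))
     (free_product_norm {..<l} (\<lambda>j. C_interval R))"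

definition CR_norm :: "real => nat => (nat => nat) => CR_elem => real" where
  "CR_norm R n r = completion_norm (free_star_algebra {..<n} (\<lambda>i. CR_part R (r i)))
     (free_product_norm {..<n} (\<lambda>i. CR_part R (r i)))"

lemma part_family: "R > 0 ==> cstar_family {..<l} (\<lambda>j::nat. C_interval R) (\<lambda>j. sup_norm R)"
  by (simp add: cstar_family_def alg_family_def cstar_family_axioms_def C_interval_star_alg C_interval_cstar)

lemma part_cstar: "R > 0 ==> cstar (CR_part R l) (part_norm R l)"
  unfolding CR_part_def part_norm_def by (rule cstar_family.cstar_FA[OF part_family])

lemma CR_family: "R > 0 ==> cstar_family {..<n} (\<lambda>i::nat. CR_part R (r i)) (\<lambda>i. part_norm R (r i))"
  using part_cstar[of R]
  by (simp add: cstar_family_def alg_family_def cstar_family_axioms_def) (simp add: cstar_def cstar_semi_def)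

lemma CR_cstar: "R > 0 ==> cstar (CR R n r) (CR_norm R n r)"
  unfolding CR_def CR_norm_def by (rule cstar_family.cstar_FA[OF CR_family])

lemma CR_incl_hom: "R > 0 ==> i < n ==> CR_incl R n r i \<in> unital_star_hom (CR_part R (r i)) (CR R n r)"
  using cstar_family.incl_hom[OF CR_family, of R i n r] unfolding CR_def CR_incl_def by simp

lemma part_incl_hom: "R > 0 ==> j < l ==>
   free_product_incl {..<l} (\<lambda>j. C_interval R) j \<in> unital_star_hom (C_interval R) (CR_part R l)"
  using cstar_family.incl_hom[OF part_family, of R j l] unfolding CR_part_def by simp

lemma interval_coord_facts:
  assumes "R > 0"
  shows "interval_coord R \<in> carrier (C_interval R)" "star (C_interval R) (interval_coord R) = interval_coord R"
    "sup_norm R (interval_coord R) \<le> R"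
proof -
  show "interval_coord R \<in> carrier (C_interval R)"
    using poly_fun_carrier[of R "[:0,1:]"] by (simp only: poly_fun_ops(6))
  show "star (C_interval R) (interval_coord R) = interval_coord R"
    by (auto simp: C_interval_def interval_coord_def fun_eq_iff)
  show "sup_norm R (interval_coord R) \<le> R"
    by (rule sup_norm_least[OF assms]) (auto simp: interval_coord_def)
qed

lemma part_gen_facts:
  assumes R: "R > 0" and j: "j < l"
  shows "part_gen R l j \<in> carrier (CR_part R l)" "star (CR_part R l) (part_gen R l j) = part_gen R l j"
    "part_norm R l (part_gen R l j) \<le> R"
proof -
  note h = part_incl_hom[OF R j] and c = interval_coord_facts[OF R]
  interpret cstar "CR_part R l" "part_norm R l" by (rule part_cstar[OF R])
  show "part_gen R l j \<in> carrier (CR_part R l)" "star (CR_part R l) (part_gen R l j) = part_gen R l j"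
    unfolding part_gen_def using unital_star_homD(1,6)[OF h c(1)] c(2) by simp_all
  show "part_norm R l (part_gen R l j) \<le> R"
    unfolding part_gen_def using hom_contractive[OF C_interval_cstar[OF R] semi h c(1)] c(3) by linarith
qed

lemma part_generated:
  assumes R: "R > 0" and D: "closed_subalgebra (CR_part R l) (part_norm R l) D"
    and g: "\<And>j. j < l ==> part_gen R l j \<in> D"
  shows "carrier (CR_part R l) \<subseteq> D"
  unfolding CR_part_def
proof (rule cstar_family.FA_generated[OF part_family[OF R]])
  show "closed_subalgebra (cstar_free_product {..<l} (\<lambda>j. C_interval R))
     (completion_norm (free_star_algebra {..<l} (\<lambda>j. C_interval R)) (free_product_norm {..<l} (\<lambda>j. C_interval R))) D"
    using D unfolding CR_part_def part_norm_def .
  fix j a assume j: "j \<in> {..<l}" and a: "a \<in> carrier (C_interval R)"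
  then have h: "free_product_incl {..<l} (\<lambda>j. C_interval R) j \<in> unital_star_hom (C_interval R) (CR_part R l)"
    using part_incl_hom[OF R] by simp
  have "carrier (C_interval R) \<subseteq> {x \<in> carrier (C_interval R). free_product_incl {..<l} (\<lambda>j. C_interval R) j x \<in> D}"
    by (rule C_interval_generated[OF R closed_subalgebra_preimage[OF C_interval_cstar[OF R] part_cstar[OF R] h D]])
       (use g[of j] j interval_coord_facts(1)[OF R] in \<open>auto simp: part_gen_def\<close>)
  then show "free_product_incl {..<l} (\<lambda>j. C_interval R) j a \<in> D" using a by blast
qed

lemma CR_generated:
  assumes R: "R > 0" and D: "closed_subalgebra (CR R n r) (CR_norm R n r) D"
    and g: "\<And>i j. i < n ==> j < r i ==> CR_gen R n r i j \<in> D"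
  shows "carrier (CR R n r) \<subseteq> D"
  unfolding CR_def
proof (rule cstar_family.FA_generated[OF CR_family[OF R]])
  show "closed_subalgebra (cstar_free_product {..<n} (\<lambda>i. CR_part R (r i)))
     (completion_norm (free_star_algebra {..<n} (\<lambda>i. CR_part R (r i))) (free_product_norm {..<n} (\<lambda>i. CR_part R (r i)))) D"
    using D unfolding CR_def CR_norm_def .
  fix i a assume i: "i \<in> {..<n}" and a: "a \<in> carrier (CR_part R (r i))"
  then have h: "CR_incl R n r i \<in> unital_star_hom (CR_part R (r i)) (CR R n r)"
    using CR_incl_hom[OF R] by simp
  have "carrier (CR_part R (r i)) \<subseteq> {x \<in> carrier (CR_part R (r i)). CR_incl R n r i x \<in> D}"
    by (rule part_generated[OF R closed_subalgebra_preimage[OF part_cstar[OF R] CR_cstar[OF R] h D]])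
       (use g[of i] i part_gen_facts(1)[OF R] in \<open>auto simp: CR_gen_def\<close>)
  then show "free_product_incl {..<n} (\<lambda>i. CR_part R (r i)) i a \<in> D" using a unfolding CR_incl_def by blast
qed

lemma part_hom_eq:
  assumes R: "R > 0" and B: "cstar B \<mu>" and h: "\<phi> \<in> unital_star_hom (CR_part R l) B" "\<psi> \<in> unital_star_hom (CR_part R l) B"
    and eq: "\<And>j. j < l ==> \<phi> (part_gen R l j) = \<psi> (part_gen R l j)" and x: "x \<in> carrier (CR_part R l)"
  shows "\<phi> x = \<psi> x"
  using part_generated[OF R closed_subalgebra_equalizer[OF part_cstar[OF R] B h]] eq part_gen_facts(1)[OF R] x by blast

lemma CR_gen_carrier: "R > 0 ==> i < n ==> j < r i ==> CR_gen R n r i j \<in> carrier (CR R n r)"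
  unfolding CR_gen_def by (rule unital_star_homD(1)[OF CR_incl_hom part_gen_facts(1)])

lemma CR_hom_eq:
  assumes R: "R > 0" and B: "cstar B \<mu>" and h: "\<phi> \<in> unital_star_hom (CR R n r) B" "\<psi> \<in> unital_star_hom (CR R n r) B"
    and eq: "\<And>i j. i < n ==> j < r i ==> \<phi> (CR_gen R n r i j) = \<psi> (CR_gen R n r i j)"
    and x: "x \<in> carrier (CR R n r)"
  shows "\<phi> x = \<psi> x"
  using CR_generated[OF R closed_subalgebra_equalizer[OF CR_cstar[OF R] B h]] eq CR_gen_carrier[OF R] x by blast

lemma part_hom:
  assumes R: "R > 0" and B: "cstar B \<mu>"
    and b: "\<And>j. j < l ==> b j \<in> carrier B" "\<And>j. j < l ==> star B (b j) = b j" "\<And>j. j < l ==> \<mu> (b j) \<le> R"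
  shows "\<exists>\<phi>\<in>unital_star_hom (CR_part R l) B. \<forall>j<l. \<phi> (part_gen R l j) = b j"
proof -
  have "\<forall>j. \<exists>\<phi>. j < l \<longrightarrow> \<phi> \<in> unital_star_hom (C_interval R) B \<and> \<phi> (interval_coord R) = b j"
    using functional_calculus[OF B b R] by blast
  then obtain \<phi> where phi: "\<And>j. j < l ==> \<phi> j \<in> unital_star_hom (C_interval R) B"
     "\<And>j. j < l ==> \<phi> j (interval_coord R) = b j" by metis
  have "\<exists>\<Phi>\<in>unital_star_hom (CR_part R l) B. \<forall>j\<in>{..<l}. \<forall>a\<in>carrier (C_interval R).
      \<Phi> (free_product_incl {..<l} (\<lambda>j. C_interval R) j a) = \<phi> j a"
    unfolding CR_part_def by (rule cstar_family.FA_hom[OF part_family[OF R] B]) (use phi in simp)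
  then show ?thesis
    using phi(2) interval_coord_facts(1)[OF R] unfolding part_gen_def by (metis lessThan_iff)
qed

lemma CR_hom:
  assumes R: "R > 0" and B: "cstar B \<mu>"
    and phi: "\<And>i. i < n ==> \<phi> i \<in> unital_star_hom (CR_part R (r i)) B"
  shows "\<exists>\<Phi>\<in>unital_star_hom (CR R n r) B. \<forall>i<n. \<forall>a\<in>carrier (CR_part R (r i)). \<Phi> (CR_incl R n r i a) = \<phi> i a"
proof -
  have "\<exists>\<Phi>\<in>unital_star_hom (CR R n r) B. \<forall>i\<in>{..<n}. \<forall>a\<in>carrier (CR_part R (r i)).
      \<Phi> (free_product_incl {..<n} (\<lambda>i. CR_part R (r i)) i a) = \<phi> i a"
    unfolding CR_def by (rule cstar_family.FA_hom[OF CR_family[OF R] B]) (use phi in simp)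
  then show ?thesis unfolding CR_incl_def by auto
qed

lemma CR_hom_gens:
  assumes R: "R > 0" and B: "cstar B \<mu>"
    and b: "\<And>i j. i < n ==> j < r i ==> b i j \<in> carrier B"
      "\<And>i j. i < n ==> j < r i ==> star B (b i j) = b i j"
      "\<And>i j. i < n ==> j < r i ==> \<mu> (b i j) \<le> R"
  shows "\<exists>\<Phi>\<in>unital_star_hom (CR R n r) B. \<forall>i<n. \<forall>j<r i. \<Phi> (CR_gen R n r i j) = b i j"
proof -
  have "\<forall>i. \<exists>\<phi>. i < n \<longrightarrow> \<phi> \<in> unital_star_hom (CR_part R (r i)) B \<and> (\<forall>j<r i. \<phi> (part_gen R (r i) j) = b i j)"
  proof
    fix i
    have "\<exists>\<phi>\<in>unital_star_hom (CR_part R (r i)) B. \<forall>j<r i. \<phi> (part_gen R (r i) j) = b i j" if "i < n"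
      by (rule part_hom[OF R B]) (use b that in auto)
    then show "\<exists>\<phi>. i < n \<longrightarrow> \<phi> \<in> unital_star_hom (CR_part R (r i)) B \<and> (\<forall>j<r i. \<phi> (part_gen R (r i) j) = b i j)"
      by blast
  qed
  then obtain \<phi> where phi: "\<And>i. i < n ==> \<phi> i \<in> unital_star_hom (CR_part R (r i)) B"
     "\<And>i j. i < n ==> j < r i ==> \<phi> i (part_gen R (r i) j) = b i j" by metis
  have "\<exists>\<Phi>\<in>unital_star_hom (CR R n r) B. \<forall>i<n. \<forall>a\<in>carrier (CR_part R (r i)). \<Phi> (CR_incl R n r i a) = \<phi> i a"
    by (rule CR_hom[OF R B]) (use phi in simp)
  then obtain \<Phi> where "\<Phi> \<in> unital_star_hom (CR R n r) B"
     "\<And>i a. i < n ==> a \<in> carrier (CR_part R (r i)) ==> \<Phi> (CR_incl R n r i a) = \<phi> i a" by blast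
  then show ?thesis
    using phi(2) part_gen_facts(1)[OF R] unfolding CR_gen_def by (intro bexI[of _ \<Phi>]) auto
qed

text \<open>Existence and uniqueness of the homomorphism make the definite description meaningful; the third statement identifies it with
  any homomorphism that has the right values on the generators.\<close>

lemma CR_eval:
  assumes R: "R > 0" and B: "cstar B \<mu>"
    and b: "\<And>i j. i < n ==> j < r i ==> b i j \<in> carrier B"
      "\<And>i j. i < n ==> j < r i ==> star B (b i j) = b i j"
      "\<And>i j. i < n ==> j < r i ==> \<mu> (b i j) \<le> R"
  shows "CR_eval R n r B b \<in> unital_star_hom (CR R n r) B"
    and "\<And>i j. i < n ==> j < r i ==> CR_eval R n r B b (CR_gen R n r i j) = b i j"
    and "\<And>\<phi> x. \<phi> \<in> unital_star_hom (CR R n r) B ==>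
       (\<And>i j. i < n ==> j < r i ==> \<phi> (CR_gen R n r i j) = b i j) ==>
       x \<in> carrier (CR R n r) ==> CR_eval R n r B b x = \<phi> x"
proof -
  let ?C = "CR R n r"
  interpret C: cstar ?C "CR_norm R n r" by (rule CR_cstar[OF R])
  let ?Q = "\<lambda>\<phi>. \<phi> \<in> unital_star_hom ?C B \<and> \<phi> \<in> extensional (carrier ?C) \<and> (\<forall>i<n. \<forall>j<r i. \<phi> (CR_gen R n r i j) = b i j)"
  obtain \<Phi> where Ph: "\<Phi> \<in> unital_star_hom ?C B" "\<And>i j. i < n ==> j < r i ==> \<Phi> (CR_gen R n r i j) = b i j"
  proof -
    have "\<exists>\<Phi>\<in>unital_star_hom ?C B. \<forall>i<n. \<forall>j<r i. \<Phi> (CR_gen R n r i j) = b i j"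
      by (rule CR_hom_gens[OF R B]) (use b in auto)
    then show ?thesis using that by blast
  qed
  have 1: "?Q (restrict \<Phi> (carrier ?C))"
    using Ph CR_gen_carrier[OF R] by (auto intro!: unital_star_homI simp: unital_star_homD[OF Ph(1)])
  have 2: "\<phi> = \<psi>" if "?Q \<phi>" "?Q \<psi>" for \<phi> \<psi>
  proof (rule extensionalityI)
    show "\<phi> \<in> extensional (carrier ?C)" "\<psi> \<in> extensional (carrier ?C)" using that by auto
    fix x assume x: "x \<in> carrier ?C"
    show "\<phi> x = \<psi> x"
      by (rule CR_hom_eq[OF R B conjunct1[OF that(1)] conjunct1[OF that(2)] _ x]) (simp add: that)
  qed
  have Q: "?Q (CR_eval R n r B b)"
    unfolding CR_eval_def by (rule theI[where P="?Q", OF 1 2[OF _ 1]])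
  then show "CR_eval R n r B b \<in> unital_star_hom ?C B"
    "\<And>i j. i < n ==> j < r i ==> CR_eval R n r B b (CR_gen R n r i j) = b i j" by auto
  fix \<phi> x assume h: "\<phi> \<in> unital_star_hom ?C B"
     "\<And>i j. i < n ==> j < r i ==> \<phi> (CR_gen R n r i j) = b i j" "x \<in> carrier ?C"
  show "CR_eval R n r B b x = \<phi> x"
    by (rule CR_hom_eq[OF R B conjunct1[OF Q] h(1) _ h(3)]) (simp add: Q h(2))
qed

section \<open>Matrix algebras\<close>

lemma mat_adjoint_carrier [simp]: "A \<in> carrier_mat N N ==> mat_adjoint A \<in> carrier_mat N N"
  by (auto simp: mat_adjoint_def mat_of_rows_def)

lemma mat_adjoint_index [simp]:
  "A \<in> carrier_mat N N ==> i < N ==> j < N ==> mat_adjoint A $$ (i, j) = cnj (A $$ (j, i))" for A :: "complex mat"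
  by (auto simp: mat_adjoint_def mat_of_rows_def conjugate_complex_def)

lemma mat_adjoint_dims [simp]: "dim_row (mat_adjoint A) = dim_col A" "dim_col (mat_adjoint A) = dim_row A"
  by (auto simp: mat_adjoint_def mat_of_rows_def)

lemma mat_adjoint_mult: "A \<in> carrier_mat N N ==> B \<in> carrier_mat N N ==>
   mat_adjoint (A * B) = mat_adjoint B * mat_adjoint A" for A :: "complex mat"
  by (rule eq_matI) (auto simp: mat_adjoint_index[of _ N] scalar_prod_def mult.commute intro!: sum.cong)

lemma mat_algebra_simps [simp]:
  "carrier (mat_algebra N) = carrier_mat N N" "A \<otimes>\<^bsub>mat_algebra N\<^esub> B = A * B" "A \<oplus>\<^bsub>mat_algebra N\<^esub> B = A + B"
  "\<one>\<^bsub>mat_algebra N\<^esub> = 1\<^sub>m N" "\<zero>\<^bsub>mat_algebra N\<^esub> = 0\<^sub>m N N" "smul (mat_algebra N) c A = c \<cdot>\<^sub>m A"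
  "star (mat_algebra N) A = mat_adjoint A"
  by (simp_all add: mat_algebra_def)

lemma mat_star_alg: "star_alg (mat_algebra N)"
proof (rule star_algI)
  fix A B C :: "complex mat" and c d
  assume A: "A \<in> carrier (mat_algebra N)"
  then have A': "A \<in> carrier_mat N N" by simp
  show "smul (mat_algebra N) 0 A = \<zero>\<^bsub>mat_algebra N\<^esub>" using A' by auto
  show "\<one>\<^bsub>mat_algebra N\<^esub> \<otimes>\<^bsub>mat_algebra N\<^esub> A = A" "A \<otimes>\<^bsub>mat_algebra N\<^esub> \<one>\<^bsub>mat_algebra N\<^esub> = A" using A' by auto
  show "smul (mat_algebra N) (c + d) A = smul (mat_algebra N) c A \<oplus>\<^bsub>mat_algebra N\<^esub> smul (mat_algebra N) d A"
    using A' by (auto simp: add_smult_distrib_right_mat)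
  show "smul (mat_algebra N) c (smul (mat_algebra N) d A) = smul (mat_algebra N) (c * d) A"
    "smul (mat_algebra N) 1 A = A" using A' by auto
  show "star (mat_algebra N) (star (mat_algebra N) A) = A"
    using A' by (auto intro!: eq_matI simp: mat_adjoint_index[of _ N])
  show "star (mat_algebra N) (smul (mat_algebra N) c A) = smul (mat_algebra N) (cnj c) (star (mat_algebra N) A)"
    using A' by (auto intro!: eq_matI simp: mat_adjoint_index[of _ N])
  assume B: "B \<in> carrier (mat_algebra N)"
  then have B': "B \<in> carrier_mat N N" by simp
  show "smul (mat_algebra N) c (A \<oplus>\<^bsub>mat_algebra N\<^esub> B) = smul (mat_algebra N) c A \<oplus>\<^bsub>mat_algebra N\<^esub> smul (mat_algebra N) c B"
    using A' B' by (auto simp: add_smult_distrib_left_mat)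
  show "smul (mat_algebra N) c A \<otimes>\<^bsub>mat_algebra N\<^esub> B = smul (mat_algebra N) c (A \<otimes>\<^bsub>mat_algebra N\<^esub> B)"
     "A \<otimes>\<^bsub>mat_algebra N\<^esub> smul (mat_algebra N) c B = smul (mat_algebra N) c (A \<otimes>\<^bsub>mat_algebra N\<^esub> B)"
    using A' B' by auto
  show "A \<oplus>\<^bsub>mat_algebra N\<^esub> B = B \<oplus>\<^bsub>mat_algebra N\<^esub> A" using A' B' by (auto intro: comm_add_mat)
  show "star (mat_algebra N) (A \<oplus>\<^bsub>mat_algebra N\<^esub> B) = star (mat_algebra N) A \<oplus>\<^bsub>mat_algebra N\<^esub> star (mat_algebra N) B"
    using A' B' by (auto intro!: eq_matI simp: mat_adjoint_index[of _ N])
  show "star (mat_algebra N) (A \<otimes>\<^bsub>mat_algebra N\<^esub> B) = star (mat_algebra N) B \<otimes>\<^bsub>mat_algebra N\<^esub> star (mat_algebra N) A"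
    using A' B' by (simp add: mat_adjoint_mult)
  assume C: "C \<in> carrier (mat_algebra N)"
  then have C': "C \<in> carrier_mat N N" by simp
  show "A \<otimes>\<^bsub>mat_algebra N\<^esub> B \<otimes>\<^bsub>mat_algebra N\<^esub> C = A \<otimes>\<^bsub>mat_algebra N\<^esub> (B \<otimes>\<^bsub>mat_algebra N\<^esub> C)"
    "A \<oplus>\<^bsub>mat_algebra N\<^esub> B \<oplus>\<^bsub>mat_algebra N\<^esub> C = A \<oplus>\<^bsub>mat_algebra N\<^esub> (B \<oplus>\<^bsub>mat_algebra N\<^esub> C)"
    "(A \<oplus>\<^bsub>mat_algebra N\<^esub> B) \<otimes>\<^bsub>mat_algebra N\<^esub> C = A \<otimes>\<^bsub>mat_algebra N\<^esub> C \<oplus>\<^bsub>mat_algebra N\<^esub> B \<otimes>\<^bsub>mat_algebra N\<^esub> C"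
    "C \<otimes>\<^bsub>mat_algebra N\<^esub> (A \<oplus>\<^bsub>mat_algebra N\<^esub> B) = C \<otimes>\<^bsub>mat_algebra N\<^esub> A \<oplus>\<^bsub>mat_algebra N\<^esub> C \<otimes>\<^bsub>mat_algebra N\<^esub> B"
    using A' B' C' by (simp_all add: assoc_mult_mat[of _ N N _ N _ N] assoc_add_mat[of _ N N]
       add_mult_distrib_mat[of _ N N] mult_add_distrib_mat[of _ N N])
qed auto

lemma cvec_norm_L2: "v \<in> carrier_vec N ==> cvec_norm v = L2_set (\<lambda>i. cmod (v $ i)) {..<N}"
  by (auto simp: cvec_norm_def L2_set_def)

lemma cvec_norm_ge0: "0 \<le> cvec_norm v"
  by (simp add: cvec_norm_def sum_nonneg)

lemma cvec_norm_smult: "cvec_norm (c \<cdot>\<^sub>v v) = cmod c * cvec_norm v"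
  by (simp add: cvec_norm_def norm_mult power_mult_distrib sum_distrib_left[symmetric] real_sqrt_mult)

lemma cvec_norm_add: assumes "u \<in> carrier_vec N" "v \<in> carrier_vec N"
  shows "cvec_norm (u + v) \<le> cvec_norm u + cvec_norm v"
proof -
  have "cvec_norm (u + v) \<le> L2_set (\<lambda>i. cmod (u $ i) + cmod (v $ i)) {..<N}"
    using assms by (subst cvec_norm_L2[of _ N]) (auto intro!: L2_set_mono norm_triangle_ineq)
  also have "\<dots> \<le> cvec_norm u + cvec_norm v"
    using assms by (simp add: cvec_norm_L2[of _ N] L2_set_triangle_ineq)
  finally show ?thesis .
qed

lemma mult_vec_entry: "A \<in> carrier_mat N N ==> v \<in> carrier_vec N ==> i < N ==>
   (A *\<^sub>v v) $ i = (\<Sum>j<N. A $$ (i, j) * v $ j)"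
  by (auto simp: scalar_prod_def lessThan_atLeast0 intro!: sum.cong)

lemma cvec_entry_le: "v \<in> carrier_vec N ==> i < N ==> cmod (v $ i) \<le> cvec_norm v"
  by (subst cvec_norm_L2[of _ N]) (auto intro!: member_le_L2_set)

lemma cvec_norm_mult_le_entries:
  assumes A: "A \<in> carrier_mat N N" and v: "v \<in> carrier_vec N"
  shows "cvec_norm (A *\<^sub>v v) \<le> (\<Sum>i<N. \<Sum>j<N. cmod (A $$ (i, j))) * cvec_norm v"
proof -
  have Av: "A *\<^sub>v v \<in> carrier_vec N" using A v by auto
  have "cvec_norm (A *\<^sub>v v) \<le> (\<Sum>i<N. cmod ((A *\<^sub>v v) $ i))"
    unfolding cvec_norm_L2[OF Av] by (rule L2_set_le_sum) auto
  also have "\<dots> \<le> (\<Sum>i<N. \<Sum>j<N. cmod (A $$ (i, j)) * cvec_norm v)"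
  proof (rule sum_mono)
    fix i assume i: "i \<in> {..<N}"
    have "cmod ((A *\<^sub>v v) $ i) \<le> (\<Sum>j<N. cmod (A $$ (i, j) * v $ j))"
      using i by (simp only: mult_vec_entry[OF A v] lessThan_iff) (rule norm_sum)
    also have "\<dots> \<le> (\<Sum>j<N. cmod (A $$ (i, j)) * cvec_norm v)"
      using cvec_entry_le[OF v] by (intro sum_mono) (auto simp: norm_mult intro!: mult_left_mono)
    finally show "cmod ((A *\<^sub>v v) $ i) \<le> (\<Sum>j<N. cmod (A $$ (i, j)) * cvec_norm v)" .
  qed
  finally show ?thesis by (simp add: sum_distrib_right)
qed

lemma mat_opnorm_bdd:
  assumes A: "A \<in> carrier_mat N N"
  shows "bdd_above ((\<lambda>v. cvec_norm (A *\<^sub>v v)) ` {v \<in> carrier_vec N. cvec_norm v \<le> 1})"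
proof (rule bdd_aboveI2)
  fix v :: "complex Matrix.vec" assume v: "v \<in> {v \<in> carrier_vec N. cvec_norm v \<le> 1}"
  have "cvec_norm (A *\<^sub>v v) \<le> (\<Sum>i<N. \<Sum>j<N. cmod (A $$ (i, j))) * cvec_norm v"
    using v by (intro cvec_norm_mult_le_entries A) auto
  also have "\<dots> \<le> (\<Sum>i<N. \<Sum>j<N. cmod (A $$ (i, j))) * 1"
    using v by (intro mult_left_mono) (auto intro!: sum_nonneg)
  finally show "cvec_norm (A *\<^sub>v v) \<le> (\<Sum>i<N. \<Sum>j<N. cmod (A $$ (i, j)))" by simp
qed

lemma mat_opnorm_upper:
  assumes A: "A \<in> carrier_mat N N" and v: "v \<in> carrier_vec N"
  shows "cvec_norm (A *\<^sub>v v) \<le> mat_opnorm N A * cvec_norm v"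
proof (cases "cvec_norm v = 0")
  case True
  then show ?thesis using cvec_norm_mult_le_entries[OF A v] by simp
next
  case False
  then have pos: "cvec_norm v > 0" using cvec_norm_ge0[of v] by linarith
  let ?c = "complex_of_real (1 / cvec_norm v)"
  have "cmod ?c = 1 / cvec_norm v" using pos by (simp only: norm_of_real) simp
  then have u: "?c \<cdot>\<^sub>v v \<in> carrier_vec N" "cvec_norm (?c \<cdot>\<^sub>v v) \<le> 1"
    using v pos by (auto simp only: cvec_norm_smult smult_carrier_vec) simp
  have "cvec_norm (A *\<^sub>v (?c \<cdot>\<^sub>v v)) \<le> mat_opnorm N A"
    unfolding mat_opnorm_def by (rule cSUP_upper[OF _ mat_opnorm_bdd[OF A]]) (use u in simp)
  moreover have "A *\<^sub>v (?c \<cdot>\<^sub>v v) = ?c \<cdot>\<^sub>v (A *\<^sub>v v)" using A v by (simp add: mult_mat_vec)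
  ultimately have "1 / cvec_norm v * cvec_norm (A *\<^sub>v v) \<le> mat_opnorm N A"
    by (simp only: cvec_norm_smult \<open>cmod ?c = 1 / cvec_norm v\<close>)
  then show ?thesis using pos by (simp add: divide_le_eq)
qed

lemma cvec_norm_zero [simp]: "cvec_norm (0\<^sub>v N) = 0"
  by (simp add: cvec_norm_def)

lemma mat_opnorm_least:
  assumes C: "C \<ge> 0" and le: "\<And>v :: complex Matrix.vec. v \<in> carrier_vec N ==> cvec_norm (A *\<^sub>v v) \<le> C * cvec_norm v"
  shows "mat_opnorm N A \<le> C"
  unfolding mat_opnorm_def
proof (rule cSUP_least)
  show "{v \<in> carrier_vec N. cvec_norm v \<le> 1} \<noteq> {}"
    using zero_carrier_vec[of N] by (metis (mono_tags, lifting) cvec_norm_zero empty_iff mem_Collect_eq zero_le_one)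
  fix v :: "complex Matrix.vec" assume v: "v \<in> {v \<in> carrier_vec N. cvec_norm v \<le> 1}"
  show "cvec_norm (A *\<^sub>v v) \<le> C"
    using le[of v] v C mult_left_mono[of "cvec_norm v" 1 C] by simp
qed

lemma mat_opnorm_ge0: assumes A: "A \<in> carrier_mat N N" shows "0 \<le> mat_opnorm N A"
proof -
  have "cvec_norm (A *\<^sub>v 0\<^sub>v N) \<le> mat_opnorm N A"
    unfolding mat_opnorm_def by (rule cSUP_upper[OF _ mat_opnorm_bdd[OF A]]) simp
  then show ?thesis using cvec_norm_ge0 order_trans by blast
qed

lemma mat_opnorm_le_entries: "A \<in> carrier_mat N N ==> mat_opnorm N A \<le> (\<Sum>i<N. \<Sum>j<N. cmod (A $$ (i, j)))"
  by (rule mat_opnorm_least) (auto intro!: sum_nonneg cvec_norm_mult_le_entries)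

lemma mat_entry_le_opnorm:
  assumes A: "A \<in> carrier_mat N N" and ij: "i < N" "j < N" shows "cmod (A $$ (i, j)) \<le> mat_opnorm N A"
proof -
  have u: "unit_vec N j \<in> carrier_vec N" by simp
  have "cvec_norm (unit_vec N j) = 1"
  proof -
    have "(\<Sum>i<N. (cmod ((unit_vec N j :: complex Matrix.vec) $ i))\<^sup>2) = (\<Sum>i<N. if i = j then 1 else 0)"
      using ij by (intro sum.cong) (auto simp: unit_vec_def)
    then show ?thesis using ij by (simp add: cvec_norm_def)
  qed
  moreover have "(A *\<^sub>v unit_vec N j) $ i = A $$ (i, j)"
  proof -
    have "(A *\<^sub>v unit_vec N j) $ i = (\<Sum>k<N. if k = j then A $$ (i, j) else 0)"
      unfolding mult_vec_entry[OF A u ij(1)] using ij by (intro sum.cong) (auto simp: unit_vec_def)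
    then show ?thesis using ij by simp
  qed
  ultimately show ?thesis
    using mat_opnorm_upper[OF A u] cvec_entry_le[of "A *\<^sub>v unit_vec N j" N i] A ij by simp
qed

lemma adjoint_sprod:
  fixes A :: "complex mat"
  assumes A: "A \<in> carrier_mat N N" and v: "v \<in> carrier_vec N"
  shows "of_real ((cvec_norm (A *\<^sub>v v))\<^sup>2) = (\<Sum>j<N. cnj (v $ j) * (mat_adjoint A *\<^sub>v (A *\<^sub>v v)) $ j)"
proof -
  let ?w = "A *\<^sub>v v"
  have w: "?w \<in> carrier_vec N" using A v by auto
  have "(\<Sum>j<N. cnj (v $ j) * (mat_adjoint A *\<^sub>v ?w) $ j)
      = (\<Sum>j<N. \<Sum>i<N. cnj (v $ j) * (cnj (A $$ (i, j)) * ?w $ i))"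
    by (intro sum.cong refl) (use A in \<open>simp add: mult_vec_entry[OF mat_adjoint_carrier[OF A] w] sum_distrib_left del: index_mult_mat_vec\<close>)
  also have "\<dots> = (\<Sum>i<N. cnj (\<Sum>j<N. A $$ (i, j) * v $ j) * ?w $ i)"
    by (subst sum.swap) (simp add: sum_distrib_right sum_distrib_left mult_ac del: index_mult_mat_vec)
  also have "\<dots> = (\<Sum>i<N. cnj (?w $ i) * ?w $ i)"
    by (intro sum.cong refl) (simp only: mult_vec_entry[OF A v] lessThan_iff)
  also have "\<dots> = (\<Sum>i<N. of_real ((cmod (?w $ i))\<^sup>2))"
    by (simp add: complex_norm_square mult.commute del: of_real_power index_mult_mat_vec)
  also have "\<dots> = of_real ((cvec_norm ?w)\<^sup>2)"
    unfolding cvec_norm_def carrier_vecD[OF w] by (simp add: sum_nonneg del: index_mult_mat_vec)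
  finally show ?thesis ..
qed

text \<open>\<open>\<parallel>A v\<parallel>\<^sup>2 = \<langle>v, A* A v\<rangle>\<close>, with the Cauchy-Schwarz
  inequality.\<close>

lemma mat_opnorm_sq_le:
  assumes A: "A \<in> carrier_mat N N"
  shows "(mat_opnorm N A)\<^sup>2 \<le> mat_opnorm N (mat_adjoint A * A)"
proof -
  let ?B = "mat_adjoint A * A"
  have B: "?B \<in> carrier_mat N N" using A by auto
  have "mat_opnorm N A \<le> sqrt (mat_opnorm N ?B)"
  proof (rule mat_opnorm_least)
    show "0 \<le> sqrt (mat_opnorm N ?B)" using mat_opnorm_ge0[OF B] by simp
    fix v :: "complex Matrix.vec" assume v: "v \<in> carrier_vec N"
    have Bv: "?B *\<^sub>v v \<in> carrier_vec N" using B v by auto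
    have eq: "mat_adjoint A *\<^sub>v (A *\<^sub>v v) = ?B *\<^sub>v v" using A v by (simp add: assoc_mult_mat_vec[of _ N N _ N])
    have "(cvec_norm (A *\<^sub>v v))\<^sup>2 = cmod (\<Sum>j<N. cnj (v $ j) * (?B *\<^sub>v v) $ j)"
      using arg_cong[OF adjoint_sprod[OF A v], of cmod] by (simp only: eq norm_of_real abs_power2)
    also have "\<dots> \<le> (\<Sum>j<N. cmod (v $ j) * cmod ((?B *\<^sub>v v) $ j))"
      by (rule order_trans[OF norm_sum]) (simp add: norm_mult)
    also have "\<dots> \<le> cvec_norm v * cvec_norm (?B *\<^sub>v v)"
      using L2_set_mult_ineq[of "\<lambda>j. cmod (v $ j)" "\<lambda>j. cmod ((?B *\<^sub>v v) $ j)" "{..<N}"]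
      by (simp add: cvec_norm_L2[OF v] cvec_norm_L2[OF Bv])
    also have "\<dots> \<le> cvec_norm v * (mat_opnorm N ?B * cvec_norm v)"
      by (intro mult_left_mono mat_opnorm_upper B v cvec_norm_ge0)
    finally have "(cvec_norm (A *\<^sub>v v))\<^sup>2 \<le> mat_opnorm N ?B * (cvec_norm v)\<^sup>2"
      by (simp add: power2_eq_square mult_ac)
    then have "cvec_norm (A *\<^sub>v v) \<le> sqrt (mat_opnorm N ?B * (cvec_norm v)\<^sup>2)" by (rule real_le_rsqrt)
    then show "cvec_norm (A *\<^sub>v v) \<le> sqrt (mat_opnorm N ?B) * cvec_norm v"
      using cvec_norm_ge0[of v] by (simp add: real_sqrt_mult)
  qed
  then have "(mat_opnorm N A)\<^sup>2 \<le> (sqrt (mat_opnorm N ?B))\<^sup>2" using mat_opnorm_ge0[OF A] by (rule power_mono)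
  then show ?thesis using mat_opnorm_ge0[OF B] by simp
qed

lemma mat_opnorm_mult:
  assumes A: "A \<in> carrier_mat N N" and B: "B \<in> carrier_mat N N"
  shows "mat_opnorm N (A * B) \<le> mat_opnorm N A * mat_opnorm N B"
proof (rule mat_opnorm_least)
  show "0 \<le> mat_opnorm N A * mat_opnorm N B" using mat_opnorm_ge0 A B by simp
  fix v :: "complex Matrix.vec" assume v: "v \<in> carrier_vec N"
  have "cvec_norm (A * B *\<^sub>v v) \<le> mat_opnorm N A * cvec_norm (B *\<^sub>v v)"
    using mat_opnorm_upper[OF A, of "B *\<^sub>v v"] A B v by (simp add: assoc_mult_mat_vec[of _ N N _ N])
  also have "\<dots> \<le> mat_opnorm N A * (mat_opnorm N B * cvec_norm v)"
    by (intro mult_left_mono mat_opnorm_upper mat_opnorm_ge0 A B v)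
  finally show "cvec_norm (A * B *\<^sub>v v) \<le> mat_opnorm N A * mat_opnorm N B * cvec_norm v" by (simp add: mult_ac)
qed

lemma mat_opnorm_adjoint_le:
  assumes A: "A \<in> carrier_mat N N"
  shows "mat_opnorm N A \<le> mat_opnorm N (mat_adjoint A)"
proof (cases "mat_opnorm N A = 0")
  case True
  then show ?thesis using mat_opnorm_ge0[OF mat_adjoint_carrier[OF A]] by simp
next
  case False
  then have "mat_opnorm N A > 0" using mat_opnorm_ge0[OF A] by linarith
  moreover have "mat_opnorm N A * mat_opnorm N A \<le> mat_opnorm N (mat_adjoint A) * mat_opnorm N A"
    using mat_opnorm_sq_le[OF A] mat_opnorm_mult[OF mat_adjoint_carrier[OF A] A] by (simp add: power2_eq_square)
  ultimately show ?thesis by simp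
qed

lemma mat_opnorm_smult_le: assumes A: "A \<in> carrier_mat N N" shows "mat_opnorm N (c \<cdot>\<^sub>m A) \<le> cmod c * mat_opnorm N A"
proof (rule mat_opnorm_least)
  show "0 \<le> cmod c * mat_opnorm N A" using mat_opnorm_ge0[OF A] by simp
  fix v :: "complex Matrix.vec" assume v: "v \<in> carrier_vec N"
  have "c \<cdot>\<^sub>m A *\<^sub>v v = c \<cdot>\<^sub>v (A *\<^sub>v v)"
    using A v by (intro eq_vecI) (auto simp: scalar_prod_def sum_distrib_left mult_ac)
  then show "cvec_norm (c \<cdot>\<^sub>m A *\<^sub>v v) \<le> cmod c * mat_opnorm N A * cvec_norm v"
    using mat_opnorm_upper[OF A v] by (simp add: cvec_norm_smult mult.assoc mult_left_mono)
qed

lemma mat_seminorm: "cstar_seminorm (mat_algebra N) (mat_opnorm N)"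
  unfolding cstar_seminorm_def mat_algebra_simps
proof (intro conjI ballI allI)
  fix A B :: "complex mat" assume A: "A \<in> carrier_mat N N" and B: "B \<in> carrier_mat N N"
  show "mat_opnorm N (A * B) \<le> mat_opnorm N A * mat_opnorm N B" by (rule mat_opnorm_mult[OF A B])
  show "mat_opnorm N (A + B) \<le> mat_opnorm N A + mat_opnorm N B"
  proof (rule mat_opnorm_least)
    show "0 \<le> mat_opnorm N A + mat_opnorm N B" using mat_opnorm_ge0 A B by simp
    fix v :: "complex Matrix.vec" assume v: "v \<in> carrier_vec N"
    have "cvec_norm ((A + B) *\<^sub>v v) \<le> cvec_norm (A *\<^sub>v v) + cvec_norm (B *\<^sub>v v)"
      using A B v cvec_norm_add[of "A *\<^sub>v v" N "B *\<^sub>v v"] by (simp add: add_mult_distrib_mat_vec[of _ N N])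
    also have "\<dots> \<le> mat_opnorm N A * cvec_norm v + mat_opnorm N B * cvec_norm v"
      by (intro add_mono mat_opnorm_upper A B v)
    finally show "cvec_norm ((A + B) *\<^sub>v v) \<le> (mat_opnorm N A + mat_opnorm N B) * cvec_norm v"
      by (simp add: algebra_simps)
  qed
next
  fix A :: "complex mat" and c assume A: "A \<in> carrier_mat N N"
  show "0 \<le> mat_opnorm N A" by (rule mat_opnorm_ge0[OF A])
  show "mat_opnorm N (c \<cdot>\<^sub>m A) = cmod c * mat_opnorm N A"
  proof (cases "c = 0")
    case True
    then show ?thesis using mat_opnorm_smult_le[OF A, of 0] mat_opnorm_ge0[of "0 \<cdot>\<^sub>m A" N] A by simp
  next
    case False
    have "(1/c) \<cdot>\<^sub>m (c \<cdot>\<^sub>m A) = A" using False A by (intro eq_matI) auto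
    then have "mat_opnorm N A \<le> cmod (1/c) * mat_opnorm N (c \<cdot>\<^sub>m A)"
      using mat_opnorm_smult_le[of "c \<cdot>\<^sub>m A" N "1/c"] False A by simp
    then have "cmod c * mat_opnorm N A \<le> mat_opnorm N (c \<cdot>\<^sub>m A)" using False by (simp add: norm_divide field_simps)
    then show ?thesis using mat_opnorm_smult_le[OF A, of c] by simp
  qed
  have "mat_adjoint (mat_adjoint A) = A"
    using star_alg.star_star[OF mat_star_alg, of A N] A by simp
  then have "mat_opnorm N (mat_adjoint A) \<le> mat_opnorm N A"
    using mat_opnorm_adjoint_le[OF mat_adjoint_carrier[OF A]] by simp
  then have "mat_opnorm N (mat_adjoint A * A) \<le> mat_opnorm N A * mat_opnorm N A"
    using mat_opnorm_mult[OF mat_adjoint_carrier[OF A] A] mat_opnorm_ge0[OF A]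
    by (meson mult_right_mono order_trans)
  then show "mat_opnorm N (mat_adjoint A * A) = (mat_opnorm N A)\<^sup>2"
    using mat_opnorm_sq_le[OF A] by (simp add: power2_eq_square)
qed

text \<open>Completeness is entrywise: the operator norm lies between the largest entry and the sum of all entries.\<close>

lemma mat_cstar: "cstar (mat_algebra N) (mat_opnorm N)"
proof -
  interpret cstar_semi "mat_algebra N" "mat_opnorm N"
    by (simp add: cstar_semi_def cstar_semi_axioms_def mat_star_alg mat_seminorm)
  have dist: "seminorm_dist (mat_algebra N) (mat_opnorm N) A B = mat_opnorm N (A + (-1) \<cdot>\<^sub>m B)" for A B
    by (simp add: seminorm_dist_def)
  show ?thesis
  proof unfold_locales
    fix A assume "A \<in> carrier (mat_algebra N)" "mat_opnorm N A = 0"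
    then show "A = \<zero>\<^bsub>mat_algebra N\<^esub>"
      using mat_entry_le_opnorm[of A N] by (intro eq_matI) auto
  next
    fix f assume f: "f \<in> cauchy_seqs (mat_algebra N) (mat_opnorm N)"
    then have fC: "f k \<in> carrier_mat N N" for k by (simp add: cauchy_seqs_def)
    have ent: "cmod (f k $$ (i, j) - f l $$ (i, j)) \<le> seminorm_dist (mat_algebra N) (mat_opnorm N) (f k) (f l)"
      if "i < N" "j < N" for i j k l
      using mat_entry_le_opnorm[of "f k + (-1) \<cdot>\<^sub>m f l" N i j] that fC[of k] fC[of l] unfolding dist by simp
    have "Cauchy (\<lambda>k. f k $$ (i, j))" if ij: "i < N" "j < N" for i j
    proof (rule metric_CauchyI)
      fix e :: real assume "e > 0"
      then obtain K where K: "\<forall>k\<ge>K. \<forall>l\<ge>K. seminorm_dist (mat_algebra N) (mat_opnorm N) (f k) (f l) < e"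
        using f unfolding cauchy_seqs_def by blast
      have "dist (f m $$ (i, j)) (f n $$ (i, j)) < e" if "m \<ge> K" "n \<ge> K" for m n
        using ent[OF ij, of m n] K that unfolding dist_norm by (meson le_less_trans)
      then show "\<exists>M. \<forall>m\<ge>M. \<forall>n\<ge>M. dist (f m $$ (i, j)) (f n $$ (i, j)) < e" by blast
    qed
    then have L: "(\<lambda>k. f k $$ (i, j)) \<longlonglongrightarrow> lim (\<lambda>k. f k $$ (i, j))" if "i < N" "j < N" for i j
      using that by (simp add: Cauchy_convergent_iff convergent_LIMSEQ_iff)
    define B where "B = Matrix.mat N N (\<lambda>(i, j). lim (\<lambda>k. f k $$ (i, j)))"
    have B: "B \<in> carrier_mat N N" by (simp add: B_def)
    have "conv f B"
    proof (rule conv_bound)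
      show "f k \<in> carrier (mat_algebra N)" for k using fC by simp
      show "B \<in> carrier (mat_algebra N)" using B by simp
      show "seminorm_dist (mat_algebra N) (mat_opnorm N) (f k) B
        \<le> (\<Sum>i<N. \<Sum>j<N. cmod (f k $$ (i, j) - lim (\<lambda>k. f k $$ (i, j))))" for k
      proof -
        have "f k + (-1) \<cdot>\<^sub>m B \<in> carrier_mat N N" using fC B by auto
        then show ?thesis using mat_opnorm_le_entries[of "f k + (-1) \<cdot>\<^sub>m B" N] fC[of k] B
          unfolding dist by (simp add: B_def)
      qed
      show "(\<lambda>k. \<Sum>i<N. \<Sum>j<N. cmod (f k $$ (i, j) - lim (\<lambda>k. f k $$ (i, j)))) \<longlonglongrightarrow> 0"
        using L by (intro tendsto_null_sum tendsto_norm_zero LIM_zero) auto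
    qed
    then show "\<exists>l. conv f l" by blast
  qed
qed

lemma ntr_add: "A \<in> carrier_mat N N ==> B \<in> carrier_mat N N ==> ntr N (A + B) = ntr N A + ntr N B"
  by (simp add: ntr_def sum.distrib add_divide_distrib)

lemma ntr_smult: "A \<in> carrier_mat N N ==> ntr N (c \<cdot>\<^sub>m A) = c * ntr N A"
  by (simp add: ntr_def sum_distrib_left)

lemma ntr_bound: assumes A: "A \<in> carrier_mat N N" shows "cmod (ntr N A) \<le> mat_opnorm N A"
proof (cases "N = 0")
  case True
  then show ?thesis using mat_opnorm_ge0[OF A] by (simp add: ntr_def)
next
  case False
  have "cmod (\<Sum>i<N. A $$ (i, i)) \<le> (\<Sum>i<N. cmod (A $$ (i, i)))" by (rule norm_sum)
  also have "\<dots> \<le> (\<Sum>i<N. mat_opnorm N A)" by (rule sum_mono) (use mat_entry_le_opnorm[OF A] in auto)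
  finally show ?thesis using False by (simp add: ntr_def norm_divide divide_le_eq mult.commute)
qed

lemma unitary_conj_hom:
  assumes V: "V \<in> unitary_mats N"
  shows "(\<lambda>A. V * A * mat_adjoint V) \<in> unital_star_hom (mat_algebra N) (mat_algebra N)"
proof -
  have Vc: "V \<in> carrier_mat N N" "V * mat_adjoint V = 1\<^sub>m N" "mat_adjoint V * V = 1\<^sub>m N"
    using V by (auto simp: unitary_mats_def)
  let ?W = "mat_adjoint V"
  have W: "?W \<in> carrier_mat N N" using Vc by simp
  note as = assoc_mult_mat[of _ N N _ N _ N] mult_carrier_mat[of _ N N _ N]
  interpret star_alg "mat_algebra N" by (rule mat_star_alg)
  have ss: "mat_adjoint ?W = V" using star_star[of V] Vc by simp
  show ?thesis
  proof (rule unital_star_homI)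
    fix A B c assume A0: "A \<in> carrier (mat_algebra N)"
    then have A: "A \<in> carrier_mat N N" by simp
    show "V * A * ?W \<in> carrier (mat_algebra N)" using Vc(1) W A by (simp add: as)
    show "V * smul (mat_algebra N) c A * ?W = smul (mat_algebra N) c (V * A * ?W)"
      using Vc(1) W A by (simp add: as mult_smult_distrib[of _ N N _ N] mult_smult_assoc_mat[of _ N N _ N])
    show "V * star (mat_algebra N) A * ?W = star (mat_algebra N) (V * A * ?W)"
      using Vc(1) W A by (simp add: mat_adjoint_mult[of _ N] ss as)
    assume "B \<in> carrier (mat_algebra N)"
    then have B: "B \<in> carrier_mat N N" by simp
    show "V * (A \<oplus>\<^bsub>mat_algebra N\<^esub> B) * ?W = V * A * ?W \<oplus>\<^bsub>mat_algebra N\<^esub> V * B * ?W"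
      using Vc(1) W A B by (simp add: as(2) add_mult_distrib_mat[of _ N N _ _ N] mult_add_distrib_mat[of _ N N _ N])
    have "(V * A * ?W) * (V * B * ?W) = V * (A * ((?W * V) * (B * ?W)))"
      using Vc(1) W A B by (simp add: as)
    also have "\<dots> = V * (A * B) * ?W" unfolding Vc(3) using Vc(1) W A B by (simp add: as)
    finally show "V * (A \<otimes>\<^bsub>mat_algebra N\<^esub> B) * ?W = V * A * ?W \<otimes>\<^bsub>mat_algebra N\<^esub> (V * B * ?W)" by simp
  next
    show "V * \<one>\<^bsub>mat_algebra N\<^esub> * ?W = \<one>\<^bsub>mat_algebra N\<^esub>" using Vc by simp
  qed
qed

section \<open>Hilbert space\<close>

instance complex_hilbert_space \<subseteq> banach ..

lemma cinner_add_left: "cinner (x + y) z = cinner x z + cinner y z" for x :: "'h::complex_hilbert_space"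
  by (metis cinner_add_right cinner_commute complex_cnj_add)

lemma cinner_scaleC_left: "cinner (scaleC c x) y = cnj c * cinner x y" for x :: "'h::complex_hilbert_space"
  by (metis cinner_commute cinner_scaleC_right complex_cnj_mult)

lemma cinner_scaleR_right: "cinner x (t *\<^sub>R y) = of_real t * cinner x y" for x :: "'h::complex_hilbert_space"
  by (metis cinner_scaleC_right scaleC_of_real)

lemma cinner_scaleR_left: "cinner (t *\<^sub>R x) y = of_real t * cinner x y" for x :: "'h::complex_hilbert_space"
  by (metis cinner_scaleC_left scaleC_of_real complex_cnj_complex_of_real)

lemma cinner_minus_right: "cinner x (- y) = - cinner x y" for x :: "'h::complex_hilbert_space"
  using cinner_scaleR_right[of x "-1" y] by simp

lemma cinner_minus_left: "cinner (- x) y = - cinner x y" for x :: "'h::complex_hilbert_space"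
  using cinner_scaleR_left[of "-1" x y] by simp

lemma cinner_diff_right: "cinner x (y - z) = cinner x y - cinner x z" for x :: "'h::complex_hilbert_space"
  using cinner_add_right[of x y "- z"] by (simp add: cinner_minus_right)

lemma cinner_diff_left: "cinner (x - y) z = cinner x z - cinner y z" for x :: "'h::complex_hilbert_space"
  using cinner_add_left[of x "- y" z] by (simp add: cinner_minus_left)

lemma cinner_zero_right [simp]: "cinner x 0 = 0" for x :: "'h::complex_hilbert_space"
  using cinner_scaleR_right[of x 0 0] by simp

lemma cinner_zero_left [simp]: "cinner 0 x = 0" for x :: "'h::complex_hilbert_space"
  using cinner_scaleR_left[of 0 0 x] by simp

lemma cinner_eqI:
  fixes x y :: "'h::complex_hilbert_space"
  assumes "\<And>z. cinner z x = cinner z y" shows "x = y"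
proof -
  have "cinner (x - y) (x - y) = 0" using assms[of "x - y"] by (simp add: cinner_diff_right)
  then show ?thesis by (simp add: cinner_self)
qed

lemma scaleC_diff_right: "scaleC c (x - y) = scaleC c x - scaleC c y" for x :: "'h::complex_hilbert_space"
  by (rule cinner_eqI) (simp add: cinner_diff_right cinner_scaleC_right algebra_simps)

lemma scaleC_zero_right [simp]: "scaleC c (0 :: 'h::complex_hilbert_space) = 0"
  by (rule cinner_eqI) (simp add: cinner_scaleC_right)

lemma norm_scaleC: "norm (scaleC c x) = cmod c * norm x" for x :: "'h::complex_hilbert_space"
proof -
  have "complex_of_real ((norm (scaleC c x))\<^sup>2) = (c * cnj c) * of_real ((norm x)\<^sup>2)"
    by (simp only: cinner_self[symmetric] cinner_scaleC_left cinner_scaleC_right mult_ac)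
  also have "\<dots> = of_real ((cmod c * norm x)\<^sup>2)"
    by (simp add: complex_norm_square[symmetric] power_mult_distrib)
  finally have "(norm (scaleC c x))\<^sup>2 = (cmod c * norm x)\<^sup>2" by (simp only: of_real_eq_iff)
  then show ?thesis by (simp add: power2_eq_iff_nonneg)
qed

lemma norm_add_sq: "(norm (x + y))\<^sup>2 = (norm x)\<^sup>2 + 2 * Re (cinner x y) + (norm y)\<^sup>2" for x :: "'h::complex_hilbert_space"
proof -
  have "complex_of_real ((norm (x + y))\<^sup>2) = of_real ((norm x)\<^sup>2) + cinner x y + cinner y x + of_real ((norm y)\<^sup>2)"
    by (simp only: cinner_self[symmetric] cinner_add_left cinner_add_right add_ac)
  then have "Re (complex_of_real ((norm (x + y))\<^sup>2)) = Re (of_real ((norm x)\<^sup>2) + cinner x y + cinner y x + of_real ((norm y)\<^sup>2))"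
    by (rule arg_cong)
  moreover have "Re (cinner y x) = Re (cinner x y)" by (subst cinner_commute) simp
  ultimately show ?thesis by simp
qed

lemma norm_diff_sq: "(norm (x - y))\<^sup>2 = (norm x)\<^sup>2 - 2 * Re (cinner x y) + (norm y)\<^sup>2" for x :: "'h::complex_hilbert_space"
  using norm_add_sq[of x "- y"] by (simp add: cinner_minus_right)

lemma parallelogram: "(norm (x - y))\<^sup>2 = 2 * (norm x)\<^sup>2 + 2 * (norm y)\<^sup>2 - 4 * (norm ((1/2) *\<^sub>R (x + y)))\<^sup>2"
  for x :: "'h::complex_hilbert_space"
proof -
  have "(norm ((1/2) *\<^sub>R (x + y)))\<^sup>2 = (norm (x + y))\<^sup>2 / 4" by (simp add: power_divide)
  then show ?thesis using norm_add_sq[of x y] norm_diff_sq[of x y] by simp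
qed

lemma Re_cinner_le: "Re (cinner x y) \<le> norm x * norm y" for x :: "'h::complex_hilbert_space"
proof -
  have "(norm (x + y))\<^sup>2 \<le> (norm x + norm y)\<^sup>2" by (intro power_mono norm_triangle_ineq) simp
  then show ?thesis by (simp add: norm_add_sq power2_sum)
qed

lemma cinner_le: "cmod (cinner x y) \<le> norm x * norm y" for x :: "'h::complex_hilbert_space"
proof (cases "cinner x y = 0")
  case False
  define c where "c = cnj (cinner x y) / of_real (cmod (cinner x y))"
  have c: "cmod c = 1" using False by (simp add: c_def norm_divide)
  have "c * cinner x y = of_real (cmod (cinner x y))"
    using False by (simp add: c_def complex_norm_square[symmetric] power2_eq_square mult.commute divide_eq_eq)
  then have "Re (cinner x (scaleC c y)) = cmod (cinner x y)" by (simp add: cinner_scaleC_right)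
  then show ?thesis using Re_cinner_le[of x "scaleC c y"] by (simp add: norm_scaleC c)
qed simp

lemma cinner_tendsto: "(f \<longlongrightarrow> x) F ==> (g \<longlongrightarrow> y) F ==> ((\<lambda>k. cinner (f k) (g k)) \<longlongrightarrow> cinner x y) F"
  for x y :: "'h::complex_hilbert_space"
proof -
  have "bounded_bilinear (cinner :: 'h => 'h => complex)"
    by (rule bounded_bilinear.intro)
       (auto simp: cinner_add_left cinner_add_right cinner_scaleR_left cinner_scaleR_right scaleR_conv_of_real
        intro!: exI[of _ 1] cinner_le)
  then show "(f \<longlongrightarrow> x) F ==> (g \<longlongrightarrow> y) F ==> ((\<lambda>k. cinner (f k) (g k)) \<longlongrightarrow> cinner x y) F"
    by (rule bounded_bilinear.tendsto)
qed

text \<open>The projection theorem for the closure of the real subspace \<open>C\<close> of \<open>K\<close>-tuples: a minimizing sequence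
  is Cauchy by the parallelogram law. It is stated for sequences of which only the first \<open>K\<close> entries count, so that no type of
  tuples is needed. Real subspaces matter in \<open>selfadjoint_adherent\<close>, where the self-adjoint elements of an algebra act.\<close>

lemma tuple_projection:
  fixes C :: "(nat => 'h::complex_hilbert_space) set" and v :: "nat => 'h" and K :: nat
  assumes zero: "(\<lambda>k. 0) \<in> C" and add: "\<And>a b. a \<in> C ==> b \<in> C ==> (\<lambda>k. a k + b k) \<in> C"
    and scale: "\<And>a t. a \<in> C ==> (\<lambda>k. t *\<^sub>R a k) \<in> C"
  shows "\<exists>p c. (\<forall>n. c n \<in> C) \<and> (\<forall>k<K. (\<lambda>n. c n k) \<longlonglongrightarrow> p k) \<and>
           (\<forall>a\<in>C. (\<Sum>k<K. Re (cinner (a k) (v k - p k))) = 0)"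
proof -
  define N2 where "N2 f = (\<Sum>k<K. (norm (f k :: 'h))\<^sup>2)" for f
  define d where "d = (INF c\<in>C. N2 (\<lambda>k. v k - c k))"
  have bdd: "bdd_below ((\<lambda>c. N2 (\<lambda>k. v k - c k)) ` C)" by (rule bdd_belowI2[of _ 0]) (simp add: N2_def sum_nonneg)
  have dle: "d \<le> N2 (\<lambda>k. v k - c k)" if "c \<in> C" for c
    unfolding d_def by (rule cINF_lower[OF bdd that])
  have "\<exists>c\<in>C. N2 (\<lambda>k. v k - c k) < d + 1 / real (Suc n)" for n
  proof (rule ccontr)
    assume "\<not> ?thesis"
    then have "d + 1 / real (Suc n) \<le> N2 (\<lambda>k. v k - c k)" if "c \<in> C" for c using that by (meson not_less)
    then have "d + 1 / real (Suc n) \<le> d"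
      by (subst (2) d_def) (rule cINF_greatest, use zero in auto)
    then show False by simp
  qed
  then obtain c where c: "\<And>n. c n \<in> C" "\<And>n. N2 (\<lambda>k. v k - c n k) < d + 1 / real (Suc n)" by metis
  have diff: "N2 (\<lambda>k. c m k - c n k) \<le> 2 / real (Suc n) + 2 / real (Suc m)" for m n
  proof -
    have avg: "(\<lambda>k. (1/2) *\<^sub>R (c n k + c m k)) \<in> C" using scale[OF add[OF c(1) c(1)]] .
    have "N2 (\<lambda>k. c m k - c n k) = 2 * N2 (\<lambda>k. v k - c n k) + 2 * N2 (\<lambda>k. v k - c m k)
       - 4 * N2 (\<lambda>k. v k - (1/2) *\<^sub>R (c n k + c m k))"
    proof -
      have "(norm (c m k - c n k))\<^sup>2 = 2 * (norm (v k - c n k))\<^sup>2 + 2 * (norm (v k - c m k))\<^sup>2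
         - 4 * (norm (v k - (1/2) *\<^sub>R (c n k + c m k)))\<^sup>2" for k
      proof -
        have "(1/2) *\<^sub>R ((v k - c n k) + (v k - c m k)) = v k - (1/2) *\<^sub>R (c n k + c m k)"
          by (simp add: algebra_simps scaleR_2[symmetric])
        then show ?thesis using parallelogram[of "v k - c n k" "v k - c m k"] by simp
      qed
      then show ?thesis by (simp add: N2_def sum.distrib sum_subtractf sum_distrib_left)
    qed
    also have "\<dots> \<le> 2 * (d + 1 / real (Suc n)) + 2 * (d + 1 / real (Suc m)) - 4 * d"
    proof -
      have "2 * x + 2 * y - 4 * z \<le> 2 * (d + s) + 2 * (d + t) - 4 * d" if "d \<le> z" "x < d + s" "y < d + t" for x y z s t :: real
        using that by (simp add: distrib_left)
      from this[OF dle[OF avg] c(2)[of n] c(2)[of m]] show ?thesis .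
    qed
    finally show ?thesis by simp
  qed
  have lim1: "(\<lambda>n. 1 / real (Suc n)) \<longlonglongrightarrow> 0" using LIMSEQ_inverse_real_of_nat by (simp add: inverse_eq_divide)
  have "Cauchy (\<lambda>n. c n k)" if k: "k < K" for k
  proof (rule metric_CauchyI)
    fix e :: real assume e: "e > 0"
    then obtain M where M: "\<And>n. n \<ge> M ==> 1 / real (Suc n) < e\<^sup>2 / 4"
      using order_tendstoD(2)[OF lim1, of "e\<^sup>2 / 4"] by (auto simp: eventually_sequentially)
    have "dist (c m k) (c n k) < e" if "m \<ge> M" "n \<ge> M" for m n
    proof -
      have "(norm (c m k - c n k))\<^sup>2 \<le> N2 (\<lambda>k. c m k - c n k)"
        unfolding N2_def using k by (intro member_le_sum) auto
      also have "\<dots> < e\<^sup>2" using diff[of m n] M[OF that(1)] M[OF that(2)] by simp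
      finally show ?thesis using e by (simp add: dist_norm power2_less_imp_less)
    qed
    then show "\<exists>M. \<forall>m\<ge>M. \<forall>n\<ge>M. dist (c m k) (c n k) < e" by blast
  qed
  then have "\<forall>k. \<exists>q. k < K \<longrightarrow> (\<lambda>n. c n k) \<longlonglongrightarrow> q" using Cauchy_convergent convergent_def by blast
  then obtain p where p: "\<And>k. k < K ==> (\<lambda>n. c n k) \<longlonglongrightarrow> p k" by metis
  have orth: "(\<Sum>k<K. Re (cinner (a k) (v k - p k))) = 0" if a: "a \<in> C" for a
  proof -
    let ?s = "\<Sum>k<K. Re (cinner (a k) (v k - p k))"
    have N2lim: "(\<lambda>n. N2 (\<lambda>k. v k - c n k - t *\<^sub>R a k)) \<longlonglongrightarrow> N2 (\<lambda>k. v k - p k - t *\<^sub>R a k)" for t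
      unfolding N2_def by (intro tendsto_intros) (use p in auto)
    have d0: "N2 (\<lambda>k. v k - p k) \<le> d"
    proof (rule LIMSEQ_le)
      show "(\<lambda>n. N2 (\<lambda>k. v k - c n k)) \<longlonglongrightarrow> N2 (\<lambda>k. v k - p k)" using N2lim[of 0] by simp
      show "(\<lambda>n. d + 1 / real (Suc n)) \<longlonglongrightarrow> d" using tendsto_add[OF tendsto_const lim1, of d] by simp
      show "\<exists>N. \<forall>n\<ge>N. N2 (\<lambda>k. v k - c n k) \<le> d + 1 / real (Suc n)" using c(2) less_imp_le by blast
    qed
    have dt: "d \<le> N2 (\<lambda>k. v k - p k - t *\<^sub>R a k)" for t
    proof (rule LIMSEQ_le_const[OF N2lim])
      have "d \<le> N2 (\<lambda>k. v k - c n k - t *\<^sub>R a k)" for n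
        using dle[OF add[OF c(1)[of n] scale[OF a, of t]]] by (simp add: diff_diff_eq)
      then show "\<exists>N. \<forall>n\<ge>N. d \<le> N2 (\<lambda>k. v k - c n k - t *\<^sub>R a k)" by blast
    qed
    have exp: "N2 (\<lambda>k. v k - p k - t *\<^sub>R a k) = N2 (\<lambda>k. v k - p k) - 2 * t * ?s + t\<^sup>2 * N2 a" for t
    proof -
      have "(norm (v k - p k - t *\<^sub>R a k))\<^sup>2 = (norm (v k - p k))\<^sup>2 - 2 * t * Re (cinner (a k) (v k - p k)) + t\<^sup>2 * (norm (a k))\<^sup>2" for k
      proof -
        have "Re (cinner (v k - p k) (t *\<^sub>R a k)) = t * Re (cinner (a k) (v k - p k))"
          by (subst cinner_commute) (simp add: cinner_scaleR_left)
        then show ?thesis by (subst norm_diff_sq) (simp add: power_mult_distrib)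
      qed
      then show ?thesis by (simp add: N2_def sum.distrib sum_subtractf sum_distrib_left)
    qed
    have ineq: "2 * t * ?s \<le> t\<^sup>2 * N2 a" for t using dt[of t] d0 exp[of t] by linarith
    have Na: "N2 a \<ge> 0" by (simp add: N2_def sum_nonneg)
    define t where "t = ?s / (N2 a + 1)"
    have "2 * t * ?s = 2 * (?s\<^sup>2 / (N2 a + 1))" by (simp add: t_def power2_eq_square)
    moreover have "t\<^sup>2 * N2 a \<le> ?s\<^sup>2 / (N2 a + 1)"
    proof -
      have "t\<^sup>2 * N2 a \<le> t\<^sup>2 * (N2 a + 1)" by (simp add: mult_left_mono)
      also have "\<dots> = ?s\<^sup>2 / (N2 a + 1)" using Na by (simp add: t_def power_divide power2_eq_square)
      finally show ?thesis .
    qed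
    ultimately have "?s\<^sup>2 / (N2 a + 1) \<le> 0" using ineq[of t] by linarith
    then have "?s\<^sup>2 \<le> 0" using Na by (simp add: divide_le_0_iff)
    then show ?thesis by simp
  qed
  show ?thesis using c(1) p orth by blast
qed

section \<open>Bounded operators\<close>

lemma bounded_opsD: "T \<in> bounded_ops ==> T (scaleC c x) = scaleC c (T x)"
  by (simp add: bounded_ops_def)

text \<open>The functional is represented by a multiple of the component of a vector orthogonal to its kernel.\<close>

lemma riesz:
  fixes T :: "'h::complex_hilbert_space \<Rightarrow>\<^sub>L 'h"
  assumes T: "T \<in> bounded_ops"
  shows "\<exists>z. \<forall>y. cinner z y = cinner x (T y)"
proof -
  define l where "l y = cinner x (T y)" for y
  have ladd: "l (y + z) = l y + l z" and lsc: "l (scaleC c y) = c * l y" and lsr: "l (t *\<^sub>R y) = of_real t * l y" for y z c t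
    by (simp_all add: l_def blinfun.add_right cinner_add_right bounded_opsD[OF T] cinner_scaleC_right
        blinfun.scaleR_right cinner_scaleR_right)
  have llim: "(\<lambda>n. l (f n)) \<longlonglongrightarrow> l y" if "f \<longlonglongrightarrow> y" for f y
    unfolding l_def by (intro cinner_tendsto blinfun.tendsto tendsto_const that)
  have "\<exists>z. \<forall>y. cinner z y = l y"
  proof (cases "\<forall>y. l y = 0")
    case True
    then show ?thesis by (intro exI[of _ 0]) simp
  next
    case False
    then obtain v where v: "l v \<noteq> 0" by blast
    define C where "C = {a :: nat => 'h. l (a 0) = 0}"
    have l0: "l 0 = 0" using lsr[of 0 0] by simp
    have "\<exists>p c. (\<forall>n. c n \<in> C) \<and> (\<forall>k<1. (\<lambda>n. c n k) \<longlonglongrightarrow> p k) \<and>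
           (\<forall>a\<in>C. (\<Sum>k<1. Re (cinner (a k) ((\<lambda>_. v) k - p k))) = 0)"
      by (rule tuple_projection) (auto simp: C_def ladd lsr l0)
    then obtain p c where c: "\<And>n. c n \<in> C" "(\<lambda>n. c n 0) \<longlonglongrightarrow> p (0::nat)"
        and o: "\<And>a. a \<in> C ==> Re (cinner (a 0) (v - p 0)) = 0" by auto
    have lp: "l (p 0) = 0"
    proof -
      have "(\<lambda>n. l (c n 0)) \<longlonglongrightarrow> l (p 0)" by (rule llim[OF c(2)])
      moreover have "l (c n 0) = 0" for n using c(1) by (simp add: C_def)
      ultimately show ?thesis by (simp add: LIMSEQ_const_iff)
    qed
    define w where "w = v - p 0"
    have lw: "l w \<noteq> 0"
    proof
      assume "l w = 0"
      then have "l (w + p 0) = 0" using lp ladd by simp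
      then show False using v by (simp add: w_def)
    qed
    have wn: "norm w \<noteq> 0" using lw l0 by auto
    have orth: "cinner a w = 0" if a: "l a = 0" for a
    proof (rule complex_eqI)
      show "Re (cinner a w) = Re 0" using o[of "\<lambda>_. a"] a by (simp add: C_def w_def)
      have "Re (cinner (scaleC \<i> a) w) = 0" using o[of "\<lambda>_. scaleC \<i> a"] a by (simp add: C_def w_def lsc)
      then show "Im (cinner a w) = Im 0" by (simp add: cinner_scaleC_left)
    qed
    let ?z = "scaleC (cnj (l w) / of_real ((norm w)\<^sup>2)) w"
    have "cinner ?z y = l y" for y
    proof -
      have "l (y + scaleC (- (l y / l w)) w) = 0" using lw by (simp add: ladd lsc)
      then have "cinner w (y + scaleC (- (l y / l w)) w) = 0" using orth by (subst cinner_commute) simp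
      then have "cinner w y = l y / l w * of_real ((norm w)\<^sup>2)"
        by (simp add: cinner_add_right cinner_scaleC_right cinner_self)
      then show ?thesis using lw wn by (simp add: cinner_scaleC_left)
    qed
    then show ?thesis by blast
  qed
  then show ?thesis by (simp add: l_def)
qed

lemma op_adjoint:
  fixes T :: "'h::complex_hilbert_space \<Rightarrow>\<^sub>L 'h"
  assumes T: "T \<in> bounded_ops"
  shows "op_adjoint T \<in> bounded_ops"
    and "cinner ((op_adjoint T) x) y = cinner x (T y)"
    and "S \<in> bounded_ops ==> (\<And>x y. cinner (S x) y = cinner x (T y)) ==> op_adjoint T = S"
proof -
  obtain f where f: "\<And>x y. cinner (f x) y = cinner x (T y)" using riesz[OF T] by metis
  have eqI: "a = b" if "\<And>y. cinner a y = cinner b y" for a b :: 'h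
    by (rule cinner_eqI) (metis that cinner_commute)
  have nf: "norm (f x) \<le> norm x * norm T" for x
  proof (cases "f x = 0")
    case False
    have "(norm (f x))\<^sup>2 = cmod (cinner (f x) (f x))" by (simp only: cinner_self norm_of_real abs_power2)
    also have "\<dots> = cmod (cinner x (T (f x)))" by (simp add: f)
    also have "\<dots> \<le> norm x * (norm T * norm (f x))"
      by (rule order_trans[OF cinner_le]) (intro mult_left_mono norm_blinfun norm_ge_zero)
    finally have "norm (f x) * norm (f x) \<le> (norm x * norm T) * norm (f x)" by (simp add: power2_eq_square mult_ac)
    then show ?thesis using False by simp
  qed simp
  have bl: "bounded_linear f"
    by (rule bounded_linear_intro[where K="norm T"])
       (auto intro!: eqI nf simp: f cinner_add_left cinner_scaleR_left)
  have fs: "f (scaleC c x) = scaleC c (f x)" for c x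
    by (rule eqI) (simp add: f cinner_scaleC_left)
  let ?Q = "\<lambda>S. S \<in> bounded_ops \<and> (\<forall>x y. cinner (S x) y = cinner x (T y))"
  have 1: "?Q (Blinfun f)"
    by (auto simp: bounded_ops_def bounded_linear_Blinfun_apply[OF bl] fs f)
  have 2: "S = S'" if "?Q S" "?Q S'" for S S'
    by (rule blinfun_eqI) (rule eqI, use that in simp)
  have Q: "?Q (op_adjoint T)" unfolding op_adjoint_def by (rule theI[where P="?Q", OF 1 2[OF _ 1]])
  then show "op_adjoint T \<in> bounded_ops" "cinner ((op_adjoint T) x) y = cinner x (T y)" by auto
  show "S \<in> bounded_ops ==> (\<And>x y. cinner (S x) y = cinner x (T y)) ==> op_adjoint T = S"
    using 2[of "op_adjoint T" S] Q by blast
qed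

lemma op_adjoint_right: "T \<in> bounded_ops ==> cinner x ((op_adjoint T) y) = cinner (T x) y"
  for T :: "'h::complex_hilbert_space \<Rightarrow>\<^sub>L 'h"
  by (metis cinner_commute op_adjoint(2))

definition op_scale :: "complex => ('h::complex_hilbert_space \<Rightarrow>\<^sub>L 'h) => ('h \<Rightarrow>\<^sub>L 'h)" where
  "op_scale c T = Blinfun (\<lambda>x. scaleC c (T x))"

lemma op_scale_apply [simp]: "(op_scale c T) x = scaleC c (T x)"
proof -
  have "bounded_linear (\<lambda>x. scaleC c (T x))"
  proof (rule bounded_linear_intro[where K="cmod c * norm T"])
    show "scaleC c (T (r *\<^sub>R x)) = r *\<^sub>R scaleC c (T x)" for r x
      unfolding blinfun.scaleR_right by (simp only: scaleC_of_real[symmetric] scaleC_scaleC mult.commute)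
    show "norm (scaleC c (T x)) \<le> norm x * (cmod c * norm T)" for x
      using mult_left_mono[OF norm_blinfun[of T x], of "cmod c"] by (simp add: norm_scaleC mult_ac)
  qed (simp add: blinfun.add_right scaleC_add_right)
  then show ?thesis by (simp add: op_scale_def bounded_linear_Blinfun_apply)
qed

lemma op_algebra_simps [simp]:
  "carrier (op_algebra M) = M" "S \<otimes>\<^bsub>op_algebra M\<^esub> T = S o\<^sub>L T" "S \<oplus>\<^bsub>op_algebra M\<^esub> T = S + T"
  "\<one>\<^bsub>op_algebra M\<^esub> = id_blinfun" "\<zero>\<^bsub>op_algebra M\<^esub> = 0" "smul (op_algebra M) c T = op_scale c T"
  "star (op_algebra M) T = op_adjoint T"
  by (simp_all add: op_algebra_def op_scale_def)

lemma bounded_ops_closed: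
  shows "S \<in> bounded_ops ==> T \<in> bounded_ops ==> S + T \<in> bounded_ops"
    and "S \<in> bounded_ops ==> T \<in> bounded_ops ==> S o\<^sub>L T \<in> bounded_ops"
    and "T \<in> bounded_ops ==> op_scale c T \<in> bounded_ops" and "id_blinfun \<in> bounded_ops" and "0 \<in> bounded_ops"
  by (auto simp: bounded_ops_def blinfun.add_left scaleC_add_right scaleC_scaleC mult.commute)

lemma vN_closed:
  assumes "von_neumann_algebra M"
  shows "T \<in> M ==> T \<in> bounded_ops" "id_blinfun \<in> M" "S \<in> M ==> T \<in> M ==> S + T \<in> M"
    "S \<in> M ==> T \<in> M ==> S o\<^sub>L T \<in> M" "T \<in> M ==> op_scale c T \<in> M" "T \<in> M ==> op_adjoint T \<in> M" "0 \<in> M"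
proof -
  show c: "T \<in> M ==> T \<in> bounded_ops" "id_blinfun \<in> M" "S \<in> M ==> T \<in> M ==> S + T \<in> M"
    "S \<in> M ==> T \<in> M ==> S o\<^sub>L T \<in> M" "T \<in> M ==> op_scale c T \<in> M" "T \<in> M ==> op_adjoint T \<in> M" for S T c
    using assms unfolding von_neumann_algebra_def by auto
  have "op_scale 0 id_blinfun = (0 :: 'a \<Rightarrow>\<^sub>L 'a)"
    by (rule blinfun_eqI) (use scaleC_of_real[of 0] in simp)
  then show "0 \<in> M" using c(5)[OF c(2), of 0] by simp
qed

lemma op_star_alg: assumes M: "von_neumann_algebra M" shows "star_alg (op_algebra M)"
proof -
  note c = vN_closed[OF M]
  show ?thesis
  proof (rule star_algI; unfold op_algebra_simps)
    fix S T :: "'a \<Rightarrow>\<^sub>L 'a" and c assume S: "S \<in> M" and T: "T \<in> M"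
    note s = c(1)[OF S] and t = c(1)[OF T]
    note adj = op_adjoint(1,2)[OF s] op_adjoint(1,2)[OF t]
    show "op_adjoint (S + T) = op_adjoint S + op_adjoint T"
      by (rule op_adjoint(3)) (auto intro!: bounded_ops_closed s t adj simp: blinfun.add_left cinner_add_left cinner_add_right adj)
    show "op_adjoint (S o\<^sub>L T) = op_adjoint T o\<^sub>L op_adjoint S"
      by (rule op_adjoint(3)) (auto intro!: bounded_ops_closed s t adj simp: adj)
    show "op_scale c S o\<^sub>L T = op_scale c (S o\<^sub>L T)" "S o\<^sub>L op_scale c T = op_scale c (S o\<^sub>L T)"
      "op_scale c (S + T) = op_scale c S + op_scale c T"
      by (rule blinfun_eqI, simp add: bounded_opsD[OF s] blinfun.add_left scaleC_add_right)+
    show "S + T = T + S" by (rule add.commute)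
    show "S + T \<in> M" "S o\<^sub>L T \<in> M" using c S T by auto
  next
    fix T :: "'a \<Rightarrow>\<^sub>L 'a" and c d assume T: "T \<in> M"
    note t = c(1)[OF T]
    note adj = op_adjoint(1,2)[OF t]
    show "op_adjoint (op_scale c T) = op_scale (cnj c) (op_adjoint T)"
      by (rule op_adjoint(3)) (auto intro!: bounded_ops_closed t adj simp: cinner_scaleC_left cinner_scaleC_right adj)
    show "op_adjoint (op_adjoint T) = T"
      by (rule op_adjoint(3)[OF adj(1) t]) (rule op_adjoint_right[OF t, symmetric])
    show "op_scale (c + d) T = op_scale c T + op_scale d T" "op_scale c (op_scale d T) = op_scale (c * d) T"
      by (rule blinfun_eqI, simp add: blinfun.add_left scaleC_add_left scaleC_scaleC)+
    show "op_scale 1 T = T" "op_scale 0 T = 0"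
      using scaleC_of_real[of 1] scaleC_of_real[of 0] by (auto intro!: blinfun_eqI)
    show "op_adjoint T \<in> M" "op_scale c T \<in> M" using c T by auto
    show "id_blinfun o\<^sub>L T = T" "T o\<^sub>L id_blinfun = T" by (auto intro!: blinfun_eqI)
  qed (auto intro!: blinfun_eqI c(2,7) simp: blinfun.add_left blinfun.add_right)
qed

text \<open>\<open>\<parallel>T x\<parallel>\<^sup>2 = \<langle>T* T x, x\<rangle>\<close> gives one inequality; it also shows that
  \<open>T\<close> and its adjoint have the same norm, hence the other.\<close>

lemma norm_adjoint_comp:
  fixes T :: "'h::complex_hilbert_space \<Rightarrow>\<^sub>L 'h"
  assumes T: "T \<in> bounded_ops"
  shows "norm (op_adjoint T o\<^sub>L T) = (norm T)\<^sup>2"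
proof -
  have sq: "(norm T)\<^sup>2 \<le> norm (op_adjoint T o\<^sub>L T)" if T: "T \<in> bounded_ops" for T :: "'h \<Rightarrow>\<^sub>L 'h"
  proof -
    let ?B = "op_adjoint T o\<^sub>L T"
    have "norm T \<le> sqrt (norm ?B)"
    proof (rule norm_blinfun_bound)
      fix x
      have "(norm (T x))\<^sup>2 = cmod (cinner (T x) (T x))"
        by (simp only: cinner_self norm_of_real abs_power2)
      also have "\<dots> = cmod (cinner (?B x) x)" by (simp add: op_adjoint(2)[OF T])
      also have "\<dots> \<le> norm ?B * norm x * norm x"
        by (rule order_trans[OF cinner_le]) (intro mult_right_mono norm_blinfun norm_ge_zero)
      finally have "norm (T x) \<le> sqrt (norm ?B * norm x * norm x)" by (rule real_le_rsqrt)
      then show "norm (T x) \<le> sqrt (norm ?B) * norm x" by (simp add: real_sqrt_mult mult.assoc)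
    qed simp
    then have "(norm T)\<^sup>2 \<le> (sqrt (norm ?B))\<^sup>2" by (rule power_mono) simp
    then show ?thesis by simp
  qed
  have le: "norm T \<le> norm (op_adjoint T)" if T: "T \<in> bounded_ops" for T :: "'h \<Rightarrow>\<^sub>L 'h"
  proof (cases "T = 0")
    case False
    have "norm T * norm T \<le> norm (op_adjoint T) * norm T"
      using sq[OF T] norm_blinfun_compose[of "op_adjoint T" T] by (simp add: power2_eq_square)
    then show ?thesis using False by simp
  qed simp
  have "op_adjoint (op_adjoint T) = T"
    by (rule op_adjoint(3)[OF op_adjoint(1)[OF T] T]) (rule op_adjoint_right[OF T, symmetric])
  then have "norm (op_adjoint T) \<le> norm T" using le[OF op_adjoint(1)[OF T]] by simp
  then have "norm (op_adjoint T o\<^sub>L T) \<le> norm T * norm T"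
    using norm_blinfun_compose[of "op_adjoint T" T] by (meson mult_right_mono norm_ge_zero order_trans)
  then show ?thesis using sq[OF T] by (simp add: power2_eq_square)
qed

lemma norm_op_scale: "norm (op_scale c T) = cmod c * norm T" for T :: "'h::complex_hilbert_space \<Rightarrow>\<^sub>L 'h"
proof -
  have le: "norm (op_scale c T) \<le> cmod c * norm T" for c and T :: "'h \<Rightarrow>\<^sub>L 'h"
    by (rule norm_blinfun_bound) (auto simp: norm_scaleC mult.assoc intro!: mult_left_mono norm_blinfun)
  show ?thesis
  proof (cases "c = 0")
    case True
    then show ?thesis using le[of 0 T] by simp
  next
    case False
    have "op_scale (1 / c) (op_scale c T) = T"
      using False scaleC_of_real[of 1] by (intro blinfun_eqI) (simp add: scaleC_scaleC)
    then have "norm T \<le> cmod (1 / c) * norm (op_scale c T)" using le[of "1 / c" "op_scale c T"] by simp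
    then have "cmod c * norm T \<le> norm (op_scale c T)" using False by (simp add: norm_divide field_simps)
    then show ?thesis using le[of c T] by simp
  qed
qed

lemma op_seminorm: assumes M: "von_neumann_algebra M" shows "cstar_seminorm (op_algebra M) norm"
  unfolding cstar_seminorm_def
  using vN_closed(1)[OF M] by (auto simp: norm_op_scale norm_triangle_ineq norm_blinfun_compose norm_adjoint_comp)

text \<open>Finite intersections of the subbasic sets are a neighbourhood basis.\<close>

lemma generated_topology_nhd:
  assumes "openin (topology_generated_by \<S>) U" "T \<in> U"
  shows "\<exists>F. finite F \<and> F \<subseteq> \<S> \<and> T \<in> \<Inter>F \<and> \<Inter>F \<subseteq> U"
proof -
  have "generate_topology_on \<S> U" using assms(1) by (simp add: openin_topology_generated_by_iff)
  then show ?thesis using assms(2)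
  proof (induction rule: generate_topology_on.induct)
    case (Int a b)
    then obtain F G where "finite F \<and> F \<subseteq> \<S> \<and> T \<in> \<Inter>F \<and> \<Inter>F \<subseteq> a" "finite G \<and> G \<subseteq> \<S> \<and> T \<in> \<Inter>G \<and> \<Inter>G \<subseteq> b" by auto
    then show ?case by (intro exI[of _ "F \<union> G"]) auto
  next
    case (UN K)
    then obtain k where "k \<in> K" "T \<in> k" by blast
    then show ?case using UN(2)[of k] by (meson Union_upper subset_trans)
  next
    case (Basis s)
    then show ?case by (intro exI[of _ "{s}"]) auto
  qed simp
qed

lemma wot_topspace: "topspace (weak_operator_topology :: ('h::complex_hilbert_space \<Rightarrow>\<^sub>L 'h) topology) = bounded_ops"
proof -
  have "{T \<in> bounded_ops. cinner (0::'h) (T 0) \<in> UNIV} = bounded_ops" by simp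
  then show ?thesis unfolding weak_operator_topology_def topology_generated_by_topspace
    by (auto intro!: exI[of _ "bounded_ops :: ('h \<Rightarrow>\<^sub>L 'h) set"] exI[of _ "0::'h"] exI[of _ UNIV])
qed

lemma wot_continuous: "continuous_map weak_operator_topology euclidean (\<lambda>T. cinner x (T y))"
  for x y :: "'h::complex_hilbert_space"
proof -
  have "openin weak_operator_topology {T \<in> bounded_ops. cinner x (T y) \<in> U}" if "open U" for U
    unfolding weak_operator_topology_def by (rule topology_generated_by_Basis) (use that in blast)
  then show ?thesis by (simp add: continuous_map_def wot_topspace)
qed

text \<open>Norm convergence implies convergence in the weak operator topology.\<close>

lemma vN_norm_closed:
  assumes M: "von_neumann_algebra M" and f: "\<And>k. f k \<in> M" and lim: "f \<longlonglongrightarrow> T"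
  shows "T \<in> M"
proof (rule ccontr)
  assume n: "T \<notin> M"
  have ap: "(\<lambda>k. (f k) x) \<longlonglongrightarrow> T x" for x
    by (intro blinfun.tendsto lim tendsto_const)
  have T: "T \<in> bounded_ops"
    unfolding bounded_ops_def
  proof (intro CollectI allI)
    fix c x
    have "(\<lambda>k. scaleC c ((f k) x)) \<longlonglongrightarrow> scaleC c (T x)"
    proof (rule LIM_zero_cancel, rule tendsto_norm_zero_cancel)
      show "(\<lambda>k. norm (scaleC c ((f k) x) - scaleC c (T x))) \<longlonglongrightarrow> 0"
        using tendsto_mult_left[OF tendsto_norm_zero[OF LIM_zero[OF ap[of x]]], of "cmod c"]
        by (simp add: scaleC_diff_right[symmetric] norm_scaleC)
    qed
    then show "T (scaleC c x) = scaleC c (T x)"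
      using ap[of "scaleC c x"] bounded_opsD[OF vN_closed(1)[OF M f]] by (simp add: LIMSEQ_unique)
  qed
  have "openin weak_operator_topology (bounded_ops - M)"
    using M by (simp add: von_neumann_algebra_def closedin_def wot_topspace)
  then have "\<exists>F. finite F \<and> F \<subseteq> {{T \<in> bounded_ops. cinner x (T y) \<in> U} | x y U. open U} \<and>
     T \<in> \<Inter>F \<and> \<Inter>F \<subseteq> bounded_ops - M"
    unfolding weak_operator_topology_def by (rule generated_topology_nhd) (use T n in simp)
  then obtain F where F: "finite F" "F \<subseteq> {{T \<in> bounded_ops. cinner x (T y) \<in> U} | x y U. open U}"
     "T \<in> \<Inter>F" "\<Inter>F \<subseteq> bounded_ops - M"
    by (elim exE conjE)
  have "\<forall>\<^sub>F k in sequentially. \<forall>s\<in>F. f k \<in> s"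
  proof (rule eventually_ball_finite[OF F(1)], rule ballI)
    fix s assume s: "s \<in> F"
    then obtain x y U where s': "s = {T \<in> bounded_ops. cinner x (T y) \<in> U}" "open U" using F(2) by blast
    have "(\<lambda>k. cinner x ((f k) y)) \<longlonglongrightarrow> cinner x (T y)"
      by (intro cinner_tendsto tendsto_const ap)
    moreover have "cinner x (T y) \<in> U" using F(3) s s' by blast
    ultimately have "\<forall>\<^sub>F k in sequentially. cinner x ((f k) y) \<in> U"
      using s'(2) topological_tendstoD by blast
    then show "\<forall>\<^sub>F k in sequentially. f k \<in> s"
      by eventually_elim (use s'(1) vN_closed(1)[OF M f] in simp)
  qed
  then obtain k where "\<forall>s\<in>F. f k \<in> s" by (auto simp: eventually_sequentially)
  then show False using F(4) f[of k] by blast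
qed

lemma op_dist: "seminorm_dist (op_algebra M) norm S T = norm (S - T)" for T :: "'h::complex_hilbert_space \<Rightarrow>\<^sub>L 'h"
proof -
  have "op_scale (-1) T = - T"
    using scaleC_of_real[of "-1"] by (intro blinfun_eqI) (simp add: blinfun.minus_left)
  then show ?thesis by (simp add: seminorm_dist_def)
qed

lemma op_cstar: assumes M: "von_neumann_algebra M" shows "cstar (op_algebra M) norm"
proof -
  interpret cstar_semi "op_algebra M" norm
    by (simp add: cstar_semi_def cstar_semi_axioms_def op_star_alg[OF M] op_seminorm[OF M])
  show ?thesis
  proof unfold_locales
    fix f assume f: "f \<in> cauchy_seqs (op_algebra M) norm"
    then have fM: "f k \<in> M" for k by (simp add: cauchy_seqs_def)
    have "Cauchy f"
      using f unfolding cauchy_seqs_def op_dist by (auto simp: Cauchy_def dist_norm)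
    then obtain T where T: "f \<longlonglongrightarrow> T" using Cauchy_convergent convergent_def by blast
    have "conv f T"
      unfolding conv_def op_dist using vN_norm_closed[OF M fM T] fM tendsto_norm_zero[OF LIM_zero[OF T]] by simp
    then show "\<exists>l. conv f l" by blast
  qed simp
qed

section \<open>Haar measure on the unitary group\<close>

lemma unitary_matsD:
  assumes "V \<in> unitary_mats N"
  shows "V \<in> carrier_mat N N" "V * mat_adjoint V = 1\<^sub>m N" "mat_adjoint V * V = 1\<^sub>m N"
  using assms by (auto simp: unitary_mats_def)

lemma adj_adj: "A \<in> carrier_mat N N ==> mat_adjoint (mat_adjoint A) = A" for A :: "complex mat"
  using star_alg.star_star[OF mat_star_alg, of A N] by simp

lemma mc [simp]: "A \<in> carrier_mat N N ==> B \<in> carrier_mat N N ==> A * B \<in> carrier_mat N N" for A :: "complex mat"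
  by (rule mult_carrier_mat)

lemma unitary_mult: assumes U: "U \<in> unitary_mats N" and V: "V \<in> unitary_mats N" shows "U * V \<in> unitary_mats N"
proof -
  note u = unitary_matsD[OF U] and v = unitary_matsD[OF V]
  have u': "mat_adjoint U \<in> carrier_mat N N" and v': "mat_adjoint V \<in> carrier_mat N N" using u v by simp_all
  note as = assoc_mult_mat[of _ N N _ N _ N]
  have "U * V * (mat_adjoint V * mat_adjoint U) = U * ((V * mat_adjoint V) * mat_adjoint U)"
    using u(1) v(1) u' v' by (simp add: as)
  then have 1: "U * V * (mat_adjoint V * mat_adjoint U) = 1\<^sub>m N" unfolding v(2) using u u' by simp
  have "mat_adjoint V * mat_adjoint U * (U * V) = mat_adjoint V * ((mat_adjoint U * U) * V)"
    using u(1) v(1) u' v' by (simp add: as)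
  then have 2: "mat_adjoint V * mat_adjoint U * (U * V) = 1\<^sub>m N" unfolding u(3) using v v' by simp
  show ?thesis unfolding unitary_mats_def mem_Collect_eq mat_adjoint_mult[OF u(1) v(1)]
    using mc[OF u(1) v(1)] 1 2 by blast
qed

lemma unitary_adjoint: "V \<in> unitary_mats N ==> mat_adjoint V \<in> unitary_mats N"
  unfolding unitary_mats_def by (auto simp: adj_adj[of _ N])

lemma unitary_inj_adj: "U \<in> unitary_mats N ==> A \<in> carrier_mat N N ==> mat_adjoint U * (U * A) = A"
  using unitary_matsD[of U N] by (simp add: assoc_mult_mat[of _ N N _ N _ N, symmetric])

lemma unitary_inj_adj': "U \<in> unitary_mats N ==> A \<in> carrier_mat N N ==> U * (mat_adjoint U * A) = A"
  using unitary_matsD[of U N] by (simp add: assoc_mult_mat[of _ N N _ N _ N, symmetric])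

text \<open>Matrices of all sizes share one type, so measurability is expressed through the entries.\<close>

definition mat_meas :: "nat => 'x measure => ('x => complex mat) => bool" where
  "mat_meas N M A \<longleftrightarrow> (\<forall>x\<in>space M. A x \<in> carrier_mat N N) \<and>
     (\<forall>i<N. \<forall>j<N. (\<lambda>x. A x $$ (i, j)) \<in> borel_measurable M)"

lemma mat_meas_const: "C \<in> carrier_mat N N ==> mat_meas N M (\<lambda>x. C)"
  by (simp add: mat_meas_def)

lemma mat_meas_mult: assumes "mat_meas N M A" "mat_meas N M B" shows "mat_meas N M (\<lambda>x. A x * B x)"
  unfolding mat_meas_def
proof (intro conjI allI impI ballI)
  fix i j assume ij: "i < N" "j < N"
  have "(\<lambda>x. \<Sum>k<N. A x $$ (i, k) * B x $$ (k, j)) \<in> borel_measurable M"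
    using assms ij by (intro borel_measurable_sum borel_measurable_times) (auto simp: mat_meas_def)
  moreover have "(A x * B x) $$ (i, j) = (\<Sum>k<N. A x $$ (i, k) * B x $$ (k, j))" if x: "x \<in> space M" for x
  proof -
    have "A x \<in> carrier_mat N N" "B x \<in> carrier_mat N N" using assms x by (auto simp: mat_meas_def)
    then show ?thesis using ij by (auto simp: scalar_prod_def lessThan_atLeast0 intro!: sum.cong)
  qed
  ultimately show "(\<lambda>x. (A x * B x) $$ (i, j)) \<in> borel_measurable M"
    by (subst measurable_cong[where g="\<lambda>x. \<Sum>k<N. A x $$ (i, k) * B x $$ (k, j)"]) auto
qed (use assms in \<open>auto simp: mat_meas_def\<close>)

lemma mat_meas_add: assumes "mat_meas N M A" "mat_meas N M B" shows "mat_meas N M (\<lambda>x. A x + B x)"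
  unfolding mat_meas_def
proof (intro conjI allI impI ballI)
  fix i j assume ij: "i < N" "j < N"
  have "(\<lambda>x. A x $$ (i, j) + B x $$ (i, j)) \<in> borel_measurable M"
    using assms ij by (intro borel_measurable_add) (auto simp: mat_meas_def)
  moreover have "(A x + B x) $$ (i, j) = A x $$ (i, j) + B x $$ (i, j)" if x: "x \<in> space M" for x
  proof -
    have "A x \<in> carrier_mat N N" "B x \<in> carrier_mat N N" using assms x by (auto simp: mat_meas_def)
    then show ?thesis using ij by auto
  qed
  ultimately show "(\<lambda>x. (A x + B x) $$ (i, j)) \<in> borel_measurable M"
    by (subst measurable_cong[where g="\<lambda>x. A x $$ (i, j) + B x $$ (i, j)"]) auto
qed (use assms in \<open>auto simp: mat_meas_def\<close>)

lemma mat_meas_smult: assumes "mat_meas N M A" shows "mat_meas N M (\<lambda>x. c \<cdot>\<^sub>m A x)"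
  unfolding mat_meas_def
proof (intro conjI allI impI ballI)
  fix i j assume ij: "i < N" "j < N"
  have "(\<lambda>x. c * A x $$ (i, j)) \<in> borel_measurable M"
    using assms ij by (intro borel_measurable_times) (auto simp: mat_meas_def)
  moreover have "(c \<cdot>\<^sub>m A x) $$ (i, j) = c * A x $$ (i, j)" if x: "x \<in> space M" for x
  proof -
    have "A x \<in> carrier_mat N N" using assms x by (auto simp: mat_meas_def)
    then show ?thesis using ij by auto
  qed
  ultimately show "(\<lambda>x. (c \<cdot>\<^sub>m A x) $$ (i, j)) \<in> borel_measurable M"
    by (subst measurable_cong[where g="\<lambda>x. c * A x $$ (i, j)"]) auto
qed (use assms in \<open>auto simp: mat_meas_def\<close>)

lemma mat_meas_adjoint: assumes "mat_meas N M A" shows "mat_meas N M (\<lambda>x. mat_adjoint (A x))"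
  unfolding mat_meas_def
proof (intro conjI allI impI ballI)
  fix i j assume ij: "i < N" "j < N"
  have "(\<lambda>x. cnj (A x $$ (j, i))) \<in> borel_measurable M"
    using assms ij by (intro borel_measurable_continuous_on[where f=cnj] continuous_intros) (auto simp: mat_meas_def)
  moreover have "mat_adjoint (A x) $$ (i, j) = cnj (A x $$ (j, i))" if x: "x \<in> space M" for x
  proof -
    have "A x \<in> carrier_mat N N" using assms x by (auto simp: mat_meas_def)
    then show ?thesis using ij by auto
  qed
  ultimately show "(\<lambda>x. mat_adjoint (A x) $$ (i, j)) \<in> borel_measurable M"
    by (subst measurable_cong[where g="\<lambda>x. cnj (A x $$ (j, i))"]) auto
qed (use assms in \<open>auto simp: mat_meas_def\<close>)

lemma unitary_borel_gen:
  "{{V \<in> unitary_mats N. V $$ (i, j) \<in> B} | i j B. i < N \<and> j < N \<and> B \<in> sets borel} \<subseteq> Pow (unitary_mats N)"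
  by auto

lemma space_unitary_borel [simp]: "space (unitary_borel N) = unitary_mats N"
  unfolding unitary_borel_def by (rule space_measure_of[OF unitary_borel_gen])

lemma measurable_unitary_iff:
  "A \<in> measurable M (unitary_borel N) \<longleftrightarrow> mat_meas N M A \<and> (\<forall>x\<in>space M. A x \<in> unitary_mats N)"
proof
  assume A: "A \<in> measurable M (unitary_borel N)"
  then have sp: "A x \<in> unitary_mats N" if "x \<in> space M" for x using measurable_space[OF A that] by simp
  have "(\<lambda>x. A x $$ (i, j)) \<in> borel_measurable M" if ij: "i < N" "j < N" for i j
  proof (rule measurableI)
    fix B :: "complex set" assume B: "B \<in> sets borel"
    have "{V \<in> unitary_mats N. V $$ (i, j) \<in> B} \<in> sets (unitary_borel N)"
      unfolding unitary_borel_def using ij B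
      by (subst sets_measure_of[OF unitary_borel_gen]) (blast intro: sigma_sets.Basic)
    from measurable_sets[OF A this] have "A -` {V \<in> unitary_mats N. V $$ (i, j) \<in> B} \<inter> space M \<in> sets M" .
    moreover have "A -` {V \<in> unitary_mats N. V $$ (i, j) \<in> B} \<inter> space M = (\<lambda>x. A x $$ (i, j)) -` B \<inter> space M"
      using sp by auto
    ultimately show "(\<lambda>x. A x $$ (i, j)) -` B \<inter> space M \<in> sets M" by simp
  qed simp
  then show "mat_meas N M A \<and> (\<forall>x\<in>space M. A x \<in> unitary_mats N)"
    using sp unitary_matsD(1) by (auto simp: mat_meas_def)
next
  assume A: "mat_meas N M A \<and> (\<forall>x\<in>space M. A x \<in> unitary_mats N)"
  show "A \<in> measurable M (unitary_borel N)"
    unfolding unitary_borel_def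
  proof (rule measurable_measure_of[OF unitary_borel_gen])
    show "A \<in> space M \<rightarrow> unitary_mats N" using A by blast
    fix y assume "y \<in> {{V \<in> unitary_mats N. V $$ (i, j) \<in> B} | i j B. i < N \<and> j < N \<and> B \<in> sets borel}"
    then obtain i j and B :: "complex set" where y: "y = {V \<in> unitary_mats N. V $$ (i, j) \<in> B}" "i < N" "j < N" "B \<in> sets borel" by blast
    have "A -` y \<inter> space M = (\<lambda>x. A x $$ (i, j)) -` B \<inter> space M" using A y(1) by auto
    then show "A -` y \<inter> space M \<in> sets M" using A y measurable_sets[of "\<lambda>x. A x $$ (i, j)" M borel B] by (auto simp: mat_meas_def)
  qed
qed

definition is_haar :: "nat => complex mat measure => bool" where
  "is_haar N \<mu> \<longleftrightarrow> sets \<mu> = sets (unitary_borel N) \<and> prob_space \<mu> \<and>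
     (\<forall>U\<in>unitary_mats N. distr \<mu> \<mu> (\<lambda>V. U * V) = \<mu>)"

lemma is_haarD:
  assumes "is_haar N \<mu>"
  shows "sets \<mu> = sets (unitary_borel N)" "prob_space \<mu>" "space \<mu> = unitary_mats N"
  using assms sets_eq_imp_space_eq[of \<mu> "unitary_borel N"] by (auto simp: is_haar_def)

lemma is_haar_integral:
  assumes mu: "is_haar N \<mu>" and U: "U \<in> unitary_mats N" and g: "g \<in> borel_measurable (unitary_borel N)"
  shows "(\<integral>\<^sup>+V. g (U * V) \<partial>\<mu>) = (\<integral>\<^sup>+V. g V \<partial>\<mu>)"
proof -
  note d = is_haarD[OF mu]
  have g': "g \<in> borel_measurable \<mu>" using g by (simp add: measurable_cong_sets[OF d(1) refl])
  have id: "(\<lambda>V. V) \<in> measurable \<mu> (unitary_borel N)" using d(1) by (intro measurable_ident_sets) simp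
  then have "mat_meas N \<mu> (\<lambda>V. V)" by (simp add: measurable_unitary_iff)
  then have "(\<lambda>V. U * V) \<in> measurable \<mu> (unitary_borel N)"
    using U unitary_matsD(1)[OF U] unitary_mult[OF U] d(3)
    by (auto simp: measurable_unitary_iff intro!: mat_meas_mult mat_meas_const)
  then have m: "(\<lambda>V. U * V) \<in> measurable \<mu> \<mu>" by (simp add: measurable_cong_sets[OF refl d(1)])
  have "(\<integral>\<^sup>+V. g V \<partial>\<mu>) = (\<integral>\<^sup>+V. g V \<partial>(distr \<mu> \<mu> (\<lambda>V. U * V)))" using mu U by (simp add: is_haar_def)
  also have "\<dots> = (\<integral>\<^sup>+V. g (U * V) \<partial>\<mu>)" by (rule nn_integral_distr[OF m]) (use g' in simp)
  finally show ?thesis ..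
qed

text \<open>Integrate \<open>g (y* x)\<close>, with \<open>x\<close> distributed by \<open>\<nu>\<close> and \<open>y\<close> by
  \<open>\<mu>\<close>, in both orders: invariance of \<open>\<nu>\<close> under \<open>y*\<close> removes \<open>y\<close>, and as
  \<open>y* x = (x* y)*\<close>, invariance of \<open>\<mu>\<close> under \<open>x*\<close> removes \<open>x\<close>.\<close>

lemma is_haar_flip:
  assumes mu: "is_haar N \<mu>" and nu: "is_haar N \<nu>" and g: "g \<in> borel_measurable (unitary_borel N)"
  shows "(\<integral>\<^sup>+V. g V \<partial>\<nu>) = (\<integral>\<^sup>+V. g (mat_adjoint V) \<partial>\<mu>)"
proof -
  note dm = is_haarD[OF mu] and dn = is_haarD[OF nu]
  interpret mu: prob_space \<mu> by (rule dm(2))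
  interpret nu: prob_space \<nu> by (rule dn(2))
  interpret P: pair_sigma_finite \<nu> \<mu> ..
  have m1: "mat_meas N (\<nu> \<Otimes>\<^sub>M \<mu>) fst" "mat_meas N (\<nu> \<Otimes>\<^sub>M \<mu>) snd"
  proof -
    have "fst \<in> measurable (\<nu> \<Otimes>\<^sub>M \<mu>) (unitary_borel N)" "snd \<in> measurable (\<nu> \<Otimes>\<^sub>M \<mu>) (unitary_borel N)"
      using measurable_fst[of \<nu> \<mu>] measurable_snd[of \<nu> \<mu>]
      by (simp_all add: measurable_cong_sets[OF refl dn(1)] measurable_cong_sets[OF refl dm(1)])
    then show "mat_meas N (\<nu> \<Otimes>\<^sub>M \<mu>) fst" "mat_meas N (\<nu> \<Otimes>\<^sub>M \<mu>) snd" by (auto simp: measurable_unitary_iff)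
  qed
  have "(\<lambda>p. mat_adjoint (snd p) * fst p) \<in> measurable (\<nu> \<Otimes>\<^sub>M \<mu>) (unitary_borel N)"
    unfolding measurable_unitary_iff
    using dm(3) dn(3) by (auto intro!: mat_meas_mult mat_meas_adjoint m1 unitary_mult unitary_adjoint simp: space_pair_measure)
  then have meas: "case_prod (\<lambda>x y. g (mat_adjoint y * x)) \<in> borel_measurable (\<nu> \<Otimes>\<^sub>M \<mu>)"
    using measurable_compose[OF _ g] by (simp add: case_prod_beta')
  have "(\<lambda>V. mat_adjoint V) \<in> measurable (unitary_borel N) (unitary_borel N)"
    using measurable_ident[of "unitary_borel N"] by (auto simp: measurable_unitary_iff id_def intro!: mat_meas_adjoint unitary_adjoint)
  then have ga: "(\<lambda>V. g (mat_adjoint V)) \<in> borel_measurable (unitary_borel N)" by (rule measurable_compose[OF _ g])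
  have "(\<integral>\<^sup>+V. g V \<partial>\<nu>) = (\<integral>\<^sup>+y. (\<integral>\<^sup>+V. g V \<partial>\<nu>) \<partial>\<mu>)" by (simp add: mu.emeasure_space_1)
  also have "\<dots> = (\<integral>\<^sup>+y. (\<integral>\<^sup>+x. g (mat_adjoint y * x) \<partial>\<nu>) \<partial>\<mu>)"
    by (rule nn_integral_cong) (use dm(3) in \<open>simp add: is_haar_integral[OF nu unitary_adjoint g]\<close>)
  also have "\<dots> = (\<integral>\<^sup>+x. (\<integral>\<^sup>+y. g (mat_adjoint y * x) \<partial>\<mu>) \<partial>\<nu>)" by (rule P.Fubini'[OF meas])
  also have "\<dots> = (\<integral>\<^sup>+x. (\<integral>\<^sup>+y. g (mat_adjoint y) \<partial>\<mu>) \<partial>\<nu>)"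
  proof (rule nn_integral_cong)
    fix x assume "x \<in> space \<nu>"
    then have x: "x \<in> unitary_mats N" using dn(3) by simp
    have "(\<integral>\<^sup>+y. g (mat_adjoint y * x) \<partial>\<mu>) = (\<integral>\<^sup>+y. g (mat_adjoint (mat_adjoint x * y)) \<partial>\<mu>)"
    proof (rule nn_integral_cong)
      fix y assume "y \<in> space \<mu>"
      then have y: "y \<in> unitary_mats N" using dm(3) by simp
      show "g (mat_adjoint y * x) = g (mat_adjoint (mat_adjoint x * y))"
        using unitary_matsD(1)[OF x] unitary_matsD(1)[OF y] by (simp add: mat_adjoint_mult[of _ N] adj_adj[of _ N])
    qed
    also have "\<dots> = (\<integral>\<^sup>+y. g (mat_adjoint y) \<partial>\<mu>)" by (rule is_haar_integral[OF mu unitary_adjoint[OF x] ga])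
    finally show "(\<integral>\<^sup>+y. g (mat_adjoint y * x) \<partial>\<mu>) = (\<integral>\<^sup>+y. g (mat_adjoint y) \<partial>\<mu>)" .
  qed
  also have "\<dots> = (\<integral>\<^sup>+y. g (mat_adjoint y) \<partial>\<mu>)" by (simp add: nu.emeasure_space_1)
  finally show ?thesis .
qed

text \<open>Both measures are the image of \<open>\<mu>\<close> under the adjoint.\<close>

lemma is_haar_unique: assumes mu: "is_haar N \<mu>" and nu: "is_haar N \<nu>" shows "\<mu> = \<nu>"
proof (rule measure_eqI)
  show "sets \<mu> = sets \<nu>" using is_haarD(1)[OF mu] is_haarD(1)[OF nu] by simp
  fix A assume A: "A \<in> sets \<mu>"
  then have g: "(indicator A :: complex mat => ennreal) \<in> borel_measurable (unitary_borel N)"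
    using is_haarD(1)[OF mu] by (intro borel_measurable_indicator) simp
  have "(\<integral>\<^sup>+V. indicator A V \<partial>\<mu>) = (\<integral>\<^sup>+V. indicator A V \<partial>\<nu>)"
    using is_haar_flip[OF mu mu g] is_haar_flip[OF mu nu g] by simp
  then show "emeasure \<mu> A = emeasure \<nu> A"
    using A is_haarD(1)[OF mu] is_haarD(1)[OF nu] by simp
qed

context cstar
begin

text \<open>The iteration \<open>b \<mapsto> b (1 + (1 - b* b) / 2)\<close> for the unitary polar part. Unlike the polar
  decomposition it consists of algebraic operations, so it is measurable and commutes with left multiplication by unitaries.\<close>

primrec newton_schulz :: "'a => nat => 'a" where
  "newton_schulz b 0 = b"
| "newton_schulz b (Suc k) = newton_schulz b k \<otimes>
     (\<one> \<oplus> smul A (1/2) (sb \<one> (star A (newton_schulz b k) \<otimes> newton_schulz b k)))"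

text \<open>With \<open>e = 1 - b* b\<close>, the new defect is \<open>(3 e\<^sup>2 + e\<^sup>3) / 4\<close>.\<close>

lemma newton_schulz_step:
  assumes b: "b \<in> carrier A" and e: "e = sb \<one> (star A b \<otimes> b)" and le: "\<nu> e \<le> 1/2"
    and b': "b' = b \<otimes> (\<one> \<oplus> smul A (1/2) e)"
  shows "\<nu> (sb \<one> (star A b' \<otimes> b')) \<le> \<nu> e / 2" and "dst b' b \<le> \<nu> e"
proof -
  have ec: "e \<in> carrier A" using b by (simp add: e)
  have se: "star A e = e" using b by (simp add: e star_add star_smul star_mult)
  let ?f = "\<one> \<oplus> smul A (1/2) e"
  have f: "?f = ev [:1, 1/2:] e" using ec by (simp add: smul_mult_r)
  have sf: "star A ?f = ?f" using ec se by (simp add: star_add star_smul)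
  have bb: "star A b \<otimes> b = ev [:1, -1:] e"
  proof -
    have "ev [:1, -1:] e = sb \<one> e" using ec by (simp add: smul_mult_r)
    also have "\<dots> = star A b \<otimes> b" using b sb_swap[of "\<one>" "star A b \<otimes> b"] unfolding e
      by (simp add: smul_m1 minus_add a_assoc r_neg1 r_neg2 a_comm)
    finally show ?thesis ..
  qed
  have "star A b' \<otimes> b' = ?f \<otimes> ((star A b \<otimes> b) \<otimes> ?f)"
    unfolding b' using b ec sf by (simp only: star_mult m_closed star_closed a_closed one_closed smul_closed m_assoc)
  also have "\<dots> = ev ([:1, 1/2:] * ([:1, -1:] * [:1, 1/2:])) e"
    by (simp only: ev_mult[OF ec] f bb)
  finally have "sb \<one> (star A b' \<otimes> b') = ev (1 + Polynomial.smult (-1) ([:1, 1/2:] * ([:1, -1:] * [:1, 1/2:]))) e"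
    by (simp only: ev_add[OF ec] ev_smult[OF ec] ev_1[OF ec])
  also have "1 + Polynomial.smult (-1) ([:1, 1/2:] * ([:1, -1:] * [:1, 1/2:])) = ([:0, 1:] * [:0, 3/4, 1/4:] :: complex poly)"
    by (simp add: one_pCons)
  also have "ev ([:0, 1:] * [:0, 3/4, 1/4:]) e = e \<otimes> (smul A (3/4) e \<oplus> smul A (1/4) (e \<otimes> e))"
    unfolding ev_mult[OF ec] using ec by (simp add: r_distr smul_mult_r)
  finally have eq: "sb \<one> (star A b' \<otimes> b') = e \<otimes> (smul A (3/4) e \<oplus> smul A (1/4) (e \<otimes> e))" .
  have n0: "0 \<le> \<nu> e" using ec by simp
  have "\<nu> (smul A (3/4) e \<oplus> smul A (1/4) (e \<otimes> e)) \<le> 3/4 * \<nu> e + 1/4 * (\<nu> e * \<nu> e)"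
    using nu_add[of "smul A (3/4) e" "smul A (1/4) (e \<otimes> e)"] nu_mult[OF ec ec] ec by (simp add: nu_smul)
  also have "\<dots> \<le> 3/4 * (1/2) + 1/4 * ((1/2) * (1/2))"
    using le n0 by (intro add_mono mult_mono) auto
  also have "\<dots> \<le> 1/2" by simp
  finally have "\<nu> (smul A (3/4) e \<oplus> smul A (1/4) (e \<otimes> e)) \<le> 1/2" .
  then have "\<nu> e * \<nu> (smul A (3/4) e \<oplus> smul A (1/4) (e \<otimes> e)) \<le> \<nu> e * (1/2)"
    using n0 by (rule mult_left_mono)
  then show "\<nu> (sb \<one> (star A b' \<otimes> b')) \<le> \<nu> e / 2"
    unfolding eq using nu_mult[of e "smul A (3/4) e \<oplus> smul A (1/4) (e \<otimes> e)"] ec by simp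
  have "(\<nu> b)\<^sup>2 = \<nu> (sb \<one> e)"
  proof -
    have "sb \<one> e = star A b \<otimes> b" unfolding bb using ec by (simp add: smul_mult_r)
    then show ?thesis using nu_cstar[OF b] by simp
  qed
  also have "\<dots> \<le> 1 + 1/2" using nu_add[of "\<one>" "smul A (-1) e"] ec le nu_one_le by (simp add: nu_smul)
  also have "\<dots> \<le> 2\<^sup>2" by simp
  finally have b2: "\<nu> b \<le> 2" by (rule power2_le_imp_le) simp
  have "sb b' b = b \<otimes> smul A (1/2) e"
    unfolding b' using b ec by (simp add: r_distr smul_mult_r smul_m1 a_comm a_assoc r_neg1 r_neg2 l_neg add.m_lcomm)
  then have "dst b' b \<le> \<nu> b * (1/2 * \<nu> e)"
    using nu_mult[of b "smul A (1/2) e"] b ec by (simp add: seminorm_dist_def nu_smul)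
  also have "\<dots> \<le> 2 * (1/2 * \<nu> e)" using b2 n0 by (intro mult_right_mono) auto
  finally show "dst b' b \<le> \<nu> e" by simp
qed

lemma newton_schulz_conv:
  assumes b: "b \<in> carrier A" and le: "\<nu> (sb \<one> (star A b \<otimes> b)) \<le> 1/2"
  shows "\<exists>v. conv (newton_schulz b) v \<and> star A v \<otimes> v = \<one>"
proof -
  let ?g = "newton_schulz b"
  define e where "e k = sb \<one> (star A (?g k) \<otimes> ?g k)" for k
  have gc: "?g k \<in> carrier A" for k by (induction k) (use b in auto)
  have ele: "\<nu> (e k) \<le> 1/2 * (1/2) ^ k" for k
  proof (induction k)
    case 0
    then show ?case using le by (simp add: e_def)
  next
    case (Suc k)
    have "(1/2::real) ^ k \<le> 1" by (rule power_le_one) auto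
    then have "\<nu> (e k) \<le> 1/2" using Suc by linarith
    from newton_schulz_step(1)[OF gc[of k] _ this refl] have "\<nu> (e (Suc k)) \<le> \<nu> (e k) / 2"
      by (simp add: e_def)
    then show ?case using Suc by simp
  qed
  have half: "\<nu> (e k) \<le> 1/2" for k
  proof -
    have "(1/2::real) ^ k \<le> 1" by (rule power_le_one) auto
    then show ?thesis using ele[of k] by linarith
  qed
  have "dst (?g (Suc k)) (?g k) \<le> 1/2 * (1/2) ^ k" for k
    using newton_schulz_step(2)[OF gc[of k] e_def[of k] half refl] ele[of k] by (simp add: e_def)
  from complete_geometric[OF gc _ _ this] obtain v where v: "conv ?g v" by auto
  have "conv (\<lambda>k. star A (?g k) \<otimes> ?g k) \<one>"
  proof (rule conv_bound)
    show "star A (?g k) \<otimes> ?g k \<in> carrier A" for k using gc by simp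
    show "dst (star A (?g k) \<otimes> ?g k) \<one> \<le> 1/2 * (1/2) ^ k" for k
    proof -
      have "dst (star A (?g k) \<otimes> ?g k) \<one> = dst \<one> (star A (?g k) \<otimes> ?g k)" using gc by (intro dst_sym) auto
      also have "\<dots> = \<nu> (e k)" by (simp add: e_def seminorm_dist_def)
      finally show ?thesis using ele by simp
    qed
    show "(\<lambda>k. 1/2 * (1/2::real) ^ k) \<longlonglongrightarrow> 0" by (intro tendsto_mult_right_zero LIMSEQ_power_zero) simp
  qed simp
  moreover have "conv (\<lambda>k. star A (?g k) \<otimes> ?g k) (star A v \<otimes> v)" by (intro conv_mult conv_star v)
  ultimately have "star A v \<otimes> v = \<one>" using conv_unique by blast
  then show ?thesis using v by blast
qed

end

definition mns :: "nat => complex mat => nat => complex mat" where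
  "mns N = cstar.newton_schulz (mat_algebra N)"

lemma mns_simps:
  "mns N B 0 = B"
  "mns N B (Suc k) = mns N B k * (1\<^sub>m N + (1/2) \<cdot>\<^sub>m (1\<^sub>m N + (-1) \<cdot>\<^sub>m (mat_adjoint (mns N B k) * mns N B k)))"
  using cstar.newton_schulz.simps[OF mat_cstar, of N B] by (simp_all add: mns_def)

lemma mns_carrier [simp]: "B \<in> carrier_mat N N ==> mns N B k \<in> carrier_mat N N"
  by (induction k) (simp_all add: mns_simps)

lemma mns_unitary: assumes U: "U \<in> unitary_mats N" and B: "B \<in> carrier_mat N N"
  shows "mns N (U * B) k = U * mns N B k"
proof (induction k)
  case (Suc k)
  let ?M = "mns N B k"
  have M: "?M \<in> carrier_mat N N" using B by simp
  note u = unitary_matsD[OF U]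
  note as = assoc_mult_mat[of _ N N _ N _ N]
  have "mat_adjoint (U * ?M) * (U * ?M) = mat_adjoint ?M * (mat_adjoint U * (U * ?M))"
    using u(1) M by (simp add: mat_adjoint_mult[of _ N] as)
  also have "\<dots> = mat_adjoint ?M * ?M" using unitary_inj_adj[OF U M] by simp
  finally have eq: "mat_adjoint (U * ?M) * (U * ?M) = mat_adjoint ?M * ?M" .
  show ?case unfolding mns_simps(2) Suc eq using u(1) M by (intro as) auto
qed (simp add: mns_simps)

text \<open>Existence of the Haar measure. Lebesgue measure on \<open>N \<times> N\<close> matrices is invariant under left multiplication
  by unitaries. Restricted to the set \<open>E\<close> of nearly unitary matrices it is finite and nonzero, and the unitary polar part
  \<open>Ph\<close> is equivariant there; so the image of normalized Lebesgue measure on \<open>E\<close> under \<open>Ph\<close> is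
  invariant.\<close>

locale haar_construction =
  fixes N :: nat assumes N: "N \<ge> 1"
begin

abbreviation I where "I \<equiv> {..<N} \<times> {..<N}"
text \<open>Matrices are represented by their entries (\<open>tm\<close>), on which unitaries act by multiplication (\<open>act\<close>) and
  matrices by translation (\<open>tr\<close>).\<close>

definition Lm :: "(nat \<times> nat => complex) measure" where "Lm = (\<Pi>\<^sub>M p\<in>I. lborel)"
definition tm :: "(nat \<times> nat => complex) => complex mat" where "tm G = Matrix.mat N N G"
definition act :: "complex mat => (nat \<times> nat => complex) => nat \<times> nat => complex" where
  "act U G = (\<lambda>p\<in>I. \<Sum>k<N. U $$ (fst p, k) * G (k, snd p))"
definition tr :: "(nat \<times> nat => complex) => (nat \<times> nat => complex) => nat \<times> nat => complex" where
  "tr a G = (\<lambda>p\<in>I. G p + a p)"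

sublocale product_sigma_finite "\<lambda>_::nat \<times> nat. lborel :: complex measure" ..
sublocale finite_product_sigma_finite "\<lambda>_::nat \<times> nat. lborel :: complex measure" I by unfold_locales simp
sublocale L: sigma_finite_measure Lm unfolding Lm_def ..
sublocale LL: pair_sigma_finite Lm Lm ..

lemma space_Lm: "space Lm = (\<Pi>\<^sub>E p\<in>I. UNIV)"
  by (simp add: Lm_def space_PiM)

lemma sp: "x \<in> space Lm \<longleftrightarrow> x \<in> extensional I"
  by (auto simp: space_Lm PiE_def)

lemma act_space [simp]: "act U G \<in> space Lm" and tr_space [simp]: "tr a G \<in> space Lm"
  by (auto simp: sp act_def tr_def)

lemma Lm_component: "p \<in> I ==> (\<lambda>x. x p) \<in> borel_measurable Lm"
  unfolding Lm_def using measurable_component_singleton[of p I "\<lambda>_. lborel :: complex measure"] by simp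

lemma Lm_measurable: "(\<And>p. p \<in> I ==> (\<lambda>x. f x p) \<in> borel_measurable M) ==> (\<lambda>x. \<lambda>p\<in>I. f x p) \<in> measurable M Lm"
  unfolding Lm_def by (rule measurable_restrict) simp

lemma tr_meas: "tr a \<in> measurable Lm Lm"
  unfolding tr_def[abs_def] by (intro Lm_measurable borel_measurable_add Lm_component) auto

lemma act_meas: "act U \<in> measurable Lm Lm"
  unfolding act_def[abs_def]
  by (intro Lm_measurable borel_measurable_sum borel_measurable_times Lm_component) auto

lemma pair_meas: "(\<lambda>p. tr (fst p) (act U (snd p))) \<in> measurable (Lm \<Otimes>\<^sub>M Lm) Lm"
proof -
  have c1: "(\<lambda>x. fst x p) \<in> borel_measurable (Lm \<Otimes>\<^sub>M Lm)" if "p \<in> I" for p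
    using measurable_compose[OF measurable_fst Lm_component[OF that], of Lm] by simp
  have c2: "(\<lambda>x. snd x p) \<in> borel_measurable (Lm \<Otimes>\<^sub>M Lm)" if "p \<in> I" for p
    using measurable_compose[OF measurable_snd Lm_component[OF that], of Lm] by simp
  have "(\<lambda>p. tr (fst p) (act U (snd p))) = (\<lambda>x. \<lambda>p\<in>I. (\<Sum>k<N. U $$ (fst p, k) * snd x (k, snd p)) + fst x p)"
    by (auto simp: tr_def act_def fun_eq_iff restrict_def)
  then show ?thesis
    by (auto intro!: Lm_measurable borel_measurable_add borel_measurable_sum borel_measurable_times c1 c2)
qed

lemma distr_tr: "distr Lm Lm (tr a) = Lm"
proof -
  have "distr Lm Lm (tr a) = (\<Pi>\<^sub>M p\<in>I. lborel)"
  proof (rule PiM_eqI)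
    fix A :: "nat \<times> nat => complex set" assume A: "\<And>p. p \<in> I ==> A p \<in> sets lborel"
    have AL: "Pi\<^sub>E I A \<in> sets Lm" unfolding Lm_def using A by (intro sets_PiM_I_finite) auto
    have shift: "emeasure lborel ((\<lambda>z. z + c) -` B) = emeasure lborel B" if "B \<in> sets borel" for B and c :: complex
    proof -
      have "emeasure lborel B = emeasure (distr lborel borel ((+) c)) B" by (simp add: lborel_distr_plus)
      also have "\<dots> = emeasure lborel ((+) c -` B)" using that by (subst emeasure_distr) auto
      also have "(+) c -` B = (\<lambda>z. z + c) -` B" by (auto simp: add.commute)
      finally show ?thesis ..
    qed
    have sB: "(\<lambda>z. z + c) -` B \<in> sets borel" if "B \<in> sets borel" for B and c :: complex
      using measurable_sets[of "\<lambda>z. z + c" borel borel B] that by simp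
    have "tr a -` Pi\<^sub>E I A \<inter> space Lm = Pi\<^sub>E I (\<lambda>p. (\<lambda>z. z + a p) -` A p)"
      by (auto simp: sp tr_def PiE_iff extensional_def)
    then have "emeasure (distr Lm Lm (tr a)) (Pi\<^sub>E I A) = emeasure Lm (Pi\<^sub>E I (\<lambda>p. (\<lambda>z. z + a p) -` A p))"
      using AL by (simp add: emeasure_distr[OF tr_meas])
    also have "\<dots> = (\<Prod>p\<in>I. emeasure lborel ((\<lambda>z. z + a p) -` A p))"
      unfolding Lm_def using A sB by (intro emeasure_PiM) auto
    also have "\<dots> = (\<Prod>p\<in>I. emeasure lborel (A p))"
      using A by (intro prod.cong refl shift) auto
    finally show "emeasure (distr Lm Lm (tr a)) (Pi\<^sub>E I A) = (\<Prod>p\<in>I. emeasure lborel (A p))" .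
  qed (auto simp: Lm_def)
  then show ?thesis by (simp add: Lm_def)
qed

lemma tr_integral: "g \<in> borel_measurable Lm ==> (\<integral>\<^sup>+y. g (tr a y) \<partial>Lm) = (\<integral>\<^sup>+y. g y \<partial>Lm)"
  by (subst (2) distr_tr[of a, symmetric]) (simp add: nn_integral_distr[OF tr_meas])

lemma tm_carrier [simp]: "tm G \<in> carrier_mat N N"
  by (simp add: tm_def)

lemma tm_act: "U \<in> carrier_mat N N ==> tm (act U G) = U * tm G"
  by (rule eq_matI) (auto simp: tm_def act_def scalar_prod_def lessThan_atLeast0 intro!: sum.cong)

lemma tm_inj: "x \<in> space Lm ==> y \<in> space Lm ==> tm x = tm y ==> x = y"
proof (rule extensionalityI)
  fix p assume "tm x = tm y" "p \<in> I"
  then have "tm x $$ p = tm y $$ p" "fst p < N" "snd p < N" by auto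
  then show "x p = y p" by (cases p) (simp add: tm_def)
qed (auto simp: sp)

lemma tm_tr: "tm (tr a x) = tm x + tm a"
  by (rule eq_matI) (auto simp: tm_def tr_def)

text \<open>The action of \<open>W\<close> turns translation by \<open>W* x\<close> into translation by \<open>x\<close>.\<close>

lemma act_integral:
  assumes W: "W \<in> unitary_mats N" and g: "g \<in> borel_measurable Lm"
  shows "(\<integral>\<^sup>+y. g (tr x (act W y)) \<partial>Lm) = (\<integral>\<^sup>+y. g (act W y) \<partial>Lm)"
proof -
  note w = unitary_matsD[OF W]
  let ?a = "act (mat_adjoint W) x"
  have "act W (tr ?a y) = tr x (act W y)" for y
  proof (rule tm_inj)
    have "W * (mat_adjoint W * tm x) = tm x" by (rule unitary_inj_adj'[OF W]) simp
    then show "tm (act W (tr ?a y)) = tm (tr x (act W y))"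
      using w(1) by (simp add: tm_act tm_tr mult_add_distrib_mat[of _ N N _ N])
  qed auto
  then have "(\<integral>\<^sup>+y. g (tr x (act W y)) \<partial>Lm) = (\<integral>\<^sup>+y. g (act W (tr ?a y)) \<partial>Lm)" by simp
  also have "\<dots> = (\<integral>\<^sup>+y. g (act W y) \<partial>Lm)"
    by (rule tr_integral[where g="\<lambda>y. g (act W y)"]) (rule measurable_compose[OF act_meas g])
  finally show ?thesis .
qed

lemma neg_unitary: assumes U: "U \<in> unitary_mats N" shows "(-1) \<cdot>\<^sub>m U \<in> unitary_mats N"
proof -
  note u = unitary_matsD[OF U]
  have ad: "mat_adjoint ((-1) \<cdot>\<^sub>m U) = (-1) \<cdot>\<^sub>m mat_adjoint U"
    using star_alg.star_smul[OF mat_star_alg, of U N "-1"] u by simp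
  have "(-1) \<cdot>\<^sub>m ((-1) \<cdot>\<^sub>m (1\<^sub>m N)) = (1\<^sub>m N :: complex mat)" by (rule eq_matI) auto
  then have "((-1) \<cdot>\<^sub>m U) * mat_adjoint ((-1) \<cdot>\<^sub>m U) = 1\<^sub>m N" "mat_adjoint ((-1) \<cdot>\<^sub>m U) * ((-1) \<cdot>\<^sub>m U) = 1\<^sub>m N"
    unfolding ad using u
    by (simp_all add: mult_smult_distrib[of _ N N _ N] mult_smult_assoc_mat[of _ N N _ N])
  then show ?thesis using u by (simp add: unitary_mats_def)
qed

text \<open>The determinant is avoided by the uniqueness of translation-invariant measures: integrate
  \<open>1\<^sub>E(x) g(x + U y)\<close> over \<open>x\<close> and \<open>y\<close> in both orders. One order gives \<open>|E|\<close>
  times the left-hand side; translating \<open>x\<close> by \<open>- U y\<close> first gives \<open>|E|\<close> times the right-hand side,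
  as \<open>E\<close> is invariant under \<open>- U\<close>.\<close>

lemma unitary_invariant:
  assumes U: "U \<in> unitary_mats N" and E: "E \<in> sets Lm" "emeasure Lm E \<noteq> 0" "emeasure Lm E \<noteq> \<infinity>"
    and inv: "\<And>y. y \<in> space Lm ==> act ((-1) \<cdot>\<^sub>m U) y \<in> E \<longleftrightarrow> y \<in> E"
    and g: "g \<in> borel_measurable Lm"
  shows "(\<integral>\<^sup>+y. g (act U y) \<partial>Lm) = (\<integral>\<^sup>+y. g y \<partial>Lm)"
proof -
  note u = unitary_matsD[OF U]
  let ?W = "(-1) \<cdot>\<^sub>m U"
  have Wc: "?W \<in> carrier_mat N N" using u by simp
  have W: "?W \<in> unitary_mats N" by (rule neg_unitary[OF U])
  define f :: "(nat \<times> nat => complex) => ennreal" where "f = indicator E"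
  have f: "f \<in> borel_measurable Lm" using E by (simp add: f_def)
  have fE: "(\<integral>\<^sup>+x. f x \<partial>Lm) = emeasure Lm E" using E by (simp add: f_def)
  have fW: "(\<integral>\<^sup>+y. f (act ?W y) \<partial>Lm) = emeasure Lm E"
    unfolding fE[symmetric] by (rule nn_integral_cong) (use inv in \<open>simp add: f_def indicator_def\<close>)
  have gU: "(\<lambda>y. g (act U y)) \<in> borel_measurable Lm" by (rule measurable_compose[OF act_meas g])
  have sec: "(\<lambda>y. g (tr x (act U y))) \<in> borel_measurable Lm" for x
    by (rule measurable_compose[OF measurable_compose[OF act_meas tr_meas] g])
  have m1: "case_prod (\<lambda>x y. f x * g (tr x (act U y))) \<in> borel_measurable (Lm \<Otimes>\<^sub>M Lm)"
    unfolding case_prod_beta'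
    by (intro borel_measurable_times_ennreal measurable_compose[OF measurable_fst f] measurable_compose[OF pair_meas g])
  have m2: "case_prod (\<lambda>x y. f (tr x (act ?W y)) * g x) \<in> borel_measurable (Lm \<Otimes>\<^sub>M Lm)"
    unfolding case_prod_beta'
    by (intro borel_measurable_times_ennreal measurable_compose[OF measurable_fst g] measurable_compose[OF pair_meas f])
  have "emeasure Lm E * (\<integral>\<^sup>+y. g (act U y) \<partial>Lm) = (\<integral>\<^sup>+x. f x * (\<integral>\<^sup>+y. g (act U y) \<partial>Lm) \<partial>Lm)"
    using f by (simp add: nn_integral_multc fE)
  also have "\<dots> = (\<integral>\<^sup>+x. (\<integral>\<^sup>+y. f x * g (tr x (act U y)) \<partial>Lm) \<partial>Lm)"
    by (intro nn_integral_cong) (simp add: nn_integral_cmult[OF sec] act_integral[OF U g])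
  also have "\<dots> = (\<integral>\<^sup>+y. (\<integral>\<^sup>+x. f x * g (tr x (act U y)) \<partial>Lm) \<partial>Lm)" by (rule LL.Fubini'[OF m1, symmetric])
  also have "\<dots> = (\<integral>\<^sup>+y. (\<integral>\<^sup>+x. f (tr x (act ?W y)) * g x \<partial>Lm) \<partial>Lm)"
  proof (rule nn_integral_cong)
    fix y
    let ?z = "act U y" and ?z' = "act ?W y"
    let ?h = "\<lambda>x. f (tr ?z' x) * g x"
    have tc: "tr x v = tr v x" for x v by (auto simp: tr_def fun_eq_iff add.commute)
    have h: "?h \<in> borel_measurable Lm"
      by (intro borel_measurable_times_ennreal g measurable_compose[OF tr_meas f])
    have zz: "tr ?z' (tr ?z x) = x" if "x \<in> space Lm" for x
    proof (rule tm_inj[OF _ that])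
      have tz: "tm ?z' = (-1) \<cdot>\<^sub>m (U * tm y)" using u(1) Wc
        by (simp only: tm_act) (simp add: mult_smult_assoc_mat[of _ N N _ N])
      show "tm (tr ?z' (tr ?z x)) = tm x"
        unfolding tm_tr tz tm_act[OF u(1)]
      proof -
        have cancel: "C + D + (-1) \<cdot>\<^sub>m D = C" if "C \<in> carrier_mat N N" "D \<in> carrier_mat N N" for C D :: "complex mat"
          by (rule eq_matI) (use that in auto)
        show "tm x + U * tm y + (-1) \<cdot>\<^sub>m (U * tm y) = tm x"
          by (rule cancel[OF tm_carrier mult_carrier_mat[OF u(1) tm_carrier]])
      qed
    qed simp
    have "(\<integral>\<^sup>+x. f (tr x ?z') * g x \<partial>Lm) = (\<integral>\<^sup>+x. ?h x \<partial>Lm)" by (simp add: tc[of _ ?z'])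
    also have "\<dots> = (\<integral>\<^sup>+x. ?h (tr ?z x) \<partial>Lm)" by (rule tr_integral[OF h, symmetric])
    also have "\<dots> = (\<integral>\<^sup>+x. f x * g (tr x ?z) \<partial>Lm)"
      by (rule nn_integral_cong) (simp only: zz tc[of _ ?z])
    finally show "(\<integral>\<^sup>+x. f x * g (tr x ?z) \<partial>Lm) = (\<integral>\<^sup>+x. f (tr x ?z') * g x \<partial>Lm)" ..
  qed
  also have "\<dots> = (\<integral>\<^sup>+x. (\<integral>\<^sup>+y. f (tr x (act ?W y)) * g x \<partial>Lm) \<partial>Lm)" by (rule LL.Fubini'[OF m2])
  also have "\<dots> = (\<integral>\<^sup>+x. emeasure Lm E * g x \<partial>Lm)"
  proof (rule nn_integral_cong)
    fix x
    have "(\<lambda>y. f (tr x (act ?W y))) \<in> borel_measurable Lm"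
      by (rule measurable_compose[OF measurable_compose[OF act_meas tr_meas] f])
    then show "(\<integral>\<^sup>+y. f (tr x (act ?W y)) * g x \<partial>Lm) = emeasure Lm E * g x"
      by (simp add: nn_integral_multc act_integral[OF W f] fW)
  qed
  also have "\<dots> = emeasure Lm E * (\<integral>\<^sup>+x. g x \<partial>Lm)" using g by (rule nn_integral_cmult)
  finally show ?thesis using E(2,3) by (simp add: ennreal_mult_cancel_left)
qed

end

context haar_construction
begin

text \<open>The entrywise sum bounds the operator norm of \<open>1 - B* B\<close> and, unlike it, is evidently measurable.\<close>

definition dev :: "complex mat => real" where
  "dev B = (\<Sum>i<N. \<Sum>j<N. cmod ((1\<^sub>m N + (-1) \<cdot>\<^sub>m (mat_adjoint B * B)) $$ (i, j)))"

definition E where "E = {G \<in> space Lm. dev (tm G) < 1/2}"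

lemma tm_mat_meas: "mat_meas N Lm tm"
  using Lm_component by (auto simp: mat_meas_def tm_def)

lemma E_sets: "E \<in> sets Lm"
proof -
  have m: "mat_meas N Lm (\<lambda>G. 1\<^sub>m N + (-1) \<cdot>\<^sub>m (mat_adjoint (tm G) * tm G))"
    by (intro mat_meas_add mat_meas_const mat_meas_smult mat_meas_mult mat_meas_adjoint tm_mat_meas) simp
  have "(\<lambda>G. dev (tm G)) \<in> borel_measurable Lm"
    unfolding dev_def using m
    by (intro borel_measurable_sum measurable_compose[OF _ borel_measurable_norm]) (auto simp: mat_meas_def)
  then show ?thesis unfolding E_def by measurable
qed

lemma gram_unitary: assumes U: "U \<in> unitary_mats N" and B: "B \<in> carrier_mat N N"
  shows "mat_adjoint (U * B) * (U * B) = mat_adjoint B * B"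
proof -
  note u = unitary_matsD[OF U]
  note as = assoc_mult_mat[of _ N N _ N _ N]
  have "mat_adjoint (U * B) * (U * B) = mat_adjoint B * (mat_adjoint U * (U * B))"
    using u(1) B by (simp add: mat_adjoint_mult[of _ N] as)
  then show ?thesis using unitary_inj_adj[OF U B] by simp
qed

lemma E_unitary: "U \<in> unitary_mats N ==> act U y \<in> E \<longleftrightarrow> dev (tm y) < 1/2"
  using unitary_matsD(1)[of U N] by (simp add: E_def tm_act dev_def gram_unitary)

lemma gram_entry: "(mat_adjoint (tm G) * tm G) $$ (i, j) = (\<Sum>k<N. cnj (G (k, i)) * G (k, j))" if "i < N" "j < N"
proof -
  have "(mat_adjoint (tm G) * tm G) $$ (i, j) = (\<Sum>k<N. mat_adjoint (tm G) $$ (i, k) * tm G $$ (k, j))"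
    using that carrier_matD[OF tm_carrier[of G]]
    by (auto simp: scalar_prod_def lessThan_atLeast0 intro!: sum.cong)
  also have "\<dots> = (\<Sum>k<N. cnj (G (k, i)) * G (k, j))"
    using that by (intro sum.cong refl) (simp add: mat_adjoint_index[OF tm_carrier], simp add: tm_def)
  finally show ?thesis .
qed

lemma dev_entry: "(1\<^sub>m N + (-1) \<cdot>\<^sub>m (mat_adjoint (tm G) * tm G)) $$ (i, j)
    = (if i = j then 1 else 0) - (\<Sum>k<N. cnj (G (k, i)) * G (k, j))" if "i < N" "j < N"
  using that carrier_matD[OF tm_carrier[of G]] gram_entry[OF that, of G] by (simp del: index_mult_mat(1))

text \<open>The diagonal entries of \<open>B* B\<close> bound the columns of \<open>B\<close>.\<close>

lemma E_finite: "emeasure Lm E \<noteq> \<infinity>"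
proof -
  have "E \<subseteq> (\<Pi>\<^sub>E p\<in>I. cball 0 2)"
  proof
    fix G assume G: "G \<in> E"
    have "cmod (G (i, j)) \<le> 2" if ij: "i < N" "j < N" for i j
    proof -
      let ?X = "1\<^sub>m N + (-1) \<cdot>\<^sub>m (mat_adjoint (tm G) * tm G)"
      have "cmod (?X $$ (j, j)) \<le> (\<Sum>b<N. cmod (?X $$ (j, b)))"
        using ij by (intro member_le_sum) auto
      also have "\<dots> \<le> dev (tm G)" unfolding dev_def
        using ij by (intro member_le_sum[where f="\<lambda>a. \<Sum>b<N. cmod (?X $$ (a, b))"] sum_nonneg) auto
      finally have "cmod (?X $$ (j, j)) < 1/2" using G by (simp add: E_def)
      then have "cmod (1 - (\<Sum>k<N. cnj (G (k, j)) * G (k, j))) < 1/2" using dev_entry[OF ij(2) ij(2), of G] by simp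
      moreover have "(\<Sum>k<N. cnj (G (k, j)) * G (k, j)) = of_real (\<Sum>k<N. (cmod (G (k, j)))\<^sup>2)"
        by (simp only: of_real_sum complex_norm_square mult.commute)
      ultimately have "cmod (of_real (1 - (\<Sum>k<N. (cmod (G (k, j)))\<^sup>2))) < 1/2" by simp
      then have "\<bar>1 - (\<Sum>k<N. (cmod (G (k, j)))\<^sup>2)\<bar> < 1/2" by (simp only: norm_of_real)
      moreover have "\<bar>1 - t\<bar> < 1/2 ==> t \<le> 2\<^sup>2" for t :: real by (auto simp: abs_if split: if_splits)
      ultimately have "(\<Sum>k<N. (cmod (G (k, j)))\<^sup>2) \<le> 2\<^sup>2" by blast
      moreover have "(cmod (G (i, j)))\<^sup>2 \<le> (\<Sum>k<N. (cmod (G (k, j)))\<^sup>2)" using ij by (intro member_le_sum) auto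
      ultimately have "(cmod (G (i, j)))\<^sup>2 \<le> 2\<^sup>2" by (rule order_trans[rotated])
      then show ?thesis by (rule power2_le_imp_le) simp
    qed
    then show "G \<in> (\<Pi>\<^sub>E p\<in>I. cball 0 2)" using G by (auto simp: E_def sp PiE_iff)
  qed
  moreover have "(\<Pi>\<^sub>E p\<in>I. cball (0::complex) 2) \<in> sets Lm" unfolding Lm_def by (intro sets_PiM_I_finite) auto
  ultimately have "emeasure Lm E \<le> emeasure Lm (\<Pi>\<^sub>E p\<in>I. cball 0 2)" by (rule emeasure_mono)
  also have "\<dots> = (\<Prod>p\<in>I. emeasure lborel (cball (0::complex) 2))" unfolding Lm_def by (rule emeasure_PiM) auto
  also have "\<dots> < \<infinity>"
    using emeasure_bounded_finite[OF bounded_cball[of "0::complex" 2]] by (simp add: power_less_top_ennreal)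
  finally show ?thesis by simp
qed

text \<open>A product of small balls around the entries of the identity matrix lies in the set.\<close>

lemma E_pos: "emeasure Lm E \<noteq> 0"
proof -
  \<comment> \<open>The \<open>N\<^sup>2\<close> entries of \<open>1 - B* B\<close> are each at most \<open>3 e\<close>.\<close>
  define e where "e = 1 / (8 * (real N)\<^sup>2)"
  have N1: "1 \<le> real N" using N by simp
  then have e: "e > 0" "real N * e \<le> 1" by (auto simp: e_def power2_eq_square field_simps)
  let ?d = "\<lambda>p::nat \<times> nat. if fst p = snd p then 1 else (0::complex)"
  have "(\<Pi>\<^sub>E p\<in>I. ball (?d p) e) \<subseteq> E"
  proof
    fix G assume G: "G \<in> (\<Pi>\<^sub>E p\<in>I. ball (?d p) e)"
    define h where "h p = G p - ?d p" for p
    have h: "cmod (h (i, j)) \<le> e" if "i < N" "j < N" for i j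
    proof -
      have "G (i, j) \<in> ball (?d (i, j)) e" using G that by (auto simp: PiE_iff)
      then show ?thesis unfolding h_def mem_ball dist_norm by (simp only: norm_minus_commute less_imp_le)
    qed
    have ent: "cmod ((1\<^sub>m N + (-1) \<cdot>\<^sub>m (mat_adjoint (tm G) * tm G)) $$ (i, j)) \<le> 3 * e" if ij: "i < N" "j < N" for i j
    proof -
      have "(\<Sum>k<N. cnj (G (k, i)) * G (k, j)) = (\<Sum>k<N. (if k = i then (if i = j then 1 else 0) else 0)
          + (if k = i then h (i, j) else 0) + (if k = j then cnj (h (j, i)) else 0) + cnj (h (k, i)) * h (k, j))"
        by (intro sum.cong refl) (auto simp: h_def algebra_simps)
      also have "\<dots> = (if i = j then 1 else 0) + h (i, j) + cnj (h (j, i)) + (\<Sum>k<N. cnj (h (k, i)) * h (k, j))"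
        using ij by (simp add: sum.distrib)
      finally have eq: "(1\<^sub>m N + (-1) \<cdot>\<^sub>m (mat_adjoint (tm G) * tm G)) $$ (i, j)
          = - (h (i, j) + cnj (h (j, i)) + (\<Sum>k<N. cnj (h (k, i)) * h (k, j)))"
        using dev_entry[OF ij, of G] by simp
      have "cmod (\<Sum>k<N. cnj (h (k, i)) * h (k, j)) \<le> (\<Sum>k<N. e * e)"
        using h ij e by (intro sum_norm_le) (auto simp: norm_mult intro!: mult_mono)
      also have "\<dots> = (real N * e) * e" by simp
      also have "\<dots> \<le> 1 * e" using e by (intro mult_right_mono) auto
      finally have 3: "cmod (\<Sum>k<N. cnj (h (k, i)) * h (k, j)) \<le> e" by simp
      have "cmod (h (i, j) + cnj (h (j, i)) + (\<Sum>k<N. cnj (h (k, i)) * h (k, j))) \<le> (e + e) + e"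
        using h[OF ij] h[OF ij(2) ij(1)] 3 by (intro norm_triangle_le add_mono order_trans[OF norm_triangle_ineq]) auto
      then show ?thesis unfolding eq norm_minus_cancel by simp
    qed
    have "dev (tm G) \<le> (\<Sum>i<N. \<Sum>j<N. 3 * e)" unfolding dev_def by (intro sum_mono ent) auto
    also have "\<dots> < 1/2" using N1 by (simp add: e_def power2_eq_square)
    finally show "G \<in> E" using G by (auto simp: E_def sp PiE_iff)
  qed
  moreover have "0 < emeasure Lm (\<Pi>\<^sub>E p\<in>I. ball (?d p) e)"
  proof -
    have "emeasure Lm (\<Pi>\<^sub>E p\<in>I. ball (?d p) e) = (\<Prod>p\<in>I. emeasure lborel (ball (?d p) e))"
      unfolding Lm_def by (rule emeasure_PiM) auto
    moreover have "emeasure lborel (ball c e) \<noteq> 0" for c :: complex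
    proof -
      have "ennreal (unit_ball_vol 2 * e ^ 2) \<noteq> 0" using e by (simp add: unit_ball_vol_2)
      moreover have "emeasure lborel (ball c e) = ennreal (unit_ball_vol 2 * e ^ 2)"
        using emeasure_ball[of e c] e by simp
      ultimately show ?thesis by simp
    qed
    ultimately show ?thesis by (simp add: prod_zero_iff zero_less_iff_neq_zero)
  qed
  ultimately have "0 < emeasure Lm E" using emeasure_mono[OF _ E_sets] less_le_trans by blast
  then show ?thesis by simp
qed

lemma Lm_unitary_integral:
  assumes U: "U \<in> unitary_mats N" and g: "g \<in> borel_measurable Lm"
  shows "(\<integral>\<^sup>+y. g (act U y) \<partial>Lm) = (\<integral>\<^sup>+y. g y \<partial>Lm)"
  by (rule unitary_invariant[OF U E_sets E_pos E_finite _ g])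
     (simp add: E_unitary[OF neg_unitary[OF U]], simp add: E_def)

text \<open>Only used on \<open>E\<close>, where the limit exists and is unitary.\<close>

definition Ph :: "(nat \<times> nat => complex) => complex mat" where
  "Ph G = Matrix.mat N N (\<lambda>p. lim (\<lambda>k. mns N (tm G) k $$ p))"

lemma mns_meas: "mat_meas N Lm (\<lambda>G. mns N (tm G) k)"
proof (induction k)
  case 0
  show ?case using tm_mat_meas by (simp add: mns_simps)
next
  case (Suc k)
  show ?case unfolding mns_simps
    by (intro mat_meas_mult mat_meas_add mat_meas_smult mat_meas_const mat_meas_adjoint Suc) auto
qed

lemma Ph_meas: "mat_meas N Lm Ph"
  unfolding mat_meas_def
proof (intro conjI allI impI ballI)
  fix i j assume ij: "i < N" "j < N"
  have "(\<lambda>G. lim (\<lambda>k. mns N (tm G) k $$ (i, j))) \<in> borel_measurable Lm"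
    by (rule borel_measurable_lim_metric) (use mns_meas ij in \<open>auto simp: mat_meas_def\<close>)
  then show "(\<lambda>G. Ph G $$ (i, j)) \<in> borel_measurable Lm" using ij by (simp add: Ph_def)
qed (simp add: Ph_def)

lemma Ph_lim:
  assumes G: "G \<in> E"
  shows "cstar_semi.conv (mat_algebra N) (mat_opnorm N) (mns N (tm G)) (Ph G)" and "Ph G \<in> unitary_mats N"
proof -
  interpret cstar "mat_algebra N" "mat_opnorm N" by (rule mat_cstar)
  let ?B = "tm G"
  have X: "1\<^sub>m N + (-1) \<cdot>\<^sub>m (mat_adjoint ?B * ?B) \<in> carrier_mat N N"
    using tm_carrier[of G] mat_adjoint_carrier[OF tm_carrier[of G]] by simp
  have "mat_opnorm N (sb \<one>\<^bsub>mat_algebra N\<^esub> (star (mat_algebra N) ?B \<otimes>\<^bsub>mat_algebra N\<^esub> ?B)) \<le> 1/2"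
    using mat_opnorm_le_entries[OF X] G unfolding E_def dev_def by simp
  then obtain v where v: "conv (newton_schulz ?B) v" "mat_adjoint v * v = 1\<^sub>m N"
    using newton_schulz_conv[of ?B] by auto
  have vc: "v \<in> carrier_mat N N" using convD(2)[OF v(1)] by simp
  have ent: "(\<lambda>k. mns N ?B k $$ (i, j)) \<longlonglongrightarrow> v $$ (i, j)" if ij: "i < N" "j < N" for i j
  proof (rule LIM_zero_cancel, rule Lim_null_comparison)
    have "norm (mns N ?B k $$ (i, j) - v $$ (i, j)) \<le> seminorm_dist (mat_algebra N) (mat_opnorm N) (mns N ?B k) v" for k
    proof -
      have m: "mns N ?B k \<in> carrier_mat N N" by simp
      then have "mns N ?B k + (-1) \<cdot>\<^sub>m v \<in> carrier_mat N N" using vc by simp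
      from mat_entry_le_opnorm[OF this ij] show ?thesis
        using ij vc carrier_matD[OF m] by (simp add: seminorm_dist_def)
    qed
    then show "\<forall>\<^sub>F k in sequentially. norm (mns N ?B k $$ (i, j) - v $$ (i, j)) \<le> seminorm_dist (mat_algebra N) (mat_opnorm N) (mns N ?B k) v"
      by simp
    show "(\<lambda>k. seminorm_dist (mat_algebra N) (mat_opnorm N) (mns N ?B k) v) \<longlonglongrightarrow> 0"
      using v(1) unfolding conv_def mns_def by blast
  qed
  have "Ph G = v"
    by (rule eq_matI) (use vc ent in \<open>auto simp: Ph_def limI\<close>)
  then show "conv (mns N (tm G)) (Ph G)" "Ph G \<in> unitary_mats N"
    using v vc mat_mult_left_right_inverse[OF _ vc v(2)] by (auto simp: mns_def unitary_mats_def)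
qed

lemma Ph_act: assumes U: "U \<in> unitary_mats N" and G: "G \<in> E" shows "Ph (act U G) = U * Ph G"
proof -
  interpret cstar "mat_algebra N" "mat_opnorm N" by (rule mat_cstar)
  note u = unitary_matsD[OF U]
  have G': "act U G \<in> E" using E_unitary[OF U, of G] G by (simp add: E_def)
  have "conv (\<lambda>k. U \<otimes>\<^bsub>mat_algebra N\<^esub> mns N (tm G) k) (U \<otimes>\<^bsub>mat_algebra N\<^esub> Ph G)"
    by (intro conv_mult conv_const Ph_lim[OF G]) (use u in simp)
  moreover have "mns N (tm (act U G)) = (\<lambda>k. U \<otimes>\<^bsub>mat_algebra N\<^esub> mns N (tm G) k)"
    by (rule ext) (simp add: tm_act[OF u(1)] mns_unitary[OF U])
  ultimately have "conv (mns N (tm (act U G))) (U * Ph G)" by simp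
  then show ?thesis using conv_unique[OF Ph_lim(1)[OF G']] by simp
qed

definition hm :: "complex mat measure" where
  "hm = distr (uniform_measure Lm E) (unitary_borel N) (\<lambda>G. if G \<in> E then Ph G else 1\<^sub>m N)"

lemma one_unitary: "1\<^sub>m N \<in> unitary_mats N"
  using star_alg.star_one[OF mat_star_alg, of N] by (simp add: unitary_mats_def)

lemma P_meas: "(\<lambda>G. if G \<in> E then Ph G else 1\<^sub>m N) \<in> measurable Lm (unitary_borel N)"
  unfolding measurable_unitary_iff
proof (intro conjI ballI)
  show "mat_meas N Lm (\<lambda>G. if G \<in> E then Ph G else 1\<^sub>m N)"
    unfolding mat_meas_def
  proof (intro conjI allI impI ballI)
    fix i j assume ij: "i < N" "j < N"
    have "(\<lambda>G. if G \<in> E then Ph G $$ (i, j) else 1\<^sub>m N $$ (i, j)) \<in> borel_measurable Lm"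
      using Ph_meas ij E_sets by (intro measurable_If_set) (auto simp: mat_meas_def)
    then show "(\<lambda>G. (if G \<in> E then Ph G else 1\<^sub>m N) $$ (i, j)) \<in> borel_measurable Lm"
      by (simp add: if_distrib[of "\<lambda>A. A $$ (i, j)"])
  qed (use Ph_meas in \<open>auto simp: mat_meas_def\<close>)
  fix G show "(if G \<in> E then Ph G else 1\<^sub>m N) \<in> unitary_mats N" using Ph_lim(2) one_unitary by simp
qed

lemma hm_emeasure: assumes B: "B \<in> sets (unitary_borel N)"
  shows "emeasure hm B = emeasure Lm {G \<in> E. Ph G \<in> B} / emeasure Lm E"
proof -
  let ?f = "\<lambda>G. if G \<in> E then Ph G else 1\<^sub>m N"
  have m: "?f \<in> measurable (uniform_measure Lm E) (unitary_borel N)"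
    using P_meas by (simp add: measurable_cong_sets[OF sets_uniform_measure refl])
  have s: "?f -` B \<inter> space Lm \<in> sets Lm" by (rule measurable_sets[OF P_meas B])
  have "emeasure hm B = emeasure (uniform_measure Lm E) (?f -` B \<inter> space Lm)"
    unfolding hm_def by (subst emeasure_distr[OF m B]) simp
  also have "\<dots> = emeasure Lm (E \<inter> (?f -` B \<inter> space Lm)) / emeasure Lm E"
    by (rule emeasure_uniform_measure[OF E_sets s])
  also have "E \<inter> (?f -` B \<inter> space Lm) = {G \<in> E. Ph G \<in> B}" by (auto simp: E_def)
  finally show ?thesis .
qed

lemma hm_set: assumes B: "B \<in> sets (unitary_borel N)" shows "{G \<in> E. Ph G \<in> B} \<in> sets Lm"
proof -
  have "E \<inter> ((\<lambda>G. if G \<in> E then Ph G else 1\<^sub>m N) -` B \<inter> space Lm) \<in> sets Lm"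
    using E_sets measurable_sets[OF P_meas B] by (rule sets.Int)
  moreover have "E \<inter> ((\<lambda>G. if G \<in> E then Ph G else 1\<^sub>m N) -` B \<inter> space Lm) = {G \<in> E. Ph G \<in> B}" by (auto simp: E_def)
  ultimately show ?thesis by simp
qed

lemma hm_haar: "is_haar N hm"
  unfolding is_haar_def
proof (intro conjI ballI)
  show s: "sets hm = sets (unitary_borel N)" by (simp add: hm_def)
  have m: "(\<lambda>G. if G \<in> E then Ph G else 1\<^sub>m N) \<in> measurable (uniform_measure Lm E) (unitary_borel N)"
    using P_meas by (simp add: measurable_cong_sets[OF sets_uniform_measure refl])
  show "prob_space hm" unfolding hm_def
    by (rule prob_space.prob_space_distr[OF prob_space_uniform_measure[OF E_pos E_finite] m])
  fix U assume U: "U \<in> unitary_mats N"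
  have sp': "space hm = unitary_mats N" by (simp add: hm_def)
  have "mat_meas N hm (\<lambda>V. V)"
  proof -
    have "(\<lambda>V. V) \<in> measurable hm (unitary_borel N)" by (rule measurable_ident_sets[OF s])
    then show ?thesis by (simp add: measurable_unitary_iff)
  qed
  then have mU: "(\<lambda>V. U * V) \<in> measurable hm (unitary_borel N)"
    unfolding measurable_unitary_iff
    using unitary_matsD(1)[OF U] unitary_mult[OF U] sp' by (auto intro!: mat_meas_mult mat_meas_const)
  then have mU': "(\<lambda>V. U * V) \<in> measurable hm hm" by (simp add: measurable_cong_sets[OF refl s])
  show "distr hm hm (\<lambda>V. U * V) = hm"
  proof (rule measure_eqI)
    fix B assume "B \<in> sets (distr hm hm (\<lambda>V. U * V))"
    then have B: "B \<in> sets (unitary_borel N)" "B \<in> sets hm" using s by auto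
    let ?B' = "(\<lambda>V. U * V) -` B \<inter> space hm"
    have B': "?B' \<in> sets (unitary_borel N)" using measurable_sets[OF mU B(1)] s by simp
    have "emeasure (distr hm hm (\<lambda>V. U * V)) B = emeasure hm ?B'" by (rule emeasure_distr[OF mU' B(2)])
    also have "\<dots> = emeasure Lm {G \<in> E. Ph G \<in> ?B'} / emeasure Lm E" by (rule hm_emeasure[OF B'])
    also have "emeasure Lm {G \<in> E. Ph G \<in> ?B'} = (\<integral>\<^sup>+G. indicator {G \<in> E. Ph G \<in> B} (act U G) \<partial>Lm)"
    proof -
      have "emeasure Lm {G \<in> E. Ph G \<in> ?B'} = (\<integral>\<^sup>+G. indicator {G \<in> E. Ph G \<in> ?B'} G \<partial>Lm)"
        using hm_set[OF B'] by simp
      also have "\<dots> = (\<integral>\<^sup>+G. indicator {G \<in> E. Ph G \<in> B} (act U G) \<partial>Lm)"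
      proof (rule nn_integral_cong)
        fix G assume G: "G \<in> space Lm"
        have "G \<in> E \<and> Ph G \<in> ?B' \<longleftrightarrow> act U G \<in> E \<and> Ph (act U G) \<in> B"
        proof (cases "G \<in> E")
          case True
          then show ?thesis using E_unitary[OF U, of G] Ph_act[OF U True] Ph_lim(2)[OF True] sp' by (simp add: E_def)
        next
          case False
          then show ?thesis using E_unitary[OF U, of G] G by (simp add: E_def)
        qed
        then show "indicator {G \<in> E. Ph G \<in> ?B'} G = (indicator {G \<in> E. Ph G \<in> B} (act U G) :: ennreal)"
          by (simp add: indicator_def)
      qed
      finally show ?thesis .
    qed
    also have "\<dots> = emeasure Lm {G \<in> E. Ph G \<in> B}"
      using Lm_unitary_integral[OF U, of "indicator {G \<in> E. Ph G \<in> B}"] hm_set[OF B(1)] by simp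
    also have "emeasure Lm {G \<in> E. Ph G \<in> B} / emeasure Lm E = emeasure hm B" by (rule hm_emeasure[OF B(1), symmetric])
    finally show "emeasure (distr hm hm (\<lambda>V. U * V)) B = emeasure hm B" .
  qed simp
qed

end

theorem haar_unitary_is_haar: assumes "N \<ge> 1" shows "is_haar N (haar_unitary N)"
proof -
  interpret haar_construction N by unfold_locales (rule assms)
  have "is_haar N (THE \<mu>. is_haar N \<mu>)"
    by (rule theI[of "is_haar N", OF hm_haar]) (rule is_haar_unique[OF _ hm_haar])
  then show ?thesis unfolding haar_unitary_def is_haar_def .
qed

corollary space_haar_unitary: "N \<ge> 1 ==> space (haar_unitary N) = unitary_mats N"
  using is_haarD(3)[OF haar_unitary_is_haar] .

section \<open>Density theorems\<close>

definition commutant :: "('h::complex_hilbert_space \<Rightarrow>\<^sub>L 'h) set => ('h \<Rightarrow>\<^sub>L 'h) set" where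
  "commutant A = {P \<in> bounded_ops. \<forall>a\<in>A. a o\<^sub>L P = P o\<^sub>L a}"

definition bicommutant :: "('h::complex_hilbert_space \<Rightarrow>\<^sub>L 'h) set => ('h \<Rightarrow>\<^sub>L 'h) set" where
  "bicommutant A = {T \<in> bounded_ops. \<forall>P\<in>commutant A. T o\<^sub>L P = P o\<^sub>L T}"

text \<open>Commuting with a given operator is a closed condition in the weak operator topology, and the commutant of a self-adjoint set is
  self-adjoint.\<close>

lemma bicommutant_inter_vN:
  assumes M: "von_neumann_algebra M" and A: "A \<subseteq> bounded_ops" and star: "\<And>a. a \<in> A ==> op_adjoint a \<in> A"
  shows "von_neumann_algebra (M \<inter> bicommutant A)"
proof -
  note m = vN_closed[OF M]
  have adj: "op_adjoint P \<in> commutant A" if P: "P \<in> commutant A" for P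
  proof -
    have Pb: "P \<in> bounded_ops" using P by (simp add: commutant_def)
    have "a o\<^sub>L op_adjoint P = op_adjoint P o\<^sub>L a" if a: "a \<in> A" for a
    proof (rule blinfun_eqI, rule cinner_eqI)
      fix x y
      have ab: "a \<in> bounded_ops" using a A by blast
      have "op_adjoint a o\<^sub>L P = P o\<^sub>L op_adjoint a" using P star[OF a] by (simp add: commutant_def)
      then have e: "(op_adjoint a) (P y) = P ((op_adjoint a) y)" for y
        by (metis blinfun_apply_blinfun_compose)
      have "cinner y (a ((op_adjoint P) x)) = cinner (P ((op_adjoint a) y)) x"
        by (simp add: op_adjoint(2)[OF ab, symmetric] op_adjoint_right[OF Pb])
      also have "\<dots> = cinner y ((op_adjoint P) (a x))"
        by (simp add: e[symmetric] op_adjoint(2)[OF ab] op_adjoint_right[OF Pb])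
      finally show "cinner y ((a o\<^sub>L op_adjoint P) x) = cinner y ((op_adjoint P o\<^sub>L a) x)" by simp
    qed
    then show ?thesis using op_adjoint(1)[OF Pb] by (simp add: commutant_def)
  qed
  have cb: "T \<in> bicommutant A \<longleftrightarrow> T \<in> bounded_ops \<and> (\<forall>P\<in>commutant A. \<forall>x. T (P x) = P (T x))" for T
    by (simp add: bicommutant_def blinfun_apply_inject[symmetric] fun_eq_iff)
  have PD: "P \<in> bounded_ops" if "P \<in> commutant A" for P using that by (simp add: commutant_def)
  have star': "op_adjoint T \<in> bicommutant A" if T: "T \<in> bicommutant A" for T
  proof -
    have Tb: "T \<in> bounded_ops" using T by (simp add: cb)
    have "(op_adjoint T) (P x) = P ((op_adjoint T) x)" if P: "P \<in> commutant A" for P x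
    proof (rule cinner_eqI)
      fix y
      have "cinner y ((op_adjoint T) (P x)) = cinner ((op_adjoint P) (T y)) x"
        by (simp add: op_adjoint_right[OF Tb] op_adjoint(2)[OF PD[OF P]])
      also have "(op_adjoint P) (T y) = T ((op_adjoint P) y)"
        using T adj[OF P] by (simp add: cb)
      also have "cinner \<dots> x = cinner y (P ((op_adjoint T) x))"
        by (simp add: op_adjoint_right[OF Tb, symmetric] op_adjoint(2)[OF PD[OF P]])
      finally show "cinner y ((op_adjoint T) (P x)) = cinner y (P ((op_adjoint T) x))" .
    qed
    then show ?thesis using op_adjoint(1)[OF Tb] by (simp add: cb)
  qed
  have closed: "closedin weak_operator_topology (bicommutant A)"
  proof -
    let ?S = "\<lambda>P x y. {T \<in> topspace weak_operator_topology.
       cinner y (blinfun_apply T (blinfun_apply P x)) - cinner (blinfun_apply (op_adjoint P) y) (blinfun_apply T x) \<in> {0}}"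
    let ?F = "insert (topspace weak_operator_topology) {?S P x y | P x y. P \<in> commutant A}"
    have "closedin weak_operator_topology (?S P x y)" for P x y
      by (rule closedin_continuous_map_preimage[OF continuous_map_diff[OF wot_continuous wot_continuous]]) simp
    then have "closedin weak_operator_topology (\<Inter>?F)" by (intro closedin_Inter) auto
    moreover have "\<Inter>?F = bicommutant A"
    proof (rule Set.set_eqI)
      fix T
      have "T \<in> \<Inter>?F \<longleftrightarrow> T \<in> bounded_ops \<and> (\<forall>P\<in>commutant A. \<forall>x y. cinner y (T (P x)) = cinner y (P (T x)))"
      proof (intro iffI)
        assume a: "T \<in> \<Inter>?F"
        then have Tb: "T \<in> bounded_ops" by (simp add: wot_topspace)
        moreover have "cinner y (blinfun_apply T (blinfun_apply P x)) = cinner y (blinfun_apply P (blinfun_apply T x))"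
          if P: "P \<in> commutant A" for P x y
        proof -
          have "T \<in> ?S P x y" by (rule InterD[OF a]) (use P in blast)
          then show ?thesis by (simp add: op_adjoint(2)[OF PD[OF P]])
        qed
        ultimately show "T \<in> bounded_ops \<and> (\<forall>P\<in>commutant A. \<forall>x y. cinner y (T (P x)) = cinner y (P (T x)))"
          by blast
      next
        assume a: "T \<in> bounded_ops \<and> (\<forall>P\<in>commutant A. \<forall>x y. cinner y (T (P x)) = cinner y (P (T x)))"
        then have "T \<in> ?S P x y" if P: "P \<in> commutant A" for P x y
          using P by (simp add: wot_topspace op_adjoint(2)[OF PD[OF P]])
        then show "T \<in> \<Inter>?F" using a wot_topspace by auto
      qed
      also have "\<dots> \<longleftrightarrow> T \<in> bicommutant A" unfolding cb by (metis cinner_eqI)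
      finally show "T \<in> \<Inter>?F \<longleftrightarrow> T \<in> bicommutant A" .
    qed
    ultimately show ?thesis by simp
  qed
  have "closedin weak_operator_topology (M \<inter> bicommutant A)"
    using M closed by (simp add: von_neumann_algebra_def closedin_Int)
  moreover have "S + T \<in> bicommutant A" "S o\<^sub>L T \<in> bicommutant A"
    if "S \<in> bicommutant A" "T \<in> bicommutant A" for S T
    using that by (auto simp: cb bounded_ops_closed blinfun.add_left blinfun.add_right)
  moreover have "op_scale c T \<in> bicommutant A" if "T \<in> bicommutant A" for c T
    using that PD by (auto simp: cb bounded_ops_closed bounded_opsD)
  moreover have "id_blinfun \<in> bicommutant A" by (simp add: cb bounded_ops_closed)
  ultimately show ?thesis
    using m star' unfolding von_neumann_algebra_def op_algebra_simps by auto
qed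

text \<open>The right-hand side is one of the von Neumann algebras in the intersection.\<close>

lemma generated_vN_subset_bicommutant:
  assumes M: "von_neumann_algebra M" and A: "A \<subseteq> M" "\<And>a. a \<in> A ==> op_adjoint a \<in> A" and X: "X \<subseteq> A"
  shows "generated_vN M X \<subseteq> M \<inter> bicommutant A"
proof -
  have Ab: "A \<subseteq> bounded_ops" using A(1) vN_closed(1)[OF M] by blast
  have "A \<subseteq> bicommutant A" using Ab by (auto simp: bicommutant_def commutant_def)
  then show ?thesis
    using bicommutant_inter_vN[OF M Ab A(2)] A(1) X unfolding generated_vN_def by (intro Inter_lower) auto
qed

text \<open>The density theorem: members of the bicommutant are limits of members of \<open>A\<close> on finite tuples \<open>\<xi>\<close>
  of vectors. As usual the orthogonal projection onto the closure of \<open>A \<xi>\<close> in the \<open>K\<close>-fold sum of the Hilbert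
  space is used; its matrix entries (\<open>comp\<close>) lie in the commutant of \<open>A\<close>, so a member of the bicommutant preserves
  its range. The projection is handled through the relation \<open>proj_of\<close> between tuples.\<close>

locale operator_star_algebra =
  fixes A :: "('h::complex_hilbert_space \<Rightarrow>\<^sub>L 'h) set"
  assumes bounded: "a \<in> A ==> a \<in> bounded_ops" and one: "id_blinfun \<in> A"
    and add: "a \<in> A ==> b \<in> A ==> a + b \<in> A" and mult: "a \<in> A ==> b \<in> A ==> a o\<^sub>L b \<in> A"
    and scale: "a \<in> A ==> op_scale c a \<in> A" and star: "a \<in> A ==> op_adjoint a \<in> A"
begin

context
  fixes K :: nat and \<xi> :: "nat => 'h"
begin

definition orbit :: "(nat => 'h) set" where
  "orbit = {\<lambda>k. blinfun_apply a (\<xi> k) | a. a \<in> A}"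

definition orth :: "(nat => 'h) => bool" where
  "orth w \<longleftrightarrow> (\<forall>a\<in>A. (\<Sum>k<K. cinner (a (\<xi> k)) (w k)) = 0)"

definition adherent :: "(nat => 'h) => bool" where
  "adherent p \<longleftrightarrow> (\<exists>a. (\<forall>n. a n \<in> A) \<and> (\<forall>k<K. (\<lambda>n. (a n) (\<xi> k)) \<longlonglongrightarrow> p k))"

lemma orth_adherent: assumes "orth w" "adherent p" shows "(\<Sum>k<K. cinner (p k) (w k)) = 0"
proof -
  obtain a where a: "\<And>n. a n \<in> A" "\<And>k. k < K ==> (\<lambda>n. (a n) (\<xi> k)) \<longlonglongrightarrow> p k"
    using assms(2) unfolding adherent_def by blast
  have "(\<lambda>n. \<Sum>k<K. cinner ((a n) (\<xi> k)) (w k)) \<longlonglongrightarrow> (\<Sum>k<K. cinner (p k) (w k))"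
    by (intro tendsto_sum cinner_tendsto tendsto_const a(2)) simp
  moreover have "(\<lambda>n. \<Sum>k<K. cinner ((a n) (\<xi> k)) (w k)) = (\<lambda>n. 0)"
    using assms(1) a(1) by (simp add: orth_def)
  ultimately show ?thesis using LIMSEQ_unique[OF tendsto_const] by metis
qed

lemma adherent_add: assumes "adherent p" "adherent q" shows "adherent (\<lambda>k. p k + q k)"
proof -
  obtain a b where ab: "\<And>n. a n \<in> A" "\<And>k. k < K ==> (\<lambda>n. (a n) (\<xi> k)) \<longlonglongrightarrow> p k"
     "\<And>n. b n \<in> A" "\<And>k. k < K ==> (\<lambda>n. (b n) (\<xi> k)) \<longlonglongrightarrow> q k"
    using assms unfolding adherent_def by blast
  show ?thesis unfolding adherent_def
    by (rule exI[of _ "\<lambda>n. a n + b n"]) (use ab in \<open>auto simp: blinfun.add_left intro!: add tendsto_add\<close>)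
qed

lemma adherent_mult: assumes "adherent p" "b \<in> A" shows "adherent (\<lambda>k. b (p k))"
proof -
  obtain a where a: "\<And>n. a n \<in> A" "\<And>k. k < K ==> (\<lambda>n. (a n) (\<xi> k)) \<longlonglongrightarrow> p k"
    using assms(1) unfolding adherent_def by blast
  show ?thesis unfolding adherent_def
    by (rule exI[of _ "\<lambda>n. b o\<^sub>L a n"]) (use a assms(2) in \<open>auto intro!: mult blinfun.tendsto\<close>)
qed

lemma orth_add: "orth v ==> orth w ==> orth (\<lambda>k. v k + w k)"
  by (simp add: orth_def cinner_add_right sum.distrib)

lemma orth_mult: assumes w: "orth w" and b: "b \<in> A" shows "orth (\<lambda>k. b (w k))"
  unfolding orth_def
proof
  fix a assume a: "a \<in> A"
  have "(\<Sum>k<K. cinner ((op_adjoint b o\<^sub>L a) (\<xi> k)) (w k)) = 0"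
    using w mult[OF star[OF b] a] unfolding orth_def by blast
  then show "(\<Sum>k<K. cinner (a (\<xi> k)) (b (w k))) = 0"
    by (simp add: op_adjoint(2)[OF bounded[OF b]])
qed

definition proj_of :: "(nat => 'h) => (nat => 'h) => bool" where
  "proj_of v p \<longleftrightarrow> adherent p \<and> orth (\<lambda>k. v k - p k)"

lemma proj_exists: "\<exists>p. proj_of v p"
proof -
  have "\<exists>p c. (\<forall>n. c n \<in> orbit) \<and> (\<forall>k<K. (\<lambda>n. c n k) \<longlonglongrightarrow> p k) \<and>
           (\<forall>a\<in>orbit. (\<Sum>k<K. Re (cinner (a k) (v k - p k))) = 0)"
  proof (rule tuple_projection)
    show "(\<lambda>k. 0) \<in> orbit"
    proof -
      have "scaleC 0 x = 0" for x :: 'h using scaleC_of_real[of 0 x] by simp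
      then show ?thesis
        unfolding orbit_def using scale[OF one, of 0] by (intro CollectI exI[of _ "op_scale 0 id_blinfun"]) simp
    qed
    fix a b t assume a: "a \<in> orbit"
    then obtain a' where a': "a' \<in> A" "a = (\<lambda>k. a' (\<xi> k))" by (auto simp: orbit_def)
    show "(\<lambda>k. t *\<^sub>R a k) \<in> orbit" unfolding orbit_def
      using scale[OF a'(1), of "of_real t"] a'(2) by (auto intro!: exI[of _ "op_scale (of_real t) a'"] simp: scaleC_of_real)
    assume "b \<in> orbit"
    then obtain b' where b': "b' \<in> A" "b = (\<lambda>k. b' (\<xi> k))" by (auto simp: orbit_def)
    show "(\<lambda>k. a k + b k) \<in> orbit" unfolding orbit_def
      using add[OF a'(1) b'(1)] a'(2) b'(2) by (auto intro!: exI[of _ "a' + b'"] simp: blinfun.add_left)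
  qed
  then obtain p c where pc: "\<And>n. c n \<in> orbit" "\<And>k. k < K ==> (\<lambda>n. c n k) \<longlonglongrightarrow> p k"
     "\<And>a. a \<in> orbit ==> (\<Sum>k<K. Re (cinner (a k) (v k - p k))) = 0" by blast
  have "\<forall>n. \<exists>a. a \<in> A \<and> c n = (\<lambda>k. a (\<xi> k))" using pc(1) unfolding orbit_def by blast
  then obtain a where a: "\<And>n. a n \<in> A" "\<And>n. c n = (\<lambda>k. (a n) (\<xi> k))" by metis
  have "adherent p" unfolding adherent_def using a pc(2) by auto
  moreover have "orth (\<lambda>k. v k - p k)"
    unfolding orth_def
  proof
    fix b assume b: "b \<in> A"
    let ?s = "\<Sum>k<K. cinner (b (\<xi> k)) (v k - p k)"
    have re: "Re (\<Sum>k<K. cinner (b' (\<xi> k)) (v k - p k)) = 0" if "b' \<in> A" for b'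
      using pc(3)[of "\<lambda>k. b' (\<xi> k)"] that by (auto simp: orbit_def)
    have "(\<Sum>k<K. cinner ((op_scale \<i> b) (\<xi> k)) (v k - p k)) = - \<i> * ?s"
      by (simp add: cinner_scaleC_left sum_distrib_left sum_negf)
    then have "Im ?s = 0" using re[OF scale[OF b, of \<i>]] by simp
    then show "?s = 0" using re[OF b] by (simp add: complex_eq_iff)
  qed
  ultimately show ?thesis unfolding proj_of_def by blast
qed

lemma proj_diff: assumes "proj_of v p" "proj_of v q" "k < K" shows "p k = q k"
proof -
  note am = adherent_mult[OF _ scale[OF one, of "-1"]]
  have neg: "scaleC (-1) x = - x" for x :: 'h using scaleC_of_real[of "-1"] by simp
  have "adherent (\<lambda>k. p k + - q k)"
    using adherent_add[OF _ am, of p q] assms(1,2) by (simp add: proj_of_def neg)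
  moreover have "orth (\<lambda>k. (v k - q k) + - (v k - p k))"
    using orth_add[OF _ orth_mult[OF _ scale[OF one, of "-1"]], of "\<lambda>k. v k - q k" "\<lambda>k. v k - p k"] assms(1,2)
    by (simp add: proj_of_def neg)
  ultimately have "(\<Sum>k<K. cinner (p k + - q k) ((v k - q k) + - (v k - p k))) = 0"
    using orth_adherent by blast
  then have "(\<Sum>k<K. cinner (p k - q k) (p k - q k)) = 0" by simp
  then have "of_real (\<Sum>k<K. (norm (p k - q k))\<^sup>2) = (0 :: complex)" by (simp only: cinner_self of_real_sum)
  then have "(\<Sum>k<K. (norm (p k - q k))\<^sup>2) = 0" by (simp only: of_real_eq_0_iff)
  then have "(norm (p k - q k))\<^sup>2 = 0" using assms(3) by (subst (asm) sum_nonneg_eq_0_iff) auto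
  then show ?thesis by simp
qed

lemma proj_add: "proj_of v p ==> proj_of w q ==> proj_of (\<lambda>k. v k + w k) (\<lambda>k. p k + q k)"
  using adherent_add[of p q] orth_add[of "\<lambda>k. v k - p k" "\<lambda>k. w k - q k"]
  by (simp add: proj_of_def algebra_simps)

lemma proj_mult: "proj_of v p ==> b \<in> A ==> proj_of (\<lambda>k. b (v k)) (\<lambda>k. b (p k))"
  using adherent_mult[of p b] orth_mult[of "\<lambda>k. v k - p k" b] by (simp add: proj_of_def blinfun.diff_right)

lemma proj_scale: "proj_of v p ==> proj_of (\<lambda>k. scaleC c (v k)) (\<lambda>k. scaleC c (p k))"
  using proj_mult[OF _ scale[OF one, of c], of v p] by simp

lemma proj_norm: assumes "proj_of v p" shows "(\<Sum>k<K. (norm (p k))\<^sup>2) \<le> (\<Sum>k<K. (norm (v k))\<^sup>2)"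
proof -
  have "(\<Sum>k<K. cinner (p k) (v k - p k)) = 0" using orth_adherent assms by (simp add: proj_of_def)
  then have "(\<Sum>k<K. Re (cinner (p k) (v k - p k))) = 0" by (simp flip: Re_sum)
  moreover have "(norm (v k))\<^sup>2 = (norm (p k))\<^sup>2 + 2 * Re (cinner (p k) (v k - p k)) + (norm (v k - p k))\<^sup>2" for k
    using norm_add_sq[of "p k" "v k - p k"] by simp
  ultimately have "(\<Sum>k<K. (norm (v k))\<^sup>2) = (\<Sum>k<K. (norm (p k))\<^sup>2) + (\<Sum>k<K. (norm (v k - p k))\<^sup>2)"
    by (simp add: sum.distrib sum_distrib_left[symmetric])
  then show ?thesis by (simp add: sum_nonneg)
qed

definition pr :: "(nat => 'h) => nat => 'h" where "pr v = (SOME p. proj_of v p)"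

lemma pr: "proj_of v (pr v)"
  unfolding pr_def by (rule someI_ex[OF proj_exists])

lemma pr_eq: "proj_of v p ==> k < K ==> pr v k = p k"
  by (rule proj_diff[OF pr])

definition slot :: "nat => 'h => nat => 'h" where "slot l x = (\<lambda>k. if k = l then x else 0)"

definition comp :: "nat => nat => 'h \<Rightarrow>\<^sub>L 'h" where "comp k l = Blinfun (\<lambda>x. pr (slot l x) k)"

lemma comp_apply: assumes k: "k < K" and l: "l < K" shows "(comp k l) x = pr (slot l x) k"
proof -
  have "bounded_linear (\<lambda>x. pr (slot l x) k)"
  proof (rule bounded_linear_intro[where K=1])
    fix x y :: 'h and t :: real
    have s: "slot l (x + y) = (\<lambda>k. slot l x k + slot l y k)" "slot l (t *\<^sub>R x) = (\<lambda>k. scaleC (of_real t) (slot l x k))"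
      by (auto simp: slot_def scaleC_of_real)
    show "pr (slot l (x + y)) k = pr (slot l x) k + pr (slot l y) k"
      unfolding s by (rule pr_eq[OF proj_add[OF pr pr] k])
    show "pr (slot l (t *\<^sub>R x)) k = t *\<^sub>R pr (slot l x) k"
      unfolding s by (subst pr_eq[OF proj_scale[OF pr] k]) (simp add: scaleC_of_real)
    have "(norm (pr (slot l x) k))\<^sup>2 \<le> (\<Sum>k<K. (norm (pr (slot l x) k))\<^sup>2)" using k by (intro member_le_sum) auto
    also have "\<dots> \<le> (\<Sum>k<K. (norm (slot l x k))\<^sup>2)" by (rule proj_norm[OF pr])
    also have "\<dots> = (\<Sum>k<K. if k = l then (norm x)\<^sup>2 else 0)" by (intro sum.cong) (auto simp: slot_def)
    also have "\<dots> = (norm x)\<^sup>2" using l by simp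
    finally show "norm (pr (slot l x) k) \<le> norm x * 1" by (simp add: power2_le_iff_abs_le)
  qed
  then show ?thesis by (simp add: comp_def bounded_linear_Blinfun_apply)
qed

lemma comp_commutant: assumes k: "k < K" and l: "l < K" shows "comp k l \<in> commutant A"
proof -
  have "(comp k l) (scaleC c x) = scaleC c ((comp k l) x)" for c x
  proof -
    have "slot l (scaleC c x) = (\<lambda>k. scaleC c (slot l x k))" by (auto simp: slot_def)
    then show ?thesis using pr_eq[OF proj_scale[OF pr] k] by (simp add: comp_apply[OF assms])
  qed
  moreover have "a o\<^sub>L comp k l = comp k l o\<^sub>L a" if a: "a \<in> A" for a
  proof (rule blinfun_eqI)
    fix x
    have "slot l (a x) = (\<lambda>k. a (slot l x k))" by (auto simp: slot_def)
    then show "(a o\<^sub>L comp k l) x = (comp k l o\<^sub>L a) x"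
      using pr_eq[OF proj_mult[OF pr a] k] by (simp add: comp_apply[OF assms])
  qed
  ultimately show ?thesis by (simp add: commutant_def bounded_ops_def)
qed

lemma pr_sum: assumes k: "k < K" shows "pr v k = (\<Sum>l<K. (comp k l) (v l))"
proof -
  have "proj_of (\<lambda>k. \<Sum>l<m. slot l (v l) k) (\<lambda>k. \<Sum>l<m. pr (slot l (v l)) k)" for m
  proof (induction m)
    case 0
    have "scaleC 0 x = 0" for x :: 'h using scaleC_of_real[of 0] by simp
    then show ?case using proj_scale[OF pr, of 0 "\<lambda>k. 0"] by simp
  next
    case (Suc m)
    show ?case using proj_add[OF Suc pr[of "slot m (v m)"]] by simp
  qed
  from this[of K] have "proj_of v (\<lambda>k. \<Sum>l<K. pr (slot l (v l)) k)"
    by (simp add: proj_of_def orth_def slot_def)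
  then show ?thesis using pr_eq k by (simp add: comp_apply[OF k])
qed

text \<open>The tuple \<open>\<xi>\<close> lies in \<open>A \<xi>\<close> because \<open>A\<close> is unital.\<close>

lemma bicommutant_adherent: assumes T: "T \<in> bicommutant A" shows "adherent (\<lambda>k. T (\<xi> k))"
proof -
  have Tc: "T (P x) = P (T x)" if "P \<in> commutant A" for P x
    using T that unfolding bicommutant_def by (metis (mono_tags, lifting) blinfun_apply_blinfun_compose mem_Collect_eq)
  have "proj_of \<xi> \<xi>"
    unfolding proj_of_def adherent_def orth_def using one by (auto intro!: exI[of _ "\<lambda>n. id_blinfun"])
  then have id: "(\<Sum>l<K. (comp k l) (\<xi> l)) = \<xi> k" if "k < K" for k
    using pr_eq pr_sum that by metis
  have "pr (\<lambda>k. T (\<xi> k)) k = T (\<xi> k)" if k: "k < K" for k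
  proof -
    have "T (\<xi> k) = T (\<Sum>l<K. (comp k l) (\<xi> l))" by (simp only: id[OF k])
    also have "\<dots> = (\<Sum>l<K. (comp k l) (T (\<xi> l)))"
      by (simp add: blinfun.sum_right Tc[OF comp_commutant[OF k]])
    also have "\<dots> = pr (\<lambda>k. T (\<xi> k)) k" by (rule pr_sum[OF k, symmetric])
    finally show ?thesis ..
  qed
  then show ?thesis using pr[of "\<lambda>k. T (\<xi> k)"] unfolding proj_of_def adherent_def by metis
qed

end

end

context operator_star_algebra
begin

text \<open>Let \<open>\<eta>\<close> be the component of \<open>T \<xi>\<close> orthogonal (for the real inner product) to all
  \<open>b \<xi>\<close> with \<open>b\<close> self-adjoint in \<open>A\<close>. Approximating \<open>T\<close> on both
  \<open>\<xi>\<close> and \<open>\<eta>\<close> by \<open>a\<close> in \<open>A\<close>, the real parts \<open>(a + a*) / 2\<close>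
  satisfy
  \<open>Re \<langle>(a + a*) \<xi> / 2, \<eta>\<rangle> \<longlonglongrightarrow> Re \<langle>T \<xi>, \<eta>\<rangle>\<close>,
  although \<open>a*\<close> need not converge. Hence \<open>T \<xi>\<close> is orthogonal to \<open>\<eta>\<close>, so
  \<open>\<eta> = 0\<close>.\<close>

lemma selfadjoint_adherent:
  fixes K :: nat and \<xi> :: "nat => 'h"
  assumes T: "T \<in> bicommutant A" "op_adjoint T = T"
  shows "\<exists>b. (\<forall>n. b n \<in> A \<and> op_adjoint (b n) = b n) \<and> (\<forall>k<K. (\<lambda>n. (b n) (\<xi> k)) \<longlonglongrightarrow> T (\<xi> k))"
proof -
  have Tb: "T \<in> bounded_ops" using T(1) by (simp add: bicommutant_def)
  let ?C = "{\<lambda>k. blinfun_apply b (\<xi> k) | b. b \<in> A \<and> op_adjoint b = b}"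
  have adj_add: "op_adjoint (a + b) = op_adjoint a + op_adjoint b" if "a \<in> A" "b \<in> A" for a b
  proof -
    note ab = bounded[OF that(1)] bounded[OF that(2)]
    show ?thesis
      by (rule op_adjoint(3)[OF bounded_ops_closed(1)[OF ab] bounded_ops_closed(1)[OF op_adjoint(1)[OF ab(1)] op_adjoint(1)[OF ab(2)]]])
         (simp add: blinfun.add_left cinner_add_left cinner_add_right op_adjoint(2)[OF ab(1)] op_adjoint(2)[OF ab(2)])
  qed
  have adj_scale: "op_adjoint (op_scale (of_real t) a) = op_scale (of_real t) (op_adjoint a)" if "a \<in> A" for a t
  proof -
    note ab = bounded[OF that(1)]
    show ?thesis
      by (rule op_adjoint(3)[OF bounded_ops_closed(3)[OF ab] bounded_ops_closed(3)[OF op_adjoint(1)[OF ab]]])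
         (simp add: cinner_scaleC_left cinner_scaleC_right op_adjoint(2)[OF ab])
  qed
  have adj_adj: "op_adjoint (op_adjoint a) = a" if "a \<in> A" for a
    by (rule op_adjoint(3)[OF op_adjoint(1)[OF bounded[OF that]] bounded[OF that]])
       (rule op_adjoint_right[OF bounded[OF that], symmetric])
  have "\<exists>p c. (\<forall>n. c n \<in> ?C) \<and> (\<forall>k<K. (\<lambda>n. c n k) \<longlonglongrightarrow> p k) \<and>
      (\<forall>a\<in>?C. (\<Sum>k<K. Re (cinner (a k) (T (\<xi> k) - p k))) = 0)"
  proof (rule tuple_projection)
    have z: "scaleC 0 x = 0" for x :: 'h using scaleC_of_real[of 0 x] by simp
    show "(\<lambda>k. 0) \<in> ?C"
      using scale[OF one, of "of_real 0"] adj_scale[OF one, of 0] z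
      by (intro CollectI exI[of _ "op_scale 0 (id_blinfun :: 'h \<Rightarrow>\<^sub>L 'h)"]) (auto intro!: blinfun_eqI)
    fix a b t assume "a \<in> ?C"
    then obtain a' where a': "a' \<in> A" "op_adjoint a' = a'" "a = (\<lambda>k. a' (\<xi> k))" by blast
    show "(\<lambda>k. t *\<^sub>R a k) \<in> ?C"
      using scale[OF a'(1), of "of_real t"] adj_scale[OF a'(1), of t] a'
      by (intro CollectI exI[of _ "op_scale (of_real t) a'"]) (simp add: scaleC_of_real)
    assume "b \<in> ?C"
    then obtain b' where b': "b' \<in> A" "op_adjoint b' = b'" "b = (\<lambda>k. b' (\<xi> k))" by blast
    show "(\<lambda>k. a k + b k) \<in> ?C"
      using add[OF a'(1) b'(1)] adj_add[OF a'(1) b'(1)] a' b'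
      by (intro CollectI exI[of _ "a' + b'"]) (simp add: blinfun.add_left)
  qed
  then obtain p c where pc0: "(\<forall>n. c n \<in> ?C) \<and> (\<forall>k<K. (\<lambda>n. c n k) \<longlonglongrightarrow> p k) \<and>
      (\<forall>a\<in>?C. (\<Sum>k<K. Re (cinner (a k) (T (\<xi> k) - p k))) = 0)" by (elim exE)
  have pc: "c n \<in> ?C" "k < K ==> (\<lambda>n. c n k) \<longlonglongrightarrow> p k"
      "a \<in> ?C ==> (\<Sum>k<K. Re (cinner (a k) (T (\<xi> k) - p k))) = 0" for n k a
    subgoal by (rule spec[OF conjunct1[OF pc0]])
    subgoal by (rule spec[OF conjunct1[OF conjunct2[OF pc0]], rule_format])
    subgoal by (rule bspec[OF conjunct2[OF conjunct2[OF pc0]]])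
    done
  define \<eta> where "\<eta> k = T (\<xi> k) - p k" for k
  have 1: "(\<Sum>k<K. Re (cinner (p k) (\<eta> k))) = 0"
  proof -
    have "(\<lambda>n. \<Sum>k<K. Re (cinner (c n k) (\<eta> k))) \<longlonglongrightarrow> (\<Sum>k<K. Re (cinner (p k) (\<eta> k)))"
      by (intro tendsto_sum tendsto_Re cinner_tendsto tendsto_const pc(2)) simp
    moreover have "(\<lambda>n. \<Sum>k<K. Re (cinner (c n k) (\<eta> k))) = (\<lambda>n. 0)"
      using pc(3)[OF pc(1)] by (simp add: \<eta>_def)
    ultimately show ?thesis using LIMSEQ_unique[OF tendsto_const] by metis
  qed
  have 2: "(\<Sum>k<K. Re (cinner (blinfun_apply T (\<xi> k)) (\<eta> k))) = 0"
  proof -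
    \<comment> \<open>The concatenation of \<open>\<xi>\<close> and \<open>\<eta>\<close>, so that one sequence approximates \<open>T\<close> on both.\<close>
    let ?z = "\<lambda>k. if k < K then \<xi> k else \<eta> (k - K)"
    obtain a where a: "\<And>n. a n \<in> A" "\<And>k. k < K + K ==> (\<lambda>n. blinfun_apply (a n) (?z k)) \<longlonglongrightarrow> blinfun_apply T (?z k)"
      using bicommutant_adherent[OF T(1), of "K + K" ?z] unfolding adherent_def by blast
    have ax: "(\<lambda>n. blinfun_apply (a n) (\<xi> k)) \<longlonglongrightarrow> blinfun_apply T (\<xi> k)" if "k < K" for k
      using a(2)[of k] that by simp
    have ae: "(\<lambda>n. blinfun_apply (a n) (\<eta> k)) \<longlonglongrightarrow> blinfun_apply T (\<eta> k)" if "k < K" for k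
      using a(2)[of "K + k"] that by simp
    define b where "b n = op_scale (of_real (1/2)) (a n + op_adjoint (a n))" for n
    have sum: "a n + op_adjoint (a n) \<in> A" for n using add[OF a(1) star[OF a(1)]] .
    have bA: "b n \<in> A" "op_adjoint (b n) = b n" for n
      unfolding b_def using scale[OF sum] adj_scale[OF sum, of "1/2" n] adj_add[OF a(1) star[OF a(1)], of n n]
      by (auto simp: adj_adj a(1) add.commute)
    have zero: "(\<Sum>k<K. Re (cinner (blinfun_apply (b n) (\<xi> k)) (\<eta> k))) = 0" for n
      unfolding \<eta>_def by (rule pc(3)[of "\<lambda>k. (b n) (\<xi> k)"]) (use bA in blast)
    have expand: "(\<Sum>k<K. Re (cinner (blinfun_apply (b n) (\<xi> k)) (\<eta> k)))
        = (\<Sum>k<K. (1/2) * (Re (cinner ((a n) (\<xi> k)) (\<eta> k)) + Re (cinner (\<xi> k) ((a n) (\<eta> k)))))" for n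
    proof (intro sum.cong refl)
      fix k
      have "cinner (blinfun_apply (b n) (\<xi> k)) (\<eta> k) = of_real (1/2) * (cinner (blinfun_apply (a n) (\<xi> k)) (\<eta> k) + cinner (\<xi> k) (blinfun_apply (a n) (\<eta> k)))"
        unfolding b_def op_scale_apply cinner_scaleC_left blinfun.add_left cinner_add_left op_adjoint(2)[OF bounded[OF a(1)]] by simp
      then show "Re (cinner (blinfun_apply (b n) (\<xi> k)) (\<eta> k)) = (1/2) * (Re (cinner (blinfun_apply (a n) (\<xi> k)) (\<eta> k)) + Re (cinner (\<xi> k) (blinfun_apply (a n) (\<eta> k))))"
        by (simp only: times_complex.sel Re_complex_of_real Im_complex_of_real plus_complex.sel)
    qed
    have "(\<lambda>n. \<Sum>k<K. (1/2) * (Re (cinner (blinfun_apply (a n) (\<xi> k)) (\<eta> k)) + Re (cinner (\<xi> k) (blinfun_apply (a n) (\<eta> k)))))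
       \<longlonglongrightarrow> (\<Sum>k<K. (1/2) * (Re (cinner (T (\<xi> k)) (\<eta> k)) + Re (cinner (\<xi> k) (T (\<eta> k)))))"
      by (intro tendsto_sum tendsto_mult_left tendsto_add tendsto_Re cinner_tendsto tendsto_const ax ae) auto
    then have "(\<Sum>k<K. (1/2) * (Re (cinner (blinfun_apply T (\<xi> k)) (\<eta> k)) + Re (cinner (\<xi> k) (blinfun_apply T (\<eta> k))))) = 0"
      using zero unfolding expand by (simp add: LIMSEQ_const_iff)
    moreover have "cinner (\<xi> k) (blinfun_apply T (\<eta> k)) = cinner (blinfun_apply T (\<xi> k)) (\<eta> k)" for k
      using op_adjoint(2)[OF Tb, of "\<xi> k" "\<eta> k"] T(2) by simp
    ultimately show ?thesis by simp
  qed
  have "(\<Sum>k<K. (norm (\<eta> k))\<^sup>2) = (\<Sum>k<K. Re (cinner (T (\<xi> k)) (\<eta> k)) - Re (cinner (p k) (\<eta> k)))"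
  proof (intro sum.cong refl)
    fix k
    have "complex_of_real ((norm (\<eta> k))\<^sup>2) = cinner (\<eta> k) (\<eta> k)" by (rule cinner_self[symmetric])
    also have "\<dots> = cinner (T (\<xi> k)) (\<eta> k) - cinner (p k) (\<eta> k)"
      by (subst (1) \<eta>_def) (rule cinner_diff_left)
    finally show "(norm (\<eta> k))\<^sup>2 = Re (cinner (T (\<xi> k)) (\<eta> k)) - Re (cinner (p k) (\<eta> k))"
      by (metis Re_complex_of_real minus_complex.sel(1))
  qed
  then have "(\<Sum>k<K. (norm (\<eta> k))\<^sup>2) = 0" using 1 2 by (simp add: sum_subtractf)
  then have "(norm (\<eta> k))\<^sup>2 = 0" if "k < K" for k using that by (subst (asm) sum_nonneg_eq_0_iff) auto
  then have eq: "p k = T (\<xi> k)" if "k < K" for k using that by (simp add: \<eta>_def)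
  have "\<forall>n. \<exists>b. b \<in> A \<and> op_adjoint b = b \<and> c n = (\<lambda>k. b (\<xi> k))" using pc(1) by blast
  then obtain b where "\<And>n. b n \<in> A" "\<And>n. op_adjoint (b n) = b n" "\<And>n. c n = (\<lambda>k. (b n) (\<xi> k))" by metis
  then show ?thesis using pc(2) eq by (intro exI[of _ b]) auto
qed

lemma selfadjoint_dense:
  assumes T: "T \<in> bicommutant A" "op_adjoint T = T" and W: "finite W" and e: "e > 0"
  shows "\<exists>b\<in>A. op_adjoint b = b \<and> (\<forall>x\<in>W. norm (b x - T x) < e)"
proof -
  obtain \<xi> and K :: nat where xi: "W = \<xi> ` {i. i < K}" using finite_imp_nat_seg_image_inj_on[OF W] by blast
  obtain b where b: "\<And>n. b n \<in> A \<and> op_adjoint (b n) = b n"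
     "\<And>k. k < K ==> (\<lambda>n. (b n) (\<xi> k)) \<longlonglongrightarrow> T (\<xi> k)"
    using selfadjoint_adherent[OF T, of K \<xi>] by blast
  have "\<forall>\<^sub>F n in sequentially. \<forall>x\<in>W. norm ((b n) x - T x) < e"
  proof (rule eventually_ball_finite[OF W], rule ballI)
    fix x assume "x \<in> W"
    then have "(\<lambda>n. (b n) x) \<longlonglongrightarrow> T x" using b(2) xi by auto
    then show "\<forall>\<^sub>F n in sequentially. norm ((b n) x - T x) < e"
      using e by (simp add: tendsto_iff dist_norm)
  qed
  then obtain n where "\<forall>x\<in>W. norm ((b n) x - T x) < e" by (auto simp: eventually_sequentially)
  then show ?thesis using b(1) by blast
qed

end

text \<open>The function \<open>f(t) = 2 t / (1 + t\<^sup>2)\<close> maps the line into \<open>[-1, 1]\<close>, and differences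
  \<open>f(b) - f(Z)\<close> factor through \<open>b - Z\<close>, as used in \<open>kaplansky\<close>; \<open>q\<close> is the resolvent
  \<open>1 / (1 + b\<^sup>2)\<close>.\<close>

lemma cayley_transform:
  assumes B: "cstar B \<mu>" and b: "b \<in> carrier B" "star B b = b"
  shows "\<exists>q f. q \<in> carrier B \<and> f \<in> carrier B \<and> star B f = f \<and> \<mu> q \<le> 1 \<and> \<mu> f \<le> 1 \<and>
     q \<otimes>\<^bsub>B\<^esub> (\<one>\<^bsub>B\<^esub> \<oplus>\<^bsub>B\<^esub> b \<otimes>\<^bsub>B\<^esub> b) = \<one>\<^bsub>B\<^esub> \<and> f = smul B 2 (q \<otimes>\<^bsub>B\<^esub> b)"
proof -
  interpret B: cstar B \<mu> by (rule B)
  define R where "R = \<mu> b + 1"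
  have R: "R > 0" "\<mu> b \<le> R" using b by (auto simp: R_def add_nonneg_pos)
  interpret C: cstar "C_interval R" "sup_norm R" by (rule C_interval_cstar[OF R(1)])
  obtain \<phi> where phi: "\<phi> \<in> unital_star_hom (C_interval R) B" "\<phi> (interval_coord R) = b"
    using functional_calculus[OF B b R(2,1)] by blast
  note h = unital_star_homD[OF phi(1)]
  define q f where "q t = (if t \<in> {-R..R} then of_real (1 / (1 + t\<^sup>2)) else (0::complex))"
    and "f t = (if t \<in> {-R..R} then of_real (2 * t / (1 + t\<^sup>2)) else (0::complex))" for t :: real
  have nz: "1 + t\<^sup>2 \<noteq> 0" "1 + t * t \<noteq> 0" for t :: real using zero_le_power2[of t] by (auto simp: power2_eq_square add_nonneg_eq_0_iff)
  have car: "q \<in> carrier (C_interval R)" "f \<in> carrier (C_interval R)" "interval_coord R \<in> carrier (C_interval R)"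
  proof -
    have "continuous_on {-R..R} q"
      by (rule continuous_on_eq[where f="\<lambda>t. of_real (1 / (1 + t\<^sup>2))"]) (auto intro!: continuous_intros simp: nz q_def simp del: of_real_divide)
    then show "q \<in> carrier (C_interval R)" by (simp add: C_interval_def q_def)
    have "continuous_on {-R..R} f"
      by (rule continuous_on_eq[where f="\<lambda>t. of_real (2 * t / (1 + t\<^sup>2))"]) (auto intro!: continuous_intros simp: nz f_def simp del: of_real_divide)
    then show "f \<in> carrier (C_interval R)" by (simp add: C_interval_def f_def)
  qed (rule interval_coord_facts(1)[OF R(1)])
  have norm: "sup_norm R q \<le> 1" "sup_norm R f \<le> 1"
  proof -
    have "\<bar>2 * t\<bar> \<le> 1 + t\<^sup>2" for t :: real
      using zero_le_power2[of "t - 1"] zero_le_power2[of "t + 1"] by (auto simp: power2_eq_square algebra_simps abs_le_iff)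
    moreover have pos: "0 < 1 + t\<^sup>2" for t :: real by (simp add: add_pos_nonneg)
    ultimately have "\<bar>2 * t / (1 + t\<^sup>2)\<bar> \<le> 1" for t :: real
      by (simp only: abs_divide) (simp add: divide_le_eq_1)
    then show "sup_norm R f \<le> 1" using R(1) by (intro sup_norm_least) (simp_all only: f_def norm_of_real split: if_split, auto)
    have "\<bar>1 / (1 + t\<^sup>2)\<bar> \<le> 1" for t :: real
      using pos[of t] by (simp add: divide_le_eq_1)
    then show "sup_norm R q \<le> 1" using R(1) by (intro sup_norm_least) (simp_all only: q_def norm_of_real split: if_split, auto)
  qed
  have id1: "q \<otimes>\<^bsub>C_interval R\<^esub> (\<one>\<^bsub>C_interval R\<^esub> \<oplus>\<^bsub>C_interval R\<^esub> interval_coord R \<otimes>\<^bsub>C_interval R\<^esub> interval_coord R) = \<one>\<^bsub>C_interval R\<^esub>"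
  proof -
    have "complex_of_real (1 / (1 + t\<^sup>2)) * (1 + of_real t * of_real t) = 1" for t
    proof -
      have "complex_of_real (1 / (1 + t\<^sup>2)) * (1 + of_real t * of_real t) = of_real (1 / (1 + t\<^sup>2) * (1 + t * t))" by simp
      also have "1 / (1 + t\<^sup>2) * (1 + t * t) = 1" using nz(2)[of t] by (simp add: power2_eq_square)
      finally show ?thesis by simp
    qed
    then show ?thesis by (auto simp: C_interval_def q_def interval_coord_def fun_eq_iff simp del: of_real_divide)
  qed
  have id2: "f = smul (C_interval R) 2 (q \<otimes>\<^bsub>C_interval R\<^esub> interval_coord R)"
    by (auto simp: C_interval_def q_def f_def interval_coord_def fun_eq_iff)
  have st: "star (C_interval R) f = f" by (auto simp: C_interval_def f_def fun_eq_iff)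
  have "\<phi> q \<otimes>\<^bsub>B\<^esub> (\<one>\<^bsub>B\<^esub> \<oplus>\<^bsub>B\<^esub> b \<otimes>\<^bsub>B\<^esub> b) = \<one>\<^bsub>B\<^esub>"
    using arg_cong[OF id1, of \<phi>] car by (simp add: h phi(2))
  moreover have "\<phi> f = smul B 2 (\<phi> q \<otimes>\<^bsub>B\<^esub> b)"
    using arg_cong[OF id2, of \<phi>] car by (simp add: h phi(2))
  moreover have "star B (\<phi> f) = \<phi> f" using h(6)[OF car(2)] st by simp
  moreover have "\<mu> (\<phi> q) \<le> 1" "\<mu> (\<phi> f) \<le> 1"
    using hom_contractive[OF C.cstar_axioms B.semi phi(1)] car norm order_trans by blast+
  ultimately show ?thesis using h(1)[OF car(1)] h(1)[OF car(2)] by (intro exI conjI)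
qed

text \<open>On \<open>[-1, 1]\<close> the function \<open>f\<close> has the right inverse \<open>t / (1 + s)\<close> with
  \<open>s = sqrt (1 - t\<^sup>2)\<close>; for this \<open>Z\<close> one has
  \<open>1 / (1 + Z\<^sup>2) = (1 + s) / 2\<close>.\<close>

lemma cayley_inverse:
  assumes B: "cstar B \<mu>" and y: "y \<in> carrier B" "star B y = y" "\<mu> y \<le> 1"
  shows "\<exists>Z Q. Z \<in> carrier B \<and> Q \<in> carrier B \<and> star B Z = Z \<and>
     (\<one>\<^bsub>B\<^esub> \<oplus>\<^bsub>B\<^esub> Z \<otimes>\<^bsub>B\<^esub> Z) \<otimes>\<^bsub>B\<^esub> Q = \<one>\<^bsub>B\<^esub> \<and> y = smul B 2 (Z \<otimes>\<^bsub>B\<^esub> Q)"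
proof -
  interpret B: cstar B \<mu> by (rule B)
  interpret C: cstar "C_interval 1" "sup_norm 1" by (rule C_interval_cstar) simp
  obtain \<phi> where phi: "\<phi> \<in> unital_star_hom (C_interval 1) B" "\<phi> (interval_coord 1) = y"
    using functional_calculus[OF B y] by auto
  note h = unital_star_homD[OF phi(1)]
  define s where "s t = sqrt (1 - t\<^sup>2)" for t :: real
  define Q Z where "Q t = (if t \<in> {-1..1} then of_real ((1 + s t) / 2) else (0::complex))"
    and "Z t = (if t \<in> {-1..1} then of_real (t / (1 + s t)) else (0::complex))" for t :: real
  have s: "s t \<ge> 0" "s t * s t = 1 - t * t" "1 + s t \<noteq> 0" if "t \<in> {-1..1}" for t
  proof -
    have "t\<^sup>2 \<le> 1" using that by (auto simp: abs_square_le_1 abs_le_iff)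
    then show "s t \<ge> 0" "s t * s t = 1 - t * t" by (auto simp: s_def power2_eq_square)
    then show "1 + s t \<noteq> 0" by simp
  qed
  have car: "Q \<in> carrier (C_interval 1)" "Z \<in> carrier (C_interval 1)" "interval_coord 1 \<in> carrier (C_interval 1)"
  proof -
    have "continuous_on {-1..1} Q"
      by (rule continuous_on_eq[where f="\<lambda>t. of_real ((1 + s t) / 2)"]) (auto intro!: continuous_intros simp: Q_def s_def simp del: of_real_divide)
    then show "Q \<in> carrier (C_interval 1)" by (simp add: C_interval_def Q_def)
    have "continuous_on {-1..1} (\<lambda>t. complex_of_real (t / (1 + s t)))"
      using s(3) by (auto intro!: continuous_intros simp: s_def simp del: of_real_divide)
    then have "continuous_on {-1..1} Z"
      by (rule continuous_on_eq) (simp add: Z_def)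
    then show "Z \<in> carrier (C_interval 1)" by (simp add: C_interval_def Z_def)
  qed (rule interval_coord_facts(1), simp)
  have id1: "(\<one>\<^bsub>C_interval 1\<^esub> \<oplus>\<^bsub>C_interval 1\<^esub> Z \<otimes>\<^bsub>C_interval 1\<^esub> Z) \<otimes>\<^bsub>C_interval 1\<^esub> Q = \<one>\<^bsub>C_interval 1\<^esub>"
  proof -
    have frac: "(1 + t / d * (t / d)) * (d / 2) = (d * d + t * t) / (2 * d)" if "d \<noteq> 0" for d t :: real
      using that by (simp add: field_simps)
    have "(1 + complex_of_real (t / (1 + s t)) * of_real (t / (1 + s t))) * of_real ((1 + s t) / 2) = 1" if t: "t \<in> {-1..1}" for t
    proof -
      have "(1 + complex_of_real (t / (1 + s t)) * of_real (t / (1 + s t))) * of_real ((1 + s t) / 2)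
          = of_real ((1 + t / (1 + s t) * (t / (1 + s t))) * ((1 + s t) / 2))" by simp
      also have "(1 + t / (1 + s t) * (t / (1 + s t))) * ((1 + s t) / 2) = ((1 + s t) * (1 + s t) + t * t) / (2 * (1 + s t))"
        by (rule frac[OF s(3)[OF t]])
      also have "(1 + s t) * (1 + s t) + t * t = 2 * (1 + s t)" using s(2)[OF t] by (simp add: algebra_simps)
      also have "2 * (1 + s t) / (2 * (1 + s t)) = 1" using s(3)[OF t] by simp
      finally show ?thesis by simp
    qed
    then show ?thesis unfolding C_interval_def Q_def Z_def fun_eq_iff
      by (simp del: of_real_divide of_real_add atLeastAtMost_iff)
  qed
  have id2: "interval_coord 1 = smul (C_interval 1) 2 (Z \<otimes>\<^bsub>C_interval 1\<^esub> Q)"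
  proof -
    have "complex_of_real t = 2 * (of_real (t / (1 + s t)) * of_real ((1 + s t) / 2))" if t: "t \<in> {-1..1}" for t
    proof -
      have "2 * (complex_of_real (t / (1 + s t)) * of_real ((1 + s t) / 2)) = of_real (2 * (t / (1 + s t) * ((1 + s t) / 2)))"
        by (simp only: of_real_mult of_real_numeral)
      also have "2 * (t / (1 + s t) * ((1 + s t) / 2)) = t" using s(3)[OF t] by simp
      finally show ?thesis by simp
    qed
    then show ?thesis unfolding C_interval_def Q_def Z_def interval_coord_def fun_eq_iff
      by (simp del: of_real_divide of_real_add atLeastAtMost_iff)
  qed
  have st: "star (C_interval 1) Z = Z" by (auto simp: C_interval_def Z_def fun_eq_iff)
  have "(\<one>\<^bsub>B\<^esub> \<oplus>\<^bsub>B\<^esub> \<phi> Z \<otimes>\<^bsub>B\<^esub> \<phi> Z) \<otimes>\<^bsub>B\<^esub> \<phi> Q = \<one>\<^bsub>B\<^esub>"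
    using arg_cong[OF id1, of \<phi>] car by (simp add: h)
  moreover have "y = smul B 2 (\<phi> Z \<otimes>\<^bsub>B\<^esub> \<phi> Q)"
    using arg_cong[OF id2, of \<phi>] car by (simp add: h phi(2))
  moreover have "star B (\<phi> Z) = \<phi> Z" using h(6)[OF car(2)] st by simp
  ultimately show ?thesis using h(1)[OF car(1)] h(1)[OF car(2)] by (intro exI conjI)
qed

lemma hom_image_operator_star_algebra:
  assumes M: "von_neumann_algebra M" and B: "star_alg B" and phi: "\<phi> \<in> unital_star_hom B (op_algebra M)"
  shows "operator_star_algebra (\<phi> ` carrier B)"
proof -
  interpret B: star_alg B by (rule B)
  note h = unital_star_homD[OF phi, unfolded op_algebra_simps]
  show ?thesis
  proof
    fix a assume "a \<in> \<phi> ` carrier B"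
    then obtain x where x: "a = \<phi> x" "x \<in> carrier B" by blast
    show "a \<in> bounded_ops" using vN_closed(1)[OF M h(1)[OF x(2)]] x by simp
    show "op_scale c a \<in> \<phi> ` carrier B" for c unfolding x h(5)[OF x(2), symmetric] using x by blast
    show "op_adjoint a \<in> \<phi> ` carrier B" unfolding x h(6)[OF x(2), symmetric] using x by blast
    fix b assume "b \<in> \<phi> ` carrier B"
    then obtain y where y: "b = \<phi> y" "y \<in> carrier B" by blast
    show "a + b \<in> \<phi> ` carrier B" unfolding x y h(3)[OF x(2) y(2), symmetric] using x y by blast
    show "a o\<^sub>L b \<in> \<phi> ` carrier B" unfolding x y h(2)[OF x(2) y(2), symmetric] using x y by blast
  next
    show "id_blinfun \<in> \<phi> ` carrier B" unfolding h(4)[symmetric] by blast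
  qed
qed

text \<open>Write \<open>Y / S = f(Z)\<close> with \<open>Z\<close> self-adjoint in the bicommutant, approximate \<open>Z\<close> by
  self-adjoint \<open>b\<close> in the image of \<open>\<phi>\<close>, and lift \<open>b\<close> to \<open>p\<close>. Then
  \<open>S f(p)\<close> has norm at most \<open>S\<close> in \<open>B\<close> itself, which a norm bound for its image would not
  give.\<close>

lemma kaplansky:
  fixes Y :: "'h::complex_hilbert_space \<Rightarrow>\<^sub>L 'h"
  assumes M: "von_neumann_algebra M" and B: "cstar B \<mu>" and phi: "\<phi> \<in> unital_star_hom B (op_algebra M)"
    and Y: "Y \<in> M \<inter> bicommutant (\<phi> ` carrier B)" "op_adjoint Y = Y" "norm Y \<le> S" and S: "S > 0"
    and W: "finite W" and e: "e > 0"
  shows "\<exists>g. g \<in> carrier B \<and> star B g = g \<and> \<mu> g \<le> S \<and> (\<forall>x\<in>W. norm ((\<phi> g) x - Y x) < e)"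
proof -
  interpret B: cstar B \<mu> by (rule B)
  interpret A: operator_star_algebra "\<phi> ` carrier B"
    by (rule hom_image_operator_star_algebra[OF M B.star_alg_axioms phi])
  note h = unital_star_homD[OF phi, unfolded op_algebra_simps]
  note m = vN_closed[OF M]
  define L where "L = M \<inter> bicommutant (\<phi> ` carrier B)"
  have L: "von_neumann_algebra L"
    unfolding L_def by (rule bicommutant_inter_vN[OF M]) (use A.bounded A.star in auto)
  note l = vN_closed[OF L]
  interpret L: cstar "op_algebra L" norm by (rule op_cstar[OF L])
  define y where "y = op_scale (of_real (1 / S)) Y"
  have YL: "Y \<in> L" using Y(1) by (simp add: L_def)
  have yL: "y \<in> L" unfolding y_def by (rule l(5)[OF YL])
  have yadj: "op_adjoint y = y"
    using L.star_smul[of Y "of_real (1 / S)"] YL Y(2) by (simp add: y_def)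
  have ynorm: "norm y \<le> 1" using Y(3) S by (simp add: y_def norm_op_scale norm_divide)
  have "\<exists>Z Q. Z \<in> L \<and> Q \<in> L \<and> op_adjoint Z = Z \<and> (id_blinfun + (Z o\<^sub>L Z)) o\<^sub>L Q = id_blinfun \<and> y = op_scale 2 (Z o\<^sub>L Q)"
    using cayley_inverse[OF op_cstar[OF L], unfolded op_algebra_simps, OF yL yadj ynorm] .
  then obtain Z Q where Z: "Z \<in> L" "op_adjoint Z = Z" and Q: "(id_blinfun + (Z o\<^sub>L Z)) o\<^sub>L Q = id_blinfun" "y = op_scale 2 (Z o\<^sub>L Q)"
    by (elim exE conjE)
  define e' where "e' = e / (3 * S)"
  have e': "e' > 0" using e S by (simp add: e'_def)
  have "\<exists>b\<in>\<phi> ` carrier B. op_adjoint b = b \<and>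
      (\<forall>x\<in>Q ` W \<union> y ` W. norm (b x - Z x) < e')"
    by (rule A.selfadjoint_dense) (use Z W e' in \<open>auto simp: L_def\<close>)
  then obtain p0 where p0: "p0 \<in> carrier B" "op_adjoint (\<phi> p0) = \<phi> p0"
      "\<And>x. x \<in> W ==> norm ((\<phi> p0) (Q x) - Z (Q x)) < e'"
      "\<And>x. x \<in> W ==> norm ((\<phi> p0) (y x) - Z (y x)) < e'"
    by auto
  define p where "p = smul B (1/2) (p0 \<oplus>\<^bsub>B\<^esub> star B p0)"
  define b where "b = \<phi> p0"
  have p: "p \<in> carrier B" "star B p = p"
    using p0(1) by (auto simp: p_def B.star_smul B.star_add B.a_comm)
  have "\<phi> p = op_scale (1/2) (b + b)" using p0 by (simp add: p_def h b_def)
  also have "\<dots> = b"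
  proof (rule blinfun_eqI)
    fix x
    have "(b + b) x = 2 *\<^sub>R b x" by (simp only: blinfun.add_left scaleR_2)
    then show "(op_scale (1/2) (b + b)) x = b x"
      using scaleC_of_real[of "1/2" "2 *\<^sub>R b x"] by simp
  qed
  finally have pb: "\<phi> p = b" .
  obtain q f where q: "q \<in> carrier B" "\<mu> q \<le> 1" "q \<otimes>\<^bsub>B\<^esub> (\<one>\<^bsub>B\<^esub> \<oplus>\<^bsub>B\<^esub> p \<otimes>\<^bsub>B\<^esub> p) = \<one>\<^bsub>B\<^esub>"
    and f: "f \<in> carrier B" "star B f = f" "\<mu> f \<le> 1" "f = smul B 2 (q \<otimes>\<^bsub>B\<^esub> p)"
    using cayley_transform[OF B p] by (elim exE conjE)
  define F q' where "F = \<phi> f" and "q' = \<phi> q"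
  have contr: "norm F \<le> 1" "norm q' \<le> 1"
    using hom_contractive[OF B op_seminorm[OF M] phi f(1)] hom_contractive[OF B op_seminorm[OF M] phi q(1)] f(3) q(2)
    by (auto simp: F_def q'_def)
  have two: "scaleC 2 x = 2 *\<^sub>R x" for x :: 'h using scaleC_of_real[of 2 x] by simp
  have Fa: "F x = 2 *\<^sub>R q' (b x)" for x
  proof -
    have "F = op_scale 2 (q' o\<^sub>L b)" using q(1) p(1) by (simp add: F_def f(4) q'_def h pb)
    then show ?thesis by (simp add: two)
  qed
  have qa: "q' x + q' (b (b x)) = x" for x
  proof -
    have "q' o\<^sub>L (id_blinfun + (b o\<^sub>L b)) = id_blinfun"
      using arg_cong[OF q(3), of \<phi>] q(1) p(1) by (simp add: q'_def h pb)
    then have "(q' o\<^sub>L (id_blinfun + (b o\<^sub>L b))) x = x" by simp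
    then show ?thesis by (simp add: blinfun.add_left blinfun.add_right)
  qed
  have ya: "y x = 2 *\<^sub>R Z (Q x)" for x by (simp add: Q(2) two)
  have Qa: "Q x + Z (Z (Q x)) = x" for x
  proof -
    have "((id_blinfun + (Z o\<^sub>L Z)) o\<^sub>L Q) x = x" using Q(1) by simp
    then show ?thesis by (simp add: blinfun.add_left)
  qed
  have close: "norm (F x - y x) < 3 * e'" if x: "x \<in> W" for x
  proof -
    define u where "u = Q x"
    define v where "v = Z u"
    define d1 d2 where "d1 = b u - Z u"
      and "d2 = b (y x) - Z (y x)"
    have yx: "y x = 2 *\<^sub>R v" by (simp add: ya u_def v_def)
    have xx: "x = u + Z v" using Qa[of x] by (simp add: u_def v_def)
    have "F x = 2 *\<^sub>R q' (b u) + 2 *\<^sub>R q' (b (Z v))"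
      by (subst xx) (simp add: Fa blinfun.add_right scaleR_add_right)
    moreover have "y x = 2 *\<^sub>R q' v + 2 *\<^sub>R q' (b (b v))"
      unfolding yx by (subst qa[symmetric]) (simp add: scaleR_add_right)
    moreover have "2 *\<^sub>R q' d1 = 2 *\<^sub>R q' (b u) - 2 *\<^sub>R q' v"
      by (simp add: d1_def v_def blinfun.diff_right scaleR_diff_right)
    moreover have "(1/2) *\<^sub>R F d2 = 2 *\<^sub>R q' (b (b v)) - 2 *\<^sub>R q' (b (Z v))"
      by (simp add: d2_def yx Fa blinfun.diff_right blinfun.scaleR_right scaleR_diff_right)
    \<comment> \<open>The identity \<open>f(b) - f(Z) = 2 q (b - Z) Q - f(b) (b - Z) f(Z) / 2\<close>, in which the factor \<open>b - Z\<close> is applied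
      only to vectors that do not depend on \<open>b\<close>.\<close>
    ultimately have id: "F x - y x = 2 *\<^sub>R q' d1 - (1/2) *\<^sub>R F d2"
      by (simp add: algebra_simps)
    have "norm (q' d1) \<le> 1 * norm d1"
      by (rule order_trans[OF norm_blinfun]) (intro mult_right_mono contr norm_ge_zero)
    moreover have "norm (F d2) \<le> 1 * norm d2"
      by (rule order_trans[OF norm_blinfun]) (intro mult_right_mono contr norm_ge_zero)
    moreover have "norm d1 < e'" "norm d2 < e'"
      using p0(3,4)[OF x] by (auto simp: d1_def d2_def u_def b_def)
    moreover have "norm (F x - y x) \<le> 2 * norm (q' d1) + (1/2) * norm (F d2)"
      unfolding id by (rule order_trans[OF norm_triangle_ineq4]) simp
    ultimately show ?thesis using e' by linarith
  qed
  define g where "g = smul B (of_real S) f"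
  have "g \<in> carrier B" "star B g = g" using f by (auto simp: g_def B.star_smul)
  moreover have "\<mu> g \<le> S" using f S by (simp add: g_def B.nu_smul mult_left_le)
  moreover have "norm ((\<phi> g) x - Y x) < e" if x: "x \<in> W" for x
  proof -
    have "(\<phi> g) x = S *\<^sub>R F x"
      using f(1) by (simp add: g_def h F_def scaleC_of_real)
    moreover have "Y x = S *\<^sub>R y x"
      using S unfolding y_def op_scale_apply scaleC_of_real by simp
    ultimately have "(\<phi> g) x - Y x = S *\<^sub>R (F x - y x)"
      by (simp add: scaleR_diff_right)
    then have "norm ((\<phi> g) x - Y x) = S * norm (F x - y x)"
      using S by simp
    also have "\<dots> < S * (3 * e')" using close[OF x] S by (rule mult_strict_left_mono)
    also have "\<dots> = e" using S by (simp add: e'_def)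
    finally show ?thesis .
  qed
  ultimately show ?thesis by blast
qed

text \<open>Normality reduces the claim to finitely many sums
  \<open>\<Sum> \<langle>\<xi>\<^sub>k, d\<^sup>2 \<eta>\<^sub>k\<rangle>\<close> with \<open>d = \<phi> g - Y\<close>. By
  Kaplansky's theorem there is a bounded sequence of such \<open>d\<close> that converges to 0 on all the \<open>\<eta>\<^sub>k\<close>, and
  dominated convergence applies.\<close>

lemma normal_approximation:
  fixes Y :: "'h::complex_hilbert_space \<Rightarrow>\<^sub>L 'h"
  assumes tr: "tracial_Wstar_prob_space M \<tau>" and B: "cstar B \<mu>" and phi: "\<phi> \<in> unital_star_hom B (op_algebra M)"
    and Y: "Y \<in> M \<inter> bicommutant (\<phi> ` carrier B)" "op_adjoint Y = Y" "norm Y \<le> S" and S: "S > 0" and e: "e > 0"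
  shows "\<exists>g. g \<in> carrier B \<and> star B g = g \<and> \<mu> g \<le> S \<and> cmod (\<tau> ((\<phi> g - Y) o\<^sub>L (\<phi> g - Y))) < e"
proof -
  have M: "von_neumann_algebra M" using tr by (simp add: tracial_Wstar_prob_space_def)
  interpret M: cstar "op_algebra M" norm by (rule op_cstar[OF M])
  note m = vN_closed[OF M] and h = unital_star_homD[OF phi, unfolded op_algebra_simps]
  have YM: "Y \<in> M" using Y(1) by simp
  have cont: "continuous_map (subtopology ultraweak_topology M) euclidean \<tau>"
    using tr by (simp add: tracial_Wstar_prob_space_def)
  have tau0: "\<tau> 0 = 0"
  proof -
    have "tracial_state (op_algebra M) \<tau>" using tr by (simp add: tracial_Wstar_prob_space_def)
    then have "\<tau> (op_scale 0 0) = 0 * \<tau> 0" unfolding tracial_state_def op_algebra_simps using m(7) by blast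
    moreover have "op_scale 0 (0 :: 'h \<Rightarrow>\<^sub>L 'h) = 0" by (rule blinfun_eqI) simp
    ultimately show ?thesis by simp
  qed
  let ?sub = "\<lambda>\<xi> \<eta> U. {T \<in> bounded_ops. (\<Sum>k. cinner (\<xi> k) (T (\<eta> k))) \<in> U} :: ('h \<Rightarrow>\<^sub>L 'h) set"
  let ?S = "{?sub \<xi> \<eta> U | (\<xi> :: nat => 'h) \<eta> U.
          summable (\<lambda>k. (norm (\<xi> k))\<^sup>2) \<and> summable (\<lambda>k. (norm (\<eta> k))\<^sup>2) \<and> open U}"
  have top: "(bounded_ops :: ('h \<Rightarrow>\<^sub>L 'h) set) \<subseteq> topspace ultraweak_topology"
  proof -
    have "?sub (\<lambda>k. 0) (\<lambda>k. 0) UNIV \<in> ?S"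
      by (rule CollectI, rule exI[of _ "\<lambda>k. 0"], rule exI[of _ "\<lambda>k. 0"], rule exI[of _ UNIV]) simp
    then have "?sub (\<lambda>k. 0) (\<lambda>k. 0) UNIV \<subseteq> topspace ultraweak_topology"
      unfolding ultraweak_topology_def topology_generated_by_topspace by (rule Union_upper)
    then show ?thesis by simp
  qed
  have "openin (subtopology ultraweak_topology M) {T \<in> topspace (subtopology ultraweak_topology M). \<tau> T \<in> ball 0 e}"
    by (rule openin_continuous_map_preimage[OF cont]) simp
  then obtain V where V: "openin ultraweak_topology V" "{T \<in> topspace (subtopology ultraweak_topology M). \<tau> T \<in> ball 0 e} = V \<inter> M"
    unfolding openin_subtopology by blast
  have "0 \<in> topspace (subtopology ultraweak_topology M)" using top bounded_ops_closed(5) m(7) by (auto simp: topspace_subtopology)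
  then have "0 \<in> V" using V(2) tau0 e by (metis (mono_tags, lifting) Int_iff centre_in_ball mem_Collect_eq)
  then have "\<exists>F. finite F \<and> F \<subseteq> ?S \<and> 0 \<in> \<Inter>F \<and> \<Inter>F \<subseteq> V"
    using V(1) unfolding ultraweak_topology_def by (intro generated_topology_nhd)
  then obtain F where F: "finite F" "F \<subseteq> ?S" "0 \<in> \<Inter>F" "\<Inter>F \<subseteq> V" by (elim exE conjE)
  let ?Q = "\<lambda>s t. s = ?sub (fst t) (fst (snd t)) (snd (snd t)) \<and> summable (\<lambda>k. (norm (fst t k))\<^sup>2) \<and>
      summable (\<lambda>k. (norm (fst (snd t) k))\<^sup>2) \<and> open (snd (snd t))"
  have "\<forall>s\<in>F. \<exists>t. ?Q s t"
  proof
    fix s assume "s \<in> F"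
    then have "s \<in> ?S" using F(2) by (rule rev_subsetD)
    then obtain \<xi> \<eta> U where "s = ?sub \<xi> \<eta> U" "summable (\<lambda>k. (norm (\<xi> k))\<^sup>2)" "summable (\<lambda>k. (norm (\<eta> k))\<^sup>2)" "open U"
      by (elim CollectE exE conjE)
    then show "\<exists>t. ?Q s t" by (intro exI[of _ "(\<xi>, \<eta>, U)"]) simp
  qed
  from bchoice[OF this] obtain t where t: "\<forall>s\<in>F. ?Q s (t s)" by (elim exE)
  define \<xi> \<eta> U where "\<xi> s = fst (t s)" and "\<eta> s = fst (snd (t s))" and "U s = snd (snd (t s))" for s
  have sub0: "s = ?sub (\<xi> s) (\<eta> s) (U s) \<and> summable (\<lambda>k. (norm (\<xi> s k))\<^sup>2) \<and> summable (\<lambda>k. (norm (\<eta> s k))\<^sup>2) \<and> open (U s)"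
    if "s \<in> F" for s
    using bspec[OF t that] unfolding \<xi>_def \<eta>_def U_def .
  note sub = sub0[THEN conjunct1] sub0[THEN conjunct2, THEN conjunct1]
    sub0[THEN conjunct2, THEN conjunct2, THEN conjunct1] sub0[THEN conjunct2, THEN conjunct2, THEN conjunct2]
  have "\<forall>m. \<exists>g. g \<in> carrier B \<and> star B g = g \<and> \<mu> g \<le> S \<and>
      (\<forall>x\<in>(\<Union>s\<in>F. \<eta> s ` {..<m}). norm ((\<phi> g) x - Y x) < 1 / real (Suc m))"
    by (intro allI kaplansky[OF M B phi Y S]) (use F(1) in auto)
  then obtain g where g: "\<And>m. g m \<in> carrier B" "\<And>m. star B (g m) = g m" "\<And>m. \<mu> (g m) \<le> S"
      "\<And>m x. x \<in> (\<Union>s\<in>F. \<eta> s ` {..<m}) ==> norm ((\<phi> (g m)) x - Y x) < 1 / real (Suc m)"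
    by metis
  define d where "d m = \<phi> (g m) - Y" for m
  have dM: "d m \<in> M" for m
  proof -
    have "d m = \<phi> (g m) + op_scale (-1) Y"
      unfolding d_def
    proof (rule blinfun_eqI)
      fix x show "(\<phi> (g m) - Y) x = (\<phi> (g m) + op_scale (- 1) Y) x"
        using scaleC_of_real[of "-1" "Y x"] by (simp add: blinfun.diff_left blinfun.add_left)
    qed
    then show ?thesis using m(3)[OF h(1)[OF g(1)] m(5)[OF YM]] by simp
  qed
  have dn: "norm (d k) \<le> 2 * S" for k
  proof -
    have "norm (\<phi> (g k)) \<le> S" using hom_contractive[OF B op_seminorm[OF M] phi g(1)] g(3) order_trans by blast
    then show ?thesis unfolding d_def using norm_triangle_ineq4[of "\<phi> (g k)" Y] Y(3) by linarith
  qed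
  have dlim: "(\<lambda>m. (d m) (\<eta> s k)) \<longlonglongrightarrow> 0" if s: "s \<in> F" for s k
  proof (rule Lim_null_comparison[OF _ LIMSEQ_inverse_real_of_nat])
    show "\<forall>\<^sub>F m in sequentially. norm ((d m) (\<eta> s k)) \<le> inverse (real (Suc m))"
    proof (rule eventually_sequentiallyI[of "Suc k"])
      fix m assume "Suc k \<le> m"
      then have "\<eta> s k \<in> (\<Union>s\<in>F. \<eta> s ` {..<m})" by (intro UN_I[OF s] imageI) simp
      from g(4)[OF this] show "norm ((d m) (\<eta> s k)) \<le> inverse (real (Suc m))"
        by (simp add: d_def blinfun.diff_left inverse_eq_divide)
    qed
  qed
  define T where "T m = d m o\<^sub>L d m" for m
  have Tlim: "(\<lambda>m. (T m) (\<eta> s k)) \<longlonglongrightarrow> 0" if s: "s \<in> F" for s k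
  proof (rule Lim_null_comparison)
    show "\<forall>\<^sub>F m in sequentially. norm ((T m) (\<eta> s k)) \<le> (2 * S) * norm ((d m) (\<eta> s k))"
      unfolding T_def blinfun_apply_blinfun_compose
      by (intro always_eventually allI order_trans[OF norm_blinfun] mult_right_mono dn norm_ge_zero)
    show "(\<lambda>m. (2 * S) * norm ((d m) (\<eta> s k))) \<longlonglongrightarrow> 0"
      using tendsto_mult_left[OF tendsto_norm_zero[OF dlim[OF s]]] by simp
  qed
  have "\<forall>\<^sub>F m in sequentially. \<forall>s\<in>F. T m \<in> s"
  proof (rule eventually_ball_finite[OF F(1)], rule ballI)
    fix s assume s: "s \<in> F"
    let ?D = "\<lambda>k. (2 * S) * (2 * S) * (((norm (\<xi> s k))\<^sup>2 + (norm (\<eta> s k))\<^sup>2) / 2)"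
    have "(\<lambda>m. \<Sum>k. cinner (\<xi> s k) ((T m) (\<eta> s k))) \<longlonglongrightarrow> (\<Sum>k. 0)"
    proof (rule conjunct2[OF conjunct2[OF tannerys_theorem[where M="?D"]]])
      show "(\<lambda>m. cinner (\<xi> s k) ((T m) (\<eta> s k))) \<longlonglongrightarrow> 0" for k
        using cinner_tendsto[OF tendsto_const Tlim[OF s], of "\<xi> s k" k] by simp
      show "summable ?D" by (intro summable_mult summable_divide summable_add sub(2,3)[OF s])
      show "\<forall>\<^sub>F (k, m) in sequentially \<times>\<^sub>F sequentially. norm (cinner (\<xi> s k) ((T m) (\<eta> s k))) \<le> ?D k"
      proof (intro always_eventually allI, clarify)
        fix k m
        have "norm (T m) \<le> (2 * S) * (2 * S)" unfolding T_def
          by (rule order_trans[OF norm_blinfun_compose]) (intro mult_mono dn; use S in simp)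
        then have "norm ((T m) (\<eta> s k)) \<le> (2 * S) * (2 * S) * norm (\<eta> s k)"
          by (intro order_trans[OF norm_blinfun] mult_right_mono norm_ge_zero)
        then have "norm (cinner (\<xi> s k) ((T m) (\<eta> s k))) \<le> norm (\<xi> s k) * ((2 * S) * (2 * S) * norm (\<eta> s k))"
          by (intro order_trans[OF cinner_le] mult_left_mono norm_ge_zero)
        also have "\<dots> = (2 * S) * (2 * S) * (norm (\<xi> s k) * norm (\<eta> s k))" by (simp only: mult.left_commute mult.assoc)
        also have "\<dots> \<le> ?D k"
        proof (rule mult_left_mono)
          show "norm (\<xi> s k) * norm (\<eta> s k) \<le> ((norm (\<xi> s k))\<^sup>2 + (norm (\<eta> s k))\<^sup>2) / 2"
            using sum_squares_bound[of "norm (\<xi> s k)" "norm (\<eta> s k)"] by simp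
        qed simp
        finally show "norm (cinner (\<xi> s k) ((T m) (\<eta> s k))) \<le> ?D k" .
      qed
    qed simp
    moreover have "(\<Sum>k. 0) \<in> U s"
    proof -
      have "0 \<in> ?sub (\<xi> s) (\<eta> s) (U s)" using F(3) s sub(1)[OF s] by (metis InterD)
      then show ?thesis by simp
    qed
    ultimately have "\<forall>\<^sub>F m in sequentially. (\<Sum>k. cinner (\<xi> s k) ((T m) (\<eta> s k))) \<in> U s"
      using sub(4)[OF s] topological_tendstoD by blast
    then show "\<forall>\<^sub>F m in sequentially. T m \<in> s"
    proof eventually_elim
      case (elim i)
      have "T i \<in> bounded_ops" unfolding T_def by (rule m(1)[OF m(4)[OF dM dM]])
      then have "T i \<in> ?sub (\<xi> s) (\<eta> s) (U s)" using elim by simp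
      then show ?case using sub(1)[OF s] by metis
    qed
  qed
  then obtain k where "\<forall>s\<in>F. T k \<in> s" by (auto simp: eventually_sequentially)
  then have "T k \<in> V" using F(4) by blast
  then have "\<tau> (T k) \<in> ball 0 e" using V(2) m(4)[OF dM dM, of k k] unfolding T_def by blast
  then show ?thesis using g(1-3)[of k] by (intro exI[of _ "g k"]) (simp add: T_def d_def)
qed

section \<open>The trace seminorm\<close>

locale tracial_cstar = cstar A \<nu> for A :: "('a, 'z) star_algebra_scheme" (structure) and \<nu> +
  fixes \<sigma> :: "'a => complex"
  assumes trace: "tracial_state A \<sigma>"
begin

lemma sig_add: "a \<in> carrier A ==> b \<in> carrier A ==> \<sigma> (a \<oplus> b) = \<sigma> a + \<sigma> b"
  and sig_smul: "a \<in> carrier A ==> \<sigma> (smul A c a) = c * \<sigma> a"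
  and sig_pos: "a \<in> carrier A ==> \<sigma> (star A a \<otimes> a) \<in> \<real>\<^sub>\<ge>\<^sub>0"
  and sig_one: "\<sigma> \<one> = 1"
  and sig_tr: "a \<in> carrier A ==> b \<in> carrier A ==> \<sigma> (a \<otimes> b) = \<sigma> (b \<otimes> a)"
  using trace unfolding tracial_state_def by auto

text \<open>The square of the 2-norm. Squares obey \<open>sq (a + b) \<le> 2 sq a + 2 sq b\<close>, which suffices for
  convergence and follows from the parallelogram law without the Cauchy-Schwarz inequality.\<close>

definition sq :: "'a => real" where "sq a = Re (\<sigma> (star A a \<otimes> a))"

lemma sq_ge0 [simp]: "a \<in> carrier A ==> 0 \<le> sq a"
  using sig_pos[of a] by (simp add: sq_def complex_nonneg_Reals_iff)

lemma sq_of_real: "a \<in> carrier A ==> \<sigma> (star A a \<otimes> a) = of_real (sq a)"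
  using sig_pos[of a] by (simp add: sq_def complex_nonneg_Reals_iff complex_eq_iff)

lemma sq_expand:
  assumes a: "a \<in> carrier A" and b: "b \<in> carrier A"
  shows "\<sigma> (star A (a \<oplus> smul A t b) \<otimes> (a \<oplus> smul A t b)) =
     \<sigma> (star A a \<otimes> a) + t * \<sigma> (star A a \<otimes> b) + cnj t * \<sigma> (star A b \<otimes> a) + cnj t * t * \<sigma> (star A b \<otimes> b)"
proof -
  have "star A (a \<oplus> smul A t b) \<otimes> (a \<oplus> smul A t b) =
     (star A a \<otimes> a \<oplus> smul A (cnj t) (star A b \<otimes> a)) \<oplus> (smul A t (star A a \<otimes> b) \<oplus> smul A (cnj t * t) (star A b \<otimes> b))"
    using a b by (simp add: star_add star_smul l_distr r_distr smul_mult_l smul_mult_r smul_add_r mult.commute)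
  then show ?thesis using a b by (simp add: sig_add sig_smul)
qed

lemma sq_add: assumes a: "a \<in> carrier A" and b: "b \<in> carrier A" shows "sq (a \<oplus> b) \<le> 2 * sq a + 2 * sq b"
proof -
  have "sq (a \<oplus> smul A 1 b) + sq (a \<oplus> smul A (-1) b) = 2 * sq a + 2 * sq b"
    unfolding sq_def sq_expand[OF a b] by simp
  moreover have "0 \<le> sq (a \<oplus> smul A (-1) b)" using a b by (intro sq_ge0) simp
  ultimately show ?thesis using b by simp
qed

text \<open>Expand \<open>sq (a - \<sigma> a) \<ge> 0\<close>.\<close>

lemma sig_le_sq: assumes a: "a \<in> carrier A" shows "(cmod (\<sigma> a))\<^sup>2 \<le> sq a"
proof -
  have "0 \<le> sq (a \<oplus> smul A (- \<sigma> a) \<one>)" using a by simp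
  moreover have "\<sigma> (star A a) = cnj (\<sigma> a)"
  proof -
    have "\<sigma> (star A (a \<oplus> smul A 1 \<one>) \<otimes> (a \<oplus> smul A 1 \<one>)) = of_real (sq (a \<oplus> smul A 1 \<one>))"
      "\<sigma> (star A (a \<oplus> smul A \<i> \<one>) \<otimes> (a \<oplus> smul A \<i> \<one>)) = of_real (sq (a \<oplus> smul A \<i> \<one>))"
      "\<sigma> (star A a \<otimes> a) = of_real (sq a)"
      using a by (auto intro!: sq_of_real)
    then have "Im (\<sigma> (star A a) + \<sigma> a) = 0" "Im (- \<i> * \<sigma> a + \<i> * \<sigma> (star A a)) = 0"
      unfolding sq_expand[OF a one_closed] using a by (simp_all add: sig_one complex_eq_iff)
    then show ?thesis by (simp add: complex_eq_iff)
  qed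
  ultimately have "0 \<le> sq a - (cmod (\<sigma> a))\<^sup>2"
    unfolding sq_def sq_expand[OF a one_closed] using a
    by (simp add: sig_one cmod_def power2_eq_square)
  then show ?thesis by simp
qed

lemma sq_star: "a \<in> carrier A ==> sq (star A a) = sq a"
  using sig_tr[of a "star A a"] by (simp add: sq_def)

text \<open>\<open>1 - a* a / K\<close> is a square \<open>c\<^sup>2\<close>, and \<open>sq (c b) \<ge> 0\<close>.\<close>

lemma sq_mult_left:
  assumes a: "a \<in> carrier A" and b: "b \<in> carrier A" and K: "(\<nu> a)\<^sup>2 < K" shows "sq (a \<otimes> b) \<le> K * sq b"
proof -
  have K0: "K > 0" using K zero_le_power2[of "\<nu> a"] by linarith
  define e where "e = smul A (of_real (1 / K)) (star A a \<otimes> a)"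
  have e: "e \<in> carrier A" "star A e = e" using a by (auto simp: e_def star_smul star_mult)
  have "\<nu> e < 1" using a K K0 by (simp add: e_def nu_smul nu_cstar norm_divide)
  then obtain c where c: "c \<in> carrier A" "star A c = c" "c \<otimes> c = sb \<one> e" using sqrt_exists[OF e] by blast
  have "star A (c \<otimes> b) \<otimes> (c \<otimes> b) = star A b \<otimes> ((c \<otimes> c) \<otimes> b)" using b c(1,2) by (simp add: star_mult m_assoc)
  also have "\<dots> = star A b \<otimes> b \<oplus> smul A (- of_real (1 / K)) (star A (a \<otimes> b) \<otimes> (a \<otimes> b))"
    unfolding c(3) e_def using a b by (simp add: l_distr r_distr smul_mult_l smul_mult_r star_mult m_assoc)
  finally have "sq (c \<otimes> b) = Re (\<sigma> (star A b \<otimes> b) + - of_real (1 / K) * \<sigma> (star A (a \<otimes> b) \<otimes> (a \<otimes> b)))"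
    unfolding sq_def using a b by (simp only: sig_add sig_smul m_closed star_closed smul_closed)
  also have "\<dots> = sq b - sq (a \<otimes> b) / K"
    using a b by (simp only: sq_of_real m_closed) (simp add: Re_divide_of_real)
  finally have "0 \<le> sq b - sq (a \<otimes> b) / K" using b c(1) sq_ge0[of "c \<otimes> b"] by simp
  then show ?thesis using K0 by (simp add: field_simps)
qed

text \<open>The trace property enters here: the 2-norm is invariant under the adjoint.\<close>

lemma sq_mult_right:
  assumes a: "a \<in> carrier A" and b: "b \<in> carrier A" and K: "(\<nu> b)\<^sup>2 < K" shows "sq (a \<otimes> b) \<le> K * sq a"
  using sq_mult_left[of "star A b" "star A a" K] sq_star[of "a \<otimes> b"] a b K by (simp add: star_mult sq_star)

lemma sq_le_nu: assumes a: "a \<in> carrier A" shows "sq a \<le> (\<nu> a)\<^sup>2"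
proof (rule dense_ge)
  fix K assume "(\<nu> a)\<^sup>2 < K"
  from sq_mult_left[OF a one_closed this] show "sq a \<le> K" using a by (simp add: sq_def sig_one)
qed

lemma sig_le_nu: assumes a: "a \<in> carrier A" shows "cmod (\<sigma> a) \<le> \<nu> a"
  using order_trans[OF sig_le_sq sq_le_nu, OF a a] a by (simp add: power2_le_iff_abs_le)

lemma sq_smul: "a \<in> carrier A ==> sq (smul A c a) = (cmod c)\<^sup>2 * sq a"
proof -
  assume a: "a \<in> carrier A"
  have "\<sigma> (star A (smul A c a) \<otimes> smul A c a) = (cnj c * c) * \<sigma> (star A a \<otimes> a)"
    using a by (simp add: star_smul smul_mult_l smul_mult_r sig_smul)
  also have "\<dots> = of_real ((cmod c)\<^sup>2 * sq a)"
    by (simp only: sq_of_real[OF a] of_real_mult complex_norm_square mult.commute)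
  finally show ?thesis unfolding sq_def[of "smul A c a"] by simp
qed

text \<open>Homomorphisms are uniformly contractive, so their convergence in the 2-norm has to be checked on generators only.\<close>

lemma sq_limit_closed_subalgebra:
  assumes B: "cstar B \<mu>" and h: "\<And>k. \<phi> k \<in> unital_star_hom B A" and h': "\<psi> \<in> unital_star_hom B A"
  shows "closed_subalgebra B \<mu> {x \<in> carrier B. (\<lambda>k. sq (sb (\<phi> k x) (\<psi> x))) \<longlonglongrightarrow> 0}" (is "closed_subalgebra B \<mu> ?D")
proof (rule closed_subalgebraI)
  interpret B: cstar B \<mu> by (rule B)
  note p = unital_star_homD[OF h] and q = unital_star_homD[OF h']
  show "?D \<subseteq> carrier B" by blast
  show "\<one>\<^bsub>B\<^esub> \<in> ?D" by (simp add: p(4) q(4) sq_def sig_add[of \<zero> \<zero>, symmetric])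
     (use sig_smul[of \<zero> 0] in simp)
  fix x assume "x \<in> ?D"
  then have x: "x \<in> carrier B" "(\<lambda>k. sq (sb (\<phi> k x) (\<psi> x))) \<longlonglongrightarrow> 0" by auto
  fix c
  have "sb (\<phi> k (smul B c x)) (\<psi> (smul B c x)) = smul A c (sb (\<phi> k x) (\<psi> x))" for k
    by (simp only: p(5)[OF x(1)] q(5)[OF x(1)] sb_smul[OF p(1)[OF x(1)] q(1)[OF x(1)]])
  then have "(\<lambda>k. sq (sb (\<phi> k (smul B c x)) (\<psi> (smul B c x)))) = (\<lambda>k. (cmod c)\<^sup>2 * sq (sb (\<phi> k x) (\<psi> x)))"
    using x(1) by (simp add: sq_smul p(1) q(1))
  then show "smul B c x \<in> ?D" using tendsto_mult_left[OF x(2), of "(cmod c)\<^sup>2"] x(1) by simp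
next
  interpret B: cstar B \<mu> by (rule B)
  note p = unital_star_homD[OF h] and q = unital_star_homD[OF h']
  have le0: "(\<lambda>k. f k) \<longlonglongrightarrow> 0" if "\<And>k. 0 \<le> f k" "\<And>k. f k \<le> g k" "g \<longlonglongrightarrow> 0" for f g :: "nat => real"
    by (rule tendsto_sandwich[of "\<lambda>_. 0" f sequentially g]) (use that in auto)
  fix x y assume "x \<in> ?D" "y \<in> ?D"
  then have x: "x \<in> carrier B" "(\<lambda>k. sq (sb (\<phi> k x) (\<psi> x))) \<longlonglongrightarrow> 0"
    and y: "y \<in> carrier B" "(\<lambda>k. sq (sb (\<phi> k y) (\<psi> y))) \<longlonglongrightarrow> 0" by auto
  let ?u = "\<lambda>k. sb (\<phi> k x) (\<psi> x)" and ?v = "\<lambda>k. sb (\<phi> k y) (\<psi> y)"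
  have car: "?u k \<in> carrier A" "?v k \<in> carrier A" "\<phi> k x \<in> carrier A" "\<psi> x \<in> carrier A" "\<phi> k y \<in> carrier A" "\<psi> y \<in> carrier A" for k
    using x(1) y(1) by (simp_all add: p(1) q(1))
  have "(\<lambda>k. sq (sb (\<phi> k (x \<oplus>\<^bsub>B\<^esub> y)) (\<psi> (x \<oplus>\<^bsub>B\<^esub> y)))) \<longlonglongrightarrow> 0"
  proof (rule le0)
    show "(\<lambda>k. 2 * sq (?u k) + 2 * sq (?v k)) \<longlonglongrightarrow> 0"
      using tendsto_add[OF tendsto_mult_left[OF x(2), of 2] tendsto_mult_left[OF y(2), of 2]] by simp
    have e: "sb (\<phi> k (x \<oplus>\<^bsub>B\<^esub> y)) (\<psi> (x \<oplus>\<^bsub>B\<^esub> y)) = ?u k \<oplus> ?v k" for k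
      using sb_add[OF car(3)[of k] car(5)[of k] car(4) car(6)] by (simp only: p(3)[OF x(1) y(1)] q(3)[OF x(1) y(1)])
    show "sq (sb (\<phi> k (x \<oplus>\<^bsub>B\<^esub> y)) (\<psi> (x \<oplus>\<^bsub>B\<^esub> y))) \<le> 2 * sq (?u k) + 2 * sq (?v k)" for k
      unfolding e by (rule sq_add[OF car(1,2)])
    show "0 \<le> sq (sb (\<phi> k (x \<oplus>\<^bsub>B\<^esub> y)) (\<psi> (x \<oplus>\<^bsub>B\<^esub> y)))" for k
      unfolding e by (rule sq_ge0[OF a_closed[OF car(1,2)]])
  qed
  then show "x \<oplus>\<^bsub>B\<^esub> y \<in> ?D" using x(1) y(1) by simp
  let ?K = "(\<mu> x)\<^sup>2 + 1" and ?K' = "(\<mu> y)\<^sup>2 + 1"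
  have K: "(\<nu> (\<phi> k x))\<^sup>2 < ?K" "(\<nu> (\<psi> y))\<^sup>2 < ?K'" for k
    using power_mono[OF hom_contractive[OF B semi h x(1), of k] nu_ge0[OF car(3)], of 2]
      power_mono[OF hom_contractive[OF B semi h' y(1)] nu_ge0[OF car(6)], of 2] by auto
  have "(\<lambda>k. sq (sb (\<phi> k (x \<otimes>\<^bsub>B\<^esub> y)) (\<psi> (x \<otimes>\<^bsub>B\<^esub> y)))) \<longlonglongrightarrow> 0"
  proof (rule le0)
    show "(\<lambda>k. 2 * (?K * sq (?v k)) + 2 * (?K' * sq (?u k))) \<longlonglongrightarrow> 0"
      using tendsto_add[OF tendsto_mult_left[OF tendsto_mult_left[OF y(2)], of 2 ?K] tendsto_mult_left[OF tendsto_mult_left[OF x(2)], of 2 ?K']] by simp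
    have e: "sb (\<phi> k (x \<otimes>\<^bsub>B\<^esub> y)) (\<psi> (x \<otimes>\<^bsub>B\<^esub> y)) = (\<phi> k x \<otimes> ?v k) \<oplus> (?u k \<otimes> \<psi> y)" for k
      using sb_mult[OF car(3)[of k] car(5)[of k] car(4) car(6)] by (simp only: p(2)[OF x(1) y(1)] q(2)[OF x(1) y(1)])
    show "sq (sb (\<phi> k (x \<otimes>\<^bsub>B\<^esub> y)) (\<psi> (x \<otimes>\<^bsub>B\<^esub> y))) \<le> 2 * (?K * sq (?v k)) + 2 * (?K' * sq (?u k))" for k
      unfolding e using sq_add[OF m_closed[OF car(3)[of k] car(2)[of k]] m_closed[OF car(1)[of k] car(6)]]
        sq_mult_left[OF car(3)[of k] car(2)[of k] K(1)[of k]] sq_mult_right[OF car(1)[of k] car(6) K(2)] by linarith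
    show "0 \<le> sq (sb (\<phi> k (x \<otimes>\<^bsub>B\<^esub> y)) (\<psi> (x \<otimes>\<^bsub>B\<^esub> y)))" for k
      unfolding e by (rule sq_ge0[OF a_closed[OF m_closed[OF car(3,2)] m_closed[OF car(1,6)]]])
  qed
  then show "x \<otimes>\<^bsub>B\<^esub> y \<in> ?D" using x(1) y(1) by simp
next
  interpret B: cstar B \<mu> by (rule B)
  note p = unital_star_homD[OF h] and q = unital_star_homD[OF h']
  fix f l assume f: "\<And>j. f j \<in> ?D" and l: "B.conv f l"
  have lc: "l \<in> carrier B" and fc: "f j \<in> carrier B" for j using B.convD[OF l] by auto
  have "(\<lambda>k. sq (sb (\<phi> k l) (\<psi> l))) \<longlonglongrightarrow> 0"
  proof (rule LIMSEQ_I)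
    fix e :: real assume e: "e > 0"
    define d where "d = min 1 (e / 13)"
    have d: "0 < d" "d \<le> 1" "12 * d < e" using e by (auto simp: d_def min_def)
    have "\<forall>\<^sub>F j in sequentially. B.dst (f j) l < d"
      using l d(1) by (intro order_tendstoD(2)[of _ 0]) (auto simp: B.conv_def)
    then obtain j where j: "B.dst (f j) l < d" by (auto simp: eventually_sequentially)
    have small: "sq (sb (\<phi>' l) (\<phi>' (f j))) \<le> d" "sq (sb (\<phi>' (f j)) (\<phi>' l)) \<le> d" if p': "\<phi>' \<in> unital_star_hom B A" for \<phi>'
    proof -
      note r = unital_star_homD[OF p']
      have "sq (\<phi>' z) \<le> d" if z: "z \<in> carrier B" "\<mu> z < d" for z
      proof -
        have "sq (\<phi>' z) \<le> (\<nu> (\<phi>' z))\<^sup>2" by (rule sq_le_nu[OF r(1)[OF z(1)]])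
        also have "\<dots> \<le> d\<^sup>2" using hom_contractive[OF B semi p' z(1)] z(2) nu_ge0[OF r(1)[OF z(1)]] by (intro power_mono) auto
        also have "\<dots> \<le> d" using d by (simp add: power2_eq_square mult_left_le)
        finally show ?thesis .
      qed
      from this[of "B.sb l (f j)"] this[of "B.sb (f j) l"]
      show "sq (sb (\<phi>' l) (\<phi>' (f j))) \<le> d" "sq (sb (\<phi>' (f j)) (\<phi>' l)) \<le> d"
        using j lc fc B.dst_sym[OF fc lc, of j] by (simp_all add: r seminorm_dist_def)
    qed
    have "\<forall>\<^sub>F k in sequentially. sq (sb (\<phi> k (f j)) (\<psi> (f j))) < d"
      using f[of j] d(1) by (intro order_tendstoD(2)[of _ 0]) auto
    then obtain k0 where k0: "\<And>k. k \<ge> k0 ==> sq (sb (\<phi> k (f j)) (\<psi> (f j))) < d" by (auto simp: eventually_sequentially)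
    show "\<exists>k0. \<forall>k\<ge>k0. norm (sq (sb (\<phi> k l) (\<psi> l)) - 0) < e"
    proof (intro exI[of _ k0] allI impI)
      fix k assume k: "k \<ge> k0"
      have car: "\<phi> k l \<in> carrier A" "\<psi> l \<in> carrier A" "\<phi> k (f j) \<in> carrier A" "\<psi> (f j) \<in> carrier A"
        using lc fc by (simp_all add: p(1) q(1))
      let ?a = "sb (\<phi> k l) (\<phi> k (f j))" and ?b = "sb (\<phi> k (f j)) (\<psi> (f j))" and ?c = "sb (\<psi> (f j)) (\<psi> l)"
      have abc: "?a \<in> carrier A" "?b \<in> carrier A" "?c \<in> carrier A" using car by simp_all
      have "sb (\<phi> k l) (\<psi> l) = ?a \<oplus> (?b \<oplus> ?c)"
        using sb_tri[OF car(1,3,2)] sb_tri[OF car(3,4,2)] by simp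
      then have "sq (sb (\<phi> k l) (\<psi> l)) \<le> 2 * sq ?a + 2 * (2 * sq ?b + 2 * sq ?c)"
        using sq_add[OF abc(1) a_closed[OF abc(2,3)]] sq_add[OF abc(2,3)] by simp
      moreover have "sq ?a \<le> d" "sq ?c \<le> d" "sq ?b < d" using small(1)[OF h] small(2)[OF h'] k0[OF k] by auto
      moreover have "x \<le> 2 * a + 2 * (2 * b + 2 * c) ==> a \<le> d ==> c \<le> d ==> b < d ==> x < e" for x a b c :: real
        using d by argo
      ultimately have "sq (sb (\<phi> k l) (\<psi> l)) < e" by blast
      moreover have "0 \<le> sq (sb (\<phi> k l) (\<psi> l))" using car by (intro sq_ge0) simp
      ultimately show "norm (sq (sb (\<phi> k l) (\<psi> l)) - 0) < e" by simp
    qed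
  qed
  then show "l \<in> ?D" using lc by simp
qed

end

section \<open>Microstates\<close>

text \<open>Closed subspaces are compared with closed subalgebras: the closed span \<open>E0\<close> of the words is stable under left
  multiplication by generators, so the elements that multiply \<open>E0\<close> into itself form a closed subalgebra containing the
  generators.\<close>

lemma part_spanned:
  assumes R: "R > 0" and E: "E \<subseteq> carrier (CR_part R l)"
    and add: "\<And>x y. x \<in> E ==> y \<in> E ==> x \<oplus>\<^bsub>CR_part R l\<^esub> y \<in> E"
    and smul: "\<And>c x. x \<in> E ==> smul (CR_part R l) c x \<in> E"
    and lim: "\<And>f x. (\<And>k. f k \<in> E) ==> cstar_semi.conv (CR_part R l) (part_norm R l) f x ==> x \<in> E"
    and mono: "\<And>js. set js \<subseteq> {..<l} ==> list_product (CR_part R l) (map (part_gen R l) js) \<in> E"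
  shows "carrier (CR_part R l) \<subseteq> E"
proof -
  let ?C = "CR_part R l"
  interpret C: cstar ?C "part_norm R l" by (rule part_cstar[OF R])
  define P where "P E' \<longleftrightarrow> E' \<subseteq> carrier ?C \<and> (\<forall>x\<in>E'. \<forall>y\<in>E'. x \<oplus>\<^bsub>?C\<^esub> y \<in> E') \<and> (\<forall>c. \<forall>x\<in>E'. smul ?C c x \<in> E') \<and>
     (\<forall>f x. (\<forall>k. f k \<in> E') \<and> C.conv f x \<longrightarrow> x \<in> E') \<and>
     (\<forall>js. set js \<subseteq> {..<l} \<longrightarrow> list_product ?C (map (part_gen R l) js) \<in> E')" for E'
  define E0 where "E0 = \<Inter>{E'. P E'}"
  have wc: "list_product ?C (map (part_gen R l) js) \<in> carrier ?C" if "set js \<subseteq> {..<l}" for js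
    using that part_gen_facts(1)[OF R] by (intro C.list_product_closed) auto
  have Pcar: "P (carrier ?C)" unfolding P_def using C.convD wc by blast
  have PE: "P E" unfolding P_def using E add smul lim mono by blast
  have PE0: "P E0"
    unfolding P_def
  proof (intro conjI ballI allI impI)
    show "E0 \<subseteq> carrier ?C" unfolding E0_def using Pcar by (intro Inter_lower CollectI)
    show "x \<oplus>\<^bsub>?C\<^esub> y \<in> E0" if "x \<in> E0" "y \<in> E0" for x y using that unfolding E0_def P_def by blast
    show "smul ?C c x \<in> E0" if "x \<in> E0" for c x using that unfolding E0_def P_def by blast
    show "list_product ?C (map (part_gen R l) js) \<in> E0" if "set js \<subseteq> {..<l}" for js
      using that unfolding E0_def P_def by blast
    fix f x assume f: "(\<forall>k. f k \<in> E0) \<and> C.conv f x"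
    show "x \<in> E0" unfolding E0_def
    proof (rule InterI)
      fix E' assume "E' \<in> {E'. P E'}"
      then have E': "P E'" by simp
      have "\<forall>k. f k \<in> E'" using f E' unfolding E0_def by blast
      then show "x \<in> E'" using f E' unfolding P_def by blast
    qed
  qed
  have PD: "x \<in> E' ==> x \<in> carrier ?C" "x \<in> E' ==> y \<in> E' ==> x \<oplus>\<^bsub>?C\<^esub> y \<in> E'" "x \<in> E' ==> smul ?C c x \<in> E'"
    "(\<And>k. f k \<in> E') ==> C.conv f x ==> x \<in> E'"
    "set js \<subseteq> {..<l} ==> list_product ?C (map (part_gen R l) js) \<in> E'" if "P E'" for E' x y c f js
    using that unfolding P_def by blast+
  note D0 = PD[OF PE0]
  have one: "\<one>\<^bsub>?C\<^esub> \<in> E0" using D0(5)[of "[]"] by (simp add: list_product_def)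
  have gen: "part_gen R l j \<otimes>\<^bsub>?C\<^esub> e \<in> E0" if j: "j < l" and e: "e \<in> E0" for j e
  proof -
    note g = part_gen_facts(1)[OF R j]
    have "P {e \<in> carrier ?C. part_gen R l j \<otimes>\<^bsub>?C\<^esub> e \<in> E0}" (is "P ?E'")
      unfolding P_def
    proof (intro conjI ballI allI impI)
      show "x \<oplus>\<^bsub>?C\<^esub> y \<in> ?E'" if "x \<in> ?E'" "y \<in> ?E'" for x y
        using that D0(2) g by (simp add: C.r_distr)
      show "smul ?C c x \<in> ?E'" if "x \<in> ?E'" for c x using that D0(3) g by (simp add: C.smul_mult_r)
      show "list_product ?C (map (part_gen R l) js) \<in> ?E'" if "set js \<subseteq> {..<l}" for js
        using D0(5)[of "j # js"] that j wc[OF that] by (simp add: list_product_def)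
      fix f x assume f: "(\<forall>k. f k \<in> ?E') \<and> C.conv f x"
      have "part_gen R l j \<otimes>\<^bsub>?C\<^esub> x \<in> E0"
        by (rule D0(4)[OF _ C.conv_mult[OF C.conv_const[OF g] conjunct2[OF f]]]) (use f in blast)
      then show "x \<in> ?E'" using C.convD(2)[OF conjunct2[OF f]] by simp
    qed blast
    then have "E0 \<subseteq> ?E'" unfolding E0_def by (intro Inter_lower CollectI)
    then show ?thesis using e by blast
  qed
  have "closed_subalgebra ?C (part_norm R l) {w \<in> carrier ?C. \<forall>e\<in>E0. w \<otimes>\<^bsub>?C\<^esub> e \<in> E0}" (is "closed_subalgebra _ _ ?D")
  proof (rule closed_subalgebraI)
    show "x \<oplus>\<^bsub>?C\<^esub> y \<in> ?D" if "x \<in> ?D" "y \<in> ?D" for x y using that D0(1,2) by (simp add: C.l_distr)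
    show "x \<otimes>\<^bsub>?C\<^esub> y \<in> ?D" if "x \<in> ?D" "y \<in> ?D" for x y using that D0(1) by (simp add: C.m_assoc)
    show "smul ?C c x \<in> ?D" if "x \<in> ?D" for c x using that D0(1,3) by (simp add: C.smul_mult_l)
    show "\<one>\<^bsub>?C\<^esub> \<in> ?D" using D0(1) by simp
    fix f x assume f: "\<And>k. f k \<in> ?D" and x: "C.conv f x"
    have "x \<otimes>\<^bsub>?C\<^esub> e \<in> E0" if e: "e \<in> E0" for e
      by (rule D0(4)[OF _ C.conv_mult[OF x C.conv_const[OF D0(1)[OF e]]]]) (use f e in blast)
    then show "x \<in> ?D" using C.convD(2)[OF x] by simp
  qed blast
  then have "carrier ?C \<subseteq> ?D"
    by (rule part_generated[OF R]) (use gen part_gen_facts(1)[OF R] in blast)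
  moreover have "E0 \<subseteq> E" unfolding E0_def using PE by (intro Inter_lower CollectI)
  ultimately show ?thesis using one by fastforce
qed

text \<open>Microstates, viewed as the representations of the universal algebra that they determine.\<close>

definition microstate_homs ::
  "real => nat => (CR_part_elem => complex) => nat => nat => real => (CR_part_elem => complex mat) set" where
  "microstate_homs R l \<sigma> N m \<delta> = {\<phi> \<in> unital_star_hom (CR_part R l) (mat_algebra N).
     (\<lambda>j\<in>{..<l}. \<phi> (part_gen R l j)) \<in> microstates R l \<sigma> N m \<delta>}"

definition near_microstate ::
  "real => nat => (CR_part_elem => complex) => CR_part_elem => nat => real => real => bool" where
  "near_microstate R l \<sigma> w m \<delta> \<epsilon> \<longleftrightarrow>
     (\<forall>N\<ge>1. \<forall>\<phi>\<in>microstate_homs R l \<sigma> N m \<delta>. cmod (ntr N (\<phi> w) - \<sigma> w) < \<epsilon>)"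

lemma near_microstate_mono:
  assumes "near_microstate R l \<sigma> w m \<delta> \<epsilon>" "m \<le> m'" "\<delta>' \<le> \<delta>"
  shows "near_microstate R l \<sigma> w m' \<delta>' \<epsilon>"
proof -
  have "microstates R l \<sigma> N m' \<delta>' \<subseteq> microstates R l \<sigma> N m \<delta>" for N
    using assms(2,3) unfolding microstates_def by fastforce
  then show ?thesis using assms(1) unfolding near_microstate_def microstate_homs_def by blast
qed

text \<open>The definition of microstates controls words only; both \<open>ntr N \<circ> \<phi>\<close> and \<open>\<sigma>\<close> are
  contractive linear functionals, so the control passes to the closed span of the words.\<close>

lemma microstate_approximation:
  assumes R: "R > 0"
    and sadd: "\<And>x y. x \<in> carrier (CR_part R l) ==> y \<in> carrier (CR_part R l) ==> \<sigma> (x \<oplus>\<^bsub>CR_part R l\<^esub> y) = \<sigma> x + \<sigma> y"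
    and ssmul: "\<And>c x. x \<in> carrier (CR_part R l) ==> \<sigma> (smul (CR_part R l) c x) = c * \<sigma> x"
    and sbnd: "\<And>x. x \<in> carrier (CR_part R l) ==> cmod (\<sigma> x) \<le> part_norm R l x"
    and sone: "\<sigma> \<one>\<^bsub>CR_part R l\<^esub> = 1"
    and w: "w \<in> carrier (CR_part R l)" and e: "\<epsilon> > 0"
  shows "\<exists>m \<delta>. m \<ge> 1 \<and> \<delta> > 0 \<and> near_microstate R l \<sigma> w m \<delta> \<epsilon>"
proof -
  let ?C = "CR_part R l" and ?H = "microstate_homs R l \<sigma>"
  interpret C: cstar ?C "part_norm R l" by (rule part_cstar[OF R])
  define good where "good \<epsilon> w \<longleftrightarrow> (\<exists>m \<delta>. m \<ge> 1 \<and> \<delta> > 0 \<and> near_microstate R l \<sigma> w m \<delta> \<epsilon>)" for \<epsilon> w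
  have goodI: "good \<epsilon> w" if "m \<ge> 1" "\<delta> > 0"
      "\<And>N \<phi>. N \<ge> 1 ==> \<phi> \<in> unital_star_hom ?C (mat_algebra N) ==> \<phi> \<in> ?H N m \<delta> ==> cmod (ntr N (\<phi> w) - \<sigma> w) < \<epsilon>"
    for \<epsilon> w m and \<delta> :: real
    unfolding good_def near_microstate_def using that by (metis (no_types, lifting) mem_Collect_eq microstate_homs_def)
  have goodE: "\<exists>m \<delta>. m \<ge> 1 \<and> \<delta> > 0 \<and> near_microstate R l \<sigma> w m \<delta> \<epsilon>" if "good \<epsilon> w" for \<epsilon> w
    using that by (simp only: good_def)
  let ?E = "{w \<in> carrier ?C. \<forall>\<epsilon>>0. good \<epsilon> w}"
  have "carrier ?C \<subseteq> ?E"
  proof (rule part_spanned[OF R])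
    show "?E \<subseteq> carrier ?C" by blast
    fix x assume "x \<in> ?E"
    then have x: "x \<in> carrier ?C" "\<And>\<epsilon>. \<epsilon> > 0 ==> good \<epsilon> x" by auto
    have "good \<epsilon> (smul ?C c x)" if "\<epsilon> > 0" for \<epsilon> c
    proof -
      have "\<epsilon> / (cmod c + 1) > 0" using that by (simp add: add_nonneg_pos)
      then obtain m \<delta> where m: "m \<ge> 1" "\<delta> > 0" "near_microstate R l \<sigma> x m \<delta> (\<epsilon> / (cmod c + 1))" using goodE[OF x(2)] by blast
      show ?thesis
      proof (rule goodI[OF m(1,2)])
        fix N \<phi> assume N: "N \<ge> 1" and ph: "\<phi> \<in> unital_star_hom ?C (mat_algebra N)" "\<phi> \<in> ?H N m \<delta>"
        have "cmod (ntr N (\<phi> x) - \<sigma> x) < \<epsilon> / (cmod c + 1)" using m(3) N ph(2) unfolding near_microstate_def by blast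
        then have "(cmod c + 1) * cmod (ntr N (\<phi> x) - \<sigma> x) < \<epsilon>" by (simp add: pos_less_divide_eq add_nonneg_pos mult.commute)
        moreover have "ntr N (\<phi> (smul ?C c x)) - \<sigma> (smul ?C c x) = c * (ntr N (\<phi> x) - \<sigma> x)"
          using x(1) unital_star_homD(1,5)[OF ph(1) x(1)] by (simp add: ntr_smult ssmul right_diff_distrib)
        moreover have "cmod c * cmod (ntr N (\<phi> x) - \<sigma> x) \<le> (cmod c + 1) * cmod (ntr N (\<phi> x) - \<sigma> x)"
          by (intro mult_right_mono) auto
        ultimately show "cmod (ntr N (\<phi> (smul ?C c x)) - \<sigma> (smul ?C c x)) < \<epsilon>"
          by (simp only: norm_mult order.strict_trans1)
      qed
    qed
    then show "smul ?C c x \<in> ?E" for c using x(1) by simp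
    fix y assume "y \<in> ?E"
    then have y: "y \<in> carrier ?C" "\<And>\<epsilon>. \<epsilon> > 0 ==> good \<epsilon> y" by auto
    have "good \<epsilon> (x \<oplus>\<^bsub>?C\<^esub> y)" if e: "\<epsilon> > 0" for \<epsilon>
    proof -
      obtain m \<delta> where m: "m \<ge> 1" "\<delta> > 0" "near_microstate R l \<sigma> x m \<delta> (\<epsilon>/2)" using goodE[OF x(2)[OF half_gt_zero[OF e]]] by blast
      obtain m' \<delta>' where m': "m' \<ge> 1" "\<delta>' > 0" "near_microstate R l \<sigma> y m' \<delta>' (\<epsilon>/2)" using goodE[OF y(2)[OF half_gt_zero[OF e]]] by blast
      have n: "near_microstate R l \<sigma> x (max m m') (min \<delta> \<delta>') (\<epsilon>/2)" "near_microstate R l \<sigma> y (max m m') (min \<delta> \<delta>') (\<epsilon>/2)"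
        by (rule near_microstate_mono[OF m(3)], simp, simp, rule near_microstate_mono[OF m'(3)], simp, simp)
      show ?thesis
      proof (rule goodI[of "max m m'" "min \<delta> \<delta>'"])
        fix N \<phi> assume N: "N \<ge> 1" and ph: "\<phi> \<in> unital_star_hom ?C (mat_algebra N)" "\<phi> \<in> ?H N (max m m') (min \<delta> \<delta>')"
        note h = unital_star_homD[OF ph(1), unfolded mat_algebra_simps]
        have "cmod (ntr N (\<phi> x) - \<sigma> x) < \<epsilon>/2" "cmod (ntr N (\<phi> y) - \<sigma> y) < \<epsilon>/2" using n N ph(2) unfolding near_microstate_def by blast+
        moreover have "ntr N (\<phi> (x \<oplus>\<^bsub>?C\<^esub> y)) - \<sigma> (x \<oplus>\<^bsub>?C\<^esub> y) = (ntr N (\<phi> x) - \<sigma> x) + (ntr N (\<phi> y) - \<sigma> y)"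
          using x(1) y(1) by (simp add: h ntr_add sadd)
        ultimately show "cmod (ntr N (\<phi> (x \<oplus>\<^bsub>?C\<^esub> y)) - \<sigma> (x \<oplus>\<^bsub>?C\<^esub> y)) < \<epsilon>"
          using norm_triangle_ineq[of "ntr N (\<phi> x) - \<sigma> x" "ntr N (\<phi> y) - \<sigma> y"] by simp
      qed (use m m' in auto)
    qed
    then show "x \<oplus>\<^bsub>?C\<^esub> y \<in> ?E" using x(1) y(1) by simp
  next
    fix f x assume f: "\<And>k. f k \<in> ?E" and x: "C.conv f x"
    note xc = C.convD(2)[OF x] and fc = C.convD(1)[OF x]
    have "good \<epsilon> x" if e: "\<epsilon> > 0" for \<epsilon>
    proof -
      have e3: "\<epsilon>/3 > 0" using e by simp
      have "\<forall>\<^sub>F k in sequentially. C.dst (f k) x < \<epsilon>/3"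
        using x e by (intro order_tendstoD(2)[of _ 0]) (auto simp: C.conv_def)
      then obtain k where k: "C.dst (f k) x < \<epsilon>/3" by (auto simp: eventually_sequentially)
      have "good (\<epsilon>/3) (f k)" using f[of k] e3 by blast
      then obtain m \<delta> where m: "m \<ge> 1" "\<delta> > 0" "near_microstate R l \<sigma> (f k) m \<delta> (\<epsilon>/3)" using goodE by blast
      show ?thesis
      proof (rule goodI[OF m(1,2)])
        fix N \<phi> assume N: "N \<ge> 1" and ph: "\<phi> \<in> unital_star_hom ?C (mat_algebra N)" "\<phi> \<in> ?H N m \<delta>"
        note h = unital_star_homD[OF ph(1), unfolded mat_algebra_simps]
        let ?z = "C.sb (f k) x"
        have zc: "?z \<in> carrier ?C" using xc fc by simp
        have "cmod (ntr N (\<phi> ?z)) \<le> mat_opnorm N (\<phi> ?z)" by (rule ntr_bound[OF h(1)[OF zc]])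
        also have "\<dots> \<le> part_norm R l ?z" by (rule hom_contractive[OF C.cstar_axioms mat_seminorm ph(1) zc])
        finally have 1: "cmod (ntr N (\<phi> ?z)) < \<epsilon>/3" using k by (simp add: seminorm_dist_def)
        have 2: "cmod (\<sigma> ?z) < \<epsilon>/3" using sbnd[OF zc] k by (simp add: seminorm_dist_def)
        have 3: "cmod (ntr N (\<phi> (f k)) - \<sigma> (f k)) < \<epsilon>/3" using m(3) N ph(2) unfolding near_microstate_def by blast
        have "ntr N (\<phi> ?z) = ntr N (\<phi> (f k)) - ntr N (\<phi> x)" "\<sigma> ?z = \<sigma> (f k) - \<sigma> x"
          using xc fc by (simp_all add: h ntr_add ntr_smult sadd ssmul)
        then have "ntr N (\<phi> x) - \<sigma> x = (ntr N (\<phi> (f k)) - \<sigma> (f k)) - ntr N (\<phi> ?z) + \<sigma> ?z" by simp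
        then show "cmod (ntr N (\<phi> x) - \<sigma> x) < \<epsilon>"
          using 1 2 3 norm_triangle_ineq[of "(ntr N (\<phi> (f k)) - \<sigma> (f k)) - ntr N (\<phi> ?z)" "\<sigma> ?z"]
            norm_triangle_ineq4[of "ntr N (\<phi> (f k)) - \<sigma> (f k)" "ntr N (\<phi> ?z)"] by simp
      qed
    qed
    then show "x \<in> ?E" using xc by simp
  next
    fix js assume js: "set js \<subseteq> {..<l}"
    let ?w = "list_product ?C (map (part_gen R l) js)"
    have gens: "set (map (part_gen R l) js) \<subseteq> carrier ?C" using js part_gen_facts(1)[OF R] by auto
    have "good \<epsilon> ?w" if e: "\<epsilon> > 0" for \<epsilon>
    proof (rule goodI[of "max 1 (length js)" \<epsilon>])
      fix N \<phi> assume N: "N \<ge> 1" and ph: "\<phi> \<in> unital_star_hom ?C (mat_algebra N)" "\<phi> \<in> ?H N (max 1 (length js)) \<epsilon>"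
      have "map \<phi> (map (part_gen R l) js) = map (\<lambda>j\<in>{..<l}. \<phi> (part_gen R l j)) js"
        unfolding map_map by (rule map_cong[OF refl]) (use js in auto)
      then have eq: "\<phi> ?w = list_product (mat_algebra N) (map (\<lambda>j\<in>{..<l}. \<phi> (part_gen R l j)) js)"
        using hom_list_product[OF C.star_alg_axioms ph(1) gens] by (simp only:)
      show "cmod (ntr N (\<phi> ?w) - \<sigma> ?w) < \<epsilon>"
      proof (cases "js = []")
        case True
        then have "ntr N (\<phi> ?w) = 1" "\<sigma> ?w = 1"
          using N unital_star_homD(4)[OF ph(1)] by (auto simp: list_product_def sone ntr_def)
        then show ?thesis using e by simp
      next
        case False
        then have "1 \<le> length js" by (simp add: Suc_le_eq)
        then show ?thesis using ph(2) js unfolding eq microstate_homs_def microstates_def by auto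
      qed
    qed (use e in auto)
    then show "?w \<in> ?E" using C.list_product_closed[OF gens] by simp
  qed
  then show ?thesis using w e goodE by blast
qed

text \<open>The integrands agree for every tuple of unitaries: both sides are values at \<open>h\<close> of homomorphisms that agree on the
  generators. It is for this step that the Haar measure must be known to live on unitaries.\<close>

lemma orb_integral_transfer:
  assumes R: "R > 0" and S: "S > 0" and N: "N \<ge> 1"
    and Th: "\<Theta> \<in> unital_star_hom (CR S n s) (CR R n r)"
    and f: "\<And>i j. i < n ==> j < s i ==> f i j \<in> carrier (CR_part R (r i))"
      "\<And>i j. i < n ==> j < s i ==> star (CR_part R (r i)) (f i j) = f i j"
      "\<And>i j. i < n ==> j < s i ==> part_norm R (r i) (f i j) \<le> S"
      "\<And>i j. i < n ==> j < s i ==> \<Theta> (CR_gen S n s i j) = CR_incl R n r i (f i j)"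
    and phi: "\<And>i. i < n ==> \<phi> i \<in> unital_star_hom (CR_part R (r i)) (mat_algebra N)"
    and A: "\<And>i j. i < n ==> j < r i ==> A i j = \<phi> i (part_gen R (r i) j)"
    and A': "\<And>i j. i < n ==> j < s i ==> A' i j = \<phi> i (f i j)"
    and h: "h \<in> carrier (CR S n s)"
  shows "orb_integral R n r (\<Theta> h) N A = orb_integral S n s h N A'"
  unfolding orb_integral_def
proof (rule Bochner_Integration.integral_cong[OF refl])
  fix V assume V: "V \<in> space (Pi\<^sub>M {..<n} (\<lambda>i. haar_unitary N))"
  define cj where "cj i B = V i * B * mat_adjoint (V i)" for i B
  have cj: "cj i \<in> unital_star_hom (mat_algebra N) (mat_algebra N)" if i: "i < n" for i
    unfolding cj_def using V i by (intro unitary_conj_hom) (auto simp: space_PiM PiE_iff space_haar_unitary[OF N])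
  have ch: "(\<lambda>x. cj i (\<phi> i x)) \<in> unital_star_hom (CR_part R (r i)) (mat_algebra N)" if i: "i < n" for i
    by (rule unital_star_hom_comp[OF phi cj]) (use i in auto)
  note chD = unital_star_homD[OF ch]
  have bound: "mat_opnorm N (cj i (\<phi> i x)) \<le> part_norm R (r i) x" if "i < n" "x \<in> carrier (CR_part R (r i))" for i x
    using hom_contractive[OF part_cstar[OF R] mat_seminorm ch] that by simp
  note ev = CR_eval[OF R mat_cstar[of N], of n r "\<lambda>i j. cj i (A i j)"]
  have a: "cj i (A i j) \<in> carrier (mat_algebra N)" "star (mat_algebra N) (cj i (A i j)) = cj i (A i j)"
    "mat_opnorm N (cj i (A i j)) \<le> R" if ij: "i < n" "j < r i" for i j
    using chD(1,6)[OF ij(1) part_gen_facts(1)[OF R ij(2)]] part_gen_facts(2,3)[OF R ij(2)]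
      bound[OF ij(1) part_gen_facts(1)[OF R ij(2)]] by (simp_all add: A[OF ij])
  note ev = ev[OF a]
  let ?\<Phi> = "CR_eval R n r (mat_algebra N) (\<lambda>i j. cj i (A i j))"
  have incl: "?\<Phi> (CR_incl R n r i x) = cj i (\<phi> i x)" if i: "i < n" and x: "x \<in> carrier (CR_part R (r i))" for i x
  proof (rule part_hom_eq[OF R mat_cstar unital_star_hom_comp[OF CR_incl_hom[OF R i] ev(1)] ch[OF i] _ x])
    fix j assume j: "j < r i"
    show "?\<Phi> (CR_incl R n r i (part_gen R (r i) j)) = cj i (\<phi> i (part_gen R (r i) j))"
      using ev(2)[of i j] i j A by (simp add: CR_gen_def)
  qed
  have b: "cj i (A' i j) \<in> carrier (mat_algebra N)" "star (mat_algebra N) (cj i (A' i j)) = cj i (A' i j)"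
    "mat_opnorm N (cj i (A' i j)) \<le> S" if ij: "i < n" "j < s i" for i j
    using chD(1,6)[OF ij(1) f(1)[OF ij]] f(2,3)[OF ij] bound[OF ij(1) f(1)[OF ij]] by (simp_all add: A'[OF ij])
  have "CR_eval S n s (mat_algebra N) (\<lambda>i j. cj i (A' i j)) h = ?\<Phi> (\<Theta> h)"
  proof (rule CR_eval(3)[OF S mat_cstar b unital_star_hom_comp[OF Th ev(1)] _ h])
    fix i j assume ij: "i < n" "j < s i"
    show "?\<Phi> (\<Theta> (CR_gen S n s i j)) = cj i (A' i j)"
      using f(4)[OF ij] incl[OF ij(1) f(1)[OF ij]] A'[OF ij] by simp
  qed
  then show "exp (- (real N)\<^sup>2 * Re (ntr N (CR_eval R n r (mat_algebra N) (\<lambda>i j. V i * A i j * mat_adjoint (V i)) (\<Theta> h)))) =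
      exp (- (real N)\<^sup>2 * Re (ntr N (CR_eval S n s (mat_algebra N) (\<lambda>i j. V i * A' i j * mat_adjoint (V i)) h)))"
    unfolding cj_def by simp
qed

section \<open>Monotonicity of the orbital entropy\<close>

lemma uniform_parameters:
  fixes P :: "'w => nat => real => bool"
  assumes "finite W" and "\<And>w. w \<in> W ==> \<exists>m \<delta>. m \<ge> 1 \<and> \<delta> > 0 \<and> P w m \<delta>"
    and mono: "\<And>w m \<delta> m' \<delta>'. P w m \<delta> ==> m \<le> m' ==> \<delta>' \<le> \<delta> ==> P w m' \<delta>'"
  shows "\<exists>m \<delta>. m \<ge> 1 \<and> \<delta> > 0 \<and> (\<forall>w\<in>W. P w m \<delta>)"
  using assms(1,2)
proof (induction W rule: finite_induct)
  case empty
  show ?case by (intro exI[of _ 1]) simp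
next
  case (insert w W)
  obtain m \<delta> where 1: "m \<ge> 1" "\<delta> > 0" "\<forall>w\<in>W. P w m \<delta>" using insert by auto
  obtain m' \<delta>' where 2: "m' \<ge> 1" "\<delta>' > 0" "P w m' \<delta>'" using insert.prems[of w] by auto
  have "P v (max m m') (min \<delta> \<delta>')" if "v \<in> insert w W" for v
    using that 1(3) 2(3) mono[of v m \<delta> "max m m'" "min \<delta> \<delta>'"] mono[of v m' \<delta>' "max m m'" "min \<delta> \<delta>'"] by auto
  then show ?case using 1 2 by (intro exI[of _ "max m m'"] exI[of _ "min \<delta> \<delta>'"]) auto
qed

text \<open>Applying \<open>f\<close> maps the microstates of the first family with parameters \<open>m'\<close>, \<open>\<delta>'\<close>
  into those of the second with parameters \<open>m\<close>, \<open>\<delta>\<close>; by \<open>near\<close> the moments differ by less than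
  \<open>\<delta>/2\<close> twice.\<close>

lemma pressure_transfer:
  assumes R: "R > 0" and S: "S > 0"
    and Th: "\<Theta> \<in> unital_star_hom (CR S n s) (CR R n r)"
    and f: "\<And>i j. i < n ==> j < s i ==> f i j \<in> carrier (CR_part R (r i))"
      "\<And>i j. i < n ==> j < s i ==> star (CR_part R (r i)) (f i j) = f i j"
      "\<And>i j. i < n ==> j < s i ==> part_norm R (r i) (f i j) \<le> S"
      "\<And>i j. i < n ==> j < s i ==> \<Theta> (CR_gen S n s i j) = CR_incl R n r i (f i j)"
    and near: "\<And>i js. i < n ==> set js \<subseteq> {..<s i} ==> length js \<le> m ==>
      near_microstate R (r i) (\<sigma> i) (list_product (CR_part R (r i)) (map (f i) js)) m' \<delta>' (\<delta>/2) \<and>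
      cmod (\<sigma> i (list_product (CR_part R (r i)) (map (f i) js)) - \<sigma>' i (list_product (CR_part S (s i)) (map (part_gen S (s i)) js))) < \<delta>/2"
    and h: "h \<in> carrier (CR S n s)" and N: "N \<ge> 1"
  shows "orb_pressure_micro R n r (\<Theta> h) \<sigma> N m' \<delta>' \<le> orb_pressure_micro S n s h \<sigma>' N m \<delta>"
  unfolding orb_pressure_micro_def
proof (rule SUP_least)
  fix A assume A: "A \<in> (\<Pi>\<^sub>E i\<in>{..<n}. microstates R (r i) (\<sigma> i) N m' \<delta>')"
  have Am: "A i \<in> microstates R (r i) (\<sigma> i) N m' \<delta>'" if "i < n" for i using A that by auto
  have Asa: "A i j \<in> bounded_sa_mats R N" if "i < n" "j < r i" for i j
    using Am[OF that(1)] that(2) unfolding microstates_def by auto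
  have "\<exists>\<phi>\<in>unital_star_hom (CR_part R (r i)) (mat_algebra N). \<forall>j<r i. \<phi> (part_gen R (r i) j) = A i j" if i: "i < n" for i
    by (rule part_hom[OF R mat_cstar]) (use Asa[OF i] in \<open>auto simp: bounded_sa_mats_def self_adjoint_elems_def\<close>)
  then have "\<forall>i. \<exists>\<phi>. i < n \<longrightarrow> \<phi> \<in> unital_star_hom (CR_part R (r i)) (mat_algebra N) \<and> (\<forall>j<r i. \<phi> (part_gen R (r i) j) = A i j)"
    by blast
  then obtain \<phi> where phi: "\<And>i. i < n ==> \<phi> i \<in> unital_star_hom (CR_part R (r i)) (mat_algebra N)"
    "\<And>i j. i < n ==> j < r i ==> \<phi> i (part_gen R (r i) j) = A i j" by metis
  define A' where "A' = (\<lambda>i\<in>{..<n}. \<lambda>j\<in>{..<s i}. \<phi> i (f i j))"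
  have "A' i \<in> microstates S (s i) (\<sigma>' i) N m \<delta>" if i: "i < n" for i
  proof -
    note hD = unital_star_homD[OF phi(1)[OF i], unfolded mat_algebra_simps]
    have A'i: "A' i = (\<lambda>j\<in>{..<s i}. \<phi> i (f i j))" using i by (simp add: A'_def)
    have sa: "\<phi> i (f i j) \<in> bounded_sa_mats S N" if j: "j < s i" for j
    proof -
      have "mat_opnorm N (\<phi> i (f i j)) \<le> S"
        using hom_contractive[OF part_cstar[OF R] mat_seminorm phi(1)[OF i] f(1)[OF i j]] f(3)[OF i j] by linarith
      then show ?thesis
        using hD(1,6)[OF f(1)[OF i j]] f(2)[OF i j] by (simp add: bounded_sa_mats_def self_adjoint_elems_def)
    qed
    have "cmod (ntr N (list_product (mat_algebra N) (map (A' i) js)) - \<sigma>' i (list_product (CR_part S (s i)) (map (part_gen S (s i)) js))) < \<delta>"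
      if js: "length js \<le> m" "set js \<subseteq> {..<s i}" for js
    proof -
      let ?w = "list_product (CR_part R (r i)) (map (f i) js)"
      interpret P: cstar "CR_part R (r i)" "part_norm R (r i)" by (rule part_cstar[OF R])
      have "map (A' i) js = map (\<phi> i) (map (f i) js)"
        unfolding map_map A'i by (rule map_cong[OF refl]) (use js(2) in auto)
      moreover have "set (map (f i) js) \<subseteq> carrier (CR_part R (r i))" using f(1)[OF i] js(2) by auto
      ultimately have eq: "list_product (mat_algebra N) (map (A' i) js) = \<phi> i ?w"
        by (simp only: hom_list_product[OF P.star_alg_axioms phi(1)[OF i]])
      have "(\<lambda>j\<in>{..<r i}. \<phi> i (part_gen R (r i) j)) = A i"
      proof (rule extensionalityI[of _ "{..<r i}"])
        show "A i \<in> extensional {..<r i}" using Am[OF i] by (auto simp: microstates_def PiE_iff)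
      qed (use phi(2)[OF i] in auto)
      then have "cmod (ntr N (\<phi> i ?w) - \<sigma> i ?w) < \<delta>/2"
        using near[OF i js(2,1)] N phi(1)[OF i] Am[OF i] unfolding near_microstate_def microstate_homs_def by auto
      then show ?thesis
        unfolding eq using conjunct2[OF near[OF i js(2,1)]]
          norm_triangle_ineq[of "ntr N (\<phi> i ?w) - \<sigma> i ?w" "\<sigma> i ?w - \<sigma>' i (list_product (CR_part S (s i)) (map (part_gen S (s i)) js))"]
        by simp
    qed
    then show ?thesis unfolding microstates_def A'i using sa by auto
  qed
  then have "A' \<in> (\<Pi>\<^sub>E i\<in>{..<n}. microstates S (s i) (\<sigma>' i) N m \<delta>)" by (auto simp: A'_def)
  then have "ereal (ln (orb_integral S n s h N A')) \<le> (SUP A\<in>(\<Pi>\<^sub>E i\<in>{..<n}. microstates S (s i) (\<sigma>' i) N m \<delta>). ereal (ln (orb_integral S n s h N A)))"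
    by (rule SUP_upper)
  moreover have "orb_integral R n r (\<Theta> h) N A = orb_integral S n s h N A'"
    by (rule orb_integral_transfer[OF R S N Th f phi(1) _ _ h]) (auto simp: phi(2) A'_def)
  ultimately show "ereal (ln (orb_integral R n r (\<Theta> h) N A)) \<le> (SUP A\<in>(\<Pi>\<^sub>E i\<in>{..<n}. microstates S (s i) (\<sigma>' i) N m \<delta>). ereal (ln (orb_integral S n s h N A)))"
    by simp
qed

lemma induced_trace_part:
  assumes M: "von_neumann_algebra M" and tr: "tracial_state (op_algebra M) \<tau>" and R: "R > 0" and i: "i < n"
    and X: "\<And>i j. i < n ==> j < r i ==> X i j \<in> self_adjoint_elems (op_algebra M) \<and> norm (X i j) \<le> R"
  defines "\<sigma> \<equiv> \<lambda>x. induced_trace R n r M \<tau> X (CR_incl R n r i x)"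
  shows "x \<in> carrier (CR_part R (r i)) ==> y \<in> carrier (CR_part R (r i)) ==> \<sigma> (x \<oplus>\<^bsub>CR_part R (r i)\<^esub> y) = \<sigma> x + \<sigma> y"
    and "x \<in> carrier (CR_part R (r i)) ==> \<sigma> (smul (CR_part R (r i)) c x) = c * \<sigma> x"
    and "x \<in> carrier (CR_part R (r i)) ==> cmod (\<sigma> x) \<le> part_norm R (r i) x"
    and "\<sigma> \<one>\<^bsub>CR_part R (r i)\<^esub> = 1"
proof -
  interpret M: tracial_cstar "op_algebra M" norm \<tau>
    by (simp add: tracial_cstar_def tracial_cstar_axioms_def op_cstar[OF M] tr)
  let ?e = "CR_eval R n r (op_algebra M) X"
  have e: "?e \<in> unital_star_hom (CR R n r) (op_algebra M)"
    by (rule CR_eval(1)[OF R op_cstar[OF M]]) (use X in \<open>auto simp: self_adjoint_elems_def\<close>)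
  note ph = unital_star_hom_comp[OF CR_incl_hom[where r=r, OF R i] e] and s = \<sigma>_def induced_trace_def
  note pD = unital_star_homD[OF ph]
  show "\<sigma> (x \<oplus>\<^bsub>CR_part R (r i)\<^esub> y) = \<sigma> x + \<sigma> y" if "x \<in> carrier (CR_part R (r i))" "y \<in> carrier (CR_part R (r i))"
    unfolding s pD(3)[OF that] by (rule M.sig_add[OF pD(1) pD(1)]) (use that in auto)
  show "\<sigma> \<one>\<^bsub>CR_part R (r i)\<^esub> = 1" unfolding s pD(4) by (rule M.sig_one)
  assume x: "x \<in> carrier (CR_part R (r i))"
  show "\<sigma> (smul (CR_part R (r i)) c x) = c * \<sigma> x"
    unfolding s pD(5)[OF x] by (rule M.sig_smul[OF pD(1)[OF x]])
  show "cmod (\<sigma> x) \<le> part_norm R (r i) x"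
    unfolding s using M.sig_le_nu[OF pD(1)[OF x]] hom_contractive[OF part_cstar[OF R] M.semi ph x] by linarith
qed

text \<open>The \<open>f k i j\<close> come from \<open>normal_approximation\<close> with error \<open>1 / (k + 1)\<close>. They are
  taken in the universal algebra of the \<open>i\<close>-th tuple alone, whose image in \<open>M\<close> is dense enough because
  \<open>Y i j\<close> lies in the von Neumann algebra generated by \<open>X i\<close>.\<close>

lemma approximating_homomorphisms:
  fixes M :: "('h::complex_hilbert_space \<Rightarrow>\<^sub>L 'h) set"
    and \<tau> :: "('h \<Rightarrow>\<^sub>L 'h) => complex"
    and R S :: real
    and n :: nat
    and r s :: "nat => nat"
    and X Y :: "nat => nat => ('h \<Rightarrow>\<^sub>L 'h)"
  assumes "tracial_Wstar_prob_space M \<tau>"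
    and "R > 0" and "S > 0"
    and "\<And>i j. i < n ==> j < r i ==> X i j \<in> self_adjoint_elems (op_algebra M) \<and> norm (X i j) \<le> R"
    and "\<And>i j. i < n ==> j < s i ==> Y i j \<in> self_adjoint_elems (op_algebra M) \<and> norm (Y i j) \<le> S"
    and "\<And>i. i < n ==> Y i ` {..<s i} \<subseteq> generated_vN M (X i ` {..<r i})"
  shows "\<exists>\<Theta> f. (\<forall>k. \<Theta> k \<in> unital_star_hom (CR S n s) (CR R n r) \<and>
       (\<forall>i<n. \<forall>j<s i. f k i j \<in> carrier (CR_part R (r i)) \<and> star (CR_part R (r i)) (f k i j) = f k i j \<and>
          part_norm R (r i) (f k i j) \<le> S \<and> \<Theta> k (CR_gen S n s i j) = CR_incl R n r i (f k i j))) \<and>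
     (\<forall>h\<in>carrier (CR S n s). (\<lambda>k. induced_trace R n r M \<tau> X (\<Theta> k h)) \<longlonglongrightarrow> induced_trace S n s M \<tau> Y h)"
proof -
  note R = assms(2) and S = assms(3)
  have M: "von_neumann_algebra M" and tr: "tracial_state (op_algebra M) \<tau>"
    using assms(1) by (auto simp: tracial_Wstar_prob_space_def)
  interpret M: tracial_cstar "op_algebra M" norm \<tau>
    by (simp add: tracial_cstar_def tracial_cstar_axioms_def op_cstar[OF M] tr)
  note oc = op_cstar[OF M]
  interpret CX: cstar "CR R n r" "CR_norm R n r" by (rule CR_cstar[OF R])
  have X: "X i j \<in> carrier (op_algebra M)" "star (op_algebra M) (X i j) = X i j" "norm (X i j) \<le> R" if "i < n" "j < r i" for i j
    using assms(4)[OF that] by (auto simp: self_adjoint_elems_def)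
  have Y: "Y i j \<in> carrier (op_algebra M)" "star (op_algebra M) (Y i j) = Y i j" "norm (Y i j) \<le> S" if "i < n" "j < s i" for i j
    using assms(5)[OF that] by (auto simp: self_adjoint_elems_def)
  let ?eX = "CR_eval R n r (op_algebra M) X" and ?eY = "CR_eval S n s (op_algebra M) Y"
  have eX: "?eX \<in> unital_star_hom (CR R n r) (op_algebra M)" by (rule CR_eval(1)[OF R oc]) (use X in auto)
  have eY: "?eY \<in> unital_star_hom (CR S n s) (op_algebra M)" by (rule CR_eval(1)[OF S oc]) (use Y in auto)
  have gX: "?eX (CR_gen R n r i j) = X i j" if "i < n" "j < r i" for i j
    by (rule CR_eval(2)[OF R oc]) (use X that in auto)
  have gY: "?eY (CR_gen S n s i j) = Y i j" if "i < n" "j < s i" for i j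
    by (rule CR_eval(2)[OF S oc]) (use Y that in auto)
  define \<sigma>X \<sigma>Y where "\<sigma>X = induced_trace R n r M \<tau> X" and "\<sigma>Y = induced_trace S n s M \<tau> Y"
  have sX: "\<sigma>X x = \<tau> (?eX x)" and sY: "\<sigma>Y y = \<tau> (?eY y)" for x y by (simp_all add: \<sigma>X_def \<sigma>Y_def induced_trace_def)
  have ph: "(\<lambda>x. ?eX (CR_incl R n r i x)) \<in> unital_star_hom (CR_part R (r i)) (op_algebra M)" if "i < n" for i
    by (rule unital_star_hom_comp[OF CR_incl_hom[OF R that] eX])
  have Ybi: "Y i j \<in> M \<inter> bicommutant ((\<lambda>x. ?eX (CR_incl R n r i x)) ` carrier (CR_part R (r i)))" if ij: "i < n" "j < s i" for i j
  proof -
    let ?A = "(\<lambda>x. ?eX (CR_incl R n r i x)) ` carrier (CR_part R (r i))"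
    interpret P: cstar "CR_part R (r i)" "part_norm R (r i)" by (rule part_cstar[OF R])
    interpret A: operator_star_algebra ?A by (rule hom_image_operator_star_algebra[OF M P.star_alg_axioms ph[OF ij(1)]])
    have "X i ` {..<r i} \<subseteq> ?A"
    proof
      fix T assume "T \<in> X i ` {..<r i}"
      then obtain k where k: "k < r i" "T = X i k" by blast
      then have "T = ?eX (CR_incl R n r i (part_gen R (r i) k))" using gX[OF ij(1) k(1)] by (simp add: CR_gen_def)
      then show "T \<in> ?A" using part_gen_facts(1)[OF R k(1)] by blast
    qed
    moreover have "?A \<subseteq> M" using unital_star_homD(1)[OF ph[OF ij(1)]] by auto
    ultimately have "generated_vN M (X i ` {..<r i}) \<subseteq> M \<inter> bicommutant ?A"
      by (intro generated_vN_subset_bicommutant[OF M]) (use A.star in auto)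
    then show ?thesis using assms(6)[OF ij(1)] ij(2) by blast
  qed
  define Q where "Q k i j g \<longleftrightarrow> g \<in> carrier (CR_part R (r i)) \<and> star (CR_part R (r i)) g = g \<and> part_norm R (r i) g \<le> S \<and>
      cmod (\<tau> ((?eX (CR_incl R n r i g) - Y i j) o\<^sub>L (?eX (CR_incl R n r i g) - Y i j))) < 1 / real (Suc k)" for k i j g
  define f where "f k i j = (SOME g. Q k i j g)" for k i j
  have Q: "Q k i j (f k i j)" if ij: "i < n" "j < s i" for k i j
  proof -
    have "op_adjoint (Y i j) = Y i j" using Y(2)[OF ij] by simp
    from normal_approximation[OF assms(1) part_cstar[OF R] ph[OF ij(1)] Ybi[OF ij] this Y(3)[OF ij] S, of "1 / real (Suc k)"]
    have "\<exists>g. Q k i j g" unfolding Q_def by simp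
    then show ?thesis unfolding f_def by (rule someI_ex)
  qed
  have f: "f k i j \<in> carrier (CR_part R (r i))" "star (CR_part R (r i)) (f k i j) = f k i j" "part_norm R (r i) (f k i j) \<le> S"
    "cmod (\<tau> ((?eX (CR_incl R n r i (f k i j)) - Y i j) o\<^sub>L (?eX (CR_incl R n r i (f k i j)) - Y i j))) < 1 / real (Suc k)"
    if "i < n" "j < s i" for k i j using Q[OF that, of k] unfolding Q_def by simp_all
  have "\<exists>\<Theta>\<in>unital_star_hom (CR S n s) (CR R n r). \<forall>i<n. \<forall>j<s i. \<Theta> (CR_gen S n s i j) = CR_incl R n r i (f k i j)" for k
  proof (rule CR_hom_gens[OF S CR_cstar[OF R]])
    fix i j assume ij: "i < n" "j < s i"
    note hD = unital_star_homD[OF CR_incl_hom[where r=r, OF R ij(1)]]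
    show "CR_incl R n r i (f k i j) \<in> carrier (CR R n r)" by (rule hD(1)[OF f(1)[OF ij]])
    show "star (CR R n r) (CR_incl R n r i (f k i j)) = CR_incl R n r i (f k i j)" using hD(6)[OF f(1)[OF ij]] f(2)[OF ij] by simp
    show "CR_norm R n r (CR_incl R n r i (f k i j)) \<le> S"
      using hom_contractive[OF part_cstar[OF R] CX.semi CR_incl_hom[where r=r, OF R ij(1)] f(1)[OF ij]] f(3)[OF ij] order_trans by blast
  qed
  then obtain \<Theta> where Th: "\<And>k. \<Theta> k \<in> unital_star_hom (CR S n s) (CR R n r)"
    "\<And>k i j. i < n ==> j < s i ==> \<Theta> k (CR_gen S n s i j) = CR_incl R n r i (f k i j)" by metis
  have lim: "(\<lambda>k. \<sigma>X (\<Theta> k h)) \<longlonglongrightarrow> \<sigma>Y h" if h: "h \<in> carrier (CR S n s)" for h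
  proof -
    have hk: "(\<lambda>x. ?eX (\<Theta> k x)) \<in> unital_star_hom (CR S n s) (op_algebra M)" for k
      by (rule unital_star_hom_comp[OF Th(1) eX])
    have neg: "S' + op_scale (- 1) T = S' - T" for S' T :: "'h \<Rightarrow>\<^sub>L 'h"
    proof (rule blinfun_eqI)
      fix x show "blinfun_apply (S' + op_scale (- 1) T) x = blinfun_apply (S' - T) x"
        using scaleC_of_real[of "-1" "blinfun_apply T x"] by (simp add: blinfun.add_left blinfun.diff_left)
    qed
    have "carrier (CR S n s) \<subseteq> {x \<in> carrier (CR S n s). (\<lambda>k. M.sq (M.sb (?eX (\<Theta> k x)) (?eY x))) \<longlonglongrightarrow> 0}"
    proof (rule CR_generated[OF S M.sq_limit_closed_subalgebra[OF CR_cstar[OF S] hk eY]], intro CollectI conjI)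
      fix i j assume ij: "i < n" "j < s i"
      show "CR_gen S n s i j \<in> carrier (CR S n s)" by (rule CR_gen_carrier[where r=s, OF S ij])
      show "(\<lambda>k. M.sq (M.sb (?eX (\<Theta> k (CR_gen S n s i j))) (?eY (CR_gen S n s i j)))) \<longlonglongrightarrow> 0"
      proof (rule Lim_null_comparison[OF _ LIMSEQ_inverse_real_of_nat], rule always_eventually, rule allI)
        fix k
        let ?F = "?eX (CR_incl R n r i (f k i j))"
        have F: "?F \<in> carrier (op_algebra M)" "star (op_algebra M) ?F = ?F"
          using unital_star_homD(1,6)[OF ph[OF ij(1)] f(1)[OF ij]] f(2)[OF ij] by auto
        have d: "M.sb ?F (Y i j) \<in> carrier (op_algebra M)" using F(1) Y(1)[OF ij] by (intro M.a_closed M.smul_closed)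
        have sa: "star (op_algebra M) (M.sb ?F (Y i j)) = M.sb ?F (Y i j)"
          using M.sb_star[OF F(1) Y(1)[OF ij]] F(2) Y(2)[OF ij] by (simp only:)
        have "M.sq (M.sb ?F (Y i j)) \<le> cmod (\<tau> ((?F - Y i j) o\<^sub>L (?F - Y i j)))"
          unfolding M.sq_def sa unfolding op_algebra_simps neg by (rule complex_Re_le_cmod)
        then have "M.sq (M.sb ?F (Y i j)) \<le> inverse (real (Suc k))"
          using f(4)[OF ij, of k] by (simp add: inverse_eq_divide)
        then show "norm (M.sq (M.sb (?eX (\<Theta> k (CR_gen S n s i j))) (?eY (CR_gen S n s i j)))) \<le> inverse (real (Suc k))"
          using M.sq_ge0[OF d] unfolding Th(2)[OF ij] gY[OF ij] by (simp only: real_norm_def abs_of_nonneg)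
      qed
    qed
    then have sq0: "(\<lambda>k. M.sq (M.sb (?eX (\<Theta> k h)) (?eY h))) \<longlonglongrightarrow> 0" using h by blast
    have c: "?eX (\<Theta> k h) \<in> carrier (op_algebra M)" "?eY h \<in> carrier (op_algebra M)" for k
      using unital_star_homD(1)[OF hk h] unital_star_homD(1)[OF eY h] by blast+
    have "\<sigma>X (\<Theta> k h) - \<sigma>Y h = \<tau> (M.sb (?eX (\<Theta> k h)) (?eY h))" for k
      unfolding sX sY M.sig_add[OF c(1) M.smul_closed[OF c(2)]] M.sig_smul[OF c(2)] by simp
    then have "(cmod (\<sigma>X (\<Theta> k h) - \<sigma>Y h))\<^sup>2 \<le> M.sq (M.sb (?eX (\<Theta> k h)) (?eY h))" for k
      using M.sig_le_sq[OF M.a_closed[OF c(1) M.smul_closed[OF c(2)]], of k "-1"] by (simp only:)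
    then have "(\<lambda>k. (cmod (\<sigma>X (\<Theta> k h) - \<sigma>Y h))\<^sup>2) \<longlonglongrightarrow> 0"
      by (intro tendsto_sandwich[OF always_eventually always_eventually tendsto_const sq0] allI) simp_all
    then have "(\<lambda>k. sqrt ((cmod (\<sigma>X (\<Theta> k h) - \<sigma>Y h))\<^sup>2)) \<longlonglongrightarrow> sqrt 0" by (rule tendsto_real_sqrt)
    then have "(\<lambda>k. cmod (\<sigma>X (\<Theta> k h) - \<sigma>Y h)) \<longlonglongrightarrow> 0" by simp
    then show ?thesis by (rule LIM_zero_cancel[OF tendsto_norm_zero_cancel])
  qed
  show ?thesis
    using Th f(1-3) lim unfolding \<sigma>X_def \<sigma>Y_def by (intro exI[of _ \<Theta>] exI[of _ f]) simp
qed

theorem theorem3p4: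
  fixes M :: "('h::complex_hilbert_space \<Rightarrow>\<^sub>L 'h) set"
    and \<tau> :: "('h \<Rightarrow>\<^sub>L 'h) \<Rightarrow> complex"
    and R S :: real
    and n :: nat
    and r s :: "nat \<Rightarrow> nat"
    and X Y :: "nat \<Rightarrow> nat \<Rightarrow> ('h \<Rightarrow>\<^sub>L 'h)"
  assumes "tracial_Wstar_prob_space M \<tau>"
    and "R > 0" and "S > 0"
    and "\<And>i j. i < n \<Longrightarrow> j < r i \<Longrightarrow> X i j \<in> self_adjoint_elems (op_algebra M) \<and> norm (X i j) \<le> R"
    and "\<And>i j. i < n \<Longrightarrow> j < s i \<Longrightarrow> Y i j \<in> self_adjoint_elems (op_algebra M) \<and> norm (Y i j) \<le> S"
    and "\<And>i. i < n \<Longrightarrow> Y i ` {..<s i} \<subseteq> generated_vN M (X i ` {..<r i})"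
  shows "eta_orb R n r (induced_trace R n r M \<tau> X) \<le> eta_orb S n s (induced_trace S n s M \<tau> Y)"
proof -
  note R = assms(2) and S = assms(3)
  have M: "von_neumann_algebra M" and tr: "tracial_state (op_algebra M) \<tau>"
    using assms(1) by (auto simp: tracial_Wstar_prob_space_def)
  define \<sigma>X \<sigma>Y where "\<sigma>X = induced_trace R n r M \<tau> X" and "\<sigma>Y = induced_trace S n s M \<tau> Y"
  obtain \<Theta> f where apx: "(\<forall>k. \<Theta> k \<in> unital_star_hom (CR S n s) (CR R n r) \<and>
       (\<forall>i<n. \<forall>j<s i. f k i j \<in> carrier (CR_part R (r i)) \<and> star (CR_part R (r i)) (f k i j) = f k i j \<and>
          part_norm R (r i) (f k i j) \<le> S \<and> \<Theta> k (CR_gen S n s i j) = CR_incl R n r i (f k i j))) \<and>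
     (\<forall>h\<in>carrier (CR S n s). (\<lambda>k. \<sigma>X (\<Theta> k h)) \<longlonglongrightarrow> \<sigma>Y h)"
    unfolding \<sigma>X_def \<sigma>Y_def by atomize_elim (rule approximating_homomorphisms; fact assms)
  have Th: "\<Theta> k \<in> unital_star_hom (CR S n s) (CR R n r)" for k using apx by blast
  have f: "f k i j \<in> carrier (CR_part R (r i))" "star (CR_part R (r i)) (f k i j) = f k i j"
    "part_norm R (r i) (f k i j) \<le> S" "\<Theta> k (CR_gen S n s i j) = CR_incl R n r i (f k i j)" if "i < n" "j < s i" for k i j
    using spec[OF conjunct1[OF apx], of k] that by simp_all
  have lim: "(\<lambda>k. \<sigma>X (\<Theta> k h)) \<longlonglongrightarrow> \<sigma>Y h" if "h \<in> carrier (CR S n s)" for h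
    by (rule bspec[OF conjunct2[OF apx] that])
  note tD = unital_star_homD[OF Th]
  let ?sX = "\<lambda>i x. \<sigma>X (CR_incl R n r i x)" and ?sY = "\<lambda>i x. \<sigma>Y (CR_incl S n s i x)"
  let ?L = "\<lambda>h m \<delta>. limsup (\<lambda>N. ereal (1 / (real N)\<^sup>2) * orb_pressure_micro S n s h ?sY N m \<delta>)"
  let ?v = "\<lambda>i js. list_product (CR_part S (s i)) (map (part_gen S (s i)) js)"
    and ?w = "\<lambda>k i js. list_product (CR_part R (r i)) (map (f k i) js)"
  have main: "eta_orb R n r \<sigma>X \<le> ereal (Re (\<sigma>Y h)) + ?L h m \<delta> + ereal e"
    if h: "h \<in> self_adjoint_elems (CR S n s)" and m: "m \<ge> 1" and \<delta>: "\<delta> > 0" and e: "e > 0" for h m and \<delta> e :: real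
  proof -
    have hc: "h \<in> carrier (CR S n s)" "star (CR S n s) h = h" using h by (auto simp: self_adjoint_elems_def)
    \<comment> \<open>The words whose moments enter the microstates of \<open>Y\<close> with parameter \<open>m\<close>.\<close>
    define W where "W = (SIGMA i:{..<n}. {js. set js \<subseteq> {..<s i} \<and> length js \<le> m})"
    have W: "finite W" unfolding W_def by (intro finite_SigmaI finite_lists_length_le) auto
    let ?y = "\<lambda>(i, js). CR_incl S n s i (?v i js)"
    have yc: "?y w \<in> carrier (CR S n s)" if wW: "w \<in> W" for w
    proof -
      obtain i js where w: "w = (i, js)" "i < n" "set js \<subseteq> {..<s i}" using wW by (auto simp: W_def)
      interpret P: cstar "CR_part S (s i)" "part_norm S (s i)" by (rule part_cstar[OF S])
      have "?v i js \<in> carrier (CR_part S (s i))"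
        using w(3) part_gen_facts(1)[OF S] by (intro P.list_product_closed) auto
      then show ?thesis using unital_star_homD(1)[OF CR_incl_hom[where r=s, OF S w(2)]] w(1) by simp
    qed
    have ev1: "\<forall>\<^sub>F k in sequentially. cmod (\<sigma>X (\<Theta> k h) - \<sigma>Y h) < e"
      using tendstoD[OF lim[OF hc(1)] e] by (simp only: dist_norm)
    have ev2: "\<forall>\<^sub>F k in sequentially. \<forall>w\<in>W. cmod (\<sigma>X (\<Theta> k (?y w)) - \<sigma>Y (?y w)) < \<delta>/2"
    proof (rule eventually_ball_finite[OF W], rule ballI)
      fix w assume "w \<in> W"
      from tendstoD[OF lim[OF yc[OF this]] half_gt_zero[OF \<delta>]]
      show "\<forall>\<^sub>F k in sequentially. cmod (\<sigma>X (\<Theta> k (?y w)) - \<sigma>Y (?y w)) < \<delta>/2"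
        by (simp only: dist_norm)
    qed
    obtain k where k: "cmod (\<sigma>X (\<Theta> k h) - \<sigma>Y h) < e" "\<forall>w\<in>W. cmod (\<sigma>X (\<Theta> k (?y w)) - \<sigma>Y (?y w)) < \<delta>/2"
      using eventually_conj[OF ev1 ev2] by (auto simp: eventually_sequentially)
    have word: "\<Theta> k (CR_incl S n s i (?v i js))
        = CR_incl R n r i (?w k i js)" if i: "i < n" and js: "set js \<subseteq> {..<s i}" for i js
    proof -
      interpret PS: cstar "CR_part S (s i)" "part_norm S (s i)" by (rule part_cstar[OF S])
      interpret PR: cstar "CR_part R (r i)" "part_norm R (r i)" by (rule part_cstar[OF R])
      have c: "set (map (part_gen S (s i)) js) \<subseteq> carrier (CR_part S (s i))" "set (map (f k i) js) \<subseteq> carrier (CR_part R (r i))"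
        using js part_gen_facts(1)[OF S] f(1)[OF i] by auto
      have m: "map (\<lambda>x. \<Theta> k (CR_incl S n s i x)) (map (part_gen S (s i)) js) = map (CR_incl R n r i) (map (f k i) js)"
        unfolding map_map by (rule map_cong[OF refl]) (use js f(4)[OF i] in \<open>auto simp: CR_gen_def\<close>)
      show ?thesis
        using hom_list_product[OF PS.star_alg_axioms unital_star_hom_comp[OF CR_incl_hom[where r=s, OF S i] Th] c(1), of k]
          hom_list_product[OF PR.star_alg_axioms CR_incl_hom[where r=r, OF R i] c(2)] m by (simp only:)
    qed
    have "\<exists>m' \<delta>'. m' \<ge> 1 \<and> \<delta>' > 0 \<and> (\<forall>w\<in>W. case w of (i, js) =>
        near_microstate R (r i) (?sX i) (?w k i js) m' \<delta>' (\<delta>/2))"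
    proof (rule uniform_parameters[OF W])
      fix w assume "w \<in> W"
      then obtain i js where w: "w = (i, js)" "i < n" "set js \<subseteq> {..<s i}" by (auto simp: W_def)
      interpret PR: cstar "CR_part R (r i)" "part_norm R (r i)" by (rule part_cstar[OF R])
      have "?w k i js \<in> carrier (CR_part R (r i))"
        using w(3) f(1)[OF w(2)] by (intro PR.list_product_closed) auto
      then have "\<exists>m' \<delta>'. m' \<ge> 1 \<and> \<delta>' > 0 \<and> near_microstate R (r i) (?sX i) (?w k i js) m' \<delta>' (\<delta>/2)"
        unfolding \<sigma>X_def using \<delta> induced_trace_part[OF M tr R w(2) assms(4)]
        by (intro microstate_approximation[OF R]) simp_all
      then show "\<exists>m' \<delta>'. m' \<ge> 1 \<and> \<delta>' > 0 \<and> (case w of (i, js) =>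
        near_microstate R (r i) (?sX i) (?w k i js) m' \<delta>' (\<delta>/2))" by (simp add: w(1))
    next
      show "case w of (i, js) => near_microstate R (r i) (?sX i) (?w k i js) m2 \<delta>2 (\<delta>/2)"
        if "case w of (i, js) => near_microstate R (r i) (?sX i) (?w k i js) m1 \<delta>1 (\<delta>/2)" "m1 \<le> m2" "\<delta>2 \<le> \<delta>1"
        for w m1 \<delta>1 m2 \<delta>2
        using that(1) near_microstate_mono[OF _ that(2,3)] by (cases w) simp
    qed
    then obtain m' \<delta>' where m': "m' \<ge> 1" "\<delta>' > 0" and nearW: "\<forall>w\<in>W. case w of (i, js) =>
        near_microstate R (r i) (?sX i) (?w k i js) m' \<delta>' (\<delta>/2)" by (elim exE conjE)
    have near: "near_microstate R (r i) (?sX i) (?w k i js) m' \<delta>' (\<delta>/2) \<and>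
      cmod (?sX i (?w k i js) - ?sY i (?v i js)) < \<delta>/2"
      if "i < n" "set js \<subseteq> {..<s i}" "length js \<le> m" for i js
    proof -
      have w: "(i, js) \<in> W" using that by (simp add: W_def)
      show ?thesis using bspec[OF nearW w] bspec[OF k(2) w] word[OF that(1,2)] by simp
    qed
    have micro: "ereal (1 / (real N)\<^sup>2) * orb_pressure_micro R n r (\<Theta> k h) ?sX N m' \<delta>' \<le>
        ereal (1 / (real N)\<^sup>2) * orb_pressure_micro S n s h ?sY N m \<delta>" for N
    proof (cases "N = 0")
      case False
      have "orb_pressure_micro R n r (\<Theta> k h) ?sX N m' \<delta>' \<le> orb_pressure_micro S n s h ?sY N m \<delta>"
        by (rule pressure_transfer[OF R S Th f near hc(1)]) (use False in auto)
      then show ?thesis by (intro ereal_mult_left_mono) auto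
    qed (simp add: zero_ereal_def[symmetric])
    have "\<Theta> k h \<in> self_adjoint_elems (CR R n r)"
      using tD(1)[OF hc(1)] tD(6)[OF hc(1), of k] hc(2) by (simp add: self_adjoint_elems_def)
    then have "eta_orb R n r \<sigma>X \<le> ereal (Re (\<sigma>X (\<Theta> k h))) + orb_pressure R n r (\<Theta> k h) ?sX"
      unfolding eta_orb_def by (rule INF_lower)
    also have "\<dots> \<le> ereal (Re (\<sigma>Y h) + e) + ?L h m \<delta>"
    proof (rule add_mono)
      show "ereal (Re (\<sigma>X (\<Theta> k h))) \<le> ereal (Re (\<sigma>Y h) + e)"
        using k(1) complex_Re_le_cmod[of "\<sigma>X (\<Theta> k h) - \<sigma>Y h"] by simp
      have "orb_pressure R n r (\<Theta> k h) ?sX \<le> limsup (\<lambda>N. ereal (1 / (real N)\<^sup>2) * orb_pressure_micro R n r (\<Theta> k h) ?sX N m' \<delta>')"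
        unfolding orb_pressure_def by (rule INF_lower2[of "(m', \<delta>')"]) (use m' in auto)
      also have "\<dots> \<le> ?L h m \<delta>"
        by (intro Limsup_mono always_eventually allI micro)
      finally show "orb_pressure R n r (\<Theta> k h) ?sX \<le> ?L h m \<delta>" .
    qed
    finally show ?thesis by (simp add: add_ac plus_ereal.simps(1)[symmetric] del: plus_ereal.simps)
  qed
  have "eta_orb R n r \<sigma>X \<le> ereal (Re (\<sigma>Y h)) + orb_pressure S n s h ?sY" if h: "h \<in> self_adjoint_elems (CR S n s)" for h
  proof -
    let ?c = "ereal (Re (\<sigma>Y h))"
    have c: "\<bar>?c\<bar> \<noteq> \<infinity>" by simp
    have "eta_orb R n r \<sigma>X - ?c \<le> ?L h m \<delta>"
      if "m \<ge> 1" "\<delta> > 0" for m and \<delta> :: real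
    proof -
      have "eta_orb R n r \<sigma>X \<le> ?c + ?L h m \<delta>" by (rule ereal_le_epsilon2) (use main[OF h that] in auto)
      then show ?thesis by (simp only: ereal_minus_le[OF c] add.commute)
    qed
    then have "eta_orb R n r \<sigma>X - ?c \<le> orb_pressure S n s h ?sY"
      unfolding orb_pressure_def by (intro INF_greatest) auto
    then show ?thesis by (simp only: ereal_minus_le[OF c] add.commute)
  qed
  then have "eta_orb R n r \<sigma>X \<le> eta_orb S n s \<sigma>Y"
    unfolding eta_orb_def[of S n s \<sigma>Y] by (rule INF_greatest)
  then show ?thesis by (simp only: \<sigma>X_def \<sigma>Y_def)
qed

end
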